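(* Let $N\in\mathbb{Z}_{\geq 1}$, $\theta>0$, $T>0$ and $1<q\leq p<\infty$. There exists a positive constant $C$ depending on $T$ such that the inequality $$\|\mu\|_{B^{-\theta,\infty}_{p,q,\infty}}\leq C\left\|\int_0^tS(t-\tau)\mu\,d\tau\right\|_{L^\infty(0,T;M^p_{q,\infty})}$$ holds for all $\mu\in\left\{f\in\mathcal{S}'(\mathbb{R}^N)\ \middle|\ \int_0^tS(t-\tau)f\,d\tau\in L^\infty(0,T;M^p_{q,\infty})\right\}$.
   Context: Lorentz spaces on $\mathbb{R}^N$: for measurable $f:\mathbb{R}^N\to\mathbb{R}$ put $\alpha_f(\sigma)=|\{x:|f(x)|>\sigma\}|$ ($\sigma>0$) and $f^*(\lambda)=\sup\{\sigma>0:\alpha_f(\sigma)>\lambda\}$ ($\sup\varnothing=0$). For $0<q<\infty$, $\|f\|_{L^{q,\infty}}=\sup_{\lambda>0}\lambda^{1/q}f^*(\lambda)$. Local Lorentz--Morrey spaces: for $0<q\le p<\infty$, $M^p_{q,\infty}=M^p_{q,\infty}(\mathbb{R}^N)$ is the set of measurable $f$ with $\|f\|_{M^p_{q,\infty}}=\sup_{0<R\le1}\sup_{z\in\mathbb{R}^N}R^{N/p-N/q}\|f\chi_{B(z,R)}\|_{L^{q,\infty}(\mathbb{R}^N)}<\infty$. (For $q>1$ regarded as a Banach space via an equivalent norm.) Littlewood--Paley decomposition: let $\zeta\in C_c^\infty([0,\infty);\mathbb{R})$ with $0\le\zeta\le1$, $\zeta\equiv1$ for $t\le3/2$, $\operatorname{supp}\zeta\subset[0,5/3)$;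 $\varphi_{(0)}(\xi)=\zeta(|\xi|)$, $\varphi_0(\xi)=\zeta(|\xi|)-\zeta(2|\xi|)$, $\varphi_j(\xi)=\varphi_0(2^{-j}\xi)$. For $f\in\mathcal{S}'(\mathbb{R}^N)$: $\Delta_0f=\mathcal{F}^{-1}[\varphi_{(0)}\mathcal{F}f]$ and $\Delta_jf=\mathcal{F}^{-1}[\varphi_j\mathcal{F}f]$ for $j\ge1$. BLM spaces: for $1<q\le p<\infty$, $s\in\mathbb{R}$, $B^{s,\infty}_{p,q,\infty}(\mathbb{R}^N)$ is the set of $f\in\mathcal{S}'(\mathbb{R}^N)$ with $\Delta_jf\in M^p_{q,\infty}$ for all $j\in\mathbb{N}=\{0,1,2,\dots\}$ and $\|f\|_{B^{s,\infty}_{p,q,\infty}}=\sup_{j\in\mathbb{N}}2^{sj}\|\Delta_jf\|_{M^p_{q,\infty}}<\infty$. $S(t)f=\mathcal{F}^{-1}[\exp(-t|\xi|^\theta)\mathcal{F}f]$ for $t>0$, $f\in\mathcal{S}'(\mathbb{R}^N)$. *)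

theory Defs
  imports "HOL-Analysis.Analysis" "HOL-Probability.Essential_Supremum"
begin

section \<open>Smooth functions and Schwartz functions\<close>

definition partial_deriv ::
    "'a::euclidean_space \<Rightarrow> ('a \<Rightarrow> 'b::real_normed_vector) \<Rightarrow> 'a \<Rightarrow> 'b" where
  "partial_deriv b f x = frechet_derivative f (at x) b"

text \<open>A list of basis vectors plays the role of a multi-index.\<close>

definition iter_partial ::
    "'a::euclidean_space list \<Rightarrow> ('a \<Rightarrow> 'b::real_normed_vector) \<Rightarrow> 'a \<Rightarrow> 'b" where
  "iter_partial bs f = foldr partial_deriv bs f"

definition smooth :: "('a::euclidean_space \<Rightarrow> 'b::real_normed_vector) \<Rightarrow> bool" where
  "smooth f \<longleftrightarrow>
     (\<forall>bs. set bs \<subseteq> Basis \<longrightarrow> (\<forall>x. iter_partial bs f differentiable (at x)))"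

definition schwartz :: "('a::euclidean_space \<Rightarrow> complex) set" where
  "schwartz = {\<phi>. smooth \<phi> \<and>
     (\<forall>k bs. set bs \<subseteq> Basis \<longrightarrow>
        (\<exists>B. \<forall>x. (1 + norm x) ^ k * norm (iter_partial bs \<phi> x) \<le> B))}"

text \<open>On Schwartz functions the supremum is over a nonempty bounded set.\<close>

definition schwartz_seminorm :: "nat \<Rightarrow> ('a::euclidean_space \<Rightarrow> complex) \<Rightarrow> real" where
  "schwartz_seminorm n \<phi> =
     (SUP (bs, x) \<in> {bs. set bs \<subseteq> Basis \<and> length bs \<le> n} \<times> UNIV.
        (1 + norm x) ^ n * norm (iter_partial bs \<phi> x))"

section \<open>Tempered distributions\<close>

text \<open>
  A distribution is a functional on all functions, of which only the values on
  Schwartz functions are meaningful.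
\<close>

type_synonym 'a distrib = "('a \<Rightarrow> complex) \<Rightarrow> complex"

definition tempered :: "('a::euclidean_space) distrib set" where
  "tempered = {f.
     (\<forall>\<phi>\<in>schwartz. \<forall>\<psi>\<in>schwartz. f (\<lambda>x. \<phi> x + \<psi> x) = f \<phi> + f \<psi>) \<and>
     (\<forall>c. \<forall>\<phi>\<in>schwartz. f (\<lambda>x. c * \<phi> x) = c * f \<phi>) \<and>
     (\<exists>C n. \<forall>\<phi>\<in>schwartz. norm (f \<phi>) \<le> C * schwartz_seminorm n \<phi>)}"

definition represents :: "('a::euclidean_space \<Rightarrow> real) \<Rightarrow> 'a distrib \<Rightarrow> bool" where
  "represents g f \<longleftrightarrow>
     (\<forall>\<phi>\<in>schwartz. integrable lebesgue (\<lambda>x. complex_of_real (g x) * \<phi> x) \<and>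
        f \<phi> = (\<integral>x. complex_of_real (g x) * \<phi> x \<partial>lebesgue))"

definition fourier :: "('a::euclidean_space \<Rightarrow> complex) \<Rightarrow> 'a \<Rightarrow> complex" where
  "fourier \<phi> \<xi> = complex_of_real ((2 * pi) powr (- (real DIM('a) / 2))) *
     (\<integral>x. cis (- (x \<bullet> \<xi>)) * \<phi> x \<partial>lborel)"

definition fourier_inv :: "('a::euclidean_space \<Rightarrow> complex) \<Rightarrow> 'a \<Rightarrow> complex" where
  "fourier_inv \<phi> x = complex_of_real ((2 * pi) powr (- (real DIM('a) / 2))) *
     (\<integral>\<xi>. cis (x \<bullet> \<xi>) * \<phi> \<xi> \<partial>lborel)"

definition dist_fourier :: "('a::euclidean_space) distrib \<Rightarrow> 'a distrib" where
  "dist_fourier f = (\<lambda>\<phi>. f (fourier \<phi>))"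

definition dist_fourier_inv :: "('a::euclidean_space) distrib \<Rightarrow> 'a distrib" where
  "dist_fourier_inv f = (\<lambda>\<phi>. f (fourier_inv \<phi>))"

text \<open>Product with a smooth symbol of compact support.\<close>

definition smooth_mult ::
    "('a::euclidean_space \<Rightarrow> real) \<Rightarrow> 'a distrib \<Rightarrow> 'a distrib" where
  "smooth_mult m f = (\<lambda>\<phi>. f (\<lambda>\<xi>. complex_of_real (m \<xi>) * \<phi> \<xi>))"

text \<open>
  The symbol of the semigroup is continuous and bounded, but not smooth at the origin
  unless the exponent is an even integer, so \<open>m \<phi>\<close> need not be a Schwartz function.
  The product \<open>m F\<close> is therefore the usual product of distributions by regularisation:
  \<open>(m F) \<phi>\<close> is the limit of \<open>(F * \<rho>\<^sub>\<epsilon>) (m \<phi>)\<close>, up to reflection of \<open>\<rho>\<close>, required to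
  exist for every mollifier and not to depend on it. It agrees with the classical
  product when \<open>m\<close> is smooth with derivatives of at most polynomial growth.
\<close>

definition mollifier :: "('a::euclidean_space \<Rightarrow> real) \<Rightarrow> bool" where
  "mollifier \<rho> \<longleftrightarrow> smooth \<rho> \<and> bounded {x. \<rho> x \<noteq> 0} \<and> (\<forall>x. 0 \<le> \<rho> x) \<and>
     (\<integral>x. \<rho> x \<partial>lborel) = 1"

definition mollify ::
    "('a::euclidean_space \<Rightarrow> real) \<Rightarrow> real \<Rightarrow> ('a \<Rightarrow> complex) \<Rightarrow> 'a \<Rightarrow> complex" where
  "mollify \<rho> \<epsilon> \<psi> x =
     (\<integral>y. complex_of_real (\<rho> ((x - y) /\<^sub>R \<epsilon>) / \<epsilon> ^ DIM('a)) * \<psi> y \<partial>lborel)"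

definition has_reg_value ::
    "('a::euclidean_space) distrib \<Rightarrow> ('a \<Rightarrow> complex) \<Rightarrow> complex \<Rightarrow> bool" where
  "has_reg_value F \<psi> v \<longleftrightarrow>
     (\<forall>\<rho>. mollifier \<rho> \<longrightarrow> ((\<lambda>\<epsilon>. F (mollify \<rho> \<epsilon> \<psi>)) \<longlongrightarrow> v) (at_right 0))"

definition dist_mult ::
    "('a::euclidean_space \<Rightarrow> real) \<Rightarrow> 'a distrib \<Rightarrow> 'a distrib" where
  "dist_mult m F = (\<lambda>\<phi>. THE v. has_reg_value F (\<lambda>\<xi>. complex_of_real (m \<xi>) * \<phi> \<xi>) v)"

definition multipliable ::
    "('a::euclidean_space \<Rightarrow> real) \<Rightarrow> 'a distrib \<Rightarrow> bool" where
  "multipliable m F \<longleftrightarrow>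
     (\<forall>\<phi>\<in>schwartz. \<exists>v. has_reg_value F (\<lambda>\<xi>. complex_of_real (m \<xi>) * \<phi> \<xi>) v) \<and>
     dist_mult m F \<in> tempered"

section \<open>Lorentz spaces and local Lorentz--Morrey spaces\<close>

definition distribution_function ::
    "('a::euclidean_space \<Rightarrow> real) \<Rightarrow> real \<Rightarrow> ennreal" where
  "distribution_function f \<sigma> = emeasure lebesgue {x. \<bar>f x\<bar> > \<sigma>}"

definition rearrangement :: "('a::euclidean_space \<Rightarrow> real) \<Rightarrow> real \<Rightarrow> ennreal" where
  "rearrangement f l =
     (SUP \<sigma> \<in> {\<sigma>. 0 < \<sigma> \<and> distribution_function f \<sigma> > ennreal l}. ennreal \<sigma>)"

definition weak_lebesgue_norm :: "real \<Rightarrow> ('a::euclidean_space \<Rightarrow> real) \<Rightarrow> ennreal" where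
  "weak_lebesgue_norm q f = (SUP l \<in> {0<..}. ennreal (l powr (1 / q)) * rearrangement f l)"

definition lm_norm :: "real \<Rightarrow> real \<Rightarrow> ('a::euclidean_space \<Rightarrow> real) \<Rightarrow> ennreal" where
  "lm_norm p q f = (SUP R \<in> {0<..1}. SUP z.
     ennreal (R powr (real DIM('a) / p - real DIM('a) / q)) *
     weak_lebesgue_norm q (\<lambda>x. f x * indicator (ball z R) x))"

definition lm_space :: "real \<Rightarrow> real \<Rightarrow> ('a::euclidean_space \<Rightarrow> real) set" where
  "lm_space p q = {f \<in> borel_measurable lebesgue. lm_norm p q f < top}"

text \<open>
  The norm of a distribution as an element of the Lorentz--Morrey space: the norm of its
  representing function, which is unique almost everywhere, and infinite if there is none.
\<close>

definition dist_lm_norm :: "real \<Rightarrow> real \<Rightarrow> ('a::euclidean_space) distrib \<Rightarrow> ennreal" where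
  "dist_lm_norm p q f = (INF g \<in> {g \<in> lm_space p q. represents g f}. lm_norm p q g)"

section \<open>Littlewood--Paley decomposition and the spaces of Besov type\<close>

text \<open>
  Membership in \<open>C\<^sup>\<infinity>([0,\<infinity>))\<close> is the existence of a smooth extension to the real line;
  the values of \<open>\<zeta>\<close> at negative arguments are irrelevant.
\<close>

definition lp_cutoff :: "(real \<Rightarrow> real) \<Rightarrow> bool" where
  "lp_cutoff \<zeta> \<longleftrightarrow>
     (\<exists>g::real \<Rightarrow> real. smooth g \<and> (\<forall>t\<ge>0. g t = \<zeta> t)) \<and>
     (\<forall>t\<ge>0. 0 \<le> \<zeta> t \<and> \<zeta> t \<le> 1) \<and>
     (\<forall>t. 0 \<le> t \<and> t \<le> 3/2 \<longrightarrow> \<zeta> t = 1) \<and>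
     closure {t. 0 \<le> t \<and> \<zeta> t \<noteq> 0} \<subseteq> {0..<5/3}"

definition lp_symbol :: "(real \<Rightarrow> real) \<Rightarrow> nat \<Rightarrow> 'a::euclidean_space \<Rightarrow> real" where
  "lp_symbol \<zeta> j \<xi> =
     (if j = 0 then \<zeta> (norm \<xi>)
      else (let \<eta> = \<xi> /\<^sub>R 2 ^ j in \<zeta> (norm \<eta>) - \<zeta> (2 * norm \<eta>)))"

definition lp_block ::
    "(real \<Rightarrow> real) \<Rightarrow> nat \<Rightarrow> ('a::euclidean_space) distrib \<Rightarrow> 'a distrib" where
  "lp_block \<zeta> j f = dist_fourier_inv (smooth_mult (lp_symbol \<zeta> j) (dist_fourier f))"

definition blm_norm ::
    "(real \<Rightarrow> real) \<Rightarrow> real \<Rightarrow> real \<Rightarrow> real \<Rightarrow> ('a::euclidean_space) distrib \<Rightarrow> ennreal" where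
  "blm_norm \<zeta> s p q f =
     (SUP j::nat. ennreal (2 powr (s * real j)) * dist_lm_norm p q (lp_block \<zeta> j f))"

definition blm_space ::
    "(real \<Rightarrow> real) \<Rightarrow> real \<Rightarrow> real \<Rightarrow> real \<Rightarrow> ('a::euclidean_space) distrib set" where
  "blm_space \<zeta> s p q = {f \<in> tempered.
     (\<forall>j. \<exists>g \<in> lm_space p q. represents g (lp_block \<zeta> j f)) \<and> blm_norm \<zeta> s p q f < top}"

section \<open>The semigroup and the Duhamel integral\<close>

definition heat_symbol :: "real \<Rightarrow> real \<Rightarrow> 'a::euclidean_space \<Rightarrow> real" where
  "heat_symbol \<theta> t \<xi> = exp (- (t * norm \<xi> powr \<theta>))"

definition heat :: "real \<Rightarrow> real \<Rightarrow> ('a::euclidean_space) distrib \<Rightarrow> 'a distrib" where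
  "heat \<theta> t f = dist_fourier_inv (dist_mult (heat_symbol \<theta> t) (dist_fourier f))"

definition heat_defined :: "real \<Rightarrow> real \<Rightarrow> ('a::euclidean_space) distrib \<Rightarrow> bool" where
  "heat_defined \<theta> t f \<longleftrightarrow> multipliable (heat_symbol \<theta> t) (dist_fourier f)"

text \<open>The time integral is taken weakly, that is, tested against Schwartz functions.\<close>

definition duhamel :: "real \<Rightarrow> real \<Rightarrow> ('a::euclidean_space) distrib \<Rightarrow> 'a distrib" where
  "duhamel \<theta> t f =
     (\<lambda>\<phi>. set_lebesgue_integral lebesgue {0<..<t} (\<lambda>\<tau>. heat \<theta> (t - \<tau>) f \<phi>))"

definition duhamel_defined :: "real \<Rightarrow> real \<Rightarrow> ('a::euclidean_space) distrib \<Rightarrow> bool" where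
  "duhamel_defined \<theta> t f \<longleftrightarrow>
     (\<forall>\<tau>\<in>{0<..<t}. heat_defined \<theta> (t - \<tau>) f) \<and>
     (\<forall>\<phi>\<in>schwartz. set_integrable lebesgue {0<..<t} (\<lambda>\<tau>. heat \<theta> (t - \<tau>) f \<phi>))"

text \<open>
  The essential supremum is infinite if the norm is not measurable in time. Strong
  measurability is not demanded; for Duhamel integrals with finite norm it is automatic,
  as these are continuous in time on \<open>(0,T)\<close> with values in the Lorentz--Morrey space.
\<close>

definition linf_lm_norm ::
    "real \<Rightarrow> real \<Rightarrow> real \<Rightarrow> (real \<Rightarrow> ('a::euclidean_space) distrib) \<Rightarrow> ennreal" where
  "linf_lm_norm T p q u = esssup (lebesgue_on {0<..<T}) (\<lambda>t. dist_lm_norm p q (u t))"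

definition duhamel_domain ::
    "real \<Rightarrow> real \<Rightarrow> real \<Rightarrow> real \<Rightarrow> ('a::euclidean_space) distrib set" where
  "duhamel_domain \<theta> T p q = {f \<in> tempered.
     (AE t in lebesgue_on {0<..<T}. duhamel_defined \<theta> t f) \<and>
     linf_lm_norm T p q (\<lambda>t. duhamel \<theta> t f) < top}"

end

theory Submission
  imports Defs "HOL-Probability.Probability"
begin

text \<open>
  In Fourier variables the Duhamel integral up to time \<open>t\<close> is multiplication by
  \<open>a\<^sub>t(\<xi>) = (1 - exp (- t |\<xi>|\<^sup>\<theta>)) / |\<xi>|\<^sup>\<theta>\<close>. For the \<open>j\<close>-th Littlewood--Paley block one takes \<open>t\<close>
  slightly smaller than \<open>T 2\<^sup>-\<^sup>j\<^sup>\<theta>\<close>: then \<open>\<phi>\<^sub>j / a\<^sub>t\<close> is the Fourier transform of a kernel of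
  integral norm \<open>O(2\<^sup>j\<^sup>\<theta>)\<close>, and convolution with an integrable kernel is bounded on the
  Lorentz--Morrey space because \<open>q > 1\<close> allows the quasi-norm to be replaced by one defined
  through integrals.

  For \<open>j > 0\<close> the block avoids the origin, so all symbols involved are smooth and one may
  divide by \<open>a\<^sub>t\<close>. For \<open>j = 0\<close> the symbols are not smooth at \<open>\<xi> = 0\<close>, and their products with
  distributions are limits over mollifications. There the transform of \<open>\<mu>\<close> and the quotient by
  \<open>a\<^sub>t\<close> of the transform of the Duhamel integral differ by a functional \<open>E\<close> supported at the
  origin. The regularised product of \<open>E\<close> with \<open>exp (- s |\<xi>|\<^sup>\<theta>)\<close> is \<open>E\<close> itself, so \<open>E\<close> contributes
  \<open>t E\<close> to the Duhamel integral, while by construction it must contribute nothing; hence \<open>E = 0\<close>.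
\<close>

section \<open>Smooth functions\<close>

text \<open>The Duhamel bound holds only for almost every time, so \<open>t\<close> is picked from
  the interval (T/2, T) scaled by 2^(-j \<theta>), which has positive length. After dilation by
  2^(-j) the symbol depends on \<open>t\<close> and \<open>j\<close> only through t 2^(j \<theta>),
  confined to a compact interval; hence kernel norms that are uniform up to the factor 2^(j
  \<theta>).

  Near the origin 1 / a_t is 1 / t plus |\<xi>|^\<theta> times a smooth function of
  |\<xi>|^\<theta>. The nonsmooth part vanishes at the origin, so its dyadic pieces have kernels
  with geometrically decaying norms, and the quotient still has an integrable kernel.

  The functional E has some finite order, so it may contain derivatives of a Dirac mass, and their
  action on a function like |\<xi>|^\<theta> has no evident meaning. Instead of classifying such
  functionals, the proof descends on the order of vanishing at the origin. High order is killed by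
  E. In each step down, the factor exp (- s |\<xi>|^\<theta>) - 1 supplies \<theta> > 0 extra powers
  of the mollification scale, which sends the Taylor coefficients up to the current order to
  zero.\<close>

primrec ndiff_on ::
    "nat \<Rightarrow> 'a set \<Rightarrow> ('a::euclidean_space \<Rightarrow> 'b::real_normed_vector) \<Rightarrow> bool" where
  "ndiff_on 0 S f \<longleftrightarrow> True"
| "ndiff_on (Suc n) S f \<longleftrightarrow>
     (\<forall>x\<in>S. f differentiable (at x)) \<and> (\<forall>b\<in>Basis. ndiff_on n S (partial_deriv b f))"

definition smooth_on :: "'a set \<Rightarrow> ('a::euclidean_space \<Rightarrow> 'b::real_normed_vector) \<Rightarrow> bool" where
  "smooth_on S f \<longleftrightarrow> (\<forall>n. ndiff_on n S f)"

lemma partial_deriv_eq: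
  assumes "(f has_derivative D) (at x)"
  shows "partial_deriv b f x = D b"
  using frechet_derivative_at[OF assms] by (simp add: partial_deriv_def)

lemma has_derivative_partial_deriv:
  fixes f :: "'a::euclidean_space \<Rightarrow> 'b::real_normed_vector"
  assumes "f differentiable (at x)"
  shows "(f has_derivative (\<lambda>h. \<Sum>b\<in>Basis. (h \<bullet> b) *\<^sub>R partial_deriv b f x)) (at x)"
proof -
  let ?D = "frechet_derivative f (at x)"
  have D: "(f has_derivative ?D) (at x)"
    using assms frechet_derivative_works by blast
  then interpret bounded_linear ?D by (rule has_derivative_bounded_linear)
  have "?D = (\<lambda>h. \<Sum>b\<in>Basis. (h \<bullet> b) *\<^sub>R partial_deriv b f x)"
  proof
    fix h
    have "?D h = ?D (\<Sum>b\<in>Basis. (h \<bullet> b) *\<^sub>R b)" by (simp add: euclidean_representation)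
    then show "?D h = (\<Sum>b\<in>Basis. (h \<bullet> b) *\<^sub>R partial_deriv b f x)"
      by (simp add: sum scaleR partial_deriv_def)
  qed
  with D show ?thesis by simp
qed

lemma has_derivative_cong_open:
  assumes "open S" "x \<in> S" "\<And>y. y \<in> S \<Longrightarrow> f y = g y"
  shows "(f has_derivative D) (at x) \<longleftrightarrow> (g has_derivative D) (at x)"
  using assms has_derivative_transform_within_open[of f D x UNIV S g]
    has_derivative_transform_within_open[of g D x UNIV S f] by auto

lemma partial_deriv_cong_open:
  assumes "open S" "x \<in> S" "\<And>y. y \<in> S \<Longrightarrow> f y = g y"
  shows "partial_deriv b f x = partial_deriv b g x"
  using has_derivative_cong_open[OF assms]
  by (simp add: partial_deriv_def frechet_derivative_def)

lemma differentiable_cong_open: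
  assumes "open S" "x \<in> S" "\<And>y. y \<in> S \<Longrightarrow> f y = g y"
  shows "f differentiable (at x) \<longleftrightarrow> g differentiable (at x)"
  using has_derivative_cong_open[OF assms] by (simp add: differentiable_def)

lemma ndiff_on_cong:
  assumes "open S" "\<And>y. y \<in> S \<Longrightarrow> f y = g y"
  shows "ndiff_on n S f \<longleftrightarrow> ndiff_on n S g"
  using assms(2)
proof (induction n arbitrary: f g)
  case (Suc n)
  have "ndiff_on n S (partial_deriv b f) = ndiff_on n S (partial_deriv b g)" for b
    by (intro Suc.IH partial_deriv_cong_open[OF assms(1)] Suc.prems)
  moreover have "\<forall>x\<in>S. f differentiable (at x) \<longleftrightarrow> g differentiable (at x)"
    using differentiable_cong_open[OF assms(1)] Suc.prems by blast
  ultimately show ?case by simp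
qed simp

lemma ndiff_on_mono: "ndiff_on n S f \<Longrightarrow> T \<subseteq> S \<Longrightarrow> ndiff_on n T f"
  by (induction n arbitrary: f) auto

lemma ndiff_on_SucD: "ndiff_on (Suc n) S f \<Longrightarrow> ndiff_on n S f"
  by (induction n arbitrary: f) auto

lemma ndiff_on_Un: "ndiff_on n S f \<Longrightarrow> ndiff_on n T f \<Longrightarrow> ndiff_on n (S \<union> T) f"
  by (induction n arbitrary: f) auto

lemma ndiff_on_SucI:
  assumes "open S" "\<And>x. x \<in> S \<Longrightarrow> (f has_derivative D x) (at x)"
    "\<And>b. b \<in> Basis \<Longrightarrow> ndiff_on n S (\<lambda>x. D x b)"
  shows "ndiff_on (Suc n) S f"
proof -
  have "ndiff_on n S (partial_deriv b f)" if "b \<in> Basis" for b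
    using ndiff_on_cong[OF assms(1), of "partial_deriv b f" "\<lambda>x. D x b"]
      partial_deriv_eq[OF assms(2)] assms(3)[OF that] by auto
  then show ?thesis using assms(2) by (auto simp: differentiable_def)
qed

lemma ndiff_on_const: "ndiff_on n S (\<lambda>x. c)"
proof (induction n arbitrary: c)
  case (Suc n)
  have "partial_deriv b (\<lambda>x. c) = (\<lambda>x. 0)" for b :: 'a
    by (rule ext) (simp add: partial_deriv_def)
  then show ?case using Suc by simp
qed simp

lemma ndiff_on_bounded_linear:
  assumes "open S" "bounded_linear L" "ndiff_on n S f"
  shows "ndiff_on n S (\<lambda>x. L (f x))"
  using assms(3)
proof (induction n arbitrary: f)
  case (Suc n)
  show ?case
  proof (rule ndiff_on_SucI[OF assms(1)])
    fix x assume "x \<in> S"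
    then have "f differentiable (at x)" using Suc.prems by simp
    from bounded_linear.has_derivative[OF assms(2) has_derivative_partial_deriv[OF this]]
    show "((\<lambda>x. L (f x)) has_derivative (\<lambda>h. L (\<Sum>b\<in>Basis. (h \<bullet> b) *\<^sub>R partial_deriv b f x))) (at x)" .
  next
    fix b :: 'a assume b: "b \<in> Basis"
    have "(\<Sum>c\<in>Basis. (b \<bullet> c) *\<^sub>R partial_deriv c f x) = partial_deriv b f x" for x
      using b by (simp add: inner_Basis if_distrib if_distribR sum.delta cong: if_cong)
    then show "ndiff_on n S (\<lambda>x. L (\<Sum>c\<in>Basis. (b \<bullet> c) *\<^sub>R partial_deriv c f x))"
      using Suc.IH Suc.prems b by simp
  qed
qed simp

lemma ndiff_on_linear:
  assumes "open S" "bounded_linear L"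
  shows "ndiff_on n S L"
proof (cases n)
  case (Suc m)
  show ?thesis unfolding Suc
    by (rule ndiff_on_SucI[OF assms(1), where D = "\<lambda>_. L"])
       (auto intro: bounded_linear_imp_has_derivative assms ndiff_on_const)
qed simp

lemma ndiff_on_add:
  assumes "open S" "ndiff_on n S f" "ndiff_on n S g"
  shows "ndiff_on n S (\<lambda>x. f x + g x)"
  using assms(2,3)
proof (induction n arbitrary: f g)
  case (Suc n)
  show ?case
  proof (rule ndiff_on_SucI[OF assms(1)])
    fix x assume "x \<in> S"
    then show "((\<lambda>x. f x + g x) has_derivative (\<lambda>h. frechet_derivative f (at x) h + frechet_derivative g (at x) h)) (at x)"
      using Suc.prems by (intro has_derivative_add) (auto simp: frechet_derivative_works[symmetric])
  next
    fix b :: 'a assume b: "b \<in> Basis"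
    have "ndiff_on n S (\<lambda>x. partial_deriv b f x + partial_deriv b g x)"
      by (rule Suc.IH) (use Suc.prems b in simp_all)
    then show "ndiff_on n S (\<lambda>x. frechet_derivative f (at x) b + frechet_derivative g (at x) b)"
      by (simp add: partial_deriv_def)
  qed
qed simp

lemma ndiff_on_sum:
  assumes "open S" "\<And>i. i \<in> I \<Longrightarrow> ndiff_on n S (f i)"
  shows "ndiff_on n S (\<lambda>x. \<Sum>i\<in>I. f i x)"
proof (cases "finite I")
  case True
  then show ?thesis using assms(2)
    by (induction I rule: finite_induct) (auto intro: ndiff_on_const ndiff_on_add assms(1))
qed (simp add: ndiff_on_const)

lemma ndiff_on_bilinear:
  assumes "open S" "bounded_bilinear m" "ndiff_on n S f" "ndiff_on n S g"
  shows "ndiff_on n S (\<lambda>x. m (f x) (g x))"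
  using assms(3,4)
proof (induction n arbitrary: f g)
  case (Suc n)
  show ?case
  proof (rule ndiff_on_SucI[OF assms(1)])
    fix x assume "x \<in> S"
    then show "((\<lambda>x. m (f x) (g x)) has_derivative
        (\<lambda>h. m (f x) (frechet_derivative g (at x) h) + m (frechet_derivative f (at x) h) (g x))) (at x)"
      using Suc.prems
      by (intro bounded_bilinear.FDERIV[OF assms(2)]) (auto simp: frechet_derivative_works[symmetric])
  next
    fix b :: 'a assume b: "b \<in> Basis"
    have "ndiff_on n S (\<lambda>x. m (f x) (partial_deriv b g x))"
      by (rule Suc.IH) (use Suc.prems ndiff_on_SucD[OF Suc.prems(1)] ndiff_on_SucD[OF Suc.prems(2)] b in simp_all)
    moreover have "ndiff_on n S (\<lambda>x. m (partial_deriv b f x) (g x))"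
      by (rule Suc.IH) (use Suc.prems ndiff_on_SucD[OF Suc.prems(1)] ndiff_on_SucD[OF Suc.prems(2)] b in simp_all)
    ultimately show "ndiff_on n S (\<lambda>x. m (f x) (frechet_derivative g (at x) b) + m (frechet_derivative f (at x) b) (g x))"
      using ndiff_on_add[OF assms(1)] by (simp add: partial_deriv_def)
  qed
qed simp

text \<open>The chain rule writes each first partial derivative as a sum of products of a derivative
  of \<open>f\<close> with a composition of lower order, so an induction generalised over
  \<open>g\<close> alone suffices.\<close>

lemma ndiff_on_compose:
  fixes f :: "'a::euclidean_space \<Rightarrow> 'b::euclidean_space" and g :: "'b \<Rightarrow> 'c::real_normed_vector"
  assumes "open S" "f ` S \<subseteq> U" "ndiff_on n S f" "ndiff_on n U g"
  shows "ndiff_on n S (\<lambda>x. g (f x))"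
  using assms(3,4)
proof (induction n arbitrary: g)
  case (Suc n)
  show ?case
  proof (rule ndiff_on_SucI[OF assms(1)])
    fix x assume x: "x \<in> S"
    then have "g differentiable (at (f x))" "f differentiable (at x)"
      using Suc.prems assms(2) by auto
    from has_derivative_compose[of f "frechet_derivative f (at x)" x UNIV g,
        OF _ has_derivative_partial_deriv[OF this(1)]] this(2)
    show "((\<lambda>x. g (f x)) has_derivative (\<lambda>h. \<Sum>e\<in>Basis. (frechet_derivative f (at x) h \<bullet> e) *\<^sub>R partial_deriv e g (f x))) (at x)"
      by (simp add: frechet_derivative_works[symmetric])
  next
    fix b :: 'a assume b: "b \<in> Basis"
    have "ndiff_on n S (\<lambda>x. (partial_deriv b f x \<bullet> e) *\<^sub>R partial_deriv e g (f x))"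
      if "e \<in> Basis" for e
    proof (rule ndiff_on_bilinear[OF assms(1) bounded_bilinear_scaleR])
      show "ndiff_on n S (\<lambda>x. partial_deriv b f x \<bullet> e)"
        by (rule ndiff_on_bounded_linear[OF assms(1) bounded_linear_inner_left])
           (use Suc.prems b in simp)
      show "ndiff_on n S (\<lambda>x. partial_deriv e g (f x))"
        using Suc.IH[OF ndiff_on_SucD, of "partial_deriv e g"] Suc.prems that by simp
    qed
    from ndiff_on_sum[OF assms(1) this]
    show "ndiff_on n S (\<lambda>x. \<Sum>e\<in>Basis. (frechet_derivative f (at x) b \<bullet> e) *\<^sub>R partial_deriv e g (f x))"
      by (simp add: partial_deriv_def)
  qed
qed simp

lemma iter_partial_snoc:
  "iter_partial (bs @ [b]) f = iter_partial bs (partial_deriv b f)"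
  by (simp add: iter_partial_def)

lemma iter_partial_Nil [simp]: "iter_partial [] f = f"
  by (simp add: iter_partial_def)

lemma iter_partial_Cons: "iter_partial (b # bs) f = partial_deriv b (iter_partial bs f)"
  by (simp add: iter_partial_def)

text \<open>\<open>ndiff_on\<close> differentiates \<open>f\<close> first and recurses on the
  derivative, and that first derivative is the last entry of the list in
  \<open>iter_partial\<close>; the lists are therefore split at their end.\<close>

lemma ndiff_on_iff_iter_partial:
  "ndiff_on n S f \<longleftrightarrow>
     (\<forall>bs. set bs \<subseteq> Basis \<and> length bs < n \<longrightarrow> (\<forall>x\<in>S. iter_partial bs f differentiable (at x)))"
proof (induction n arbitrary: f)
  case (Suc n)
  show ?case (is "_ \<longleftrightarrow> ?R")
  proof
    assume L: "ndiff_on (Suc n) S f"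
    show ?R
    proof (intro allI impI ballI)
      fix bs x assume bs: "set bs \<subseteq> (Basis::'a set) \<and> length bs < Suc n" and x: "x \<in> S"
      show "iter_partial bs f differentiable (at x)"
      proof (cases bs rule: rev_cases)
        case (snoc cs b)
        then have "ndiff_on n S (partial_deriv b f)" using L bs by auto
        then show ?thesis using Suc.IH bs x snoc by (auto simp: iter_partial_snoc)
      qed (use L x in auto)
    qed
  next
    assume R: ?R
    have "ndiff_on n S (partial_deriv b f)" if "b \<in> Basis" for b
      unfolding Suc.IH
    proof (intro allI impI ballI)
      fix bs x assume "set bs \<subseteq> (Basis::'a set) \<and> length bs < n" "x \<in> S"
      then show "iter_partial bs (partial_deriv b f) differentiable (at x)"
        using R[rule_format, of "bs @ [b]" x] that by (simp add: iter_partial_snoc)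
    qed
    moreover have "\<forall>x\<in>S. f differentiable (at x)" using R[rule_format, of "[]"] by simp
    ultimately show "ndiff_on (Suc n) S f" by simp
  qed
qed simp

lemma smooth_iff_smooth_on: "smooth f \<longleftrightarrow> smooth_on UNIV f"
  unfolding smooth_def smooth_on_def ndiff_on_iff_iter_partial by blast

lemma smooth_on_cong:
  "open S \<Longrightarrow> (\<And>y. y \<in> S \<Longrightarrow> f y = g y) \<Longrightarrow> smooth_on S f \<longleftrightarrow> smooth_on S g"
  using ndiff_on_cong[of S f g] by (simp add: smooth_on_def)

lemma smooth_on_subset: "smooth_on S f \<Longrightarrow> T \<subseteq> S \<Longrightarrow> smooth_on T f"
  unfolding smooth_on_def by (blast intro: ndiff_on_mono)

lemma smooth_on_Un: "smooth_on S f \<Longrightarrow> smooth_on T f \<Longrightarrow> smooth_on (S \<union> T) f"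
  unfolding smooth_on_def by (blast intro: ndiff_on_Un)

lemma smooth_on_const [intro, simp]: "smooth_on S (\<lambda>x. c)"
  by (simp add: smooth_on_def ndiff_on_const)

lemma smooth_on_linear: "open S \<Longrightarrow> bounded_linear L \<Longrightarrow> smooth_on S L"
  by (simp add: smooth_on_def ndiff_on_linear)

lemma smooth_on_bounded_linear:
  "open S \<Longrightarrow> bounded_linear L \<Longrightarrow> smooth_on S f \<Longrightarrow> smooth_on S (\<lambda>x. L (f x))"
  by (simp add: smooth_on_def ndiff_on_bounded_linear)

lemma smooth_on_add:
  "open S \<Longrightarrow> smooth_on S f \<Longrightarrow> smooth_on S g \<Longrightarrow> smooth_on S (\<lambda>x. f x + g x)"
  by (simp add: smooth_on_def ndiff_on_add)

lemma smooth_on_bilinear: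
  "open S \<Longrightarrow> bounded_bilinear m \<Longrightarrow> smooth_on S f \<Longrightarrow> smooth_on S g \<Longrightarrow>
     smooth_on S (\<lambda>x. m (f x) (g x))"
  by (simp add: smooth_on_def ndiff_on_bilinear)

lemma smooth_on_mult:
  fixes f g :: "'a::euclidean_space \<Rightarrow> 'b::real_normed_algebra"
  shows "open S \<Longrightarrow> smooth_on S f \<Longrightarrow> smooth_on S g \<Longrightarrow> smooth_on S (\<lambda>x. f x * g x)"
  by (rule smooth_on_bilinear[OF _ bounded_bilinear_mult])

lemma smooth_on_minus:
  assumes "open S" "smooth_on S f"
  shows "smooth_on S (\<lambda>x. - f x)"
  using smooth_on_bounded_linear[OF assms(1) bounded_linear_minus[OF bounded_linear_ident] assms(2)] by simp

lemma smooth_on_diff: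
  "open S \<Longrightarrow> smooth_on S f \<Longrightarrow> smooth_on S g \<Longrightarrow> smooth_on S (\<lambda>x. f x - g x)"
  using smooth_on_add[of S f "\<lambda>x. - g x"] by (simp add: smooth_on_minus)

lemma smooth_on_compose:
  fixes f :: "'a::euclidean_space \<Rightarrow> 'b::euclidean_space"
  assumes "open S" "f ` S \<subseteq> U" "smooth_on S f" "smooth_on U g"
  shows "smooth_on S (\<lambda>x. g (f x))"
  using assms ndiff_on_compose unfolding smooth_on_def by blast

lemma smooth_on_partial_deriv: "smooth_on S f \<Longrightarrow> b \<in> Basis \<Longrightarrow> smooth_on S (partial_deriv b f)"
  unfolding smooth_on_def by (metis ndiff_on.simps(2))

lemma smooth_on_iter_partial:
  "smooth_on S f \<Longrightarrow> set bs \<subseteq> Basis \<Longrightarrow> smooth_on S (iter_partial bs f)"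
  by (induction bs) (auto simp: iter_partial_Cons intro: smooth_on_partial_deriv)

lemma smooth_on_differentiable: "smooth_on S f \<Longrightarrow> x \<in> S \<Longrightarrow> f differentiable (at x)"
  unfolding smooth_on_def by (metis ndiff_on.simps(2))

lemma smooth_on_continuous_on: "smooth_on S f \<Longrightarrow> continuous_on S f"
  by (meson differentiable_at_withinI differentiable_imp_continuous_on differentiable_on_def
      smooth_on_differentiable)

text \<open>Reduces smoothness on the line to exhibiting all derivatives at once; serves the
  exponential, real powers and power series.\<close>

lemma smooth_on_real_sequence:
  fixes h :: "nat \<Rightarrow> real \<Rightarrow> 'b::real_normed_vector"
  assumes "open U" "\<And>n x. x \<in> U \<Longrightarrow> (h n has_vector_derivative h (Suc n) x) (at x)"
  shows "smooth_on U (h 0)"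
proof -
  have "ndiff_on n U (h k)" for n k
  proof (induction n arbitrary: k)
    case (Suc n)
    show ?case
      by (rule ndiff_on_SucI[OF assms(1) assms(2)[unfolded has_vector_derivative_def]])
         (use Suc in \<open>auto simp: Basis_real_def\<close>)
  qed simp
  then show ?thesis by (simp add: smooth_on_def)
qed

lemma smooth_on_exp: "smooth_on UNIV (exp :: real \<Rightarrow> real)"
  by (rule smooth_on_real_sequence[where h = "\<lambda>_. exp"])
     (auto simp: has_real_derivative_iff_has_vector_derivative[symmetric])

lemma smooth_on_powr: "smooth_on {0<..} (\<lambda>x::real. x powr a)"
proof -
  \<comment> \<open>\<open>h n\<close> is the n-th derivative: the falling factorial a (a - 1) ...
    (a - n + 1), written as a rising one that starts from its last factor.\<close>
  define h where "h n x = pochhammer (a - real n + 1) n * x powr (a - real n)" for n x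
  have "(h n has_vector_derivative h (Suc n) x) (at x)" if "x > 0" for n x
  proof -
    have "pochhammer (a - real (Suc n) + 1) (Suc n) = (a - real n) * pochhammer (a - real n + 1) n"
      by (simp add: pochhammer_rec)
    then have eq: "h (Suc n) x = pochhammer (a - real n + 1) n * ((a - real n) * x powr (a - real n - 1))"
      by (simp add: h_def diff_diff_eq add.commute)
    have "(h n has_real_derivative h (Suc n) x) (at x)"
      unfolding eq unfolding h_def using that
      by (intro DERIV_cmult has_real_derivative_powr)
    then show ?thesis by (simp add: has_real_derivative_iff_has_vector_derivative)
  qed
  then have "smooth_on {0<..} (h 0)" by (intro smooth_on_real_sequence) auto
  then show ?thesis by (simp add: h_def[abs_def])
qed

lemma smooth_on_inverse: "smooth_on {0<..} (inverse :: real \<Rightarrow> real)"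
  using smooth_on_powr[of "-1"]
    smooth_on_cong[of "{0<..}" "\<lambda>x::real. x powr -1" inverse] by (simp add: powr_minus)

text \<open>The square of the norm is a polynomial, positive off the origin, so the power is taken
  of \<open>x \<bullet> x\<close> with half the exponent.\<close>

lemma smooth_on_norm_powr:
  fixes S :: "'a::euclidean_space set"
  assumes "open S" "0 \<notin> S"
  shows "smooth_on S (\<lambda>x. norm x powr a)"
proof -
  have "smooth_on S (\<lambda>x. (x \<bullet> x) powr (a/2))"
  proof (rule smooth_on_compose[OF assms(1) _ _ smooth_on_powr])
    show "(\<lambda>x. x \<bullet> x) ` S \<subseteq> {0<..}" using assms(2) by auto
    show "smooth_on S (\<lambda>x. x \<bullet> x)"
      by (intro smooth_on_bilinear[OF assms(1) bounded_bilinear_inner]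
          smooth_on_linear assms bounded_linear_ident)
  qed
  moreover have "(x \<bullet> x) powr (a/2) = norm x powr a" for x :: 'a
    by (cases "x = 0") (auto simp: dot_square_norm powr_powr simp flip: powr_numeral)
  ultimately show ?thesis by simp
qed

section \<open>Weighted bounds on derivatives\<close>

text \<open>One constant for all partial derivatives of order at most \<open>n\<close> under a fixed
  weight. Carrying the bound explicitly instead of a supremum lets estimates be combined without
  boundedness side conditions, and the set \<open>S\<close> allows gluing over a cover.\<close>

primrec wbound ::
    "'a set \<Rightarrow> nat \<Rightarrow> nat \<Rightarrow> real \<Rightarrow> ('a::euclidean_space \<Rightarrow> 'b::real_normed_vector) \<Rightarrow> bool" where
  "wbound S k 0 B f \<longleftrightarrow> (\<forall>x\<in>S. (1 + norm x) ^ k * norm (f x) \<le> B)"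
| "wbound S k (Suc n) B f \<longleftrightarrow> (\<forall>x\<in>S. (1 + norm x) ^ k * norm (f x) \<le> B) \<and>
     (\<forall>b\<in>Basis. wbound S k n B (partial_deriv b f))"

lemma wboundD0: "wbound S k n B f \<Longrightarrow> x \<in> S \<Longrightarrow> (1 + norm x) ^ k * norm (f x) \<le> B"
  by (cases n) auto

lemma wbound_nonneg: "wbound S k n B f \<Longrightarrow> x \<in> S \<Longrightarrow> 0 \<le> B"
  using wboundD0[of S k n B f x] by (smt (verit) mult_nonneg_nonneg norm_ge_zero zero_le_power)

lemma wbound_partial_deriv: "wbound S k (Suc n) B f \<Longrightarrow> b \<in> Basis \<Longrightarrow> wbound S k n B (partial_deriv b f)"
  by simp

lemma wbound_iff_iter_partial:
  "wbound S k n B f \<longleftrightarrow> (\<forall>bs. set bs \<subseteq> Basis \<and> length bs \<le> n \<longrightarrow>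
     (\<forall>x\<in>S. (1 + norm x) ^ k * norm (iter_partial bs f x) \<le> B))"
proof (induction n arbitrary: f)
  case (Suc n)
  show ?case (is "_ \<longleftrightarrow> ?R")
  proof
    assume L: "wbound S k (Suc n) B f"
    show ?R
    proof (intro allI impI ballI)
      fix bs x assume bs: "set bs \<subseteq> (Basis::'a set) \<and> length bs \<le> Suc n" and x: "x \<in> S"
      show "(1 + norm x) ^ k * norm (iter_partial bs f x) \<le> B"
      proof (cases bs rule: rev_cases)
        case (snoc cs b)
        then have "wbound S k n B (partial_deriv b f)" using L bs by auto
        then show ?thesis using Suc.IH bs x snoc by (auto simp: iter_partial_snoc)
      qed (use L x in auto)
    qed
  next
    assume R: ?R
    have "wbound S k n B (partial_deriv b f)" if "b \<in> Basis" for b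
      unfolding Suc.IH
    proof (intro allI impI ballI)
      fix bs x assume "set bs \<subseteq> (Basis::'a set) \<and> length bs \<le> n" "x \<in> S"
      then show "(1 + norm x) ^ k * norm (iter_partial bs (partial_deriv b f) x) \<le> B"
        using R[rule_format, of "bs @ [b]" x] that by (simp add: iter_partial_snoc)
    qed
    moreover have "\<forall>x\<in>S. (1 + norm x) ^ k * norm (f x) \<le> B" using R[rule_format, of "[]"] by simp
    ultimately show "wbound S k (Suc n) B f" by simp
  qed
qed simp

lemma wbound_cong:
  assumes "open S" "\<And>y. y \<in> S \<Longrightarrow> f y = g y"
  shows "wbound S k n B f \<longleftrightarrow> wbound S k n B g"
  using assms(2)
proof (induction n arbitrary: f g)
  case (Suc n)
  have "wbound S k n B (partial_deriv b f) = wbound S k n B (partial_deriv b g)" for b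
    by (intro Suc.IH partial_deriv_cong_open[OF assms(1)] Suc.prems)
  then show ?case using Suc.prems by simp
qed simp

lemma wbound_mono:
  assumes "wbound S k n B f" "k' \<le> k" "n' \<le> n" "B \<le> B'" "T \<subseteq> S"
  shows "wbound T k' n' B' f"
  unfolding wbound_iff_iter_partial
proof (intro allI impI ballI)
  fix bs x assume "set bs \<subseteq> (Basis::'a set) \<and> length bs \<le> n'" "x \<in> T"
  then have "(1 + norm x) ^ k * norm (iter_partial bs f x) \<le> B"
    using assms unfolding wbound_iff_iter_partial by auto
  moreover have "(1 + norm x) ^ k' * norm (iter_partial bs f x) \<le> (1 + norm x) ^ k * norm (iter_partial bs f x)"
    using assms by (intro mult_right_mono power_increasing) auto
  ultimately show "(1 + norm x) ^ k' * norm (iter_partial bs f x) \<le> B'" using assms by linarith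
qed

lemma wbound_add:
  assumes "open S" "smooth_on S f" "smooth_on S g" "wbound S k n B f" "wbound S k n C g"
  shows "wbound S k n (B + C) (\<lambda>x. f x + g x)"
  using assms(2-)
proof (induction n arbitrary: f g)
  case 0
  have "(1 + norm x) ^ k * norm (f x + g x) \<le> (1 + norm x) ^ k * norm (f x) + (1 + norm x) ^ k * norm (g x)" for x
    by (metis distrib_left mult_left_mono norm_triangle_ineq zero_le_power add_nonneg_nonneg zero_le_one norm_ge_zero)
  with 0 show ?case by (fastforce intro: order_trans)
next
  case (Suc n)
  have "wbound S k n (B + C) (partial_deriv b (\<lambda>x. f x + g x))" if b: "b \<in> Basis" for b
  proof -
    have "partial_deriv b (\<lambda>x. f x + g x) x = partial_deriv b f x + partial_deriv b g x" if "x \<in> S" for x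
      using has_derivative_add[of f "frechet_derivative f (at x)" "at x" g "frechet_derivative g (at x)"]
        smooth_on_differentiable[OF Suc.prems(1) that] smooth_on_differentiable[OF Suc.prems(2) that]
      by (subst partial_deriv_eq) (auto simp: frechet_derivative_works[symmetric] partial_deriv_def)
    then show ?thesis
      using wbound_cong[OF assms(1), of "partial_deriv b (\<lambda>x. f x + g x)" "\<lambda>x. partial_deriv b f x + partial_deriv b g x"]
        Suc.IH[of "partial_deriv b f" "partial_deriv b g"] Suc.prems b
      by (auto intro: smooth_on_partial_deriv)
  qed
  moreover have "(1 + norm x) ^ k * norm (f x + g x) \<le> (1 + norm x) ^ k * norm (f x) + (1 + norm x) ^ k * norm (g x)" for x
    by (metis distrib_left mult_left_mono norm_triangle_ineq zero_le_power add_nonneg_nonneg zero_le_one norm_ge_zero)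
  ultimately show ?case using Suc.prems by (fastforce intro: order_trans)
qed

lemma wbound_bounded_linear:
  assumes "open S" "smooth_on S f" "wbound S k n B f" "bounded_linear L" "\<And>x. norm (L x) \<le> K * norm x" "0 \<le> K"
  shows "wbound S k n (K * B) (\<lambda>x. L (f x))"
  using assms(2,3)
proof (induction n arbitrary: f)
  have *: "(1 + norm x) ^ k * norm (L (f x)) \<le> K * B" if "(1 + norm x) ^ k * norm (f x) \<le> B" for x :: 'a and f :: "'a \<Rightarrow> 'b"
  proof -
    have "(1 + norm x) ^ k * norm (L (f x)) \<le> (1 + norm x) ^ k * (K * norm (f x))"
      by (intro mult_left_mono assms) auto
    also have "\<dots> = K * ((1 + norm x) ^ k * norm (f x))" by simp
    also have "\<dots> \<le> K * B" using that assms by (intro mult_left_mono) auto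
    finally show ?thesis .
  qed
  {
    case 0
    then show ?case using * by auto
  next
    case (Suc n)
    have "wbound S k n (K * B) (partial_deriv b (\<lambda>x. L (f x)))" if b: "b \<in> Basis" for b
    proof -
      have "partial_deriv b (\<lambda>x. L (f x)) x = L (partial_deriv b f x)" if "x \<in> S" for x
        using bounded_linear.has_derivative[OF assms(4), of f "frechet_derivative f (at x)" "at x"]
          smooth_on_differentiable[OF Suc.prems(1) that]
        by (subst partial_deriv_eq) (auto simp: frechet_derivative_works[symmetric] partial_deriv_def)
      then show ?thesis
        using wbound_cong[OF assms(1), of "partial_deriv b (\<lambda>x. L (f x))" "\<lambda>x. L (partial_deriv b f x)"]
          Suc.IH[of "partial_deriv b f"] Suc.prems b
        by (auto intro: smooth_on_partial_deriv)
    qed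
    with Suc.prems * show ?case by auto
  }
qed

lemma wbound_cmult:
  fixes f :: "'a::euclidean_space \<Rightarrow> 'b::real_normed_algebra"
  assumes "open S" "smooth_on S f" "wbound S k n B f"
  shows "wbound S k n (norm c * B) (\<lambda>x. c * f x)"
  by (rule wbound_bounded_linear[OF assms bounded_linear_mult_right]) (auto intro: norm_mult_ineq)

lemma partial_deriv_mult:
  fixes f g :: "'a::euclidean_space \<Rightarrow> 'b::real_normed_algebra"
  assumes "f differentiable (at x)" "g differentiable (at x)"
  shows "partial_deriv b (\<lambda>x. f x * g x) x = f x * partial_deriv b g x + partial_deriv b f x * g x"
  using has_derivative_mult[of f "frechet_derivative f (at x)" x UNIV g "frechet_derivative g (at x)"] assms
  by (subst partial_deriv_eq) (auto simp: frechet_derivative_works[symmetric] partial_deriv_def)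

text \<open>The factor \<open>2 ^ n\<close> counts the terms of the iterated Leibniz rule, each
  derivative doubling the number of products. The weights of the two factors add up.\<close>

lemma wbound_mult:
  fixes f g :: "'a::euclidean_space \<Rightarrow> 'b::real_normed_algebra"
  assumes "open S" "smooth_on S f" "smooth_on S g" "wbound S k n B f" "wbound S l n C g"
  shows "wbound S (k + l) n (2 ^ n * (B * C)) (\<lambda>x. f x * g x)"
  using assms(2-)
proof (induction n arbitrary: f g)
  have *: "(1 + norm x) ^ (k + l) * norm (f x * g x) \<le> B * C"
    if "(1 + norm x) ^ k * norm (f x) \<le> B" "(1 + norm x) ^ l * norm (g x) \<le> C" for x :: 'a and f g :: "'a \<Rightarrow> 'b"
  proof -
    have "(1 + norm x) ^ (k + l) * norm (f x * g x) \<le> (1 + norm x) ^ (k + l) * (norm (f x) * norm (g x))"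
      by (intro mult_left_mono norm_mult_ineq) auto
    also have "\<dots> = ((1 + norm x) ^ k * norm (f x)) * ((1 + norm x) ^ l * norm (g x))"
      by (simp add: power_add)
    also have "\<dots> \<le> B * C"
      using that by (intro mult_mono) (auto intro: order_trans[OF _ that(1)])
    finally show ?thesis .
  qed
  {
    case 0
    then show ?case using * by simp
  next
    case (Suc n)
    have "wbound S (k + l) n (2 ^ Suc n * (B * C)) (partial_deriv b (\<lambda>x. f x * g x))" if b: "b \<in> Basis" for b
    proof -
      have fg: "wbound S k n B f" "wbound S l n C g"
        using wbound_mono[OF Suc.prems(3), of k n B S] wbound_mono[OF Suc.prems(4), of l n C S] by auto
      have "wbound S (k + l) n (2 ^ n * (B * C) + 2 ^ n * (B * C))
          (\<lambda>x. f x * partial_deriv b g x + partial_deriv b f x * g x)"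
        using Suc.prems fg b
        by (intro wbound_add Suc.IH smooth_on_mult smooth_on_partial_deriv assms(1)) auto
      moreover have "2 ^ n * (B * C) + 2 ^ n * (B * C) = 2 ^ Suc n * (B * C)" by simp
      ultimately show ?thesis
        using wbound_cong[OF assms(1), of "partial_deriv b (\<lambda>x. f x * g x)"
            "\<lambda>x. f x * partial_deriv b g x + partial_deriv b f x * g x"]
          partial_deriv_mult[OF smooth_on_differentiable[OF Suc.prems(1)] smooth_on_differentiable[OF Suc.prems(2)]]
        by simp
    qed
    moreover have "(1 + norm x) ^ (k + l) * norm (f x * g x) \<le> 2 ^ Suc n * (B * C)" if "x \<in> S" for x
    proof -
      have f: "(1 + norm x) ^ k * norm (f x) \<le> B" and g: "(1 + norm x) ^ l * norm (g x) \<le> C"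
        using Suc.prems(3,4) that by auto
      have "0 \<le> B * C"
        using wbound_nonneg[OF Suc.prems(3) that] wbound_nonneg[OF Suc.prems(4) that] by simp
      then have "1 * (B * C) \<le> 2 ^ Suc n * (B * C)"
        by (intro mult_right_mono) (use one_le_power[of "2::real" "Suc n"] in auto)
      with *[of x f g, OF f g] show ?thesis by simp
    qed
    ultimately show ?case by simp
  }
qed

text \<open>The coordinate is linear, so at most one derivative can fall on it. This gives at most
  \<open>n\<close> terms besides the main one, hence \<open>n + 1\<close>; the coordinate itself
  costs one power of the weight.\<close>

lemma wbound_coord_mult:
  fixes f :: "'a::euclidean_space \<Rightarrow> complex"
  assumes "smooth_on UNIV f" "wbound UNIV (Suc k) n B f" "b \<in> Basis"
  shows "wbound UNIV k n ((real n + 1) * B) (\<lambda>x. of_real (x \<bullet> b) * f x)"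
  using assms(1,2)
proof (induction n arbitrary: f)
  have *: "(1 + norm x) ^ k * norm (of_real (x \<bullet> b) * f x) \<le> B"
    if "(1 + norm x) ^ (Suc k) * norm (f x) \<le> B" for x :: 'a and f :: "'a \<Rightarrow> complex"
  proof -
    have "(1 + norm x) ^ k * norm (of_real (x \<bullet> b) * f x) = (1 + norm x) ^ k * (\<bar>x \<bullet> b\<bar> * norm (f x))"
      by (simp add: norm_mult)
    also have "\<dots> \<le> (1 + norm x) ^ k * ((1 + norm x) * norm (f x))"
      using Basis_le_norm[OF assms(3), of x] by (intro mult_left_mono mult_right_mono) auto
    finally show ?thesis using that by (simp add: mult_ac)
  qed
  {
    case 0
    then show ?case using * by simp
  next
    case (Suc n)
    have B0: "0 \<le> B" using wbound_nonneg[OF Suc.prems(2)] by blast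
    have "wbound UNIV k n ((real (Suc n) + 1) * B) (partial_deriv c (\<lambda>x. of_real (x \<bullet> b) * f x))" if c: "c \<in> Basis" for c
    proof -
      have eq: "partial_deriv c (\<lambda>x. of_real (x \<bullet> b) * f x)
          = (\<lambda>x. of_real (x \<bullet> b) * partial_deriv c f x + of_real (c \<bullet> b) * f x)"
      proof
        fix x
        have d: "((\<lambda>x. of_real (x \<bullet> b) :: complex) has_derivative (\<lambda>h. of_real (h \<bullet> b))) (at x)"
          by (intro bounded_linear_imp_has_derivative bounded_linear_compose[OF bounded_linear_of_real] bounded_linear_inner_left)
        show "partial_deriv c (\<lambda>x. of_real (x \<bullet> b) * f x) x = of_real (x \<bullet> b) * partial_deriv c f x + of_real (c \<bullet> b) * f x"
          using partial_deriv_mult[of "\<lambda>x. of_real (x \<bullet> b)" x f c] partial_deriv_eq[OF d, of c]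
            smooth_on_differentiable[OF Suc.prems(1)] d by (auto simp: differentiable_def)
      qed
      have "norm (of_real (c \<bullet> b) :: complex) \<le> 1"
        using c assms(3) by (auto simp: inner_Basis)
      then have 1: "norm (of_real (c \<bullet> b) :: complex) * B \<le> B"
        using B0 by (simp add: mult_left_le_one_le)
      have "wbound UNIV k n (norm (of_real (c \<bullet> b) :: complex) * B) (\<lambda>x. of_real (c \<bullet> b) * f x)"
        using Suc.prems by (intro wbound_cmult wbound_mono[OF Suc.prems(2)]) auto
      then have 2: "wbound UNIV k n B (\<lambda>x. of_real (c \<bullet> b) * f x)"
        by (rule wbound_mono) (use 1 in auto)
      have sm: "smooth_on UNIV (\<lambda>x. of_real (x \<bullet> b) :: complex)"
        by (intro smooth_on_linear bounded_linear_compose[OF bounded_linear_of_real] bounded_linear_inner_left) simp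
      have "wbound UNIV k n ((real n + 1) * B + B)
          (\<lambda>x. of_real (x \<bullet> b) * partial_deriv c f x + of_real (c \<bullet> b) * f x)"
        using Suc.prems c
        by (intro wbound_add 2 Suc.IH smooth_on_mult smooth_on_partial_deriv sm smooth_on_const) auto
      moreover have "(real n + 1) * B + B = (real (Suc n) + 1) * B" by (simp add: algebra_simps)
      ultimately show ?thesis by (simp only: eq)
    qed
    moreover have "(1 + norm x) ^ k * norm (of_real (x \<bullet> b) * f x) \<le> (real (Suc n) + 1) * B" for x
    proof -
      have "1 * B \<le> (real (Suc n) + 1) * B" using B0 by (intro mult_right_mono) auto
      then show ?thesis using *[of x f] Suc.prems(2) by simp
    qed
    ultimately show ?case by simp
  }
qed

section \<open>Dilations, and families depending on a compact parameter\<close>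

lemma partial_deriv_dilate:
  assumes "\<And>x. f differentiable (at x)"
  shows "partial_deriv b (\<lambda>x. f (c *\<^sub>R x)) x = c *\<^sub>R partial_deriv b f (c *\<^sub>R x)"
proof -
  have "((\<lambda>x. f (c *\<^sub>R x)) has_derivative (\<lambda>h. frechet_derivative f (at (c *\<^sub>R x)) (c *\<^sub>R h))) (at x)"
    by (rule has_derivative_compose[OF _ assms[unfolded frechet_derivative_works]])
       (intro bounded_linear_imp_has_derivative bounded_linear_scaleR_right)
  moreover have "bounded_linear (frechet_derivative f (at (c *\<^sub>R x)))"
    using assms frechet_derivative_works has_derivative_bounded_linear by blast
  ultimately show ?thesis
    using partial_deriv_eq[of "\<lambda>x. f (c *\<^sub>R x)" _ x b] by (simp add: partial_deriv_def linear_simps(5))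
qed

lemma smooth_on_dilate:
  assumes "smooth_on UNIV f"
  shows "smooth_on UNIV (\<lambda>x. f (c *\<^sub>R x))"
  by (rule smooth_on_compose[OF _ _ smooth_on_linear assms]) (auto intro: bounded_linear_scaleR_right)

text \<open>Each derivative produces a factor \<open>c\<close>; since \<open>c\<close> is at least
  1, the highest power dominates those of lower order.\<close>

lemma wbound_dilate:
  assumes "smooth_on UNIV f" "wbound UNIV 0 n B f" "1 \<le> c"
  shows "wbound UNIV 0 n (c ^ n * B) (\<lambda>x. f (c *\<^sub>R x))"
  using assms(1,2)
proof (induction n arbitrary: f)
  case (Suc n)
  have B0: "0 \<le> B" using wbound_nonneg[OF Suc.prems(2)] by blast
  have "wbound UNIV 0 n (c ^ Suc n * B) (partial_deriv b (\<lambda>x. f (c *\<^sub>R x)))" if b: "b \<in> Basis" for b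
  proof -
    have eq: "partial_deriv b (\<lambda>x. f (c *\<^sub>R x)) = (\<lambda>x. c *\<^sub>R partial_deriv b f (c *\<^sub>R x))"
      by (intro ext partial_deriv_dilate smooth_on_differentiable[OF Suc.prems(1)]) auto
    have "wbound UNIV 0 n (c * (c ^ n * B)) (\<lambda>x. c *\<^sub>R partial_deriv b f (c *\<^sub>R x))"
      using Suc.prems b assms(3)
      by (intro wbound_bounded_linear Suc.IH bounded_linear_scaleR_right smooth_on_dilate smooth_on_partial_deriv) auto
    then show ?thesis by (simp add: eq mult_ac)
  qed
  moreover have "1 * B \<le> c ^ Suc n * B" using B0 assms(3) by (intro mult_right_mono one_le_power)
  ultimately show ?case using Suc.prems(2) by (auto intro: order_trans)
qed simp

text \<open>Compactness replaces the computation of derivatives: those of a slice in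
  \<open>x\<close> are derivatives of the joint function in the directions \<open>(b, 0)\<close>,
  hence continuous on a compact product and bounded uniformly in the parameter.\<close>

lemma wbound_family:
  fixes f :: "'a::euclidean_space \<times> 'p::euclidean_space \<Rightarrow> 'b::real_normed_vector"
  assumes "smooth_on UNIV f" "compact P"
  shows "\<exists>B. \<forall>c\<in>P. wbound (cball 0 R) k n B (\<lambda>x. f (x, c))"
  using assms(1)
proof (induction n arbitrary: f)
  have base: "\<exists>B. \<forall>c\<in>P. \<forall>x\<in>cball 0 R. (1 + norm x) ^ k * norm (f (x, c)) \<le> B"
    if "smooth_on UNIV f" for f :: "'a \<times> 'p \<Rightarrow> 'b"
  proof -
    have "continuous_on (cball 0 R \<times> P) (\<lambda>z. (1 + norm (fst z)) ^ k * norm (f z))"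
      by (intro continuous_intros continuous_on_subset[OF smooth_on_continuous_on[OF that]]) auto
    then have "compact ((\<lambda>z. (1 + norm (fst z)) ^ k * norm (f z)) ` (cball 0 R \<times> P))"
      by (intro compact_continuous_image compact_Times assms compact_cball)
    from compact_imp_bounded[OF this] obtain B where
      "\<forall>y\<in>(\<lambda>z. (1 + norm (fst z)) ^ k * norm (f z)) ` (cball 0 R \<times> P). norm y \<le> B"
      unfolding bounded_iff by blast
    then show ?thesis by (intro exI[of _ B]) force
  qed
  {
    case 0
    then show ?case using base[OF 0] by simp
  next
    case (Suc n)
    have "\<exists>B. \<forall>c\<in>P. wbound (cball 0 R) k n B (partial_deriv b (\<lambda>x. f (x, c)))" if b: "b \<in> Basis" for b
    proof -
      have eq: "partial_deriv b (\<lambda>x. f (x, c)) = (\<lambda>x. partial_deriv (b, 0) f (x, c))" for c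
      proof
        fix x
        have "((\<lambda>x. f (x, c)) has_derivative (\<lambda>h. frechet_derivative f (at (x, c)) (h, 0))) (at x)"
          using smooth_on_differentiable[OF Suc.prems, of "(x, c)"]
          by (intro has_derivative_compose[where f = "\<lambda>x. (x, c)" and g = f])
             (auto simp: frechet_derivative_works intro!: derivative_eq_intros)
        then show "partial_deriv b (\<lambda>x. f (x, c)) x = partial_deriv (b, 0) f (x, c)"
          using partial_deriv_eq[of "\<lambda>x. f (x, c)" _ x b] by (simp add: partial_deriv_def)
      qed
      have "(b, 0) \<in> (Basis :: ('a \<times> 'p) set)" using b by (simp add: Basis_prod_def)
      from Suc.IH[OF smooth_on_partial_deriv[OF Suc.prems this]] show ?thesis by (simp add: eq)
    qed
    then obtain C where C: "\<And>b. b \<in> Basis \<Longrightarrow> \<forall>c\<in>P. wbound (cball 0 R) k n (C b) (partial_deriv b (\<lambda>x. f (x, c)))"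
      by metis
    obtain B where B: "\<forall>c\<in>P. \<forall>x\<in>cball 0 R. (1 + norm x) ^ k * norm (f (x, c)) \<le> B"
      using base[OF Suc.prems] by blast
    define M where "M = Max (insert B (C ` Basis))"
    have M1: "B \<le> M" unfolding M_def by (rule Max_ge) auto
    have M2: "C b \<le> M" if "b \<in> Basis" for b unfolding M_def by (rule Max_ge) (use that in auto)
    have "wbound (cball 0 R) k (Suc n) M (\<lambda>x. f (x, c))" if c: "c \<in> P" for c
    proof -
      have "wbound (cball 0 R) k n M (partial_deriv b (\<lambda>x. f (x, c)))" if "b \<in> Basis" for b
        using C[OF that] c M2[OF that] wbound_mono[of "cball 0 R" k n "C b"] by blast
      moreover have "(1 + norm x) ^ k * norm (f (x, c)) \<le> M" if "x \<in> cball 0 R" for x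
        using B c M1 that by (meson order_trans)
      ultimately show ?thesis by simp
    qed
    then show ?case by blast
  }
qed

lemma wbound_zero:
  assumes "open S" "\<And>x. x \<in> S \<Longrightarrow> f x = 0" "0 \<le> B"
  shows "wbound S k n B f"
proof -
  have "wbound S k n B (\<lambda>x::'a. 0 :: 'b)" for k n
  proof (induction n)
    case (Suc n)
    have "partial_deriv b (\<lambda>x::'a. 0 :: 'b) = (\<lambda>x. 0)" for b :: 'a
      by (rule ext) (simp add: partial_deriv_def)
    with Suc show ?case using assms(3) by simp
  qed (use assms in simp)
  then show ?thesis using wbound_cong[OF assms(1), of f "\<lambda>_. 0"] assms(2) by blast
qed

lemma wbound_Un: "wbound S k n B f \<Longrightarrow> wbound T k n B f \<Longrightarrow> wbound (S \<union> T) k n B f"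
  by (induction n arbitrary: f) auto

text \<open>Support in the closed ball of radius \<open>R\<close>; a negative \<open>R\<close>
  forces the function to vanish. The radius stays explicit because the constants of the functionals
  below depend on it.\<close>

definition test_on :: "real \<Rightarrow> ('a::euclidean_space \<Rightarrow> complex) \<Rightarrow> bool" where
  "test_on R f \<longleftrightarrow> smooth_on UNIV f \<and> (\<forall>x. R < norm x \<longrightarrow> f x = 0)"

lemma test_on_smooth: "test_on R f \<Longrightarrow> smooth_on UNIV f"
  by (simp add: test_on_def)

lemma test_on_zero: "test_on R f \<Longrightarrow> R < norm x \<Longrightarrow> f x = 0"
  by (simp add: test_on_def)

lemma test_on_mono: "test_on R f \<Longrightarrow> R \<le> R' \<Longrightarrow> test_on R' f"
  by (auto simp: test_on_def)

lemma wbound_weight: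
  assumes "wbound (cball 0 R) 0 n B f"
  shows "wbound (cball 0 R) k n ((1 + R) ^ k * B) f"
  using assms
proof (induction n arbitrary: f)
  have *: "(1 + norm x) ^ k * norm (f x) \<le> (1 + R) ^ k * B"
    if "norm (f x) \<le> B" "x \<in> cball 0 R" for x :: 'a and f :: "'a \<Rightarrow> 'b"
  proof -
    have "0 \<le> R" using that(2) by (auto intro: order_trans[OF norm_ge_zero])
    with that show ?thesis by (intro mult_mono power_mono) auto
  qed
  {
    case 0
    then show ?case using * by simp
  next
    case (Suc n)
    then show ?case using * by simp
  }
qed

text \<open>The complement of the closed ball is open, so all derivatives vanish there, and on the
  ball the weight is at most \<open>(1 + R) ^ k\<close>.\<close>

lemma wbound_test_on:
  assumes "\<And>x. R < norm x \<Longrightarrow> f x = 0" "wbound (cball 0 R) 0 n B f" "0 \<le> R" "0 \<le> B"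
  shows "wbound UNIV k n ((1 + R) ^ k * B) f"
proof -
  have "UNIV = cball 0 R \<union> (- cball (0::'a) R)" by auto
  moreover have "wbound (- cball 0 R) k n ((1 + R) ^ k * B) f"
    using assms by (intro wbound_zero) auto
  ultimately show ?thesis
    using wbound_Un[OF wbound_weight[OF assms(2)]] by metis
qed

lemma smooth_on_family_fix:
  assumes "smooth_on UNIV f"
  shows "smooth_on UNIV (\<lambda>x. f (x, c))"
proof -
  have "smooth_on UNIV (\<lambda>x. (x, 0) + (0, c))"
    by (intro smooth_on_add smooth_on_linear bounded_linear_Pair bounded_linear_ident bounded_linear_zero smooth_on_const) auto
  then show ?thesis
    using smooth_on_compose[of UNIV "\<lambda>x. (x, c)" UNIV f] assms by auto
qed

lemma test_family_bound:
  fixes f :: "'a::euclidean_space \<times> 'p::euclidean_space \<Rightarrow> complex"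
  assumes "smooth_on UNIV f" "compact P" "\<And>x c. c \<in> P \<Longrightarrow> R < norm x \<Longrightarrow> f (x, c) = 0" "0 \<le> R"
  shows "\<exists>B\<ge>0. \<forall>c\<in>P. test_on R (\<lambda>x. f (x, c)) \<and> wbound UNIV k n B (\<lambda>x. f (x, c))"
proof -
  obtain B where B: "\<forall>c\<in>P. wbound (cball 0 R) 0 n B (\<lambda>x. f (x, c))"
    using wbound_family[OF assms(1,2)] by blast
  have B': "wbound (cball 0 R) 0 n (max B 0) (\<lambda>x. f (x, c))" if "c \<in> P" for c
    using B that by (auto intro: wbound_mono)
  have "wbound UNIV k n ((1 + R) ^ k * max B 0) (\<lambda>x. f (x, c))" if "c \<in> P" for c
    using assms(3,4) that by (intro wbound_test_on B') auto
  moreover have "test_on R (\<lambda>x. f (x, c))" if "c \<in> P" for c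
    using assms(3) that smooth_on_family_fix[OF assms(1)] by (simp add: test_on_def)
  ultimately show ?thesis using assms(4) by (intro exI[of _ "(1 + R) ^ k * max B 0"]) auto
qed

lemma test_on_wbound:
  fixes f :: "'a::euclidean_space \<Rightarrow> complex"
  assumes "test_on R f" "0 \<le> R"
  shows "\<exists>B\<ge>0. wbound UNIV k n B f"
proof -
  \<comment> \<open>A dummy real parameter turns the single function into a family over the compact
    set \<open>{0}\<close>.\<close>
  have "smooth_on UNIV (\<lambda>z::'a \<times> real. f (fst z))"
    by (rule smooth_on_compose[OF _ _ smooth_on_linear[OF _ bounded_linear_fst]])
       (use assms in \<open>auto simp: test_on_def\<close>)
  from test_family_bound[OF this, of "{0}" R k n] assms show ?thesis
    by (auto simp: test_on_def)
qed

lemma test_on_add: "test_on R f \<Longrightarrow> test_on R g \<Longrightarrow> test_on R (\<lambda>x. f x + g x)"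
  by (simp add: test_on_def smooth_on_add)

lemma test_on_diff: "test_on R f \<Longrightarrow> test_on R g \<Longrightarrow> test_on R (\<lambda>x. f x - g x)"
  by (simp add: test_on_def smooth_on_diff)

lemma test_on_mult: "smooth_on UNIV f \<Longrightarrow> test_on R g \<Longrightarrow> test_on R (\<lambda>x. f x * g x)"
  by (simp add: test_on_def smooth_on_mult)

lemma test_on_cmult: "test_on R g \<Longrightarrow> test_on R (\<lambda>x. c * g x)"
  by (rule test_on_mult) auto

section \<open>Schwartz functions\<close>

lemma schwartz_iff_wbound:
  "\<phi> \<in> schwartz \<longleftrightarrow> smooth_on UNIV \<phi> \<and> (\<forall>k n. \<exists>B. wbound UNIV k n B \<phi>)"
proof
  assume L: "\<phi> \<in> schwartz"
  have "\<exists>B. wbound UNIV k n B \<phi>" for k n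
  proof -
    obtain C where C: "\<And>bs. set bs \<subseteq> Basis \<Longrightarrow> \<forall>x. (1 + norm x) ^ k * norm (iter_partial bs \<phi> x) \<le> C bs"
      using L unfolding schwartz_def by (auto) metis
    let ?L = "{bs. set bs \<subseteq> (Basis::'a set) \<and> length bs \<le> n}"
    have fin: "finite ?L" by (rule finite_lists_length_le) simp
    have "wbound UNIV k n (Max (C ` ?L)) \<phi>"
      unfolding wbound_iff_iter_partial
    proof (intro allI impI ballI)
      fix bs x assume bs: "set bs \<subseteq> (Basis::'a set) \<and> length bs \<le> n"
      then have "C bs \<le> Max (C ` ?L)" by (intro Max_ge) (use fin in auto)
      then show "(1 + norm x) ^ k * norm (iter_partial bs \<phi> x) \<le> Max (C ` ?L)"
        using C bs by (meson order_trans)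
    qed
    then show ?thesis by blast
  qed
  with L show "smooth_on UNIV \<phi> \<and> (\<forall>k n. \<exists>B. wbound UNIV k n B \<phi>)"
    by (simp add: schwartz_def smooth_iff_smooth_on)
next
  assume R: "smooth_on UNIV \<phi> \<and> (\<forall>k n. \<exists>B. wbound UNIV k n B \<phi>)"
  have "\<exists>B. \<forall>x. (1 + norm x) ^ k * norm (iter_partial bs \<phi> x) \<le> B" if "set bs \<subseteq> Basis" for k bs
  proof -
    obtain B where "wbound UNIV k (length bs) B \<phi>" using R by blast
    with that show ?thesis unfolding wbound_iff_iter_partial by blast
  qed
  with R show "\<phi> \<in> schwartz" by (simp add: schwartz_def smooth_iff_smooth_on)
qed

lemma schwartz_smooth_on: "\<phi> \<in> schwartz \<Longrightarrow> smooth_on UNIV \<phi>"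
  by (simp add: schwartz_iff_wbound)

lemma schwartz_wbound: "\<phi> \<in> schwartz \<Longrightarrow> \<exists>B\<ge>0. wbound UNIV k n B \<phi>"
  using wbound_nonneg[of UNIV k n _ \<phi>] by (metis UNIV_I schwartz_iff_wbound)

lemma schwartz_continuous: "\<phi> \<in> schwartz \<Longrightarrow> continuous_on UNIV \<phi>"
  by (intro smooth_on_continuous_on schwartz_smooth_on)

lemma schwartz_measurable [measurable_dest]: "\<phi> \<in> schwartz \<Longrightarrow> \<phi> \<in> borel_measurable borel"
  by (intro borel_measurable_continuous_onI schwartz_continuous)

lemma test_on_schwartz: "test_on R f \<Longrightarrow> 0 \<le> R \<Longrightarrow> f \<in> schwartz"
  using test_on_wbound by (auto simp: schwartz_iff_wbound test_on_smooth) blast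

lemma wbound_schwartz_seminorm:
  assumes "\<phi> \<in> schwartz"
  shows "wbound UNIV n n (schwartz_seminorm n \<phi>) \<phi>"
  unfolding wbound_iff_iter_partial
proof (intro allI impI ballI)
  fix bs and x :: 'a assume bs: "set bs \<subseteq> (Basis::'a set) \<and> length bs \<le> n"
  obtain B where "wbound UNIV n n B \<phi>" using assms schwartz_wbound by blast
  then have "bdd_above ((\<lambda>(bs, x). (1 + norm x) ^ n * norm (iter_partial bs \<phi> x)) `
      ({bs. set bs \<subseteq> Basis \<and> length bs \<le> n} \<times> UNIV))"
    unfolding wbound_iff_iter_partial by (intro bdd_aboveI[of _ B]) auto
  from cSUP_upper[OF _ this, of "(bs, x)"] bs
  show "(1 + norm x) ^ n * norm (iter_partial bs \<phi> x) \<le> schwartz_seminorm n \<phi>"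
    by (simp add: schwartz_seminorm_def)
qed

lemma schwartz_seminorm_le:
  assumes "wbound UNIV n n B \<phi>"
  shows "schwartz_seminorm n \<phi> \<le> B"
  unfolding schwartz_seminorm_def
proof (rule cSUP_least)
  have "([], 0) \<in> {bs. set bs \<subseteq> (Basis::'a set) \<and> length bs \<le> n} \<times> (UNIV::'a set)" by simp
  then show "{bs. set bs \<subseteq> (Basis::'a set) \<and> length bs \<le> n} \<times> (UNIV::'a set) \<noteq> {}" by blast
qed (use assms in \<open>auto simp: wbound_iff_iter_partial\<close>)

text \<open>Allowing every admissible \<open>B\<close> lets later estimates insert explicit bounds
  in place of the seminorm, which is the least of them. The constant is replaced by its positive
  part, as temperedness does not fix its sign.\<close>

lemma tempered_wbound:
  assumes "f \<in> tempered"
  shows "\<exists>C\<ge>0. \<exists>n. \<forall>\<phi>\<in>schwartz. \<forall>B. wbound UNIV n n B \<phi> \<longrightarrow> norm (f \<phi>) \<le> C * B"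
proof -
  obtain C n where C: "\<forall>\<phi>\<in>schwartz. norm (f \<phi>) \<le> C * schwartz_seminorm n \<phi>"
    using assms unfolding tempered_def by blast
  have "norm (f \<phi>) \<le> max C 0 * B" if "\<phi> \<in> schwartz" "wbound UNIV n n B \<phi>" for \<phi> B
  proof -
    have s0: "0 \<le> schwartz_seminorm n \<phi>"
      using wbound_nonneg[OF wbound_schwartz_seminorm[OF that(1)]] by blast
    have "norm (f \<phi>) \<le> C * schwartz_seminorm n \<phi>" using C that by blast
    also have "\<dots> \<le> max C 0 * schwartz_seminorm n \<phi>" using s0 by (intro mult_right_mono) auto
    also have "\<dots> \<le> max C 0 * B" using schwartz_seminorm_le[OF that(2)] by (intro mult_left_mono) auto
    finally show ?thesis .
  qed
  then show ?thesis by (intro exI[of _ "max C 0"] exI[of _ n] conjI) auto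
qed

lemma schwartz_cmult:
  assumes "\<phi> \<in> schwartz"
  shows "(\<lambda>x. c * \<phi> x) \<in> schwartz"
  unfolding schwartz_iff_wbound
proof (intro conjI allI)
  show "smooth_on UNIV (\<lambda>x. c * \<phi> x)"
    by (rule smooth_on_mult[OF open_UNIV smooth_on_const schwartz_smooth_on[OF assms]])
  show "\<exists>B. wbound UNIV k n B (\<lambda>x. c * \<phi> x)" for k n
    using wbound_cmult[OF open_UNIV schwartz_smooth_on[OF assms]] schwartz_wbound[OF assms] by blast
qed

lemma schwartz_partial_deriv:
  assumes "\<phi> \<in> schwartz" "b \<in> Basis"
  shows "partial_deriv b \<phi> \<in> schwartz"
  using assms unfolding schwartz_iff_wbound
  by (auto intro!: smooth_on_partial_deriv) (meson wbound_partial_deriv)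

lemma schwartz_coord_mult:
  assumes "\<phi> \<in> schwartz" "b \<in> Basis"
  shows "(\<lambda>x. of_real (x \<bullet> b) * \<phi> x) \<in> schwartz"
proof -
  have "smooth_on UNIV (\<lambda>x::'a. of_real (x \<bullet> b) :: complex)"
    by (intro smooth_on_linear bounded_linear_compose[OF bounded_linear_of_real] bounded_linear_inner_left) simp
  then have "smooth_on UNIV (\<lambda>x. of_real (x \<bullet> b) * \<phi> x)"
    by (rule smooth_on_mult[OF open_UNIV _ schwartz_smooth_on[OF assms(1)]])
  moreover have "\<exists>B. wbound UNIV k n B (\<lambda>x. of_real (x \<bullet> b) * \<phi> x)" for k n
    using wbound_coord_mult[OF schwartz_smooth_on[OF assms(1)] _ assms(2)] assms(1)
    by (meson schwartz_iff_wbound)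
  ultimately show ?thesis by (simp add: schwartz_iff_wbound)
qed

lemma schwartz_mult_test: "\<phi> \<in> schwartz \<Longrightarrow> test_on R m \<Longrightarrow> test_on R (\<lambda>x. m x * \<phi> x)"
  using test_on_mult[OF schwartz_smooth_on, of \<phi> R m] by (simp add: mult.commute)

lemma tempered_add: "f \<in> tempered \<Longrightarrow> \<phi> \<in> schwartz \<Longrightarrow> \<psi> \<in> schwartz \<Longrightarrow> f (\<lambda>x. \<phi> x + \<psi> x) = f \<phi> + f \<psi>"
  by (simp add: tempered_def)

lemma tempered_cmult: "f \<in> tempered \<Longrightarrow> \<phi> \<in> schwartz \<Longrightarrow> f (\<lambda>x. c * \<phi> x) = c * f \<phi>"
  by (simp add: tempered_def)

section \<open>Taylor expansion\<close>

text \<open>The k-th derivative of \<open>f\<close> at \<open>z\<close> evaluated on k copies of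
  \<open>h\<close>. The sum runs over ordered lists of basis vectors, so the Taylor coefficient is 1
  / k! without multi-index factorials.\<close>

primrec taylor_term ::
    "nat \<Rightarrow> ('a::euclidean_space \<Rightarrow> 'b::real_normed_vector) \<Rightarrow> 'a \<Rightarrow> 'a \<Rightarrow> 'b" where
  "taylor_term 0 f z h = f z"
| "taylor_term (Suc k) f z h = (\<Sum>b\<in>Basis. (h \<bullet> b) *\<^sub>R taylor_term k (partial_deriv b f) z h)"

lemma taylor_term_scale: "taylor_term k f z (t *\<^sub>R h) = t ^ k *\<^sub>R taylor_term k f z h"
  by (induction k arbitrary: f) (simp_all add: scaleR_sum_right mult_ac)

text \<open>Along the segment from \<open>z\<close> to \<open>z + h\<close>, the derivative of the
  remainder of order n + 1 is the combination, with coefficients \<open>h \<bullet> b\<close>, of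
  the order n remainders of the partial derivatives. The mean value inequality then costs one factor
  \<open>DIM('a) * norm h\<close> per order; the factorial gain is given up.\<close>

lemma taylor_remainder:
  fixes f :: "'a::euclidean_space \<Rightarrow> 'b::real_normed_vector"
  assumes "smooth_on UNIV f" "wbound UNIV 0 n B f"
  shows "norm (f (z + h) - (\<Sum>k<n. (1 / fact k) *\<^sub>R taylor_term k f z h)) \<le> (DIM('a) * norm h) ^ n * B"
  using assms
proof (induction n arbitrary: f h)
  case 0
  then show ?case by simp
next
  case (Suc n)
  define R where "R g t = g (z + t *\<^sub>R h) - (\<Sum>k<n. (1 / fact k) *\<^sub>R taylor_term k g z (t *\<^sub>R h))"
    for g :: "'a \<Rightarrow> 'b" and t
  define r where "r t = f (z + t *\<^sub>R h) - (\<Sum>k<Suc n. (1 / fact k) *\<^sub>R taylor_term k f z (t *\<^sub>R h))" for t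
  define K where "K = (DIM('a) * norm h) ^ Suc n * B"
  have B0: "0 \<le> B" using wbound_nonneg[OF Suc.prems(2)] by blast
  \<comment> \<open>Splitting off the constant zeroth term shows that \<open>r\<close> vanishes at 0
    and leaves a polynomial in \<open>t\<close> without constant term.\<close>
  have r_alt: "r = (\<lambda>t. f (z + t *\<^sub>R h) - (f z + (\<Sum>k<n. t ^ Suc k *\<^sub>R (1 / fact (Suc k)) *\<^sub>R taylor_term (Suc k) f z h)))"
    unfolding r_def taylor_term_scale by (subst sum.lessThan_Suc_shift) (simp add: scaleR_left_commute)
  have dr: "(r has_vector_derivative (\<Sum>b\<in>Basis. (h \<bullet> b) *\<^sub>R R (partial_deriv b f) t)) (at t)" for t
  proof -
    have "((\<lambda>t. f (z + t *\<^sub>R h)) has_derivative (\<lambda>s. \<Sum>b\<in>Basis. ((s *\<^sub>R h) \<bullet> b) *\<^sub>R partial_deriv b f (z + t *\<^sub>R h))) (at t)"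
      by (rule has_derivative_compose[where f = "\<lambda>t. z + t *\<^sub>R h" and g = f])
         (auto intro!: derivative_eq_intros has_derivative_partial_deriv smooth_on_differentiable[OF Suc.prems(1)])
    then have 1: "((\<lambda>t. f (z + t *\<^sub>R h)) has_vector_derivative (\<Sum>b\<in>Basis. (h \<bullet> b) *\<^sub>R partial_deriv b f (z + t *\<^sub>R h))) (at t)"
      by (simp add: has_vector_derivative_def scaleR_sum_right)
    have 2: "((\<lambda>t. \<Sum>k<n. t ^ Suc k *\<^sub>R (1 / fact (Suc k)) *\<^sub>R taylor_term (Suc k) f z h) has_vector_derivative
        (\<Sum>k<n. (real (Suc k) * t ^ k) *\<^sub>R (1 / fact (Suc k)) *\<^sub>R taylor_term (Suc k) f z h)) (at t)"
    proof (rule has_vector_derivative_sum)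
      fix k
      have "((\<lambda>t. t ^ Suc k) has_real_derivative (real (Suc k) * t ^ k)) (at t)"
        using DERIV_pow[of "Suc k" t] by simp
      from has_vector_derivative_scaleR[OF this has_vector_derivative_const[of "(1 / fact (Suc k)) *\<^sub>R taylor_term (Suc k) f z h"]]
      show "((\<lambda>t. t ^ Suc k *\<^sub>R (1 / fact (Suc k)) *\<^sub>R taylor_term (Suc k) f z h) has_vector_derivative
        (real (Suc k) * t ^ k) *\<^sub>R (1 / fact (Suc k)) *\<^sub>R taylor_term (Suc k) f z h) (at t)"
        by simp
    qed
    have 3: "(\<Sum>k<n. (real (Suc k) * t ^ k) *\<^sub>R (1 / fact (Suc k)) *\<^sub>R taylor_term (Suc k) f z h)
        = (\<Sum>b\<in>Basis. (h \<bullet> b) *\<^sub>R (\<Sum>k<n. (1 / fact k) *\<^sub>R taylor_term k (partial_deriv b f) z (t *\<^sub>R h)))"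
    proof -
      have "(real (Suc k) * t ^ k) *\<^sub>R (1 / fact (Suc k)) *\<^sub>R taylor_term (Suc k) f z h
          = (\<Sum>b\<in>Basis. (h \<bullet> b) *\<^sub>R (1 / fact k) *\<^sub>R taylor_term k (partial_deriv b f) z (t *\<^sub>R h))" for k
      proof -
        have "(real (Suc k) * t ^ k) * (1 / fact (Suc k)) = t ^ k / fact k"
          by (simp add: fact_Suc divide_simps del: of_nat_Suc)
        then show ?thesis
          by (simp add: taylor_term_scale scaleR_sum_right mult_ac)
      qed
      then show ?thesis
        by (simp add: scaleR_sum_right del: taylor_term.simps) (rule sum.swap)
    qed
    have "(r has_vector_derivative ((\<Sum>b\<in>Basis. (h \<bullet> b) *\<^sub>R partial_deriv b f (z + t *\<^sub>R h)) -
        (0 + (\<Sum>b\<in>Basis. (h \<bullet> b) *\<^sub>R (\<Sum>k<n. (1 / fact k) *\<^sub>R taylor_term k (partial_deriv b f) z (t *\<^sub>R h)))))) (at t)"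
      unfolding r_alt using 1 2[unfolded 3]
      by (intro has_vector_derivative_diff has_vector_derivative_add has_vector_derivative_const)
    then show ?thesis by (simp add: R_def sum_subtractf scaleR_right_diff_distrib)
  qed
  have R_bd: "norm (\<Sum>b\<in>Basis. (h \<bullet> b) *\<^sub>R R (partial_deriv b f) t) \<le> K" if "t \<in> {0<..<1}" for t
  proof -
    have "norm ((h \<bullet> b) *\<^sub>R R (partial_deriv b f) t) \<le> norm h * ((DIM('a) * norm h) ^ n * B)" if b: "b \<in> Basis" for b
    proof -
      have "norm (R (partial_deriv b f) t) \<le> (DIM('a) * norm (t *\<^sub>R h)) ^ n * B"
        unfolding R_def using Suc.prems b by (intro Suc.IH smooth_on_partial_deriv) auto
      also have "\<dots> \<le> (DIM('a) * norm h) ^ n * B"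
        using \<open>t \<in> {0<..<1}\<close> B0 by (intro mult_right_mono power_mono mult_left_mono) (auto intro!: mult_left_le_one_le)
      finally show ?thesis using Basis_le_norm[OF b, of h] by (simp add: mult_mono)
    qed
    then have "norm (\<Sum>b\<in>Basis. (h \<bullet> b) *\<^sub>R R (partial_deriv b f) t) \<le> (\<Sum>b\<in>(Basis::'a set). norm h * ((DIM('a) * norm h) ^ n * B))"
      by (rule sum_norm_le)
    then show ?thesis by (simp add: K_def mult_ac)
  qed
  have "norm (r 1 - r 0) \<le> 1 * K - 0 * K"
  proof (rule differentiable_bound_general[where f' = "\<lambda>t. (\<Sum>b\<in>Basis. (h \<bullet> b) *\<^sub>R R (partial_deriv b f) t)" and \<phi>' = "\<lambda>_. K" and \<phi> = "\<lambda>t. t * K"])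
    show "continuous_on {0..1} r"
      using dr by (meson continuous_at_imp_continuous_on has_vector_derivative_continuous)
    show "\<And>x. 0 < x \<Longrightarrow> x < 1 \<Longrightarrow> ((\<lambda>t. t * K) has_vector_derivative K) (at x)"
      by (auto intro!: derivative_eq_intros simp: has_real_derivative_iff_has_vector_derivative[symmetric])
  qed (use dr R_bd in \<open>auto intro!: continuous_intros\<close>)
  moreover have "r 0 = 0" by (simp add: r_alt)
  moreover have "r 1 = f (z + h) - (\<Sum>k<Suc n. (1 / fact k) *\<^sub>R taylor_term k f z h)" by (simp add: r_def)
  ultimately show ?case by (simp add: K_def)
qed

corollary lipschitz_wbound:
  fixes f :: "'a::euclidean_space \<Rightarrow> 'b::real_normed_vector"
  assumes "smooth_on UNIV f" "wbound UNIV 0 1 B f"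
  shows "norm (f (z + h) - f z) \<le> DIM('a) * norm h * B"
  using taylor_remainder[OF assms, of z h] by simp

corollary taylor_second_order:
  fixes f :: "'a::euclidean_space \<Rightarrow> 'b::real_normed_vector"
  assumes "smooth_on UNIV f" "wbound UNIV 0 2 B f"
  shows "norm (f (z + h) - f z - (\<Sum>b\<in>Basis. (h \<bullet> b) *\<^sub>R partial_deriv b f z)) \<le> (DIM('a) * norm h)\<^sup>2 * B"
  using taylor_remainder[OF assms, of z h] by (simp add: numeral_2_eq_2 algebra_simps)

section \<open>Lebesgue integrals on Euclidean space\<close>

lemma lborel_nn_integral_affine:
  fixes f :: "'a::euclidean_space \<Rightarrow> ennreal"
  assumes "f \<in> borel_measurable borel" "c \<noteq> 0"
  shows "(\<integral>\<^sup>+x. f x \<partial>lborel) = ennreal (\<bar>c\<bar> ^ DIM('a)) * (\<integral>\<^sup>+x. f (t + c *\<^sub>R x) \<partial>lborel)"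
  by (subst lborel_affine[OF assms(2), of t])
     (use assms(1) in \<open>simp add: nn_integral_density nn_integral_distr nn_integral_cmult\<close>)

lemma lborel_integral_affine:
  fixes f :: "'a::euclidean_space \<Rightarrow> 'b::{banach, second_countable_topology}"
  assumes "f \<in> borel_measurable borel" "c \<noteq> 0"
  shows "(\<integral>x. f x \<partial>lborel) = \<bar>c\<bar> ^ DIM('a) *\<^sub>R (\<integral>x. f (t + c *\<^sub>R x) \<partial>lborel)"
  by (subst lborel_affine[OF assms(2), of t])
     (use assms(1) in \<open>simp add: integral_density integral_distr\<close>)

lemma lborel_integrable_affine:
  fixes f :: "'a::euclidean_space \<Rightarrow> 'b::{banach, second_countable_topology}"
  assumes "integrable lborel f" "c \<noteq> 0"
  shows "integrable lborel (\<lambda>x. f (t + c *\<^sub>R x))"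
proof -
  have m: "f \<in> borel_measurable borel" using assms(1) by simp
  have "integrable (density (distr lborel borel (\<lambda>x. t + c *\<^sub>R x)) (\<lambda>_. ennreal (\<bar>c\<bar> ^ DIM('a)))) f"
    using assms(1) lborel_affine[OF assms(2), of t] by simp
  then have "integrable lborel (\<lambda>x. (\<bar>c\<bar> ^ DIM('a)) *\<^sub>R f (t + c *\<^sub>R x))"
    using m by (simp add: integrable_density integrable_distr_eq)
  from integrable_scaleR_right[OF this, of "inverse (\<bar>c\<bar> ^ DIM('a))"] show ?thesis
    using assms(2) by simp
qed

lemma integrable_inverse_quadratic: "integrable lborel (\<lambda>x::real. inverse (1 + x\<^sup>2))"
proof -
  have "set_integrable lborel (einterval (-\<infinity>) \<infinity>) (\<lambda>x::real. inverse (1 + x^2))"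
    by (rule integrable_inverse_1_plus_square)
  then show ?thesis by (simp add: set_integrable_def)
qed

text \<open>Twice the dimension, because the square of \<open>1 + norm x\<close> dominates 1 plus
  the square of each coordinate, and the product of these one-dimensional factors has an integrable
  reciprocal.\<close>

definition decay_dim :: "'a::euclidean_space itself \<Rightarrow> nat" where
  "decay_dim _ = 2 * DIM('a)"

lemma integrable_decay:
  "integrable lborel (\<lambda>x::'a::euclidean_space. inverse ((1 + norm x) ^ decay_dim TYPE('a)))"
proof (rule integrableI_bounded)
  have *: "(\<Prod>b\<in>(Basis::'a set). 1 + (x \<bullet> b)\<^sup>2) \<le> (1 + norm x) ^ decay_dim TYPE('a)" for x :: 'a
  proof -
    have "(\<Prod>b\<in>(Basis::'a set). 1 + (x \<bullet> b)\<^sup>2) \<le> (\<Prod>b\<in>(Basis::'a set). (1 + norm x)\<^sup>2)"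
    proof (rule prod_mono, intro conjI)
      fix b :: 'a assume "b \<in> Basis"
      then have "(x \<bullet> b)\<^sup>2 \<le> (norm x)\<^sup>2"
        using Basis_le_norm[of b x] by (simp add: abs_le_square_iff[symmetric])
      then show "1 + (x \<bullet> b)\<^sup>2 \<le> (1 + norm x)\<^sup>2"
        using norm_ge_zero[of x] by (simp add: power2_sum del: norm_ge_zero)
    qed simp
    then show ?thesis by (simp add: decay_dim_def power_mult)
  qed
  have "nn_integral lborel (\<lambda>x::'a. norm (inverse ((1 + norm x) ^ decay_dim TYPE('a))))
      \<le> nn_integral lborel (\<lambda>x::'a. (\<Prod>b\<in>Basis. ennreal (inverse (1 + (x \<bullet> b)\<^sup>2))))"
  proof (intro nn_integral_mono)
    fix x :: 'a
    have "inverse ((1 + norm x) ^ decay_dim TYPE('a)) \<le> inverse (\<Prod>b\<in>(Basis::'a set). 1 + (x \<bullet> b)\<^sup>2)"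
      by (intro le_imp_inverse_le * prod_pos) (simp add: add_pos_nonneg)
    also have "\<dots> = (\<Prod>b\<in>(Basis::'a set). inverse (1 + (x \<bullet> b)\<^sup>2))"
      by (rule prod_inversef[symmetric, unfolded comp_def])
    finally show "ennreal (norm (inverse ((1 + norm x) ^ decay_dim TYPE('a))))
        \<le> (\<Prod>b\<in>Basis. ennreal (inverse (1 + (x \<bullet> b)\<^sup>2)))"
      by (simp add: prod_ennreal ennreal_leI)
  qed
  also have "\<dots> = (\<Prod>b\<in>(Basis::'a set). (\<integral>\<^sup>+x. ennreal (inverse (1 + x\<^sup>2)) \<partial>lborel))"
    using nn_integral_lborel_prod[of "\<lambda>(_::'a) x. ennreal (inverse (1 + x\<^sup>2))"] by simp
  also have "\<dots> < \<infinity>"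
  proof -
    have "(\<integral>\<^sup>+x. ennreal (inverse (1 + x\<^sup>2)) \<partial>lborel) < \<infinity>"
      using integrable_inverse_quadratic by (simp add: integrable_iff_bounded)
    then show ?thesis by (simp add: power_less_top_ennreal)
  qed
  finally show "nn_integral lborel (\<lambda>x::'a. norm (inverse ((1 + norm x) ^ decay_dim TYPE('a)))) < \<infinity>" .
qed simp

definition decay_mass :: "'a::euclidean_space itself \<Rightarrow> real" where
  "decay_mass _ = integral\<^sup>L lborel (\<lambda>x::'a. inverse ((1 + norm x) ^ decay_dim TYPE('a)))"

lemma decay_mass_nonneg: "0 \<le> decay_mass TYPE('a::euclidean_space)"
  unfolding decay_mass_def by (intro integral_nonneg_AE) auto

lemma le_decay:
  "(1 + norm x) ^ k * a \<le> B \<Longrightarrow> a \<le> B * inverse ((1 + norm x) ^ k)"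
  by (simp add: field_simps add_pos_nonneg)

lemma decay_integrable:
  fixes f :: "'a::euclidean_space \<Rightarrow> complex"
  assumes "f \<in> borel_measurable borel"
    "\<And>x. (1 + norm x) ^ decay_dim TYPE('a) * norm (f x) \<le> B"
  shows "integrable lborel f" "(\<integral>x. norm (f x) \<partial>lborel) \<le> decay_mass TYPE('a) * B"
proof -
  have le: "norm (f x) \<le> B * inverse ((1 + norm x) ^ decay_dim TYPE('a))" for x
    by (rule le_decay[OF assms(2)])
  have int: "integrable lborel (\<lambda>x::'a. B * inverse ((1 + norm x) ^ decay_dim TYPE('a)))"
    by (intro integrable_mult_right integrable_decay)
  show f: "integrable lborel f"
    by (rule Bochner_Integration.integrable_bound[OF int]) (use assms(1) le in \<open>auto intro!: AE_I2 order_trans[OF le]\<close>)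
  have "(\<integral>x. norm (f x) \<partial>lborel) \<le> integral\<^sup>L lborel (\<lambda>x::'a. B * inverse ((1 + norm x) ^ decay_dim TYPE('a)))"
    by (rule integral_mono[OF integrable_norm[OF f] int le])
  then show "(\<integral>x. norm (f x) \<partial>lborel) \<le> decay_mass TYPE('a) * B"
    by (simp add: decay_mass_def mult.commute)
qed

lemma schwartz_integrable: "\<phi> \<in> schwartz \<Longrightarrow> integrable lborel \<phi>"
  using schwartz_wbound[of \<phi> _ 0] decay_integrable(1)[OF schwartz_measurable]
  by (metis UNIV_I wbound.simps(1))

lemma cis_measurable [measurable]: "cis \<in> borel_measurable borel"
  by (intro borel_measurable_continuous_onI continuous_intros)

text \<open>
  The integral of \<open>F (x + h b) - F x\<close> vanishes by translation invariance; dividing by \<open>h\<close>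
  and letting \<open>h\<close> tend to zero gives the claim.
\<close>

lemma integral_partial_deriv_eq_0:
  fixes F :: "'a::euclidean_space \<Rightarrow> complex"
  assumes D: "\<And>x. (F has_derivative D x) (at x)" and b: "b \<in> Basis"
    and F: "\<And>x. (1 + norm x) ^ decay_dim TYPE('a) * norm (F x) \<le> A"
    and DF: "\<And>x. (1 + norm x) ^ decay_dim TYPE('a) * norm (D x b) \<le> B"
  shows "(\<integral>x. D x b \<partial>lborel) = 0"
proof -
  let ?M = "decay_dim TYPE('a)"
  define h where "h n = inverse (real (Suc n))" for n
  have h: "0 < h n" "h n \<le> 1" for n by (auto simp: h_def divide_simps)
  have cont: "continuous_on UNIV F"
    using D by (meson continuous_at_imp_continuous_on has_derivative_continuous)
  then have [measurable]: "F \<in> borel_measurable borel" by (rule borel_measurable_continuous_onI)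
  have B0: "0 \<le> B" using DF[of 0] by (smt (verit) mult_nonneg_nonneg norm_ge_zero zero_le_power)
  define q where "q n x = (1 / h n) *\<^sub>R (F (x + h n *\<^sub>R b) - F x)" for n x
  have Fint: "integrable lborel F" by (rule decay_integrable(1)[OF _ F]) simp
  then have Fint': "integrable lborel (\<lambda>x. F (x + h n *\<^sub>R b))" for n
    using lborel_integrable_affine[of F 1 "h n *\<^sub>R b"] by (simp add: add.commute)
  have "(\<integral>x. F (x + h n *\<^sub>R b) \<partial>lborel) = (\<integral>x. F x \<partial>lborel)" for n
    using lborel_integral_affine[of F 1 "h n *\<^sub>R b"] by (simp add: add.commute)
  then have q0: "(\<integral>x. q n x \<partial>lborel) = 0" for n
    unfolding q_def using Fint Fint' by simp
  \<comment> \<open>A dominating function for the difference quotients: a shift by at most 1 changes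
    \<open>1 + norm x\<close> by at most a factor 2, whence \<open>2 ^ ?M\<close>.\<close>
  have bound: "norm (q n x) \<le> 2 ^ ?M * B * inverse ((1 + norm x) ^ ?M)" for n x
  proof -
    let ?K = "2 ^ ?M * B * inverse ((1 + norm x) ^ ?M)"
    have nb: "norm b = 1" using b by simp
    have "norm (F (x + h n *\<^sub>R b) - F (x + 0 *\<^sub>R b)) \<le> h n * ?K - 0 * ?K"
    proof (rule differentiable_bound_general[where f = "\<lambda>t. F (x + t *\<^sub>R b)" and f' = "\<lambda>t. D (x + t *\<^sub>R b) b"
          and \<phi> = "\<lambda>t. t * ?K" and \<phi>' = "\<lambda>_. ?K"])
      show "continuous_on {0..h n} (\<lambda>t. F (x + t *\<^sub>R b))"
        by (rule continuous_on_compose2[OF cont]) (auto intro!: continuous_intros)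
      fix t assume t: "0 < t" "t < h n"
      have "((\<lambda>t. F (x + t *\<^sub>R b)) has_derivative (\<lambda>s. D (x + t *\<^sub>R b) (s *\<^sub>R b))) (at t)"
        by (rule has_derivative_compose[OF _ D]) (auto intro!: derivative_eq_intros)
      then show "((\<lambda>t. F (x + t *\<^sub>R b)) has_vector_derivative D (x + t *\<^sub>R b) b) (at t)"
        using linear_simps(5)[OF has_derivative_bounded_linear[OF D]] by (simp add: has_vector_derivative_def)
      have "norm x \<le> norm (x + t *\<^sub>R b) + norm (t *\<^sub>R b)"
        by (metis add_diff_cancel norm_triangle_ineq4)
      then have "1 + norm x \<le> 2 * (1 + norm (x + t *\<^sub>R b))"
        using t h(2)[of n] nb norm_ge_zero[of "x + t *\<^sub>R b"] unfolding norm_scaleR by (simp del: norm_ge_zero) 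
      then have "(1 + norm x) ^ ?M \<le> (2 * (1 + norm (x + t *\<^sub>R b))) ^ ?M"
        by (intro power_mono) auto
      then have "(1 + norm x) ^ ?M * norm (D (x + t *\<^sub>R b) b) \<le> 2 ^ ?M * ((1 + norm (x + t *\<^sub>R b)) ^ ?M * norm (D (x + t *\<^sub>R b) b))"
        unfolding mult.assoc[symmetric] power_mult_distrib[symmetric] by (rule mult_right_mono) simp
      also have "\<dots> \<le> 2 ^ ?M * B" using DF by (intro mult_left_mono) auto
      finally show "norm (D (x + t *\<^sub>R b) b) \<le> ?K" by (rule le_decay)
      show "((\<lambda>t. t * ?K) has_vector_derivative ?K) (at t)"
        by (auto intro!: derivative_eq_intros simp: has_real_derivative_iff_has_vector_derivative[symmetric])
    qed (use h in \<open>auto intro!: continuous_intros\<close>)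
    then have le: "norm (F (x + h n *\<^sub>R b) - F x) \<le> h n * ?K" by simp
    have "norm (q n x) = norm (F (x + h n *\<^sub>R b) - F x) / h n"
      using h(1)[of n] unfolding q_def norm_scaleR by simp
    also have "\<dots> \<le> (h n * ?K) / h n" using le h(1)[of n] by (intro divide_right_mono) auto
    finally show ?thesis using h(1)[of n] by simp
  qed
  have lim: "(\<lambda>n. q n x) \<longlonglongrightarrow> D x b" for x
  proof -
    have "((\<lambda>t. F (x + t *\<^sub>R b)) has_derivative (\<lambda>s. D (x + 0 *\<^sub>R b) (s *\<^sub>R b))) (at 0)"
      by (rule has_derivative_compose[OF _ D]) (auto intro!: derivative_eq_intros)
    then have "((\<lambda>t. F (x + t *\<^sub>R b)) has_derivative (\<lambda>s. s *\<^sub>R D x b)) (at 0)"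
      using linear_simps(5)[OF has_derivative_bounded_linear[OF D]] by simp
    then have q1: "((\<lambda>t. norm ((F (x + t *\<^sub>R b) - F x) - t *\<^sub>R D x b) / norm t) \<longlongrightarrow> 0) (at 0)"
      by (simp add: has_derivative_at)
    have q2: "norm ((F (x + t *\<^sub>R b) - F x) - t *\<^sub>R D x b) / norm t = norm ((1 / t) *\<^sub>R (F (x + t *\<^sub>R b) - F x) - D x b)"
      if "t \<noteq> 0" for t
    proof -
      have "(F (x + t *\<^sub>R b) - F x) - t *\<^sub>R D x b = t *\<^sub>R ((1 / t) *\<^sub>R (F (x + t *\<^sub>R b) - F x) - D x b)"
        using that by (simp add: scaleR_right_diff_distrib)
      then show ?thesis using that by simp
    qed
    have "((\<lambda>t. norm ((1 / t) *\<^sub>R (F (x + t *\<^sub>R b) - F x) - D x b)) \<longlongrightarrow> 0) (at 0)"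
      by (rule Lim_transform_eventually[OF q1]) (simp only: eventually_at_filter, use q2 in auto)
    then have "((\<lambda>t. (1 / t) *\<^sub>R (F (x + t *\<^sub>R b) - F x)) \<longlongrightarrow> D x b) (at 0)"
      by (rule LIM_zero_cancel[OF tendsto_norm_zero_cancel])
    moreover have "filterlim h (at 0) sequentially"
      unfolding h_def filterlim_at using LIMSEQ_inverse_real_of_nat by (auto simp: eventually_sequentially)
    ultimately show ?thesis unfolding q_def by (rule filterlim_compose)
  qed
  have Dm: "(\<lambda>x. D x b) \<in> borel_measurable borel"
    using borel_measurable_LIMSEQ_metric[of q borel "\<lambda>x. D x b"] lim by (simp add: q_def[abs_def])
  have "(\<lambda>n. \<integral>x. q n x \<partial>lborel) \<longlonglongrightarrow> (\<integral>x. D x b \<partial>lborel)"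
    by (rule integral_dominated_convergence[where w = "\<lambda>x. 2 ^ ?M * B * inverse ((1 + norm x) ^ ?M)"])
       (use bound lim Dm integrable_decay in \<open>auto simp: q_def[abs_def] intro!: integrable_mult_right\<close>)
  then show ?thesis unfolding q0 using LIMSEQ_unique tendsto_const by blast
qed

section \<open>The Fourier transform of Schwartz functions\<close>

lemma fourier_inv_eq_fourier: "fourier_inv \<phi> x = fourier \<phi> (- x)"
  by (simp add: fourier_def fourier_inv_def inner_commute)

definition fourier_const :: "'a::euclidean_space itself \<Rightarrow> real" where
  "fourier_const _ = (2 * pi) powr (- (real DIM('a) / 2))"

lemma fourier_const_pos: "0 < fourier_const TYPE('a::euclidean_space)"
  by (simp add: fourier_const_def)

lemma fourier_alt:
  "fourier \<phi> \<xi> = of_real (fourier_const TYPE('a)) * (\<integral>x. cis (- (x \<bullet> \<xi>)) * \<phi> x \<partial>lborel)"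
  for \<phi> :: "'a::euclidean_space \<Rightarrow> complex"
  by (simp add: fourier_def fourier_const_def)

lemma integrable_cis_mult:
  fixes f :: "'a::euclidean_space \<Rightarrow> complex"
  assumes "integrable lborel f"
  shows "integrable lborel (\<lambda>x. cis (- (x \<bullet> \<xi>)) * f x)" "integrable lborel (\<lambda>x. cis (x \<bullet> \<xi>) * f x)"
  using assms by (auto intro!: Bochner_Integration.integrable_bound[OF assms] simp: norm_mult)

lemma norm_fourier_le:
  fixes \<phi> :: "'a::euclidean_space \<Rightarrow> complex"
  shows "norm (fourier \<phi> \<xi>) \<le> fourier_const TYPE('a) * (\<integral>x. norm (\<phi> x) \<partial>lborel)"
proof -
  have "norm (\<integral>x. cis (- (x \<bullet> \<xi>)) * \<phi> x \<partial>lborel) \<le> (\<integral>x. norm (cis (- (x \<bullet> \<xi>)) * \<phi> x) \<partial>lborel)"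
    by (rule integral_norm_bound)
  then show ?thesis
    using fourier_const_pos[where ?'a = 'a] by (simp add: fourier_alt norm_mult)
qed

text \<open>Differentiation under the integral with an explicit error: \<open>cis\<close> differs
  from its first-order expansion by at most the square of the argument, so the remainder is bounded
  by the square of \<open>norm h\<close> times the second absolute moment of
  \<open>\<phi>\<close>.\<close>

lemma fourier_has_derivative:
  fixes \<phi> :: "'a::euclidean_space \<Rightarrow> complex"
  assumes "\<phi> \<in> schwartz"
  shows "(fourier \<phi> has_derivative (\<lambda>h. \<Sum>b\<in>Basis. of_real (h \<bullet> b) * fourier (\<lambda>x. - \<i> * (of_real (x \<bullet> b) * \<phi> x)) \<xi>)) (at \<xi>)"
proof -
  let ?c = "of_real (fourier_const TYPE('a)) :: complex"
  define D where "D h = (\<Sum>b\<in>Basis. of_real (h \<bullet> b) * fourier (\<lambda>x. - \<i> * (of_real (x \<bullet> b) * \<phi> x)) \<xi>)" for h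
  have blD: "bounded_linear D"
    unfolding D_def by (intro bounded_linear_sum bounded_linear_mult_const
        bounded_linear_compose[OF bounded_linear_of_real] bounded_linear_inner_left)
  have int: "integrable lborel \<phi>" "\<And>b. b \<in> Basis \<Longrightarrow> integrable lborel (\<lambda>x. of_real (x \<bullet> b) * \<phi> x)"
    by (intro schwartz_integrable schwartz_coord_mult assms; assumption)+
  obtain B where B: "B \<ge> 0" "wbound UNIV (decay_dim TYPE('a) + 2) 0 B \<phi>"
    using schwartz_wbound[OF assms] by blast
  have [measurable]: "\<phi> \<in> borel_measurable borel" by (rule schwartz_measurable[OF assms])
  have sq: "integrable lborel (\<lambda>x. of_real ((norm x)\<^sup>2) * \<phi> x)"
  proof (rule decay_integrable(1)[where B = B])
    fix x :: 'a
    have "(norm x)\<^sup>2 \<le> (1 + norm x)\<^sup>2" by (intro power_mono) auto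
    then have "(norm x)\<^sup>2 * norm (\<phi> x) \<le> (1 + norm x)\<^sup>2 * norm (\<phi> x)" by (rule mult_right_mono) simp
    then have "(1 + norm x) ^ decay_dim TYPE('a) * ((norm x)\<^sup>2 * norm (\<phi> x)) \<le> (1 + norm x) ^ decay_dim TYPE('a) * ((1 + norm x)\<^sup>2 * norm (\<phi> x))"
      by (rule mult_left_mono) simp
    also have "\<dots> \<le> B" using B(2) by (simp add: power_add mult_ac power2_eq_square)
    finally show "(1 + norm x) ^ decay_dim TYPE('a) * norm (of_real ((norm x)\<^sup>2) * \<phi> x) \<le> B"
      by (simp add: norm_mult norm_power)
  qed simp
  define K where "K = fourier_const TYPE('a) * (\<integral>x. norm (of_real ((norm x)\<^sup>2) * \<phi> x) \<partial>lborel)"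
  have K0: "0 \<le> K"
    unfolding K_def using fourier_const_pos[where ?'a = 'a] by (intro mult_nonneg_nonneg integral_nonneg_AE) auto
  have D_int: "D h = ?c * (\<integral>x. cis (- (x \<bullet> \<xi>)) * (- \<i> * of_real (x \<bullet> h) * \<phi> x) \<partial>lborel)"
    and D_ible: "integrable lborel (\<lambda>x. cis (- (x \<bullet> \<xi>)) * (- \<i> * of_real (x \<bullet> h) * \<phi> x))" for h
  proof -
    have i: "integrable lborel (\<lambda>x. of_real (h \<bullet> b) * (cis (- (x \<bullet> \<xi>)) * (- \<i> * (of_real (x \<bullet> b) * \<phi> x))))"
      if "b \<in> Basis" for b
      using int(2)[OF that] by (intro integrable_mult_right integrable_cis_mult) auto
    have eq: "(\<Sum>b\<in>Basis. of_real (h \<bullet> b) * (cis (- (x \<bullet> \<xi>)) * (- \<i> * (of_real (x \<bullet> b) * \<phi> x))))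
        = cis (- (x \<bullet> \<xi>)) * (- \<i> * of_real (x \<bullet> h) * \<phi> x)" for x
    proof -
      have "of_real (x \<bullet> h) = (\<Sum>b\<in>Basis. of_real (h \<bullet> b) * of_real (x \<bullet> b) :: complex)"
        by (subst euclidean_inner) (simp add: mult.commute)
      then show ?thesis by (simp add: sum_distrib_left sum_distrib_right mult_ac)
    qed
    show "integrable lborel (\<lambda>x. cis (- (x \<bullet> \<xi>)) * (- \<i> * of_real (x \<bullet> h) * \<phi> x))"
      using Bochner_Integration.integrable_sum[of Basis lborel
          "\<lambda>b x. of_real (h \<bullet> b) * (cis (- (x \<bullet> \<xi>)) * (- \<i> * (of_real (x \<bullet> b) * \<phi> x)))", OF i]
      unfolding eq by blast
    have "D h = ?c * (\<Sum>b\<in>Basis. of_real (h \<bullet> b) * (\<integral>x. cis (- (x \<bullet> \<xi>)) * (- \<i> * (of_real (x \<bullet> b) * \<phi> x)) \<partial>lborel))"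
      by (simp add: D_def fourier_alt sum_distrib_left mult_ac)
    also have "(\<Sum>b\<in>Basis. of_real (h \<bullet> b) * (\<integral>x. cis (- (x \<bullet> \<xi>)) * (- \<i> * (of_real (x \<bullet> b) * \<phi> x)) \<partial>lborel))
        = (\<integral>x. (\<Sum>b\<in>Basis. of_real (h \<bullet> b) * (cis (- (x \<bullet> \<xi>)) * (- \<i> * (of_real (x \<bullet> b) * \<phi> x)))) \<partial>lborel)"
      by (subst Bochner_Integration.integral_sum[OF i]) auto
    finally show "D h = ?c * (\<integral>x. cis (- (x \<bullet> \<xi>)) * (- \<i> * of_real (x \<bullet> h) * \<phi> x) \<partial>lborel)"
      unfolding eq .
  qed
  have rem: "norm (fourier \<phi> (\<xi> + h) - fourier \<phi> \<xi> - D h) \<le> K * (norm h)\<^sup>2" for h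
  proof -
    define r where "r x = cis (- (x \<bullet> (\<xi> + h))) * \<phi> x - cis (- (x \<bullet> \<xi>)) * \<phi> x - cis (- (x \<bullet> \<xi>)) * (- \<i> * of_real (x \<bullet> h) * \<phi> x)" for x
    have r_int: "integrable lborel r"
      unfolding r_def by (intro Bochner_Integration.integrable_diff integrable_cis_mult int D_ible)
    have "fourier \<phi> (\<xi> + h) - fourier \<phi> \<xi> - D h = ?c * (\<integral>x. r x \<partial>lborel)"
      unfolding r_def D_int fourier_alt
      using integrable_cis_mult(1)[OF int(1)] D_ible
      by (subst Bochner_Integration.integral_diff, simp, simp)+ (simp add: algebra_simps)
    also have "norm \<dots> \<le> fourier_const TYPE('a) * (\<integral>x. norm (r x) \<partial>lborel)"
      using fourier_const_pos[where ?'a = 'a]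
      by (simp add: norm_mult)
    also have "(\<integral>x. norm (r x) \<partial>lborel) \<le> (\<integral>x. (norm h)\<^sup>2 * norm (of_real ((norm x)\<^sup>2) * \<phi> x) \<partial>lborel)"
    proof (rule integral_mono)
      fix x
      have "r x = cis (- (x \<bullet> \<xi>)) * \<phi> x * (cis (- (x \<bullet> h)) - 1 - \<i> * of_real (- (x \<bullet> h)))"
      proof -
        have "cis (- (x \<bullet> (\<xi> + h))) = cis (- (x \<bullet> \<xi>)) * cis (- (x \<bullet> h))"
          by (simp add: cis_mult inner_add_right)
        then show ?thesis by (simp add: r_def algebra_simps)
      qed
      moreover have "norm (cis (- (x \<bullet> h)) - 1 - \<i> * of_real (- (x \<bullet> h))) \<le> (norm x * norm h)\<^sup>2"
      proof -
        have "norm (cis (- (x \<bullet> h)) - (\<Sum>k\<le>1. (\<i> * of_real (- (x \<bullet> h))) ^ k / fact k)) \<le> \<bar>- (x \<bullet> h)\<bar> ^ Suc 1 / fact (Suc 1)"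
          using iexp_approx1[of "- (x \<bullet> h)" 1] by (simp add: cis_conv_exp)
        also have "\<dots> \<le> \<bar>x \<bullet> h\<bar>\<^sup>2" by (simp add: numeral_2_eq_2)
        also have "\<dots> \<le> (norm x * norm h)\<^sup>2" using Cauchy_Schwarz_ineq2[of x h] by (intro power_mono) auto
        finally show ?thesis by (simp add: algebra_simps)
      qed
      ultimately have "norm (r x) \<le> norm (\<phi> x) * (norm x * norm h)\<^sup>2"
        by (simp add: norm_mult mult_left_mono)
      then show "norm (r x) \<le> (norm h)\<^sup>2 * norm (of_real ((norm x)\<^sup>2) * \<phi> x)"
        by (simp add: norm_mult norm_power power_mult_distrib mult_ac)
    qed (use r_int sq in auto)
    finally show ?thesis
      using fourier_const_pos[where ?'a = 'a] by (simp add: K_def mult_ac mult_left_mono)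
  qed
  have "(fourier \<phi> has_derivative D) (at \<xi>)"
    unfolding has_derivative_at
  proof (intro conjI blD)
    have lim: "((\<lambda>h::'a. K * norm h) \<longlongrightarrow> 0) (at 0)"
      by (intro tendsto_mult_right_zero tendsto_norm_zero tendsto_ident_at)
    show "(\<lambda>h. norm (fourier \<phi> (\<xi> + h) - fourier \<phi> \<xi> - D h) / norm h) \<midarrow>0\<rightarrow> 0"
    proof (rule tendsto_0_le[OF lim, of _ 1], rule always_eventually, rule allI)
      fix h :: 'a
      show "norm (norm (fourier \<phi> (\<xi> + h) - fourier \<phi> \<xi> - D h) / norm h) \<le> norm (K * norm h) * 1"
        using rem[of h] K0 by (cases "h = 0") (auto simp: divide_simps power2_eq_square mult_ac abs_mult)
    qed
  qed
  then show ?thesis by (simp add: D_def[abs_def])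
qed

lemma partial_deriv_fourier:
  assumes "\<phi> \<in> schwartz" "b \<in> Basis"
  shows "partial_deriv b (fourier \<phi>) = fourier (\<lambda>x. - \<i> * (of_real (x \<bullet> b) * \<phi> x))"
proof
  fix \<xi>
  have "(\<Sum>c\<in>Basis. of_real (b \<bullet> c) * f c) = f b" for f :: "'a \<Rightarrow> complex"
  proof -
    have "(\<Sum>c\<in>Basis. of_real (b \<bullet> c) * f c) = (\<Sum>c\<in>Basis. if b = c then f c else 0)"
      by (rule sum.cong) (use assms(2) in \<open>auto simp: inner_Basis\<close>)
    then show ?thesis using assms(2) by (simp add: sum.delta)
  qed
  then show "partial_deriv b (fourier \<phi>) \<xi> = fourier (\<lambda>x. - \<i> * (of_real (x \<bullet> b) * \<phi> x)) \<xi>"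
    using partial_deriv_eq[OF fourier_has_derivative[OF assms(1)], of b \<xi>] by simp
qed

text \<open>Integration by parts: the derivative of
  \<open>cis (- (x \<bullet> \<xi>)) * \<phi> x\<close> in direction \<open>b\<close> has integral
  zero, and the product rule separates its two terms.\<close>

lemma fourier_partial_deriv:
  fixes \<phi> :: "'a::euclidean_space \<Rightarrow> complex"
  assumes "\<phi> \<in> schwartz" "b \<in> Basis"
  shows "fourier (partial_deriv b \<phi>) \<xi> = \<i> * of_real (\<xi> \<bullet> b) * fourier \<phi> \<xi>"
proof -
  let ?M = "decay_dim TYPE('a)"
  obtain A where A: "wbound UNIV ?M 1 A \<phi>" "A \<ge> 0" using schwartz_wbound[OF assms(1)] by blast
  let ?F = "\<lambda>x. cis (- (x \<bullet> \<xi>)) * \<phi> x"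
  let ?D = "\<lambda>x h. cis (- (x \<bullet> \<xi>)) * frechet_derivative \<phi> (at x) h + ((- (h \<bullet> \<xi>)) *\<^sub>R (\<i> * cis (- (x \<bullet> \<xi>)))) * \<phi> x"
  have A1: "(1 + norm x) ^ ?M * norm (\<phi> x) \<le> A" "(1 + norm x) ^ ?M * norm (partial_deriv b \<phi> x) \<le> A" for x
    using A(1) assms(2) by auto
  have "(\<integral>x. ?D x b \<partial>lborel) = 0"
  proof (rule integral_partial_deriv_eq_0[where F = ?F and D = ?D and b = b and A = A and B = "A + \<bar>b \<bullet> \<xi>\<bar> * A"])
    show "(?F has_derivative ?D x) (at x)" for x
      using smooth_on_differentiable[OF schwartz_smooth_on[OF assms(1)], of x]
      by (intro has_derivative_mult has_derivative_cis) 
         (auto simp: frechet_derivative_works intro!: derivative_eq_intros)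
    show "(1 + norm x) ^ ?M * norm (?F x) \<le> A" for x
      using A1 by (simp add: norm_mult)
    show "(1 + norm x) ^ ?M * norm (?D x b) \<le> A + \<bar>b \<bullet> \<xi>\<bar> * A" for x
    proof -
      have "norm (?D x b) \<le> norm (partial_deriv b \<phi> x) + \<bar>b \<bullet> \<xi>\<bar> * norm (\<phi> x)"
        by (rule order_trans[OF norm_triangle_ineq]) (simp add: norm_mult partial_deriv_def)
      then have "(1 + norm x) ^ ?M * norm (?D x b) \<le> (1 + norm x) ^ ?M * (norm (partial_deriv b \<phi> x) + \<bar>b \<bullet> \<xi>\<bar> * norm (\<phi> x))"
        by (rule mult_left_mono) simp
      also have "\<dots> = (1 + norm x) ^ ?M * norm (partial_deriv b \<phi> x) + \<bar>b \<bullet> \<xi>\<bar> * ((1 + norm x) ^ ?M * norm (\<phi> x))"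
        by (simp add: algebra_simps)
      also have "\<dots> \<le> A + \<bar>b \<bullet> \<xi>\<bar> * A" using A1 by (intro add_mono mult_left_mono) auto
      finally show ?thesis .
    qed
  qed (use assms in auto)
  moreover have "(\<integral>x. ?D x b \<partial>lborel) = (\<integral>x. cis (- (x \<bullet> \<xi>)) * partial_deriv b \<phi> x \<partial>lborel)
      - \<i> * of_real (b \<bullet> \<xi>) * (\<integral>x. cis (- (x \<bullet> \<xi>)) * \<phi> x \<partial>lborel)"
  proof -
    have "?D x b = cis (- (x \<bullet> \<xi>)) * partial_deriv b \<phi> x - \<i> * of_real (b \<bullet> \<xi>) * (cis (- (x \<bullet> \<xi>)) * \<phi> x)" for x
      by (simp add: partial_deriv_def scaleR_conv_of_real)
    moreover have "integrable lborel (\<lambda>x. cis (- (x \<bullet> \<xi>)) * partial_deriv b \<phi> x)"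
      "integrable lborel (\<lambda>x. \<i> * of_real (b \<bullet> \<xi>) * (cis (- (x \<bullet> \<xi>)) * \<phi> x))"
      by (intro integrable_mult_right integrable_cis_mult schwartz_integrable schwartz_partial_deriv assms)+
    ultimately show ?thesis by simp
  qed
  ultimately show ?thesis by (simp add: fourier_alt inner_commute)
qed

text \<open>One more factor \<open>1 + norm \<xi>\<close> is at most 1 plus the sum of the absolute
  coordinates, and each coordinate is absorbed into a derivative of \<open>\<phi>\<close>. This
  gives one factor \<open>1 + DIM('a)\<close> per power.\<close>

lemma fourier_decay:
  fixes \<phi> :: "'a::euclidean_space \<Rightarrow> complex"
  assumes "\<phi> \<in> schwartz" "wbound UNIV (decay_dim TYPE('a)) k B \<phi>"
  shows "(1 + norm \<xi>) ^ k * norm (fourier \<phi> \<xi>) \<le> (1 + DIM('a)) ^ k * (fourier_const TYPE('a) * decay_mass TYPE('a) * B)"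
  using assms
proof (induction k arbitrary: \<phi>)
  case 0
  have "(\<integral>x. norm (\<phi> x) \<partial>lborel) \<le> decay_mass TYPE('a) * B"
    by (rule decay_integrable(2)[OF schwartz_measurable]) (use 0 in auto)
  then have "norm (fourier \<phi> \<xi>) \<le> fourier_const TYPE('a) * (decay_mass TYPE('a) * B)"
    using norm_fourier_le[of \<phi> \<xi>] fourier_const_pos[where ?'a = 'a] by (meson less_imp_le mult_left_mono order_trans)
  then show ?case by simp
next
  case (Suc k)
  let ?K = "(1 + DIM('a)) ^ k * (fourier_const TYPE('a) * decay_mass TYPE('a) * B)"
  have 1: "(1 + norm \<xi>) ^ k * norm (fourier \<phi> \<xi>) \<le> ?K"
    by (rule Suc.IH[OF Suc.prems(1)]) (rule wbound_mono[OF Suc.prems(2)], auto)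
  have 2: "(1 + norm \<xi>) ^ k * (\<bar>\<xi> \<bullet> b\<bar> * norm (fourier \<phi> \<xi>)) \<le> ?K" if "b \<in> Basis" for b
    using Suc.IH[OF schwartz_partial_deriv[OF Suc.prems(1) that]] Suc.prems(2) that
    by (simp add: fourier_partial_deriv[OF Suc.prems(1) that] norm_mult)
  have "(1 + norm \<xi>) ^ Suc k * norm (fourier \<phi> \<xi>)
      \<le> (1 + norm \<xi>) ^ k * ((1 + (\<Sum>b\<in>Basis. \<bar>\<xi> \<bullet> b\<bar>)) * norm (fourier \<phi> \<xi>))"
    unfolding power_Suc2 mult.assoc
    using norm_le_l1[of \<xi>] by (intro mult_left_mono mult_right_mono add_mono) auto
  also have "\<dots> = (1 + norm \<xi>) ^ k * norm (fourier \<phi> \<xi>) + (\<Sum>b\<in>Basis. (1 + norm \<xi>) ^ k * (\<bar>\<xi> \<bullet> b\<bar> * norm (fourier \<phi> \<xi>)))"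
    by (simp add: algebra_simps sum_distrib_left)
  also have "\<dots> \<le> ?K + (\<Sum>b\<in>(Basis::'a set). ?K)" using 1 2 by (intro add_mono sum_mono) auto
  also have "\<dots> = (1 + DIM('a)) ^ Suc k * (fourier_const TYPE('a) * decay_mass TYPE('a) * B)"
    by (simp add: algebra_simps)
  finally show ?case .
qed

text \<open>Differentiating the transform multiplies \<open>\<phi>\<close> by a coordinate: this
  spends one weight, hence the additional \<open>n\<close>, and enlarges the bound by the factor
  \<open>k + 1\<close> of \<open>wbound_coord_mult\<close>.\<close>

lemma fourier_wbound:
  fixes \<phi> :: "'a::euclidean_space \<Rightarrow> complex"
  assumes "\<phi> \<in> schwartz" "wbound UNIV (decay_dim TYPE('a) + n) k B \<phi>"
  shows "wbound UNIV k n (real ((k + 1) ^ n) * ((1 + DIM('a)) ^ k * (fourier_const TYPE('a) * decay_mass TYPE('a) * B))) (fourier \<phi>)"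
  using assms
proof (induction n arbitrary: \<phi> B)
  case 0
  then show ?case using fourier_decay[of \<phi> k B] by simp
next
  case (Suc n)
  let ?K = "\<lambda>B. (1 + DIM('a)) ^ k * (fourier_const TYPE('a) * decay_mass TYPE('a) * B)"
  have B0: "0 \<le> B" using wbound_nonneg[OF Suc.prems(2)] by blast
  have K0: "0 \<le> ?K B"
    using fourier_const_pos[where ?'a = 'a] decay_mass_nonneg[where ?'a = 'a] B0
    by (intro mult_nonneg_nonneg) auto
  have "wbound UNIV k n (real ((k + 1) ^ Suc n) * ?K B) (partial_deriv b (fourier \<phi>))" if b: "b \<in> Basis" for b
  proof -
    have "wbound UNIV (decay_dim TYPE('a) + n) k (norm (- \<i>) * ((k + 1) * B)) (\<lambda>x. - \<i> * (of_real (x \<bullet> b) * \<phi> x))"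
      using wbound_coord_mult[OF schwartz_smooth_on[OF Suc.prems(1)] _ b, of "decay_dim TYPE('a) + n" k B] Suc.prems(2)
      by (intro wbound_cmult schwartz_smooth_on schwartz_coord_mult Suc.prems b) (simp_all add: add.commute)
    then have "wbound UNIV k n (real ((k + 1) ^ n) * ?K ((k + 1) * B)) (fourier (\<lambda>x. - \<i> * (of_real (x \<bullet> b) * \<phi> x)))"
      using Suc.IH[OF schwartz_cmult[OF schwartz_coord_mult[OF Suc.prems(1) b]], of "(k + 1) * B" "- \<i>"] by (simp add: add.commute)
    moreover have "real ((k + 1) ^ n) * ?K (real (k + 1) * B) = real ((k + 1) ^ Suc n) * ?K B"
      by (simp only: power_Suc of_nat_mult mult_ac)
    ultimately show ?thesis unfolding partial_deriv_fourier[OF Suc.prems(1) b] by (simp only:)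
  qed
  moreover have "(1 + norm \<xi>) ^ k * norm (fourier \<phi> \<xi>) \<le> real ((k + 1) ^ Suc n) * ?K B" for \<xi>
  proof -
    have "(1 + norm \<xi>) ^ k * norm (fourier \<phi> \<xi>) \<le> ?K B"
      by (rule fourier_decay[OF Suc.prems(1)]) (rule wbound_mono[OF Suc.prems(2)], auto)
    also have "\<dots> = 1 * ?K B" by simp
    also have "\<dots> \<le> real ((k + 1) ^ Suc n) * ?K B"
      using K0 one_le_power[of "k + 1" "Suc n"] by (intro mult_right_mono) linarith+
    finally show ?thesis .
  qed
  ultimately show ?case unfolding wbound.simps by blast
qed

lemma fourier_schwartz: "\<phi> \<in> schwartz \<Longrightarrow> fourier \<phi> \<in> schwartz"
proof -
  have *: "ndiff_on n UNIV (fourier \<phi>)" if "\<phi> \<in> schwartz" for n and \<phi> :: "'a \<Rightarrow> complex"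
    using that
  proof (induction n arbitrary: \<phi>)
    case (Suc n)
    have "fourier \<phi> differentiable (at \<xi>)" for \<xi>
      using fourier_has_derivative[OF Suc.prems] by (auto simp: differentiable_def)
    moreover have "ndiff_on n UNIV (partial_deriv b (fourier \<phi>))" if "b \<in> Basis" for b
      unfolding partial_deriv_fourier[OF Suc.prems that]
      by (intro Suc.IH schwartz_cmult schwartz_coord_mult Suc.prems that)
    ultimately show ?case by simp
  qed simp
  then show "fourier \<phi> \<in> schwartz" if "\<phi> \<in> schwartz" for \<phi> :: "'a \<Rightarrow> complex"
    unfolding schwartz_iff_wbound
  proof (intro conjI allI)
    show "smooth_on UNIV (fourier \<phi>)" using * that by (simp add: smooth_on_def)
    show "\<exists>B. wbound UNIV k n B (fourier \<phi>)" for k n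
      using fourier_wbound[OF that] schwartz_wbound[OF that] by blast
  qed
qed

section \<open>Fourier inversion\<close>

lemma lborel_Fubini:
  fixes f :: "'a::euclidean_space \<Rightarrow> 'b::euclidean_space \<Rightarrow> 'c::{banach, second_countable_topology}"
  assumes f: "case_prod f \<in> borel_measurable (borel \<Otimes>\<^sub>M borel)"
    and fin: "(\<integral>\<^sup>+x. \<integral>\<^sup>+y. norm (f x y) \<partial>lborel \<partial>lborel) < \<infinity>"
  shows "integrable lborel (\<lambda>x. \<integral>y. f x y \<partial>lborel)" "integrable lborel (\<lambda>y. \<integral>x. f x y \<partial>lborel)"
    "(\<integral>x. (\<integral>y. f x y \<partial>lborel) \<partial>lborel) = (\<integral>y. (\<integral>x. f x y \<partial>lborel) \<partial>lborel)"
    "AE x in lborel. integrable lborel (\<lambda>y. f x y)" "AE y in lborel. integrable lborel (\<lambda>x. f x y)"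
proof -
  have f'[measurable]: "case_prod f \<in> borel_measurable (lborel \<Otimes>\<^sub>M lborel)"
    using f by (simp cong: measurable_cong_sets)
  have int: "integrable (lborel \<Otimes>\<^sub>M lborel) (case_prod f)"
  proof (rule integrableI_bounded)
    have "(\<integral>\<^sup>+z. norm (case_prod f z) \<partial>(lborel \<Otimes>\<^sub>M lborel)) = (\<integral>\<^sup>+x. \<integral>\<^sup>+y. norm (f x y) \<partial>lborel \<partial>lborel)"
      by (subst lborel.nn_integral_fst[symmetric]) auto
    with fin show "(\<integral>\<^sup>+z. norm (case_prod f z) \<partial>(lborel \<Otimes>\<^sub>M lborel)) < \<infinity>" by simp
  qed simp
  have int': "integrable (lborel \<Otimes>\<^sub>M lborel) (\<lambda>(y, x). f x y)"
    using lborel_pair.integrable_product_swap[OF int] by (simp add: case_prod_beta')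
  show "integrable lborel (\<lambda>x. \<integral>y. f x y \<partial>lborel)" using lborel_pair.integrable_fst'[OF int] by simp
  show "integrable lborel (\<lambda>y. \<integral>x. f x y \<partial>lborel)" using lborel_pair.integrable_fst'[OF int'] by simp
  show "(\<integral>x. (\<integral>y. f x y \<partial>lborel) \<partial>lborel) = (\<integral>y. (\<integral>x. f x y \<partial>lborel) \<partial>lborel)"
    using lborel_pair.Fubini_integral[OF int] by simp
  show "AE x in lborel. integrable lborel (\<lambda>y. f x y)" using lborel_pair.AE_integrable_fst'[OF int] by simp
  show "AE y in lborel. integrable lborel (\<lambda>x. f x y)" using lborel_pair.AE_integrable_fst'[OF int'] by simp
qed

lemma lborel_Fubini_product:
  fixes f :: "'a::euclidean_space \<Rightarrow> 'b::euclidean_space \<Rightarrow> 'c::{banach, second_countable_topology}"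
    and a :: "'a \<Rightarrow> complex" and b :: "'b \<Rightarrow> complex"
  assumes f: "case_prod f \<in> borel_measurable (borel \<Otimes>\<^sub>M borel)"
    and ab: "integrable lborel a" "integrable lborel b"
    and le: "\<And>x y. norm (f x y) \<le> norm (a x) * norm (b y)"
  shows "(\<integral>x. (\<integral>y. f x y \<partial>lborel) \<partial>lborel) = (\<integral>y. (\<integral>x. f x y \<partial>lborel) \<partial>lborel)"
proof (rule lborel_Fubini(3)[OF f])
  have [measurable]: "a \<in> borel_measurable borel" "b \<in> borel_measurable borel" using ab by auto
  have "(\<integral>\<^sup>+x. \<integral>\<^sup>+y. norm (f x y) \<partial>lborel \<partial>lborel) \<le> (\<integral>\<^sup>+x. \<integral>\<^sup>+y. norm (a x) * ennreal (norm (b y)) \<partial>lborel \<partial>lborel)"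
    using le by (intro nn_integral_mono) (simp add: ennreal_mult[symmetric] ennreal_leI)
  also have "\<dots> = (\<integral>\<^sup>+x. norm (a x) \<partial>lborel) * (\<integral>\<^sup>+y. norm (b y) \<partial>lborel)"
    by (simp add: nn_integral_cmult nn_integral_multc)
  also have "\<dots> < \<infinity>" using ab by (simp add: integrable_iff_bounded ennreal_mult_less_top)
  finally show "(\<integral>\<^sup>+x. \<integral>\<^sup>+y. norm (f x y) \<partial>lborel \<partial>lborel) < \<infinity>" .
qed

definition gauss :: "'a::euclidean_space \<Rightarrow> complex" where
  "gauss x = of_real (exp (- ((norm x)\<^sup>2 / 2)))"

text \<open>Up to the factor \<open>sqrt (2 * pi)\<close> this is the characteristic function of the
  standard normal distribution.\<close>

lemma gauss_real_integral:
  "integrable lborel (\<lambda>x::real. cis (t * x) * of_real (exp (- (x\<^sup>2 / 2))))"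
  "(\<integral>x. cis (t * x) * of_real (exp (- (x\<^sup>2 / 2))) \<partial>lborel) = of_real (sqrt (2 * pi) * exp (- (t\<^sup>2 / 2)))"
proof -
  have eq: "exp (- (x\<^sup>2 / 2)) = sqrt (2 * pi) * std_normal_density x" for x
    by (simp add: std_normal_density_def)
  have i: "integrable lborel (\<lambda>x. sqrt (2 * pi) * std_normal_density x)" by simp
  show "integrable lborel (\<lambda>x::real. cis (t * x) * of_real (exp (- (x\<^sup>2 / 2))))"
    by (rule Bochner_Integration.integrable_bound[OF i]) (auto simp: norm_mult eq normal_density_nonneg)
  have "of_real (exp (- (t\<^sup>2) / 2)) = char std_normal_distribution t"
    by (simp add: char_std_normal_distribution)
  also have "\<dots> = (\<integral>x. std_normal_density x *\<^sub>R cis (t * x) \<partial>lborel)"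
    unfolding char_def by (subst integral_density) (auto simp: normal_density_nonneg cis_conv_exp)
  also have "of_real (sqrt (2 * pi)) * \<dots> = (\<integral>x. cis (t * x) * of_real (exp (- (x\<^sup>2 / 2))) \<partial>lborel)"
    by (subst integral_mult_right_zero[symmetric]) (simp add: eq scaleR_conv_of_real mult_ac)
  finally have "of_real (sqrt (2 * pi)) * of_real (exp (- (t\<^sup>2) / 2)) = (\<integral>x. cis (t * x) * of_real (exp (- (x\<^sup>2 / 2))) \<partial>lborel)"
    by simp
  then show "(\<integral>x. cis (t * x) * of_real (exp (- (x\<^sup>2 / 2))) \<partial>lborel) = of_real (sqrt (2 * pi) * exp (- (t\<^sup>2 / 2)))"
    by simp
qed

text \<open>Lebesgue measure is the image of the product of one-dimensional measures, and the
  integrand factors over the coordinates.\<close>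

lemma gauss_integral:
  fixes w :: "'a::euclidean_space"
  shows "integrable lborel (\<lambda>x::'a. cis (w \<bullet> x) * gauss x)"
    "(\<integral>x. cis (w \<bullet> x) * gauss x \<partial>lborel) = of_real (sqrt (2 * pi)) ^ DIM('a) * gauss w"
proof -
  interpret P: product_sigma_finite "\<lambda>_::'a. lborel :: real measure" ..
  define T where "T f = (\<Sum>b\<in>Basis. f b *\<^sub>R b)" for f :: "'a \<Rightarrow> real"
  have T[measurable]: "T \<in> measurable (\<Pi>\<^sub>M b\<in>Basis. lborel) borel"
    unfolding T_def by measurable
  define f where "f b x = cis ((w \<bullet> b) * x) * of_real (exp (- (x\<^sup>2 / 2)))" for b x
  have nrm: "(norm x)\<^sup>2 = (\<Sum>b\<in>Basis. (x \<bullet> b)\<^sup>2)" for x :: 'a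
    unfolding power2_norm_eq_inner by (subst euclidean_inner) (simp add: power2_eq_square)
  have prod_eq: "cis (w \<bullet> x) * gauss x = (\<Prod>b\<in>Basis. f b (x \<bullet> b))" for x
  proof -
    have "(\<Prod>b\<in>Basis. cis ((w \<bullet> b) * (x \<bullet> b))) = cis (w \<bullet> x)"
      by (subst (2) euclidean_inner) (simp add: cis_conv_exp exp_sum sum_distrib_left)
    moreover have "(\<Prod>b\<in>Basis. exp (- ((x \<bullet> b)\<^sup>2 / 2))) = exp (- ((norm x)\<^sup>2 / 2))"
      by (simp add: nrm exp_sum[symmetric] sum_negf sum_divide_distrib)
    ultimately show ?thesis
      by (simp add: f_def prod.distrib gauss_def flip: of_real_prod)
  qed
  have Tb: "T g \<bullet> b = g b" if "b \<in> Basis" for g b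
    using that by (simp add: T_def inner_sum_left inner_Basis if_distrib sum.delta cong: if_cong)
  have PT: "(\<Prod>b\<in>Basis. f b (T g \<bullet> b)) = (\<Prod>b\<in>Basis. f b (g b))" for g
    by (rule prod.cong) (auto simp: Tb)
  have fint: "integrable lborel (f b)" for b unfolding f_def by (rule gauss_real_integral)
  have lb: "(lborel :: 'a measure) = distr (\<Pi>\<^sub>M b\<in>Basis. lborel) borel T"
    unfolding T_def by (rule lborel_eq)
  have meas: "(\<lambda>x. cis (w \<bullet> x) * gauss x) \<in> borel_measurable borel"
    unfolding gauss_def by measurable
  show "integrable lborel (\<lambda>x::'a. cis (w \<bullet> x) * gauss x)"
    unfolding lb using meas
    by (subst integrable_distr_eq) (auto simp: prod_eq PT intro!: P.product_integrable_prod fint)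
  have "(\<integral>x. cis (w \<bullet> x) * gauss x \<partial>lborel) = (\<integral>g. (\<Prod>b\<in>Basis. f b (g b)) \<partial>(\<Pi>\<^sub>M b\<in>Basis. lborel))"
    unfolding lb using meas by (subst integral_distr) (auto simp: prod_eq PT)
  also have "\<dots> = (\<Prod>b\<in>Basis. integral\<^sup>L lborel (f b))"
    by (rule P.product_integral_prod) (auto intro: fint)
  also have "\<dots> = (\<Prod>b\<in>(Basis::'a set). of_real (sqrt (2 * pi)) * of_real (exp (- ((w \<bullet> b)\<^sup>2 / 2))))"
    unfolding f_def gauss_real_integral(2) by simp
  also have "\<dots> = of_real (sqrt (2 * pi)) ^ DIM('a) * gauss w"
    by (simp add: prod.distrib gauss_def nrm exp_sum[symmetric] sum_negf sum_divide_distrib flip: of_real_prod)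
  finally show "(\<integral>x. cis (w \<bullet> x) * gauss x \<partial>lborel) = of_real (sqrt (2 * pi)) ^ DIM('a) * gauss w" .
qed

lemma gauss_measurable [measurable]: "gauss \<in> borel_measurable borel"
  unfolding gauss_def by measurable

lemma norm_gauss_le: "norm (gauss x) \<le> 1"
  by (simp add: gauss_def)

lemma integrable_gauss: "integrable lborel (gauss :: 'a::euclidean_space \<Rightarrow> complex)"
  using gauss_integral(1)[of 0] by simp

text \<open>
  Inserting the Gaussian factor \<open>gauss (\<epsilon> \<xi>)\<close> makes the double integral absolutely
  convergent and turns it into a convolution with an approximate identity.
\<close>

lemma fourier_inversion:
  fixes \<phi> :: "'a::euclidean_space \<Rightarrow> complex"
  assumes "\<phi> \<in> schwartz"
  shows "fourier_inv (fourier \<phi>) x = \<phi> x"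
proof -
  define J where "J \<xi> = (\<integral>y. cis (- (y \<bullet> \<xi>)) * \<phi> y \<partial>lborel)" for \<xi>
  define \<epsilon> where "\<epsilon> n = inverse (real (Suc n))" for n
  have \<epsilon>: "\<epsilon> n > 0" "\<epsilon> \<longlonglongrightarrow> 0" for n
    using LIMSEQ_inverse_real_of_nat by (auto simp: \<epsilon>_def[abs_def])
  let ?c = "of_real (fourier_const TYPE('a)) :: complex"
  let ?s = "of_real (sqrt (2 * pi)) ^ DIM('a) :: complex"
  have \<phi>int: "integrable lborel \<phi>" by (rule schwartz_integrable[OF assms])
  have [measurable]: "\<phi> \<in> borel_measurable borel" by (rule schwartz_measurable[OF assms])
  have cJ: "fourier \<phi> = (\<lambda>\<xi>. ?c * J \<xi>)" by (rule ext) (simp add: fourier_alt J_def)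
  have J_eq: "J = (\<lambda>\<xi>. inverse ?c * fourier \<phi> \<xi>)"
    using fourier_const_pos[where ?'a = 'a] by (auto simp: cJ)
  have Jint: "integrable lborel J"
    unfolding J_eq by (intro integrable_mult_right schwartz_integrable fourier_schwartz assms)
  have [measurable]: "J \<in> borel_measurable borel" using Jint by simp
  have ?thesis if "(\<integral>\<xi>. cis (x \<bullet> \<xi>) * J \<xi> \<partial>lborel) = ?s * ?s * \<phi> x"
  proof -
    have "fourier_inv (fourier \<phi>) x = ?c * (\<integral>\<xi>. cis (x \<bullet> \<xi>) * (?c * J \<xi>) \<partial>lborel)"
      by (simp add: fourier_inv_def fourier_const_def cJ)
    also have "(\<integral>\<xi>. cis (x \<bullet> \<xi>) * (?c * J \<xi>) \<partial>lborel) = ?c * (\<integral>\<xi>. cis (x \<bullet> \<xi>) * J \<xi> \<partial>lborel)"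
      by (subst integral_mult_right_zero[symmetric]) (simp add: mult_ac)
    finally have 1: "fourier_inv (fourier \<phi>) x = (?c * ?s) * (?c * ?s) * \<phi> x"
      unfolding that by (simp only: mult_ac)
    have "sqrt (2 * pi) ^ DIM('a) = (2 * pi) powr (real DIM('a) / 2)"
      using powr_powr[of "2 * pi" "1/2" "real DIM('a)"] by (simp add: powr_half_sqrt powr_realpow)
    then have "fourier_const TYPE('a) * sqrt (2 * pi) ^ DIM('a) = (2 * pi) powr (- (real DIM('a) / 2) + real DIM('a) / 2)"
      by (simp only: fourier_const_def powr_add)
    then have "fourier_const TYPE('a) * sqrt (2 * pi) ^ DIM('a) = 1" by simp
    then have "?c * ?s = 1" by (metis of_real_1 of_real_mult of_real_power)
    with 1 show ?thesis by simp
  qed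
  moreover have "(\<integral>\<xi>. cis (x \<bullet> \<xi>) * J \<xi> \<partial>lborel) = ?s * ?s * \<phi> x"
  proof (rule LIMSEQ_unique)
    show "(\<lambda>n. \<integral>\<xi>. gauss (\<epsilon> n *\<^sub>R \<xi>) * (cis (x \<bullet> \<xi>) * J \<xi>) \<partial>lborel) \<longlonglongrightarrow> (\<integral>\<xi>. cis (x \<bullet> \<xi>) * J \<xi> \<partial>lborel)"
    proof (rule integral_dominated_convergence[where w = "\<lambda>\<xi>. norm (J \<xi>)"])
      have "(\<lambda>n. gauss (\<epsilon> n *\<^sub>R \<xi>) * (cis (x \<bullet> \<xi>) * J \<xi>)) \<longlonglongrightarrow> of_real (exp (- ((norm (0 *\<^sub>R \<xi>))\<^sup>2 / 2))) * (cis (x \<bullet> \<xi>) * J \<xi>)" for \<xi>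
        unfolding gauss_def by (intro tendsto_intros \<epsilon>(2)) simp
      then show "AE \<xi> in lborel. (\<lambda>n. gauss (\<epsilon> n *\<^sub>R \<xi>) * (cis (x \<bullet> \<xi>) * J \<xi>)) \<longlonglongrightarrow> cis (x \<bullet> \<xi>) * J \<xi>"
        by simp
      show "AE \<xi> in lborel. norm (gauss (\<epsilon> n *\<^sub>R \<xi>) * (cis (x \<bullet> \<xi>) * J \<xi>)) \<le> norm (J \<xi>)" for n
        by (intro AE_I2) (simp add: norm_mult mult_left_le_one_le norm_gauss_le)
    qed (use Jint in auto)
    \<comment> \<open>By Fubini the integral over \<open>\<xi>\<close> becomes the transform of a
      rescaled Gaussian; the substitution \<open>y = x + \<epsilon> n *\<^sub>R z\<close> then
      cancels the powers of \<open>\<epsilon> n\<close>.\<close>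
    have conv: "(\<integral>\<xi>. gauss (\<epsilon> n *\<^sub>R \<xi>) * (cis (x \<bullet> \<xi>) * J \<xi>) \<partial>lborel) = ?s * (\<integral>z. \<phi> (x + \<epsilon> n *\<^sub>R z) * gauss z \<partial>lborel)" for n
    proof -
      let ?e = "\<epsilon> n"
      have e: "?e > 0" by (rule \<epsilon>)
      have gint: "integrable lborel (\<lambda>\<xi>. gauss (?e *\<^sub>R \<xi>) :: complex)"
        using lborel_integrable_affine[OF integrable_gauss, of ?e 0] e by simp
      have inner: "(\<integral>\<xi>. gauss (?e *\<^sub>R \<xi>) * cis (w \<bullet> \<xi>) \<partial>lborel) = of_real (inverse ?e ^ DIM('a)) * (?s * gauss (inverse ?e *\<^sub>R w))" for w :: 'a
      proof -
        have "(\<integral>\<xi>. gauss (?e *\<^sub>R \<xi>) * cis (w \<bullet> \<xi>) \<partial>lborel) = inverse ?e ^ DIM('a) *\<^sub>R (\<integral>\<xi>. cis ((inverse ?e *\<^sub>R w) \<bullet> \<xi>) * gauss \<xi> \<partial>lborel)"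
          using lborel_integral_affine[of "\<lambda>\<xi>. gauss (?e *\<^sub>R \<xi>) * cis (w \<bullet> \<xi>)" "inverse ?e" 0] e
          by (simp add: mult.commute)
        then show ?thesis unfolding gauss_integral by (simp add: scaleR_conv_of_real)
      qed
      have "(\<integral>\<xi>. gauss (?e *\<^sub>R \<xi>) * (cis (x \<bullet> \<xi>) * J \<xi>) \<partial>lborel)
          = (\<integral>\<xi>. \<integral>y. gauss (?e *\<^sub>R \<xi>) * cis ((x - y) \<bullet> \<xi>) * \<phi> y \<partial>lborel \<partial>lborel)"
      proof (rule Bochner_Integration.integral_cong[OF refl])
        fix \<xi>
        have "gauss (?e *\<^sub>R \<xi>) * (cis (x \<bullet> \<xi>) * J \<xi>) = (\<integral>y. gauss (?e *\<^sub>R \<xi>) * cis (x \<bullet> \<xi>) * (cis (- (y \<bullet> \<xi>)) * \<phi> y) \<partial>lborel)"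
          unfolding J_def by (simp add: mult.assoc)
        also have "\<dots> = (\<integral>y. gauss (?e *\<^sub>R \<xi>) * cis ((x - y) \<bullet> \<xi>) * \<phi> y \<partial>lborel)"
        proof (rule Bochner_Integration.integral_cong[OF refl])
          fix y
          have "cis ((x - y) \<bullet> \<xi>) = cis (x \<bullet> \<xi>) * cis (- (y \<bullet> \<xi>))" by (simp add: cis_mult inner_diff_left)
          then show "gauss (?e *\<^sub>R \<xi>) * cis (x \<bullet> \<xi>) * (cis (- (y \<bullet> \<xi>)) * \<phi> y) = gauss (?e *\<^sub>R \<xi>) * cis ((x - y) \<bullet> \<xi>) * \<phi> y"
            by simp
        qed
        finally show "gauss (?e *\<^sub>R \<xi>) * (cis (x \<bullet> \<xi>) * J \<xi>) = (\<integral>y. gauss (?e *\<^sub>R \<xi>) * cis ((x - y) \<bullet> \<xi>) * \<phi> y \<partial>lborel)" .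
      qed
      also have "\<dots> = (\<integral>y. \<integral>\<xi>. gauss (?e *\<^sub>R \<xi>) * cis ((x - y) \<bullet> \<xi>) * \<phi> y \<partial>lborel \<partial>lborel)"
        by (rule lborel_Fubini_product[OF _ gint \<phi>int]) (simp_all add: norm_mult)
      also have "\<dots> = (\<integral>y. of_real (inverse ?e ^ DIM('a)) * (?s * gauss (inverse ?e *\<^sub>R (x - y)) * \<phi> y) \<partial>lborel)"
        using inner by (intro Bochner_Integration.integral_cong) simp_all
      also have "\<dots> = ?e ^ DIM('a) *\<^sub>R (\<integral>z. of_real (inverse ?e ^ DIM('a)) * (?s * gauss (inverse ?e *\<^sub>R (x - (x + ?e *\<^sub>R z))) * \<phi> (x + ?e *\<^sub>R z)) \<partial>lborel)"
        using lborel_integral_affine[of "\<lambda>y. of_real (inverse ?e ^ DIM('a)) * (?s * gauss (inverse ?e *\<^sub>R (x - y)) * \<phi> y)" ?e x] e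
        by simp
      also have "\<dots> = (\<integral>z. ?s * (\<phi> (x + ?e *\<^sub>R z) * gauss z) \<partial>lborel)"
      proof -
        have g: "gauss (inverse ?e *\<^sub>R (x - (x + ?e *\<^sub>R z))) = gauss z" for z :: 'a
          using e by (simp add: gauss_def)
        show ?thesis
          unfolding g using e
          by (subst integral_scaleR_right[symmetric], intro Bochner_Integration.integral_cong refl)
             (simp add: scaleR_conv_of_real power_inverse field_simps)
      qed
      finally show ?thesis by simp
    qed
    obtain B where B: "\<And>x. norm (\<phi> x) \<le> B"
      using schwartz_wbound[OF assms, of 0 0] by auto
    have lim: "(\<lambda>n. \<phi> (x + \<epsilon> n *\<^sub>R z) * gauss z) \<longlonglongrightarrow> \<phi> x * gauss z" for z
    proof (intro tendsto_mult tendsto_const)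
      have "(\<lambda>n. x + \<epsilon> n *\<^sub>R z) \<longlonglongrightarrow> x + 0 *\<^sub>R z" by (intro tendsto_intros \<epsilon>)
      then show "(\<lambda>n. \<phi> (x + \<epsilon> n *\<^sub>R z)) \<longlonglongrightarrow> \<phi> x"
        using continuous_on_tendsto_compose[OF schwartz_continuous[OF assms]] by simp
    qed
    have "(\<lambda>n. \<integral>z. \<phi> (x + \<epsilon> n *\<^sub>R z) * gauss z \<partial>lborel) \<longlonglongrightarrow> integral\<^sup>L lborel (\<lambda>z::'a. \<phi> x * gauss z)"
      by (rule integral_dominated_convergence[where w = "\<lambda>z::'a. B * norm (gauss z)"])
         (use integrable_gauss lim B in \<open>auto simp: norm_mult intro!: mult_right_mono AE_I2\<close>)
    also have "integral\<^sup>L lborel (\<lambda>z::'a. \<phi> x * gauss z) = \<phi> x * ?s"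
      using gauss_integral(2)[of "0::'a"] by (simp add: gauss_def)
    finally have "(\<lambda>n. ?s * (\<integral>z. \<phi> (x + \<epsilon> n *\<^sub>R z) * gauss z \<partial>lborel)) \<longlonglongrightarrow> ?s * (\<phi> x * ?s)"
      by (rule tendsto_mult_left)
    then show "(\<lambda>n. \<integral>\<xi>. gauss (\<epsilon> n *\<^sub>R \<xi>) * (cis (x \<bullet> \<xi>) * J \<xi>) \<partial>lborel) \<longlonglongrightarrow> ?s * ?s * \<phi> x"
      unfolding conv by (simp add: mult_ac)
  qed
  ultimately show ?thesis .
qed

lemma fourier_reflect:
  fixes f :: "'a::euclidean_space \<Rightarrow> complex"
  assumes "f \<in> borel_measurable borel"
  shows "fourier (\<lambda>x. f (- x)) \<xi> = fourier f (- \<xi>)"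
  using lborel_integral_affine[of "\<lambda>x. cis (x \<bullet> \<xi>) * f x" "-1" 0] assms
  by (simp add: fourier_alt)

lemma fourier_inversion':
  fixes \<phi> :: "'a::euclidean_space \<Rightarrow> complex"
  assumes "\<phi> \<in> schwartz"
  shows "fourier (fourier_inv \<phi>) x = \<phi> x"
proof -
  have "fourier (\<lambda>\<xi>. fourier \<phi> (- \<xi>)) x = fourier (fourier \<phi>) (- x)"
    by (rule fourier_reflect) (rule schwartz_measurable[OF fourier_schwartz[OF assms]])
  also have "\<dots> = \<phi> x" using fourier_inversion[OF assms, of x] by (simp add: fourier_inv_eq_fourier)
  finally show ?thesis by (simp add: fourier_inv_eq_fourier[abs_def])
qed

lemma fourier_inv_schwartz:
  fixes \<phi> :: "'a::euclidean_space \<Rightarrow> complex"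
  assumes "\<phi> \<in> schwartz"
  shows "fourier_inv \<phi> \<in> schwartz"
proof -
  have f: "fourier \<phi> \<in> schwartz" by (rule fourier_schwartz[OF assms])
  have sm: "smooth_on UNIV (fourier_inv \<phi>)"
    using smooth_on_dilate[OF schwartz_smooth_on[OF f], of "-1"] by (simp add: fourier_inv_eq_fourier[abs_def])
  have "wbound UNIV k n B (\<lambda>x. g (- x))" if "smooth_on UNIV g" "wbound UNIV k n B g" for g :: "'a \<Rightarrow> complex" and k n B
    using that
  proof (induction n arbitrary: g)
    case 0
    then show ?case by (auto simp: norm_minus_cancel) (metis norm_minus_cancel)
  next
    case (Suc n)
    have "wbound UNIV k n B (partial_deriv b (\<lambda>x. g (- x)))" if b: "b \<in> Basis" for b
    proof -
      have eq: "partial_deriv b (\<lambda>x. g (- x)) = (\<lambda>x. - partial_deriv b g (- x))"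
        using partial_deriv_dilate[OF smooth_on_differentiable[OF Suc.prems(1)], of b "-1"] by auto
      have "wbound UNIV k n B (\<lambda>x. partial_deriv b g (- x))"
        using Suc.IH[OF smooth_on_partial_deriv[OF Suc.prems(1) b]] Suc.prems(2) b by simp
      from wbound_bounded_linear[OF open_UNIV _ this bounded_linear_minus[OF bounded_linear_ident], of 1]
      show ?thesis unfolding eq
        using smooth_on_dilate[OF smooth_on_partial_deriv[OF Suc.prems(1) b], of "-1"] by simp
    qed
    moreover have "(1 + norm x) ^ k * norm (g (- x)) \<le> B" for x
      using Suc.prems(2) by (auto dest: spec[of _ "- x"])
    ultimately show ?case by simp
  qed
  then have "\<exists>B. wbound UNIV k n B (\<lambda>x. fourier \<phi> (- x))" for k n
    using schwartz_wbound[OF f, of k n] schwartz_smooth_on[OF f] by blast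
  with sm show ?thesis by (simp add: schwartz_iff_wbound fourier_inv_eq_fourier[abs_def])
qed

section \<open>Mollification\<close>

definition tconv :: "('a::euclidean_space \<Rightarrow> complex) \<Rightarrow> ('a \<Rightarrow> complex) \<Rightarrow> 'a \<Rightarrow> complex" where
  "tconv \<kappa> \<psi> x = (\<integral>y. \<kappa> (x - y) * \<psi> y \<partial>lborel)"

lemma test_on_measurable: "test_on R f \<Longrightarrow> f \<in> borel_measurable borel"
  by (intro borel_measurable_continuous_onI smooth_on_continuous_on test_on_smooth)

lemma test_on_partial_deriv:
  assumes "test_on R f" "b \<in> Basis"
  shows "test_on R (partial_deriv b f)"
proof -
  have "open {x::'a. R < norm x}" by (intro open_Collect_less continuous_intros)
  then have "partial_deriv b f x = partial_deriv b (\<lambda>_. 0) x" if "R < norm x" for x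
    using partial_deriv_cong_open[of "{x. R < norm x}" x f "\<lambda>_. 0"] assms that by (simp add: test_on_def)
  then show ?thesis
    using assms by (simp add: test_on_def smooth_on_partial_deriv partial_deriv_def)
qed

lemma test_on_integrable: "test_on R f \<Longrightarrow> 0 \<le> R \<Longrightarrow> integrable lborel f"
  by (intro schwartz_integrable test_on_schwartz)

lemma tconv_integrable:
  fixes \<kappa> \<psi> :: "'a::euclidean_space \<Rightarrow> complex"
  assumes "test_on R \<kappa>" "\<And>x. norm (\<kappa> x) \<le> B" "integrable lborel \<psi>"
  shows "integrable lborel (\<lambda>y. \<kappa> (x - y) * \<psi> y)" "norm (tconv \<kappa> \<psi> x) \<le> B * (\<integral>y. norm (\<psi> y) \<partial>lborel)"
proof -
  have [measurable]: "\<kappa> \<in> borel_measurable borel" "\<psi> \<in> borel_measurable borel"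
    using test_on_measurable[OF assms(1)] assms(3) by auto
  have i: "integrable lborel (\<lambda>y. B * norm (\<psi> y))" using assms(3) by simp
  have le: "norm (\<kappa> (x - y) * \<psi> y) \<le> B * norm (\<psi> y)" for y
    using assms(2) by (simp add: norm_mult mult_right_mono)
  show int: "integrable lborel (\<lambda>y. \<kappa> (x - y) * \<psi> y)"
    by (rule Bochner_Integration.integrable_bound[OF i]) (auto intro!: AE_I2 order_trans[OF le])
  have "norm (tconv \<kappa> \<psi> x) \<le> (\<integral>y. norm (\<kappa> (x - y) * \<psi> y) \<partial>lborel)"
    unfolding tconv_def by (rule integral_norm_bound)
  also have "\<dots> \<le> (\<integral>y. B * norm (\<psi> y) \<partial>lborel)"
    by (rule integral_mono[OF integrable_norm[OF int] i le])
  finally show "norm (tconv \<kappa> \<psi> x) \<le> B * (\<integral>y. norm (\<psi> y) \<partial>lborel)" by simp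
qed

text \<open>All derivatives fall on \<open>\<kappa>\<close>, whose second-order Taylor error is
  uniform in the base point. Integrating it uses only the integrability of \<open>\<psi>\<close>, so
  that symbols which are not smooth can be mollified.\<close>

lemma tconv_has_derivative:
  fixes \<kappa> \<psi> :: "'a::euclidean_space \<Rightarrow> complex"
  assumes "test_on R \<kappa>" "0 \<le> R" "integrable lborel \<psi>"
  shows "(tconv \<kappa> \<psi> has_derivative (\<lambda>h. \<Sum>b\<in>Basis. (h \<bullet> b) *\<^sub>R tconv (partial_deriv b \<kappa>) \<psi> x)) (at x)"
proof -
  define D where "D h = (\<Sum>b\<in>Basis. (h \<bullet> b) *\<^sub>R tconv (partial_deriv b \<kappa>) \<psi> x)" for h
  obtain B where B: "B \<ge> 0" "wbound UNIV 0 2 B \<kappa>" using test_on_wbound[OF assms(1,2)] by blast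
  have \<kappa>B: "norm (\<kappa> x) \<le> B" "\<And>b. b \<in> Basis \<Longrightarrow> norm (partial_deriv b \<kappa> x) \<le> B" for x
    using B(2) by (auto simp: numeral_2_eq_2)
  have i1: "integrable lborel (\<lambda>y. \<kappa> (x - y) * \<psi> y)" for x
    by (rule tconv_integrable(1)[OF assms(1) \<kappa>B(1) assms(3)])
  have i2: "integrable lborel (\<lambda>y. (h \<bullet> b) *\<^sub>R (partial_deriv b \<kappa> (x - y) * \<psi> y))" if "b \<in> Basis" for b h
    using tconv_integrable(1)[OF test_on_partial_deriv[OF assms(1) that] \<kappa>B(2)[OF that] assms(3)] by simp
  define K where "K = (real DIM('a))\<^sup>2 * B * (\<integral>y. norm (\<psi> y) \<partial>lborel)"
  have K0: "0 \<le> K" unfolding K_def using B(1) by (intro mult_nonneg_nonneg integral_nonneg_AE) auto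
  have rem: "norm (tconv \<kappa> \<psi> (x + h) - tconv \<kappa> \<psi> x - D h) \<le> K * (norm h)\<^sup>2" for h
  proof -
    define r where "r y = \<kappa> ((x - y) + h) - \<kappa> (x - y) - (\<Sum>b\<in>Basis. (h \<bullet> b) *\<^sub>R partial_deriv b \<kappa> (x - y))" for y
    have r_eq: "r y * \<psi> y = \<kappa> ((x + h) - y) * \<psi> y - \<kappa> (x - y) * \<psi> y - (\<Sum>b\<in>Basis. (h \<bullet> b) *\<^sub>R (partial_deriv b \<kappa> (x - y) * \<psi> y))" for y
      by (simp add: r_def algebra_simps sum_distrib_left)
    have r_le: "norm (r y) \<le> (DIM('a) * norm h)\<^sup>2 * B" for y
      unfolding r_def by (rule taylor_second_order[OF test_on_smooth[OF assms(1)] B(2)])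
    have r_int: "integrable lborel (\<lambda>y. r y * \<psi> y)"
      unfolding r_eq by (intro Bochner_Integration.integrable_diff Bochner_Integration.integrable_sum i1 i2)
    have "tconv \<kappa> \<psi> (x + h) - tconv \<kappa> \<psi> x - D h = (\<integral>y. r y * \<psi> y \<partial>lborel)"
      unfolding r_eq using i1 i2
      by (simp add: tconv_def D_def Bochner_Integration.integral_sum[OF i2])
    also have "norm \<dots> \<le> (\<integral>y. norm (r y * \<psi> y) \<partial>lborel)" by (rule integral_norm_bound)
    also have "\<dots> \<le> (\<integral>y. (DIM('a) * norm h)\<^sup>2 * B * norm (\<psi> y) \<partial>lborel)"
    proof (rule integral_mono[OF integrable_norm[OF r_int]])
      show "integrable lborel (\<lambda>y. (DIM('a) * norm h)\<^sup>2 * B * norm (\<psi> y))" using assms(3) by simp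
      show "norm (r y * \<psi> y) \<le> (DIM('a) * norm h)\<^sup>2 * B * norm (\<psi> y)" for y
        unfolding norm_mult by (intro mult_right_mono r_le) simp
    qed
    finally show ?thesis by (simp add: K_def power_mult_distrib mult_ac)
  qed
  have blD: "bounded_linear D"
    unfolding D_def by (intro bounded_linear_sum bounded_linear_scaleR_const bounded_linear_inner_left)
  have "(tconv \<kappa> \<psi> has_derivative D) (at x)"
    unfolding has_derivative_at
  proof (intro conjI blD)
    have lim: "((\<lambda>h::'a. K * norm h) \<longlongrightarrow> 0) (at 0)"
      by (intro tendsto_mult_right_zero tendsto_norm_zero tendsto_ident_at)
    show "(\<lambda>h. norm (tconv \<kappa> \<psi> (x + h) - tconv \<kappa> \<psi> x - D h) / norm h) \<midarrow>0\<rightarrow> 0"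
    proof (rule tendsto_0_le[OF lim, of _ 1], rule always_eventually, rule allI)
      fix h :: 'a
      show "norm (norm (tconv \<kappa> \<psi> (x + h) - tconv \<kappa> \<psi> x - D h) / norm h) \<le> norm (K * norm h) * 1"
        using rem[of h] K0 by (cases "h = 0") (auto simp: divide_simps power2_eq_square mult_ac abs_mult)
    qed
  qed
  then show ?thesis by (simp add: D_def[abs_def])
qed

lemma partial_deriv_tconv:
  assumes "test_on R \<kappa>" "0 \<le> R" "integrable lborel \<psi>" "b \<in> Basis"
  shows "partial_deriv b (tconv \<kappa> \<psi>) = tconv (partial_deriv b \<kappa>) \<psi>"
proof
  fix x
  have "(\<Sum>c\<in>Basis. (b \<bullet> c) *\<^sub>R f c) = f b" for f :: "'a \<Rightarrow> complex"
  proof -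
    have "(\<Sum>c\<in>Basis. (b \<bullet> c) *\<^sub>R f c) = (\<Sum>c\<in>Basis. if b = c then f c else 0)"
      by (rule sum.cong) (use assms(4) in \<open>auto simp: inner_Basis\<close>)
    then show ?thesis using assms(4) by (simp add: sum.delta)
  qed
  then show "partial_deriv b (tconv \<kappa> \<psi>) x = tconv (partial_deriv b \<kappa>) \<psi> x"
    using partial_deriv_eq[OF tconv_has_derivative[OF assms(1-3)], of b x] by simp
qed

lemma iter_partial_tconv:
  assumes "test_on R \<kappa>" "0 \<le> R" "integrable lborel \<psi>" "set bs \<subseteq> Basis"
  shows "iter_partial bs (tconv \<kappa> \<psi>) = tconv (iter_partial bs \<kappa>) \<psi>"
  using assms
proof (induction bs arbitrary: \<kappa> rule: rev_induct)
  case (snoc b bs)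
  then show ?case
    using partial_deriv_tconv[of R \<kappa> \<psi> b] snoc.IH[OF test_on_partial_deriv] by (simp add: iter_partial_snoc)
qed simp

lemma test_on_tconv:
  fixes \<kappa> \<psi> :: "'a::euclidean_space \<Rightarrow> complex"
  assumes "test_on R \<kappa>" "0 \<le> R" "integrable lborel \<psi>" "\<And>x. R' < norm x \<Longrightarrow> \<psi> x = 0"
  shows "test_on (R + R') (tconv \<kappa> \<psi>)"
proof -
  have "ndiff_on n UNIV (tconv \<kappa> \<psi>)" if "test_on R \<kappa>" for n and \<kappa> :: "'a \<Rightarrow> complex"
    using that
  proof (induction n arbitrary: \<kappa>)
    case (Suc n)
    have "tconv \<kappa> \<psi> differentiable (at x)" for x
      using tconv_has_derivative[OF Suc.prems assms(2,3)] by (auto simp: differentiable_def)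
    moreover have "ndiff_on n UNIV (partial_deriv b (tconv \<kappa> \<psi>))" if "b \<in> Basis" for b
      unfolding partial_deriv_tconv[OF Suc.prems assms(2,3) that]
      by (intro Suc.IH test_on_partial_deriv Suc.prems that)
    ultimately show ?case by simp
  qed simp
  moreover have "tconv \<kappa> \<psi> x = 0" if x: "R + R' < norm x" for x
  proof -
    have "\<kappa> (x - y) * \<psi> y = 0" for y
    proof (cases "R' < norm y")
      case False
      then have "R < norm (x - y)" using x norm_triangle_ineq2[of x y] by linarith
      then show ?thesis using test_on_zero[OF assms(1)] by simp
    qed (use assms(4) in simp)
    then have "(\<lambda>y. \<kappa> (x - y) * \<psi> y) = (\<lambda>y. 0)" by blast
    then show ?thesis by (simp add: tconv_def)
  qed
  ultimately show ?thesis using assms(1) by (simp add: test_on_def smooth_on_def)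
qed

lemma tconv_commute:
  fixes \<kappa> \<psi> :: "'a::euclidean_space \<Rightarrow> complex"
  assumes "\<kappa> \<in> borel_measurable borel" "\<psi> \<in> borel_measurable borel"
  shows "tconv \<kappa> \<psi> = tconv \<psi> \<kappa>"
proof
  fix x
  have "(\<lambda>y. \<kappa> (x - y) * \<psi> y) \<in> borel_measurable borel" using assms by measurable
  from lborel_integral_affine[OF this, of "-1" x]
  show "tconv \<kappa> \<psi> x = tconv \<psi> \<kappa> x" by (simp add: tconv_def mult.commute)
qed

lemma partial_deriv_tconv_right:
  assumes "test_on R \<kappa>" "0 \<le> R" "test_on R' \<psi>" "0 \<le> R'" "b \<in> Basis"
  shows "partial_deriv b (tconv \<kappa> \<psi>) = tconv \<kappa> (partial_deriv b \<psi>)"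
  using partial_deriv_tconv[OF assms(3,4) test_on_integrable[OF assms(1,2)] assms(5)]
    tconv_commute[OF test_on_measurable[OF assms(1)] test_on_measurable[OF assms(3)]]
    tconv_commute[OF test_on_measurable[OF assms(1)] test_on_measurable[OF test_on_partial_deriv[OF assms(3,5)]]]
  by simp

lemma smooth_on_of_real:
  fixes f :: "'a::euclidean_space \<Rightarrow> real"
  shows "open S \<Longrightarrow> smooth_on S f \<Longrightarrow> smooth_on S (\<lambda>x. of_real (f x) :: complex)"
  by (rule smooth_on_bounded_linear[OF _ bounded_linear_of_real])

section \<open>Rescaled mollifiers and rates of convergence\<close>

definition dilated :: "('a::euclidean_space \<Rightarrow> real) \<Rightarrow> real \<Rightarrow> 'a \<Rightarrow> complex" where
  "dilated \<rho> \<epsilon> x = (1 / \<epsilon> ^ DIM('a)) *\<^sub>R of_real (\<rho> ((1 / \<epsilon>) *\<^sub>R x))"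

lemma mollify_eq_tconv:
  fixes \<psi> :: "'a::euclidean_space \<Rightarrow> complex"
  shows "mollify \<rho> \<epsilon> \<psi> = tconv (dilated \<rho> \<epsilon>) \<psi>"
  by (rule ext) (simp add: mollify_def tconv_def dilated_def scaleR_conv_of_real divide_inverse mult.commute)

lemma test_on_dilated:
  fixes \<rho> :: "'a::euclidean_space \<Rightarrow> real"
  assumes "smooth \<rho>" "\<And>x. r < norm x \<Longrightarrow> \<rho> x = 0" "0 < \<epsilon>"
  shows "test_on (\<epsilon> * r) (dilated \<rho> \<epsilon>)"
proof -
  have "smooth_on UNIV (\<lambda>x. of_real (\<rho> ((1 / \<epsilon>) *\<^sub>R x)) :: complex)"
    by (intro smooth_on_of_real smooth_on_dilate) (use assms(1) in \<open>auto simp: smooth_iff_smooth_on\<close>)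
  then have "smooth_on UNIV (dilated \<rho> \<epsilon>)"
    unfolding dilated_def by (rule smooth_on_bounded_linear[OF open_UNIV bounded_linear_scaleR_right])
  moreover have "dilated \<rho> \<epsilon> x = 0" if "\<epsilon> * r < norm x" for x
  proof -
    have "r < norm ((1 / \<epsilon>) *\<^sub>R x)" using that assms(3) by (simp add: field_simps)
    then show ?thesis by (simp add: dilated_def assms(2))
  qed
  ultimately show ?thesis by (simp add: test_on_def)
qed

lemma iter_partial_dilated:
  fixes \<rho> :: "'a::euclidean_space \<Rightarrow> real"
  assumes "smooth \<rho>" "set bs \<subseteq> Basis"
  shows "iter_partial bs (dilated \<rho> \<epsilon>) = (\<lambda>x. ((1 / \<epsilon> ^ DIM('a)) * (1 / \<epsilon>) ^ length bs) *\<^sub>R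
    iter_partial bs (\<lambda>x. of_real (\<rho> x) :: complex) ((1 / \<epsilon>) *\<^sub>R x))"
  using assms(2)
proof (induction bs)
  case Nil
  then show ?case by (simp add: dilated_def[abs_def])
next
  case (Cons b bs)
  let ?f = "iter_partial bs (\<lambda>x. of_real (\<rho> x) :: complex)"
  let ?a = "(1 / \<epsilon> ^ DIM('a)) * (1 / \<epsilon>) ^ length bs"
  have f: "smooth_on UNIV ?f"
    using Cons.prems assms(1) by (intro smooth_on_iter_partial smooth_on_of_real) (auto simp: smooth_iff_smooth_on)
  have "partial_deriv b (\<lambda>x. ?a *\<^sub>R ?f ((1 / \<epsilon>) *\<^sub>R x)) x = ?a *\<^sub>R partial_deriv b (\<lambda>x. ?f ((1 / \<epsilon>) *\<^sub>R x)) x" for x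
  proof -
    have "(\<lambda>x. ?f ((1 / \<epsilon>) *\<^sub>R x)) differentiable (at x)"
      by (rule smooth_on_differentiable[OF smooth_on_dilate[OF f]]) simp
    then have "((\<lambda>x. ?a *\<^sub>R ?f ((1 / \<epsilon>) *\<^sub>R x)) has_derivative (\<lambda>h. ?a *\<^sub>R frechet_derivative (\<lambda>x. ?f ((1 / \<epsilon>) *\<^sub>R x)) (at x) h)) (at x)"
      by (intro has_derivative_scaleR_right) (simp add: frechet_derivative_works)
    from partial_deriv_eq[OF this] show ?thesis by (simp add: partial_deriv_def)
  qed
  moreover have "partial_deriv b (\<lambda>x. ?f ((1 / \<epsilon>) *\<^sub>R x)) x = (1 / \<epsilon>) *\<^sub>R partial_deriv b ?f ((1 / \<epsilon>) *\<^sub>R x)" for x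
    by (rule partial_deriv_dilate) (rule smooth_on_differentiable[OF f UNIV_I])
  ultimately show ?case
    using Cons by (auto simp: iter_partial_Cons)
qed

lemma mollifier_support:
  assumes "mollifier \<rho>"
  shows "\<exists>r>0. \<forall>x. r < norm x \<longrightarrow> \<rho> x = 0"
proof -
  obtain r where "\<And>x. \<rho> x \<noteq> 0 \<Longrightarrow> norm x \<le> r"
    using assms unfolding mollifier_def bounded_iff by auto
  then have "\<forall>x. max r 1 < norm x \<longrightarrow> \<rho> x = 0" by fastforce
  then show ?thesis by (intro exI[of _ "max r 1"]) auto
qed

lemma dilated_integral:
  fixes \<rho> :: "'a::euclidean_space \<Rightarrow> real"
  assumes "mollifier \<rho>" "0 < \<epsilon>"
  shows "(\<integral>x. dilated \<rho> \<epsilon> x \<partial>lborel) = 1" "(\<integral>x. norm (dilated \<rho> \<epsilon> x) \<partial>lborel) = 1"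
proof -
  have \<rho>: "smooth \<rho>" "\<And>x. 0 \<le> \<rho> x" "(\<integral>x. \<rho> x \<partial>lborel) = 1" using assms(1) by (auto simp: mollifier_def)
  have [measurable]: "\<rho> \<in> borel_measurable borel"
    using \<rho>(1) by (intro borel_measurable_continuous_onI smooth_on_continuous_on) (simp add: smooth_iff_smooth_on)
  have "(\<integral>x. \<rho> ((1 / \<epsilon>) *\<^sub>R x) \<partial>lborel) = \<epsilon> ^ DIM('a) * (\<integral>x. \<rho> x \<partial>lborel)"
    using lborel_integral_affine[of "\<lambda>x. \<rho> ((1 / \<epsilon>) *\<^sub>R x)" \<epsilon> 0] assms(2) by simp
  then have 1: "(\<integral>x. (1 / \<epsilon> ^ DIM('a)) * \<rho> ((1 / \<epsilon>) *\<^sub>R x) \<partial>lborel) = 1"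
    using \<rho>(3) assms(2) by simp
  have "dilated \<rho> \<epsilon> x = of_real ((1 / \<epsilon> ^ DIM('a)) * \<rho> ((1 / \<epsilon>) *\<^sub>R x))" for x
    by (simp add: dilated_def scaleR_conv_of_real)
  then have "(\<integral>x. dilated \<rho> \<epsilon> x \<partial>lborel) = of_real (\<integral>x. (1 / \<epsilon> ^ DIM('a)) * \<rho> ((1 / \<epsilon>) *\<^sub>R x) \<partial>lborel)"
    by (simp only: integral_complex_of_real)
  then show "(\<integral>x. dilated \<rho> \<epsilon> x \<partial>lborel) = 1" unfolding 1 by simp
  have "norm (dilated \<rho> \<epsilon> x) = (1 / \<epsilon> ^ DIM('a)) * \<rho> ((1 / \<epsilon>) *\<^sub>R x)" for x
    using \<rho>(2) assms(2) by (simp add: dilated_def)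
  then have "(\<integral>x. norm (dilated \<rho> \<epsilon> x) \<partial>lborel) = (\<integral>x. (1 / \<epsilon> ^ DIM('a)) * \<rho> ((1 / \<epsilon>) *\<^sub>R x) \<partial>lborel)"
    by (simp only:)
  then show "(\<integral>x. norm (dilated \<rho> \<epsilon> x) \<partial>lborel) = 1" unfolding 1 .
qed

text \<open>Derivatives commute with mollification, so a sup bound is enough: the kernel has mass
  one and lives in a ball of radius \<open>\<epsilon> * r\<close>, where the Lipschitz bound
  applies. One extra derivative of \<open>\<psi>\<close> buys the rate linear in
  \<open>\<epsilon>\<close>.\<close>

lemma mollify_converges:
  fixes \<psi> :: "'a::euclidean_space \<Rightarrow> complex" and r :: real
  assumes \<rho>: "mollifier \<rho>" and r: "0 < r" "\<And>x. r < norm x \<Longrightarrow> \<rho> x = 0" and \<epsilon>: "0 < \<epsilon>"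
    and \<psi>: "test_on R \<psi>" "0 \<le> R" "wbound UNIV 0 (Suc n) B \<psi>"
  shows "wbound UNIV 0 n (DIM('a) * (\<epsilon> * r) * B) (\<lambda>x. mollify \<rho> \<epsilon> \<psi> x - \<psi> x)"
  using \<psi>(1,3)
proof (induction n arbitrary: \<psi>)
  let ?\<kappa> = "dilated \<rho> \<epsilon>"
  have sm: "smooth \<rho>" using \<rho> by (simp add: mollifier_def)
  have \<kappa>: "test_on (\<epsilon> * r) ?\<kappa>" by (rule test_on_dilated[OF sm r(2) \<epsilon>])
  have er: "0 \<le> \<epsilon> * r" using \<epsilon> r(1) by simp
  note \<kappa>int = test_on_integrable[OF \<kappa> er]
  have base: "norm (mollify \<rho> \<epsilon> \<psi> x - \<psi> x) \<le> DIM('a) * (\<epsilon> * r) * B"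
    if \<psi>: "test_on R \<psi>" "wbound UNIV 0 1 B \<psi>" for \<psi> x
  proof -
    have B0: "0 \<le> B" using wbound_nonneg[OF \<psi>(2)] by blast
    have [measurable]: "\<psi> \<in> borel_measurable borel" "?\<kappa> \<in> borel_measurable borel"
      using test_on_measurable \<psi>(1) \<kappa> by auto
    have le: "norm (\<psi> x) \<le> B" for x using \<psi>(2) by auto
    have i1: "integrable lborel (\<lambda>y. \<psi> (x - y) * ?\<kappa> y)"
      by (rule tconv_integrable(1)[OF \<psi>(1) le \<kappa>int])
    have i2: "integrable lborel (\<lambda>y. \<psi> x * ?\<kappa> y)" using \<kappa>int by simp
    have "mollify \<rho> \<epsilon> \<psi> x = (\<integral>y. \<psi> (x - y) * ?\<kappa> y \<partial>lborel)"
      unfolding mollify_eq_tconv by (subst tconv_commute) (auto simp: tconv_def)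
    moreover have "\<psi> x = (\<integral>y. \<psi> x * ?\<kappa> y \<partial>lborel)"
      using dilated_integral(1)[OF \<rho> \<epsilon>] by simp
    ultimately have "mollify \<rho> \<epsilon> \<psi> x - \<psi> x = (\<integral>y. \<psi> (x - y) * ?\<kappa> y - \<psi> x * ?\<kappa> y \<partial>lborel)"
      using i1 i2 by simp
    also have "norm \<dots> \<le> (\<integral>y. norm (\<psi> (x - y) * ?\<kappa> y - \<psi> x * ?\<kappa> y) \<partial>lborel)" by (rule integral_norm_bound)
    also have "\<dots> \<le> (\<integral>y. DIM('a) * (\<epsilon> * r) * B * norm (?\<kappa> y) \<partial>lborel)"
    proof (rule integral_mono)
      fix y
      have *: "norm (\<psi> (x - y) * ?\<kappa> y - \<psi> x * ?\<kappa> y) = norm (\<psi> (x - y) - \<psi> x) * norm (?\<kappa> y)"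
        by (simp add: norm_mult[symmetric] left_diff_distrib)
      show "norm (\<psi> (x - y) * ?\<kappa> y - \<psi> x * ?\<kappa> y) \<le> DIM('a) * (\<epsilon> * r) * B * norm (?\<kappa> y)"
      proof (cases "\<epsilon> * r < norm y")
        case True
        then show ?thesis using test_on_zero[OF \<kappa> True] by simp
      next
        case False
        have "norm (\<psi> (x + (- y)) - \<psi> x) \<le> DIM('a) * norm (- y) * B"
          by (rule lipschitz_wbound[OF test_on_smooth[OF \<psi>(1)] \<psi>(2)])
        also have "\<dots> \<le> DIM('a) * (\<epsilon> * r) * B" using False B0 by (intro mult_right_mono mult_left_mono) auto
        finally show ?thesis unfolding * by (intro mult_right_mono) auto
      qed
    qed (use i1 i2 \<kappa>int in auto)
    also have "\<dots> = DIM('a) * (\<epsilon> * r) * B" using dilated_integral(2)[OF \<rho> \<epsilon>] by simp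
    finally show ?thesis .
  qed
  {
    case 0
    then show ?case using base by simp
  next
    case (Suc n)
    have w1: "wbound UNIV 0 1 B \<psi>" by (rule wbound_mono[OF Suc.prems(2)]) auto
    have "wbound UNIV 0 n (DIM('a) * (\<epsilon> * r) * B) (partial_deriv b (\<lambda>x. mollify \<rho> \<epsilon> \<psi> x - \<psi> x))" if b: "b \<in> Basis" for b
    proof -
      have "partial_deriv b (\<lambda>x. mollify \<rho> \<epsilon> \<psi> x - \<psi> x) x = mollify \<rho> \<epsilon> (partial_deriv b \<psi>) x - partial_deriv b \<psi> x" for x
      proof -
        have d1: "tconv ?\<kappa> \<psi> differentiable (at x)"
          using tconv_has_derivative[OF \<kappa> er test_on_integrable[OF Suc.prems(1) \<psi>(2)]] by (auto simp: differentiable_def)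
        have d2: "\<psi> differentiable (at x)" by (rule smooth_on_differentiable[OF test_on_smooth[OF Suc.prems(1)]]) simp
        have "((\<lambda>x. tconv ?\<kappa> \<psi> x - \<psi> x) has_derivative (\<lambda>h. frechet_derivative (tconv ?\<kappa> \<psi>) (at x) h - frechet_derivative \<psi> (at x) h)) (at x)"
          using d1 d2 by (intro has_derivative_diff) (simp_all add: frechet_derivative_works)
        from partial_deriv_eq[OF this, of b]
        show ?thesis
          using partial_deriv_tconv_right[OF \<kappa> er Suc.prems(1) \<psi>(2) b]
          by (simp add: mollify_eq_tconv partial_deriv_def) (metis partial_deriv_def)
      qed
      then have "partial_deriv b (\<lambda>x. mollify \<rho> \<epsilon> \<psi> x - \<psi> x) = (\<lambda>x. mollify \<rho> \<epsilon> (partial_deriv b \<psi>) x - partial_deriv b \<psi> x)" by blast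
      then show ?thesis
        using Suc.IH[OF test_on_partial_deriv[OF Suc.prems(1) b]] Suc.prems(2) b by simp
    qed
    with base[OF Suc.prems(1) w1] show ?case by simp
  }
qed

lemma test_on_mollify:
  fixes \<psi> :: "'a::euclidean_space \<Rightarrow> complex" and r :: real
  assumes "mollifier \<rho>" "0 < r" "\<And>x. r < norm x \<Longrightarrow> \<rho> x = 0" "0 < \<epsilon>"
    and "integrable lborel \<psi>" "\<And>x. R < norm x \<Longrightarrow> \<psi> x = 0"
  shows "test_on (\<epsilon> * r + R) (mollify \<rho> \<epsilon> \<psi>)"
  unfolding mollify_eq_tconv using assms
  by (intro test_on_tconv test_on_dilated) (auto simp: mollifier_def)

text \<open>Every derivative falls on the kernel and costs one factor \<open>1 / \<epsilon>\<close>,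
  while only values of \<open>u\<close> at distance at most \<open>\<epsilon> * r\<close> from the
  origin enter. Derivatives of order below \<open>a\<close> therefore tend to zero with
  \<open>\<epsilon>\<close>, although \<open>u\<close> need not be smooth.\<close>

lemma mollify_derivs_at_0:
  fixes u :: "'a::euclidean_space \<Rightarrow> complex" and r :: real
  assumes \<rho>: "mollifier \<rho>" and r: "0 < r" "\<And>x. r < norm x \<Longrightarrow> \<rho> x = 0" and \<epsilon>: "0 < \<epsilon>"
    and u: "integrable lborel u" "\<And>x. norm (u x) \<le> A * norm x powr a" "0 \<le> A" "0 < a" and bs: "set bs \<subseteq> Basis"
  shows "norm (iter_partial bs (mollify \<rho> \<epsilon> u) 0) \<le>
    A * (\<epsilon> * r) powr a * (1 / \<epsilon>) ^ length bs * (\<integral>z. norm (iter_partial bs (\<lambda>x. of_real (\<rho> x) :: complex) z) \<partial>lborel)"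
proof -
  let ?P = "\<lambda>x. of_real (\<rho> x) :: complex"
  let ?Q = "iter_partial bs ?P"
  let ?c = "(1 / \<epsilon> ^ DIM('a)) * (1 / \<epsilon>) ^ length bs"
  have sm: "smooth \<rho>" using \<rho> by (simp add: mollifier_def)
  have P: "test_on r ?P" using sm r by (auto simp: test_on_def smooth_iff_smooth_on intro: smooth_on_of_real)
  have Q: "test_on r ?Q" using bs
    by (induction bs) (auto simp: iter_partial_Cons P intro: test_on_partial_deriv)
  have Qint: "integrable lborel ?Q" by (rule test_on_integrable[OF Q]) (use r in simp)
  have [measurable]: "?Q \<in> borel_measurable borel" "u \<in> borel_measurable borel"
    using test_on_measurable[OF Q] u(1) by auto
  obtain B where B: "\<And>x. norm (?Q x) \<le> B"
    using test_on_wbound[OF Q, of 0 0] r by auto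
  have \<kappa>: "test_on (\<epsilon> * r) (dilated \<rho> \<epsilon>)" by (rule test_on_dilated[OF sm r(2) \<epsilon>])
  have "iter_partial bs (mollify \<rho> \<epsilon> u) 0 = (\<integral>y. (?c *\<^sub>R ?Q ((1 / \<epsilon>) *\<^sub>R (0 - y))) * u y \<partial>lborel)"
    unfolding mollify_eq_tconv using \<epsilon> r(1) 
    by (subst iter_partial_tconv[OF \<kappa> _ u(1) bs]) (simp_all add: iter_partial_dilated[OF sm bs] tconv_def)
  also have "\<dots> = \<epsilon> ^ DIM('a) *\<^sub>R (\<integral>z. (?c *\<^sub>R ?Q (- z)) * u (\<epsilon> *\<^sub>R z) \<partial>lborel)"
    using lborel_integral_affine[of "\<lambda>y. (?c *\<^sub>R ?Q ((1 / \<epsilon>) *\<^sub>R (0 - y))) * u y" \<epsilon> 0] \<epsilon> by simp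
  also have "norm \<dots> \<le> \<epsilon> ^ DIM('a) * (\<integral>z. norm ((?c *\<^sub>R ?Q (- z)) * u (\<epsilon> *\<^sub>R z)) \<partial>lborel)"
    using \<epsilon> by (simp add: integral_norm_bound)
  also have "(\<integral>z. norm ((?c *\<^sub>R ?Q (- z)) * u (\<epsilon> *\<^sub>R z)) \<partial>lborel) \<le> (\<integral>z. ?c * (A * (\<epsilon> * r) powr a) * norm (?Q (- z)) \<partial>lborel)"
  proof (rule integral_mono)
    have Qm: "integrable lborel (\<lambda>z. ?Q (- z))" using lborel_integrable_affine[OF Qint, of "-1" 0] by simp
    then show "integrable lborel (\<lambda>z. ?c * (A * (\<epsilon> * r) powr a) * norm (?Q (- z)))" by simp
    have ui: "integrable lborel (\<lambda>z. u (\<epsilon> *\<^sub>R z))" using lborel_integrable_affine[OF u(1), of \<epsilon> 0] \<epsilon> by simp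
    have "integrable lborel (\<lambda>z. ?Q (- z) * u (\<epsilon> *\<^sub>R z))"
      by (rule Bochner_Integration.integrable_bound[of _ "\<lambda>z. B * norm (u (\<epsilon> *\<^sub>R z))"])
         (use ui B in \<open>auto simp: norm_mult intro!: AE_I2 mult_right_mono order_trans[OF _ abs_ge_self]\<close>)
    then show "integrable lborel (\<lambda>z. norm ((?c *\<^sub>R ?Q (- z)) * u (\<epsilon> *\<^sub>R z)))"
      by (simp del: norm_scaleR add: norm_mult)
    fix z
    show "norm ((?c *\<^sub>R ?Q (- z)) * u (\<epsilon> *\<^sub>R z)) \<le> ?c * (A * (\<epsilon> * r) powr a) * norm (?Q (- z))"
    proof (cases "r < norm z")
      case True
      then show ?thesis using test_on_zero[OF Q, of "- z"] by simp
    next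
      case False
      have "norm (u (\<epsilon> *\<^sub>R z)) \<le> A * norm (\<epsilon> *\<^sub>R z) powr a" by (rule u(2))
      also have "\<dots> \<le> A * (\<epsilon> * r) powr a"
        using False \<epsilon> r u(3,4) by (intro mult_left_mono powr_mono2) auto
      finally have "norm (u (\<epsilon> *\<^sub>R z)) \<le> A * (\<epsilon> * r) powr a" .
      then have "?c * norm (?Q (- z)) * norm (u (\<epsilon> *\<^sub>R z)) \<le> ?c * norm (?Q (- z)) * (A * (\<epsilon> * r) powr a)"
        using \<epsilon> by (intro mult_left_mono) auto
      then show ?thesis using \<epsilon> by (simp add: norm_mult mult_ac)
    qed
  qed
  also have "(\<integral>z. ?c * (A * (\<epsilon> * r) powr a) * norm (?Q (- z)) \<partial>lborel) = ?c * (A * (\<epsilon> * r) powr a) * (\<integral>z. norm (?Q z) \<partial>lborel)"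
    using lborel_integral_affine[of "\<lambda>z. norm (?Q z)" "-1" 0] by simp
  finally show ?thesis using \<epsilon> by (simp add: mult_ac mult_left_mono)
qed

section \<open>Local Morrey bounds and convolution\<close>

text \<open>
  For \<open>q > 1\<close> finiteness of the Lorentz--Morrey quasi-norm is equivalent to a bound on
  the integrals over small sets. Unlike the quasi-norm this bound is compatible with
  Tonelli's theorem, hence with convolution by arbitrary integrable kernels.
\<close>

definition morrey :: "real \<Rightarrow> real \<Rightarrow> real \<Rightarrow> ('a::euclidean_space \<Rightarrow> ennreal) \<Rightarrow> bool" where
  "morrey p q K F \<longleftrightarrow> F \<in> borel_measurable borel \<and>
     (\<forall>R\<in>{0<..1}. \<forall>z. \<forall>E\<in>sets borel. E \<subseteq> ball z R \<longrightarrow>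
       (\<integral>\<^sup>+x. F x * indicator E x \<partial>lborel) \<le>
         ennreal (K * (R powr (real DIM('a) / q - real DIM('a) / p) * measure lborel E powr (1 - 1 / q))))"

lemma morrey_measurable: "morrey p q K F \<Longrightarrow> F \<in> borel_measurable borel"
  by (simp add: morrey_def)

lemma morreyD:
  fixes F :: "'a::euclidean_space \<Rightarrow> ennreal"
  assumes "morrey p q K F" "0 < R" "R \<le> 1" "E \<in> sets borel" "E \<subseteq> ball z R"
  shows "(\<integral>\<^sup>+x. F x * indicator E x \<partial>lborel) \<le>
    ennreal (K * (R powr (real DIM('a) / q - real DIM('a) / p) * measure lborel E powr (1 - 1 / q)))"
  using assms unfolding morrey_def by (auto simp: Ball_def)

lemma morrey_mono:
  assumes "morrey p q K F" "\<And>x. G x \<le> F x" "G \<in> borel_measurable borel" "K \<le> K'"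
  shows "morrey p q K' G"
  unfolding morrey_def
proof (intro conjI ballI allI impI)
  fix R :: real and z :: 'a and E :: "'a set"
  assume R: "R \<in> {0<..1}" and E: "E \<in> sets borel" "E \<subseteq> ball z R"
  have "(\<integral>\<^sup>+x. G x * indicator E x \<partial>lborel) \<le> (\<integral>\<^sup>+x. F x * indicator E x \<partial>lborel)"
    by (intro nn_integral_mono mult_right_mono assms(2)) simp
  also have "\<dots> \<le> ennreal (K * (R powr (real DIM('a) / q - real DIM('a) / p) * measure lborel E powr (1 - 1 / q)))"
    by (rule morreyD[OF assms(1) _ _ E]) (use R in auto)
  also have "\<dots> \<le> ennreal (K' * (R powr (real DIM('a) / q - real DIM('a) / p) * measure lborel E powr (1 - 1 / q)))"
    using assms(4) by (intro ennreal_leI mult_right_mono) auto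
  finally show "(\<integral>\<^sup>+x. G x * indicator E x \<partial>lborel) \<le> ennreal (K' * (R powr (real DIM('a) / q - real DIM('a) / p) * measure lborel E powr (1 - 1 / q)))" .
qed (rule assms(3))

lemma emeasure_ball_subset_less_top:
  assumes "E \<subseteq> ball z R" "E \<in> sets borel"
  shows "emeasure lborel E < \<infinity>"
proof -
  have "emeasure lborel E \<le> emeasure lborel (ball z R)" using assms by (intro emeasure_mono) auto
  also have "\<dots> < \<infinity>" using emeasure_lborel_ball_finite[of z R] by (simp add: less_top)
  finally show ?thesis .
qed

lemma emeasure_ball_subset:
  assumes "E \<subseteq> ball z R" "E \<in> sets borel"
  shows "emeasure lborel E = ennreal (measure lborel E)"
  using emeasure_ball_subset_less_top[OF assms] by (intro emeasure_eq_ennreal_measure) auto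

text \<open>Chebyshev's inequality on a level set \<open>E\<close> inside the ball: dividing the
  Morrey bound for the integral over \<open>E\<close> by
  \<open>measure lborel E powr (1 - 1 / q)\<close> leaves the weak-type bound.\<close>

lemma lm_norm_le_if_morrey:
  fixes f :: "'a::euclidean_space \<Rightarrow> real"
  assumes q: "1 < q" and f: "f \<in> borel_measurable borel" and K: "0 \<le> K"
    and m: "morrey p q K (\<lambda>x. ennreal \<bar>f x\<bar>)"
  shows "lm_norm p q f \<le> ennreal K"
  unfolding lm_norm_def
proof (intro SUP_least)
  fix R :: real and z :: 'a
  assume R: "R \<in> {0<..1}"
  let ?\<gamma> = "real DIM('a) / q - real DIM('a) / p"
  let ?f = "\<lambda>x. f x * indicator (ball z R) x"
  have "weak_lebesgue_norm q ?f \<le> ennreal (K * R powr ?\<gamma>)"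
    unfolding weak_lebesgue_norm_def
  proof (rule SUP_least)
    fix l :: real assume l: "l \<in> {0<..}"
    show "ennreal (l powr (1 / q)) * rearrangement ?f l \<le> ennreal (K * R powr ?\<gamma>)"
      unfolding rearrangement_def SUP_mult_left_ennreal
    proof (rule SUP_least)
      fix \<sigma> :: real assume "\<sigma> \<in> {\<sigma>. 0 < \<sigma> \<and> ennreal l < distribution_function ?f \<sigma>}"
      then have \<sigma>: "0 < \<sigma>" "ennreal l < distribution_function ?f \<sigma>" by auto
      define E where "E = {x \<in> ball z R. \<sigma> < \<bar>f x\<bar>}"
      have E: "E \<in> sets borel" "E \<subseteq> ball z R" unfolding E_def using f by (auto intro: borel_measurable_less)
      have "{x. \<sigma> < \<bar>?f x\<bar>} = E" unfolding E_def using \<sigma>(1) by (auto simp: indicator_def split: if_splits)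
      then have d: "distribution_function ?f \<sigma> = ennreal (measure lborel E)"
        using emeasure_ball_subset[OF E(2,1)] E(1) by (simp add: distribution_function_def)
      then have lE: "l < measure lborel E" using \<sigma>(2) l by (simp add: ennreal_less_iff)
      then have E0: "0 < measure lborel E" using l by simp
      have "ennreal (\<sigma> * measure lborel E) = (\<integral>\<^sup>+x. ennreal \<sigma> * indicator E x \<partial>lborel)"
        using \<sigma>(1) E emeasure_ball_subset[OF E(2,1)] by (simp add: nn_integral_cmult_indicator ennreal_mult)
      also have "\<dots> \<le> (\<integral>\<^sup>+x. ennreal \<bar>f x\<bar> * indicator E x \<partial>lborel)"
        by (rule nn_integral_mono) (auto simp: E_def indicator_def intro: ennreal_leI)
      also have "\<dots> \<le> ennreal (K * (R powr ?\<gamma> * measure lborel E powr (1 - 1 / q)))"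
        by (rule morreyD[OF m _ _ E]) (use R in auto)
      finally have "\<sigma> * measure lborel E \<le> K * (R powr ?\<gamma> * measure lborel E powr (1 - 1 / q))"
        using K by (simp add: ennreal_le_iff)
      moreover have "measure lborel E = measure lborel E powr (1 / q) * measure lborel E powr (1 - 1 / q)"
        using E0 by (simp add: powr_add[symmetric])
      ultimately have "(\<sigma> * measure lborel E powr (1 / q)) * measure lborel E powr (1 - 1 / q) \<le> (K * R powr ?\<gamma>) * measure lborel E powr (1 - 1 / q)"
        by (metis (no_types, lifting) mult.assoc)
      then have "\<sigma> * measure lborel E powr (1 / q) \<le> K * R powr ?\<gamma>"
        using E0 by (simp add: mult_le_cancel_right)
      moreover have "\<sigma> * l powr (1 / q) \<le> \<sigma> * measure lborel E powr (1 / q)"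
        using \<sigma>(1) l lE q by (intro mult_left_mono powr_mono2) auto
      ultimately have "\<sigma> * l powr (1 / q) \<le> K * R powr ?\<gamma>" by (rule order_trans[rotated])
      then have "ennreal (\<sigma> * l powr (1 / q)) \<le> ennreal (K * R powr ?\<gamma>)" by (rule ennreal_leI)
      then show "ennreal (l powr (1 / q)) * ennreal \<sigma> \<le> ennreal (K * R powr ?\<gamma>)"
        using \<sigma>(1) by (simp add: ennreal_mult[symmetric] mult.commute)
    qed
  qed
  then have "ennreal (R powr (real DIM('a) / p - real DIM('a) / q)) * weak_lebesgue_norm q ?f
      \<le> ennreal (R powr (real DIM('a) / p - real DIM('a) / q)) * ennreal (K * R powr ?\<gamma>)"
    by (rule mult_left_mono) simp
  also have "\<dots> = ennreal K"
  proof -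
    have "R powr (real DIM('a) / p - real DIM('a) / q) * R powr ?\<gamma> = 1"
      using R by (simp add: powr_add[symmetric])
    then show ?thesis using K by (simp add: ennreal_mult[symmetric] mult.left_commute)
  qed
  finally show "ennreal (R powr (real DIM('a) / p - real DIM('a) / q)) * weak_lebesgue_norm q ?f \<le> ennreal K" .
qed

text \<open>For \<open>l\<close> below the measure of the level set, \<open>\<sigma>\<close> is
  admissible in the supremum defining the rearrangement at \<open>l\<close>, so
  \<open>l powr (1 / q) * \<sigma>\<close> is at most \<open>L\<close>. Letting \<open>l\<close>
  increase to the measure gives the claim.\<close>

lemma weak_norm_distribution:
  fixes f :: "'a::euclidean_space \<Rightarrow> real"
  assumes q: "1 < q" and L: "0 < L" and w: "weak_lebesgue_norm q f \<le> ennreal L" and \<sigma>: "0 < \<sigma>"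
  shows "distribution_function f \<sigma> \<le> ennreal ((L / \<sigma>) powr q)"
proof (rule dense_le)
  fix y assume y: "y < distribution_function f \<sigma>"
  then obtain l where l: "y = ennreal l" "0 \<le> l" by (cases y) auto
  show "y \<le> ennreal ((L / \<sigma>) powr q)"
  proof (cases "l = 0")
    case False
    then have l0: "0 < l" using l by simp
    have "ennreal (l powr (1 / q)) * ennreal \<sigma> \<le> ennreal (l powr (1 / q)) * rearrangement f l"
      unfolding rearrangement_def using \<sigma> y l(1) by (intro mult_left_mono SUP_upper) auto
    also have "\<dots> \<le> weak_lebesgue_norm q f"
      unfolding weak_lebesgue_norm_def using l0 by (intro SUP_upper) auto
    also have "\<dots> \<le> ennreal L" by (rule w)
    finally have "l powr (1 / q) * \<sigma> \<le> L" using L \<sigma> by (simp add: ennreal_mult[symmetric])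
    then have "l powr (1 / q) \<le> L / \<sigma>" using \<sigma> by (simp add: field_simps)
    then have "(l powr (1 / q)) powr q \<le> (L / \<sigma>) powr q" using q by (intro powr_mono2) auto
    then show ?thesis using l l0 q by (simp add: powr_powr ennreal_leI)
  qed (use l in simp)
qed

text \<open>The value of 1 plus the series of \<open>2 * (2 powr (1 - q)) ^ k\<close>: the part
  below a fixed height, and the dyadic layers above it. Convergence of the series is where
  \<open>q > 1\<close> enters.\<close>

definition weak_const :: "real \<Rightarrow> real" where
  "weak_const q = 1 + 2 / (1 - 2 powr (1 - q))"

lemma weak_const_pos: "1 < q \<Longrightarrow> 0 < weak_const q"
  unfolding weak_const_def using powr_less_mono[of "1 - q" 0 2] by (intro add_pos_pos divide_pos_pos) auto

text \<open>On \<open>E\<close> the function is cut at a height \<open>\<sigma>\<close>. The part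
  below contributes at most \<open>\<sigma>\<close> times the measure of \<open>E\<close>. The part
  above is dominated by dyadic layers, whose measures decay by the factor
  \<open>2 powr (- q)\<close> per layer while the heights only double.\<close>

lemma morrey_if_lm_norm_le:
  fixes f :: "'a::euclidean_space \<Rightarrow> real"
  assumes q: "1 < q" and f: "f \<in> borel_measurable borel" and K: "0 < K"
    and lm: "lm_norm p q f \<le> ennreal K"
  shows "morrey p q (weak_const q * K) (\<lambda>x. ennreal \<bar>f x\<bar>)"
  unfolding morrey_def
proof (intro conjI ballI allI impI)
  fix R :: real and z :: 'a and E :: "'a set"
  assume R: "R \<in> {0<..1}" and E: "E \<in> sets borel" "E \<subseteq> ball z R"
  let ?\<gamma> = "real DIM('a) / q - real DIM('a) / p"
  let ?f = "\<lambda>x. f x * indicator (ball z R) x"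
  let ?m = "measure lborel E"
  define L where "L = K * R powr ?\<gamma>"
  have L: "0 < L" using K R by (simp add: L_def)
  have "ennreal (R powr (- ?\<gamma>)) * weak_lebesgue_norm q ?f \<le> ennreal K"
  proof -
    have "ennreal (R powr (real DIM('a) / p - real DIM('a) / q)) * weak_lebesgue_norm q ?f \<le> lm_norm p q f"
      unfolding lm_norm_def by (rule SUP_upper2[OF R], rule SUP_upper2[of z]) auto
    with lm show ?thesis by simp
  qed
  then have le: "ennreal (R powr ?\<gamma>) * (ennreal (R powr (- ?\<gamma>)) * weak_lebesgue_norm q ?f) \<le> ennreal (R powr ?\<gamma>) * ennreal K"
    by (rule mult_left_mono) simp
  have 1: "ennreal (R powr ?\<gamma>) * ennreal (R powr (- ?\<gamma>)) = 1"
    using R by (simp add: ennreal_mult[symmetric] powr_add[symmetric])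
  have "weak_lebesgue_norm q ?f = ennreal (R powr ?\<gamma>) * (ennreal (R powr (- ?\<gamma>)) * weak_lebesgue_norm q ?f)"
    by (simp only: mult.assoc[symmetric] 1 mult_1)
  also note le
  also have "ennreal (R powr ?\<gamma>) * ennreal K = ennreal L"
    using K by (simp only: L_def mult.commute[of K] ennreal_mult[OF powr_ge_zero less_imp_le])
  finally have w: "weak_lebesgue_norm q ?f \<le> ennreal L" .
  show "(\<integral>\<^sup>+x. ennreal \<bar>f x\<bar> * indicator E x \<partial>lborel) \<le> ennreal (weak_const q * K * (R powr ?\<gamma> * ?m powr (1 - 1 / q)))"
  \<comment> \<open>Null sets are treated apart: \<open>powr\<close> with base 0 is 0, so the height
    chosen in the other case would degenerate.\<close>
  proof (cases "?m = 0")
    case True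
    then have "emeasure lborel E = 0" using emeasure_ball_subset[OF E(2,1)] by simp
    then have "AE x in lborel. x \<notin> E" using E by (intro AE_not_in) (auto simp: null_sets_def)
    then have "(\<integral>\<^sup>+x. ennreal \<bar>f x\<bar> * indicator E x \<partial>lborel) = (\<integral>\<^sup>+x. 0 \<partial>(lborel :: 'a measure))"
      by (intro nn_integral_cong_AE) auto
    then show ?thesis by simp
  next
    case False
    then have m: "0 < ?m" by (simp add: zero_less_measure_iff)
    \<comment> \<open>The height at which the weak-type bound equals \<open>?m\<close>, that is
      \<open>(L / \<sigma>) powr q = ?m\<close>; it makes the low part and the layers
      comparable.\<close>
    define \<sigma> where "\<sigma> = L * ?m powr (- (1 / q))"
    have \<sigma>: "0 < \<sigma>" using L m by (simp add: \<sigma>_def)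
    define S where "S k = {x \<in> ball z R. 2 ^ k * \<sigma> < \<bar>f x\<bar>}" for k
    have S: "S k \<in> sets borel" for k unfolding S_def using f by measurable
    have Sm: "emeasure lborel (S k) \<le> ennreal ((L / (2 ^ k * \<sigma>)) powr q)" for k
    proof -
      have "{x. 2 ^ k * \<sigma> < \<bar>?f x\<bar>} = S k"
        unfolding S_def using \<sigma> by (auto simp: indicator_def mult_less_0_iff split: if_splits)
      then show ?thesis
        using weak_norm_distribution[OF q L w, of "2 ^ k * \<sigma>"] \<sigma> S[of k] by (simp add: distribution_function_def)
    qed
    have pw: "ennreal \<bar>f x\<bar> * indicator E x \<le> ennreal \<sigma> * indicator E x + (\<Sum>k. ennreal (2 ^ Suc k * \<sigma>) * indicator (S k) x)" for x
    proof (cases "x \<in> E \<and> \<sigma> < \<bar>f x\<bar>")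
      case True
      have "\<exists>n. \<bar>f x\<bar> \<le> 2 ^ n * \<sigma>"
        using real_arch_pow[of 2 "\<bar>f x\<bar> / \<sigma>"] \<sigma> by (auto simp: field_simps intro: less_imp_le)
      \<comment> \<open>The least dyadic height above the value determines its layer: with
        \<open>n = Suc k\<close> the value lies above \<open>2 ^ k * \<sigma>\<close> and at most at
        \<open>2 ^ Suc k * \<sigma>\<close>.\<close>
      define n where "n = (LEAST n. \<bar>f x\<bar> \<le> 2 ^ n * \<sigma>)"
      have n: "\<bar>f x\<bar> \<le> 2 ^ n * \<sigma>" unfolding n_def by (rule LeastI_ex) fact
      have "n \<noteq> 0" using n True by (intro notI) auto
      then obtain k where k: "n = Suc k" by (cases n) auto
      have "\<not> \<bar>f x\<bar> \<le> 2 ^ k * \<sigma>" using not_less_Least[of k "\<lambda>n. \<bar>f x\<bar> \<le> 2 ^ n * \<sigma>"] k by (auto simp: n_def)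
      then have xS: "x \<in> S k" using True E by (auto simp: S_def)
      have "ennreal \<bar>f x\<bar> * indicator E x \<le> ennreal (2 ^ Suc k * \<sigma>) * indicator (S k) x"
        using n k True xS by (simp add: ennreal_leI)
      also have "\<dots> \<le> (\<Sum>k. ennreal (2 ^ Suc k * \<sigma>) * indicator (S k) x)"
      proof -
        have "g k \<le> suminf g" for g :: "nat \<Rightarrow> ennreal" using sum_le_suminf[of g "{k}"] by simp
        then show ?thesis .
      qed
      finally show ?thesis by (rule order_trans) simp
    next
      case False
      then have "ennreal \<bar>f x\<bar> * indicator E x \<le> ennreal \<sigma> * indicator E x"
        by (auto simp: indicator_def intro: ennreal_leI)
      then show ?thesis by (rule order_trans) simp
    qed
    have lq: "(L / (2 ^ k * \<sigma>)) powr q = ?m * (2 powr (- q)) ^ k" for k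
    proof -
      have "L / \<sigma> = ?m powr (1 / q)" using L m by (simp add: \<sigma>_def powr_minus field_simps)
      then have "L / (2 ^ k * \<sigma>) = ?m powr (1 / q) * (1 / 2 ^ k)" by (simp add: field_simps)
      then have "(L / (2 ^ k * \<sigma>)) powr q = (?m powr (1 / q)) powr q * (1 / 2 ^ k) powr q"
        by (simp only: powr_mult powr_ge_zero)
      also have "(?m powr (1 / q)) powr q = ?m" using m q by (simp add: powr_powr)
      also have "(1 / 2 ^ k) powr q = (2 powr (- q)) ^ k"
        by (simp add: powr_realpow[symmetric] powr_powr powr_minus_divide[symmetric] mult.commute)
      finally show ?thesis .
    qed
    have "(\<integral>\<^sup>+x. ennreal \<bar>f x\<bar> * indicator E x \<partial>lborel)
        \<le> (\<integral>\<^sup>+x. ennreal \<sigma> * indicator E x + (\<Sum>k. ennreal (2 ^ Suc k * \<sigma>) * indicator (S k) x) \<partial>lborel)"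
      by (rule nn_integral_mono) (rule pw)
    also have "\<dots> = ennreal \<sigma> * emeasure lborel E + (\<Sum>k. ennreal (2 ^ Suc k * \<sigma>) * emeasure lborel (S k))"
      using E S by (simp add: nn_integral_add nn_integral_cmult_indicator nn_integral_suminf)
    also have "\<dots> \<le> ennreal (\<sigma> * ?m) + (\<Sum>k. ennreal (2 * \<sigma> * ?m * (2 powr (1 - q)) ^ k))"
    proof (intro add_mono suminf_le)
      show "ennreal \<sigma> * emeasure lborel E \<le> ennreal (\<sigma> * ?m)"
        using emeasure_ball_subset[OF E(2,1)] \<sigma> by (simp add: ennreal_mult)
      fix k
      have "ennreal (2 ^ Suc k * \<sigma>) * emeasure lborel (S k) \<le> ennreal (2 ^ Suc k * \<sigma>) * ennreal ((L / (2 ^ k * \<sigma>)) powr q)"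
        by (rule mult_left_mono[OF Sm]) simp
      also have "\<dots> = ennreal (2 ^ Suc k * \<sigma> * (?m * (2 powr (- q)) ^ k))"
        using \<sigma> by (simp add: lq ennreal_mult[symmetric])
      also have "2 ^ Suc k * \<sigma> * (?m * (2 powr (- q)) ^ k) = 2 * \<sigma> * ?m * (2 powr (1 - q)) ^ k"
      proof -
        have "2 powr (1 - q) = 2 * 2 powr (- q)" by (simp add: powr_diff powr_minus field_simps)
        then show ?thesis by (simp add: power_mult_distrib)
      qed
      finally show "ennreal (2 ^ Suc k * \<sigma>) * emeasure lborel (S k) \<le> ennreal (2 * \<sigma> * ?m * (2 powr (1 - q)) ^ k)" .
    qed auto
    also have "(\<Sum>k. ennreal (2 * \<sigma> * ?m * (2 powr (1 - q)) ^ k)) = ennreal (2 * \<sigma> * ?m * (1 / (1 - 2 powr (1 - q))))"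
    proof -
      have lt: "norm (2 powr (1 - q)) < 1" using q powr_less_mono[of "1 - q" 0 2] by simp
      have "(\<lambda>k. 2 * \<sigma> * ?m * (2 powr (1 - q)) ^ k) sums (2 * \<sigma> * ?m * (1 / (1 - 2 powr (1 - q))))"
        by (intro sums_mult geometric_sums lt)
      then show ?thesis using \<sigma> m by (intro suminf_ennreal_eq) auto
    qed
    also have "ennreal (\<sigma> * ?m) + \<dots> = ennreal (weak_const q * (\<sigma> * ?m))"
    proof -
      have "2 powr (1 - q) < 1" using q powr_less_mono[of "1 - q" 0 2] by simp
      then show ?thesis using \<sigma> m by (subst ennreal_plus[symmetric]) (auto simp: weak_const_def field_simps)
    qed
    also have "\<sigma> * ?m = K * (R powr ?\<gamma> * ?m powr (1 - 1 / q))"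
      using m by (simp add: \<sigma>_def L_def powr_diff powr_minus field_simps)
    finally show ?thesis by (simp add: mult.assoc)
  qed
qed (use f in simp)

subsection \<open>Convolution with integrable kernels\<close>

definition nconv :: "('a::euclidean_space \<Rightarrow> ennreal) \<Rightarrow> ('a \<Rightarrow> ennreal) \<Rightarrow> 'a \<Rightarrow> ennreal" where
  "nconv k F x = (\<integral>\<^sup>+y. k y * F (x - y) \<partial>lborel)"

lemma nconv_measurable [measurable]:
  assumes [measurable]: "k \<in> borel_measurable borel" "F \<in> borel_measurable borel"
  shows "nconv k F \<in> borel_measurable borel"
  unfolding nconv_def by measurable

lemma nconv_alt:
  fixes k F :: "'a::euclidean_space \<Rightarrow> ennreal"
  assumes "k \<in> borel_measurable borel" "F \<in> borel_measurable borel"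
  shows "nconv k F x = (\<integral>\<^sup>+y. k (x - y) * F y \<partial>lborel)"
  unfolding nconv_def using assms
  by (subst lborel_nn_integral_affine[of _ "-1" x]) auto

text \<open>A translate of \<open>E\<close> has the same measure and lies in a ball of the same
  radius, so every shifted copy of \<open>F\<close> obeys the same bound; Tonelli averages these
  bounds against \<open>k\<close>.\<close>

lemma morrey_nconv:
  fixes k F :: "'a::euclidean_space \<Rightarrow> ennreal"
  assumes F: "morrey p q K F" and K: "0 \<le> K" and k: "k \<in> borel_measurable borel"
    and c: "(\<integral>\<^sup>+x. k x \<partial>lborel) \<le> ennreal c" "0 \<le> c"
  shows "morrey p q (c * K) (nconv k F)"
  unfolding morrey_def
proof (intro conjI ballI allI impI)
  note [measurable] = k morrey_measurable[OF F]
  fix R :: real and z :: 'a and E :: "'a set"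
  assume R: "R \<in> {0<..1}" and E: "E \<in> sets borel" "E \<subseteq> ball z R"
  note [measurable] = E(1)
  let ?b = "R powr (real DIM('a) / q - real DIM('a) / p) * measure lborel E powr (1 - 1 / q)"
  have shift: "(\<integral>\<^sup>+x. F (x - y) * indicator E x \<partial>lborel) \<le> ennreal (K * ?b)" for y
  proof -
    let ?E = "(\<lambda>x. y + x) -` E"
    have E'[measurable]: "?E \<in> sets borel"
      using measurable_sets[of "\<lambda>x. y + x" borel borel E] E(1) by simp
    have mE: "emeasure lborel ?E = emeasure lborel E"
    proof -
      have "emeasure lborel E = (\<integral>\<^sup>+x. indicator E x \<partial>lborel)" using E by simp
      also have "\<dots> = (\<integral>\<^sup>+x. indicator ?E x \<partial>lborel)"
        using lborel_nn_integral_affine[of "indicator E" 1 y] E by (simp add: indicator_def)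
      finally show ?thesis by simp
    qed
    have "(\<integral>\<^sup>+x. F (x - y) * indicator E x \<partial>lborel) = (\<integral>\<^sup>+x. F x * indicator ?E x \<partial>lborel)"
      using lborel_nn_integral_affine[of "\<lambda>x. F (x - y) * indicator E x" 1 y] by (simp add: indicator_def)
    also have "\<dots> \<le> ennreal (K * (R powr (real DIM('a) / q - real DIM('a) / p) * measure lborel ?E powr (1 - 1 / q)))"
    proof (rule morreyD[OF F])
      show "?E \<subseteq> ball (z - y) R" using E(2) by (auto simp: dist_norm algebra_simps subset_iff)
    qed (use R in auto)
    also have "measure lborel ?E = measure lborel E" using mE by (simp add: measure_def)
    finally show ?thesis .
  qed
  have "(\<integral>\<^sup>+x. nconv k F x * indicator E x \<partial>lborel) = (\<integral>\<^sup>+x. \<integral>\<^sup>+y. k y * (F (x - y) * indicator E x) \<partial>lborel \<partial>lborel)"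
    unfolding nconv_def by (simp add: nn_integral_multc[symmetric] mult.assoc)
  also have "\<dots> = (\<integral>\<^sup>+y. \<integral>\<^sup>+x. k y * (F (x - y) * indicator E x) \<partial>lborel \<partial>lborel)"
    by (rule lborel_pair.Fubini') measurable
  also have "\<dots> = (\<integral>\<^sup>+y. k y * (\<integral>\<^sup>+x. F (x - y) * indicator E x \<partial>lborel) \<partial>lborel)"
    by (simp add: nn_integral_cmult)
  also have "\<dots> \<le> (\<integral>\<^sup>+y. k y * ennreal (K * ?b) \<partial>lborel)"
    by (intro nn_integral_mono mult_left_mono shift) simp
  also have "\<dots> = (\<integral>\<^sup>+y. k y \<partial>lborel) * ennreal (K * ?b)" by (simp add: nn_integral_multc)
  also have "\<dots> \<le> ennreal c * ennreal (K * ?b)" by (intro mult_right_mono c) simp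
  also have "\<dots> = ennreal (c * K * ?b)" using K c by (simp add: ennreal_mult[symmetric] mult.assoc)
  finally show "(\<integral>\<^sup>+x. nconv k F x * indicator E x \<partial>lborel) \<le> ennreal (c * K * ?b)" .
qed (use k morrey_measurable[OF F] in measurable)

text \<open>Membership in the associate space of the Morrey class, with norm at most
  \<open>C\<close>. Transforms of functions that are not smooth at the origin are not Schwartz
  functions, and this bound is what makes their integrals against \<open>g\<close> converge.\<close>

definition pairing :: "real \<Rightarrow> real \<Rightarrow> real \<Rightarrow> ('a::euclidean_space \<Rightarrow> ennreal) \<Rightarrow> bool" where
  "pairing p q C w \<longleftrightarrow> w \<in> borel_measurable borel \<and> 0 \<le> C \<and>
     (\<forall>K\<ge>0. \<forall>F. morrey p q K F \<longrightarrow> (\<integral>\<^sup>+x. F x * w x \<partial>lborel) \<le> ennreal (C * K))"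

lemma pairingD: "pairing p q C w \<Longrightarrow> morrey p q K F \<Longrightarrow> 0 \<le> K \<Longrightarrow> (\<integral>\<^sup>+x. F x * w x \<partial>lborel) \<le> ennreal (C * K)"
  by (simp add: pairing_def)

lemma pairing_mono:
  assumes "pairing p q C w" "\<And>x. v x \<le> w x" "v \<in> borel_measurable borel"
  shows "pairing p q C v"
  unfolding pairing_def
proof (intro conjI allI impI)
  fix K :: real and F :: "'a \<Rightarrow> ennreal" assume K: "0 \<le> K" and F: "morrey p q K F"
  have "(\<integral>\<^sup>+x. F x * v x \<partial>lborel) \<le> (\<integral>\<^sup>+x. F x * w x \<partial>lborel)"
    by (intro nn_integral_mono mult_left_mono assms(2)) simp
  also have "\<dots> \<le> ennreal (C * K)" by (rule pairingD[OF assms(1) F K])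
  finally show "(\<integral>\<^sup>+x. F x * v x \<partial>lborel) \<le> ennreal (C * K)" .
qed (use assms in \<open>auto simp: pairing_def\<close>)

definition pairing_const :: "real \<Rightarrow> 'a::euclidean_space itself \<Rightarrow> real" where
  "pairing_const q _ = 2 ^ decay_dim TYPE('a) * decay_mass TYPE('a) * measure lborel (ball (0::'a) 1) powr (- (1 / q))"

text \<open>
  The weight \<open>(1 + norm x)\<close> to a negative power is dominated by its averages over unit
  balls, which reduces the claim to the Morrey bound on unit balls.
\<close>

lemma pairing_decay:
  fixes w :: "'a::euclidean_space \<Rightarrow> ennreal"
  assumes w: "w \<in> borel_measurable borel" "0 \<le> B"
    "\<And>x. w x \<le> ennreal (B * inverse ((1 + norm x) ^ decay_dim TYPE('a)))"
  shows "pairing p q (pairing_const q TYPE('a) * B) w"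
  unfolding pairing_def
proof (intro conjI allI impI)
  let ?M = "decay_dim TYPE('a)"
  let ?v = "measure lborel (ball (0::'a) 1)"
  have mb: "measure lborel (ball z 1) = ?v" for z :: 'a
    by (simp add: content_ball)
  have v: "0 < ?v" by (simp add: content_ball_pos)
  show "0 \<le> pairing_const q TYPE('a) * B"
    using w(2) decay_mass_nonneg[where ?'a = 'a] by (simp add: pairing_const_def)
  fix K :: real and F :: "'a \<Rightarrow> ennreal" assume K: "0 \<le> K" and F: "morrey p q K F"
  note [measurable] = morrey_measurable[OF F] w(1)
  let ?d = "\<lambda>z::'a. inverse ((1 + norm z) ^ ?M)"
  have avg: "w x \<le> (\<integral>\<^sup>+z. ennreal (2 ^ ?M * B / ?v * ?d z) * indicator (ball z 1) x \<partial>lborel)" for x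
  proof -
    have "ennreal (B * ?d x) = (\<integral>\<^sup>+z. ennreal (B * ?d x / ?v) * indicator (ball x 1) z \<partial>lborel)"
    proof -
      have "(\<integral>\<^sup>+z. ennreal (B * ?d x / ?v) * indicator (ball x 1) z \<partial>lborel) = ennreal (B * ?d x / ?v) * ennreal ?v"
        using emeasure_ball_subset[of "ball x 1" x 1] by (subst nn_integral_cmult_indicator) (simp_all add: mb[of x])
      also have "\<dots> = ennreal (B * ?d x / ?v * ?v)"
        by (rule ennreal_mult[symmetric]) (use v w(2) in auto)
      also have "B * ?d x / ?v * ?v = B * ?d x" using v by simp
      finally show ?thesis ..
    qed
    also have "\<dots> \<le> (\<integral>\<^sup>+z. ennreal (2 ^ ?M * B / ?v * ?d z) * indicator (ball z 1) x \<partial>lborel)"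
    proof (rule nn_integral_mono)
      fix z
      show "ennreal (B * ?d x / ?v) * indicator (ball x 1) z \<le> ennreal (2 ^ ?M * B / ?v * ?d z) * indicator (ball z 1) x"
      proof (cases "dist x z < 1")
        case True
        have "norm z \<le> norm x + dist x z" by (metis dist_norm norm_triangle_sub dist_commute)
        then have "1 + norm z \<le> 2 * (1 + norm x)" using True norm_ge_zero[of x] by argo
        then have "(1 + norm z) ^ ?M \<le> (2 * (1 + norm x)) ^ ?M" by (intro power_mono) auto
        then have "(1 + norm z) ^ ?M \<le> 2 ^ ?M * (1 + norm x) ^ ?M" by (simp only: power_mult_distrib)
        moreover have "0 < (1 + norm z) ^ ?M" "0 < (1 + norm x) ^ ?M" by (simp_all add: add_pos_nonneg)
        ultimately have "?d x \<le> 2 ^ ?M * ?d z" by (simp add: field_simps)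
        then have "B / ?v * ?d x \<le> B / ?v * (2 ^ ?M * ?d z)"
          using w(2) v by (intro mult_left_mono) auto
        then have "B * ?d x / ?v \<le> 2 ^ ?M * B / ?v * ?d z" by (simp add: mult_ac)
        then show ?thesis using True by (simp add: indicator_def ennreal_leI dist_commute)
      qed (simp add: indicator_def)
    qed
    finally show ?thesis using w(3)[of x] by (rule order_trans[rotated])
  qed
  \<comment> \<open>Measurability jointly in centre and point, obtained by reading the indicator of
    a moving ball as a condition on the distance.\<close>
  have ind[measurable]: "(\<lambda>u. indicator (ball (f u) 1) (g u) :: ennreal) \<in> borel_measurable M"
    if [measurable]: "f \<in> borel_measurable M" "g \<in> borel_measurable M" for f g :: "'b \<Rightarrow> 'a" and M
  proof -
    have "(\<lambda>u. indicator (ball (f u) 1) (g u) :: ennreal) = (\<lambda>u. if dist (f u) (g u) < 1 then 1 else 0)"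
      by (auto simp: indicator_def)
    then show ?thesis by simp
  qed
  have "(\<integral>\<^sup>+x. F x * w x \<partial>lborel) \<le> (\<integral>\<^sup>+x. F x * (\<integral>\<^sup>+z. ennreal (2 ^ ?M * B / ?v * ?d z) * indicator (ball z 1) x \<partial>lborel) \<partial>lborel)"
    by (intro nn_integral_mono mult_left_mono avg) simp
  also have "(\<integral>\<^sup>+x. F x * (\<integral>\<^sup>+z. ennreal (2 ^ ?M * B / ?v * ?d z) * indicator (ball z 1) x \<partial>lborel) \<partial>lborel)
      = (\<integral>\<^sup>+x. \<integral>\<^sup>+z. ennreal (2 ^ ?M * B / ?v * ?d z) * (F x * indicator (ball z 1) x) \<partial>lborel \<partial>lborel)"
    by (intro nn_integral_cong, subst nn_integral_cmult[symmetric]) (auto simp: mult_ac)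
  also have "\<dots> = (\<integral>\<^sup>+z. \<integral>\<^sup>+x. ennreal (2 ^ ?M * B / ?v * ?d z) * (F x * indicator (ball z 1) x) \<partial>lborel \<partial>lborel)"
    by (rule lborel_pair.Fubini') measurable
  also have "\<dots> = (\<integral>\<^sup>+z. ennreal (2 ^ ?M * B / ?v * ?d z) * (\<integral>\<^sup>+x. F x * indicator (ball z 1) x \<partial>lborel) \<partial>lborel)"
    by (simp add: nn_integral_cmult)
  also have "\<dots> \<le> (\<integral>\<^sup>+z. ennreal (2 ^ ?M * B / ?v * ?d z) * ennreal (K * ?v powr (1 - 1 / q)) \<partial>lborel)"
  proof (intro nn_integral_mono mult_left_mono)
    fix z :: 'a
    show "(\<integral>\<^sup>+x. F x * indicator (ball z 1) x \<partial>lborel) \<le> ennreal (K * ?v powr (1 - 1 / q))"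
      using morreyD[OF F, of 1 "ball z 1" z] by (simp add: mb[of z])
  qed simp
  also have "\<dots> = (\<integral>\<^sup>+z. ennreal (?d z) * ennreal (2 ^ ?M * B / ?v * (K * ?v powr (1 - 1 / q))) \<partial>lborel)"
    using w(2) v K by (intro nn_integral_cong) (simp add: ennreal_mult[symmetric] mult_ac)
  also have "\<dots> = (\<integral>\<^sup>+z. ennreal (?d z) \<partial>lborel) * ennreal (2 ^ ?M * B / ?v * (K * ?v powr (1 - 1 / q)))"
    by (rule nn_integral_multc) simp
  also have "(\<integral>\<^sup>+z. ennreal (?d z) \<partial>lborel) = ennreal (decay_mass TYPE('a))"
    unfolding decay_mass_def by (rule nn_integral_eq_integral[OF integrable_decay]) simp
  also have "ennreal (decay_mass TYPE('a)) * ennreal (2 ^ ?M * B / ?v * (K * ?v powr (1 - 1 / q)))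
      = ennreal (pairing_const q TYPE('a) * B * K)"
    using v w(2) K decay_mass_nonneg[where ?'a = 'a]
    by (simp add: ennreal_mult[symmetric] pairing_const_def powr_diff powr_minus field_simps)
  finally show "(\<integral>\<^sup>+x. F x * w x \<partial>lborel) \<le> ennreal (pairing_const q TYPE('a) * B * K)" .
qed (rule w)

lemma pairing_schwartz:
  fixes \<phi> :: "'a::euclidean_space \<Rightarrow> complex"
  assumes "\<phi> \<in> borel_measurable borel" "wbound UNIV (decay_dim TYPE('a)) n B \<phi>"
  shows "pairing p q (pairing_const q TYPE('a) * B) (\<lambda>x. ennreal (norm (\<phi> x)))"
proof (rule pairing_decay)
  show "0 \<le> B" using wbound_nonneg[OF assms(2)] by blast
  show "ennreal (norm (\<phi> x)) \<le> ennreal (B * inverse ((1 + norm x) ^ decay_dim TYPE('a)))" for x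
    by (intro ennreal_leI le_decay wboundD0[OF assms(2)]) simp
qed (use assms in simp)

text \<open>Tonelli moves \<open>k\<close>, reflected, onto \<open>F\<close>, where the Morrey bound
  for convolutions applies.\<close>

lemma pairing_nconv:
  fixes k w :: "'a::euclidean_space \<Rightarrow> ennreal"
  assumes w: "pairing p q C w" and k: "k \<in> borel_measurable borel"
    and c: "(\<integral>\<^sup>+x. k x \<partial>lborel) \<le> ennreal c" "0 \<le> c"
  shows "pairing p q (C * c) (nconv k w)"
  unfolding pairing_def
proof (intro conjI allI impI)
  have [measurable]: "w \<in> borel_measurable borel" using w by (simp add: pairing_def)
  note [measurable] = k
  show "nconv k w \<in> borel_measurable borel" by measurable
  show "0 \<le> C * c" using w c by (simp add: pairing_def)
  fix K :: real and F :: "'a \<Rightarrow> ennreal" assume K: "0 \<le> K" and F: "morrey p q K F"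
  note [measurable] = morrey_measurable[OF F]
  have "(\<integral>\<^sup>+x. F x * nconv k w x \<partial>lborel) = (\<integral>\<^sup>+x. \<integral>\<^sup>+y. F x * (k (x - y) * w y) \<partial>lborel \<partial>lborel)"
    by (intro nn_integral_cong) (simp add: nconv_alt nn_integral_cmult)
  also have "\<dots> = (\<integral>\<^sup>+y. \<integral>\<^sup>+x. F x * (k (x - y) * w y) \<partial>lborel \<partial>lborel)"
    by (rule lborel_pair.Fubini') measurable
  also have "\<dots> = (\<integral>\<^sup>+y. nconv (\<lambda>x. k (- x)) F y * w y \<partial>lborel)"
  proof (intro nn_integral_cong)
    fix y
    have "nconv (\<lambda>x. k (- x)) F y * w y = (\<integral>\<^sup>+x. k (x - y) * F x * w y \<partial>lborel)"
      by (simp add: nconv_alt nn_integral_multc)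
    then show "(\<integral>\<^sup>+x. F x * (k (x - y) * w y) \<partial>lborel) = nconv (\<lambda>x. k (- x)) F y * w y"
      by (simp only: mult_ac)
  qed
  also have "\<dots> \<le> ennreal (C * (c * K))"
  proof (intro pairingD[OF w] morrey_nconv[OF F K])
    have "(\<integral>\<^sup>+x. k (- x) \<partial>lborel) = (\<integral>\<^sup>+x. k x \<partial>lborel)"
      using lborel_nn_integral_affine[of k "-1" 0] by simp
    then show "(\<integral>\<^sup>+x. k (- x) \<partial>lborel) \<le> ennreal c" using c by simp
  qed (use c K in auto)
  finally show "(\<integral>\<^sup>+x. F x * nconv k w x \<partial>lborel) \<le> ennreal (C * c * K)" by (simp add: mult.assoc)
qed

section \<open>Multipliers with integrable kernels\<close>

text \<open>The transform is unnormalised and has a positive sign, so that multiplying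
  \<open>v\<close> by \<open>a\<close> turns \<open>fourier v\<close> into its convolution with
  \<open>k\<close> without any constant; see \<open>kernel_of_fourier\<close>.\<close>

definition kernel_of :: "('a::euclidean_space \<Rightarrow> real) \<Rightarrow> ('a \<Rightarrow> real) \<Rightarrow> bool" where
  "kernel_of k a \<longleftrightarrow> integrable lborel k \<and> (\<forall>\<xi>. of_real (a \<xi>) = (\<integral>z. cis (z \<bullet> \<xi>) * of_real (k z) \<partial>lborel))"

text \<open>The ball of radius \<open>B\<close> in the Wiener algebra of transforms of integrable
  functions, restricted to real kernels.\<close>

definition wiener :: "real \<Rightarrow> ('a::euclidean_space \<Rightarrow> real) \<Rightarrow> bool" where
  "wiener B a \<longleftrightarrow> (\<exists>k. kernel_of k a \<and> (\<integral>z. \<bar>k z\<bar> \<partial>lborel) \<le> B)"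

lemma wiener_mono: "wiener B a \<Longrightarrow> B \<le> C \<Longrightarrow> wiener C a"
  unfolding wiener_def by (meson order_trans)

lemma wiener_nonneg: "wiener B a \<Longrightarrow> 0 \<le> B"
  unfolding wiener_def by (auto intro: order_trans[rotated] Bochner_Integration.integral_nonneg)

lemma wiener_add:
  assumes "wiener B a" "wiener C b"
  shows "wiener (B + C) (\<lambda>\<xi>. a \<xi> + b \<xi>)"
proof -
  obtain k where k: "integrable lborel k" "\<And>\<xi>. of_real (a \<xi>) = (\<integral>z. cis (z \<bullet> \<xi>) * of_real (k z) \<partial>lborel)"
    "(\<integral>z. \<bar>k z\<bar> \<partial>lborel) \<le> B" using assms(1) by (auto simp: wiener_def kernel_of_def)
  obtain l where l: "integrable lborel l" "\<And>\<xi>. of_real (b \<xi>) = (\<integral>z. cis (z \<bullet> \<xi>) * of_real (l z) \<partial>lborel)"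
    "(\<integral>z. \<bar>l z\<bar> \<partial>lborel) \<le> C" using assms(2) by (auto simp: wiener_def kernel_of_def)
  have "(\<integral>z. \<bar>k z + l z\<bar> \<partial>lborel) \<le> (\<integral>z. \<bar>k z\<bar> + \<bar>l z\<bar> \<partial>lborel)"
    using k(1) l(1) by (intro integral_mono) auto
  also have "\<dots> \<le> B + C" using k(1,3) l(1,3) by simp
  finally have "(\<integral>z. \<bar>k z + l z\<bar> \<partial>lborel) \<le> B + C" .
  moreover have "kernel_of (\<lambda>z. k z + l z) (\<lambda>\<xi>. a \<xi> + b \<xi>)"
    unfolding kernel_of_def using k l integrable_cis_mult(2)[of "\<lambda>z. of_real (k z)"] integrable_cis_mult(2)[of "\<lambda>z. of_real (l z)"]
    by (auto simp: distrib_left)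
  ultimately show ?thesis unfolding wiener_def by blast
qed

lemma wiener_cmult:
  assumes "wiener B a"
  shows "wiener (\<bar>c\<bar> * B) (\<lambda>\<xi>. c * a \<xi>)"
proof -
  obtain k where k: "integrable lborel k" "\<And>\<xi>. of_real (a \<xi>) = (\<integral>z. cis (z \<bullet> \<xi>) * of_real (k z) \<partial>lborel)"
    "(\<integral>z. \<bar>k z\<bar> \<partial>lborel) \<le> B" using assms(1) by (auto simp: wiener_def kernel_of_def)
  have "kernel_of (\<lambda>z. c * k z) (\<lambda>\<xi>. c * a \<xi>)"
    unfolding kernel_of_def using k by (simp add: mult.left_commute)
  moreover have "(\<integral>z. \<bar>c * k z\<bar> \<partial>lborel) \<le> \<bar>c\<bar> * B"
    using k(3) by (simp add: abs_mult mult_left_mono)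
  ultimately show ?thesis unfolding wiener_def by blast
qed

text \<open>Dilating the symbol rescales the kernel without changing its integral norm. This
  invariance reduces all dyadic scales to a single annulus.\<close>

lemma wiener_dilate:
  fixes a :: "'a::euclidean_space \<Rightarrow> real"
  assumes "wiener B a" "0 < c"
  shows "wiener B (\<lambda>\<xi>. a (c *\<^sub>R \<xi>))"
proof -
  obtain k where k: "integrable lborel k" "\<And>\<xi>. of_real (a \<xi>) = (\<integral>z. cis (z \<bullet> \<xi>) * of_real (k z) \<partial>lborel)"
    "(\<integral>z. \<bar>k z\<bar> \<partial>lborel) \<le> B" using assms(1) by (auto simp: wiener_def kernel_of_def)
  have [measurable]: "k \<in> borel_measurable borel" using k(1) by simp
  define l where "l z = inverse c ^ DIM('a) * k (inverse c *\<^sub>R z)" for z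
  have "integrable lborel l"
    unfolding l_def using lborel_integrable_affine[OF k(1), of "inverse c" 0] assms(2) by simp
  moreover have "of_real (a (c *\<^sub>R \<xi>)) = (\<integral>z. cis (z \<bullet> \<xi>) * of_real (l z) \<partial>lborel)" for \<xi>
    unfolding k(2) l_def
    using lborel_integral_affine[of "\<lambda>z. cis (z \<bullet> (c *\<^sub>R \<xi>)) * of_real (k z)" "inverse c" 0] assms(2)
    by (simp add: scaleR_conv_of_real mult.left_commute[of "cis u" for u] mult.assoc[symmetric, of c "inverse c"])
  moreover have "(\<integral>z. \<bar>l z\<bar> \<partial>lborel) = (\<integral>z. \<bar>k z\<bar> \<partial>lborel)"
    unfolding l_def
    using lborel_integral_affine[of "\<lambda>z. \<bar>k z\<bar>" "inverse c" 0] assms(2)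
    by (simp add: abs_mult power_abs)
  ultimately show ?thesis using k(3) unfolding wiener_def kernel_of_def by auto
qed

text \<open>Completeness of the Wiener algebra: summable norms make the series of kernels converge
  absolutely almost everywhere and in the integral norm, and the transform passes through the
  sum.\<close>

lemma wiener_suminf:
  fixes a :: "nat \<Rightarrow> 'a::euclidean_space \<Rightarrow> real"
  assumes w: "\<And>i. wiener (B i) (a i)" and B: "summable B" and s: "\<And>\<xi>. (\<lambda>i. a i \<xi>) sums s \<xi>"
  shows "wiener (suminf B) s"
proof -
  have "\<forall>i. \<exists>k. integrable lborel k \<and> (\<forall>\<xi>. of_real (a i \<xi>) = (\<integral>z. cis (z \<bullet> \<xi>) * of_real (k z) \<partial>lborel)) \<and> (\<integral>z. \<bar>k z\<bar> \<partial>lborel) \<le> B i"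
    using w unfolding wiener_def kernel_of_def by blast
  then obtain k where k: "\<And>i. integrable lborel (k i)"
    "\<And>i \<xi>. of_real (a i \<xi>) = (\<integral>z. cis (z \<bullet> \<xi>) * of_real (k i z) \<partial>lborel)"
    "\<And>i. (\<integral>z. \<bar>k i z\<bar> \<partial>lborel) \<le> B i" by metis
  have [measurable]: "k i \<in> borel_measurable borel" for i using k(1)[of i] by simp
  have B0: "0 \<le> B i" for i by (rule wiener_nonneg[OF w])
  have sumk: "summable (\<lambda>i. \<integral>z. \<bar>k i z\<bar> \<partial>lborel)"
    by (rule summable_comparison_test'[OF B, of 0]) (use k(3) in auto)
  have AE_sum: "AE z in lborel. summable (\<lambda>i. \<bar>k i z\<bar>)"
  proof -
    have "(\<integral>\<^sup>+z. (\<Sum>i. ennreal \<bar>k i z\<bar>) \<partial>lborel) = (\<Sum>i. \<integral>\<^sup>+z. ennreal \<bar>k i z\<bar> \<partial>lborel)"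
      by (rule nn_integral_suminf) simp
    also have "\<dots> = (\<Sum>i. ennreal (\<integral>z. \<bar>k i z\<bar> \<partial>lborel))"
      using k(1) by (intro suminf_cong nn_integral_eq_integral) auto
    also have "\<dots> \<noteq> \<infinity>" unfolding infinity_ennreal_def by (rule ennreal_suminf_neq_top[OF sumk]) simp
    finally have "AE z in lborel. (\<Sum>i. ennreal \<bar>k i z\<bar>) \<noteq> \<infinity>"
      by (intro nn_integral_noteq_infinite) auto
    then show ?thesis by eventually_elim (auto intro: summable_suminf_not_top)
  qed
  have AE': "AE z in lborel. summable (\<lambda>i. norm (k i z))" and sumk': "summable (\<lambda>i. \<integral>z. norm (k i z) \<partial>lborel)"
    using AE_sum sumk by auto
  let ?k = "\<lambda>z. \<Sum>i. k i z"
  have ik: "integrable lborel ?k" by (rule integrable_suminf[OF k(1) AE' sumk'])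
  have "(\<integral>z. \<bar>?k z\<bar> \<partial>lborel) \<le> (\<integral>z. (\<Sum>i. norm (k i z)) \<partial>lborel)"
  proof (rule integral_mono_AE)
    show "integrable lborel (\<lambda>z. \<Sum>i. norm (k i z))"
      by (rule integrable_suminf) (use k(1) AE' sumk' in auto)
    show "AE z in lborel. \<bar>?k z\<bar> \<le> (\<Sum>i. norm (k i z))"
      using AE' by eventually_elim (auto dest: summable_rabs)
  qed (use ik in auto)
  also have "\<dots> = (\<Sum>i. \<integral>z. norm (k i z) \<partial>lborel)"
    by (rule integral_suminf) (use k(1) AE' sumk' in auto)
  also have "\<dots> \<le> suminf B" by (rule suminf_le) (use k(3) sumk' B in auto)
  finally have "(\<integral>z. \<bar>?k z\<bar> \<partial>lborel) \<le> suminf B" .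
  moreover have "kernel_of ?k s"
    unfolding kernel_of_def
  proof (intro conjI allI ik)
    fix \<xi>
    let ?f = "\<lambda>i z. cis (z \<bullet> \<xi>) * of_real (k i z)"
    have "(\<lambda>i. integral\<^sup>L lborel (?f i)) sums (\<integral>z. (\<Sum>i. ?f i z) \<partial>lborel)"
      by (rule sums_integral) (use k(1) AE' sumk' in \<open>auto simp: norm_mult intro!: integrable_cis_mult\<close>)
    also have "(\<integral>z. (\<Sum>i. ?f i z) \<partial>lborel) = (\<integral>z. cis (z \<bullet> \<xi>) * of_real (?k z) \<partial>lborel)"
    proof (rule integral_cong_AE)
      show "AE z in lborel. (\<Sum>i. ?f i z) = cis (z \<bullet> \<xi>) * of_real (?k z)"
        using AE'
      proof eventually_elim
        case (elim z)
        then have "summable (\<lambda>i. k i z)" by (rule summable_norm_cancel)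
        then show ?case
          using suminf_mult[of "\<lambda>i. of_real (k i z) :: complex" "cis (z \<bullet> \<xi>)"] suminf_of_real[of "\<lambda>i. k i z", where 'a = complex] summable_of_real
          by simp
      qed
    qed measurable
    finally have "(\<lambda>i. of_real (a i \<xi>) :: complex) sums (\<integral>z. cis (z \<bullet> \<xi>) * of_real (?k z) \<partial>lborel)"
      by (simp add: k(2))
    moreover have "(\<lambda>i. of_real (a i \<xi>) :: complex) sums of_real (s \<xi>)" using s by (simp add: sums_of_real_iff)
    ultimately show "of_real (s \<xi>) = (\<integral>z. cis (z \<bullet> \<xi>) * of_real (?k z) \<partial>lborel)" by (rule sums_unique2[symmetric])
  qed
  ultimately show ?thesis unfolding wiener_def by blast
qed

definition wiener_const :: "'a::euclidean_space itself \<Rightarrow> real" where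
  "wiener_const _ = fourier_const TYPE('a) * decay_mass TYPE('a) *
     ((1 + DIM('a)) ^ decay_dim TYPE('a) * (fourier_const TYPE('a) * decay_mass TYPE('a)))"

lemma wiener_const_nonneg: "0 \<le> wiener_const TYPE('a::euclidean_space)"
  unfolding wiener_const_def using decay_mass_nonneg[where ?'a = 'a] fourier_const_pos[where ?'a = 'a]
  by (intro mult_nonneg_nonneg) auto

text \<open>Smoothness and compact support make the transform of the symbol integrable; evenness
  makes it real, as a kernel in \<open>kernel_of\<close> has to be.\<close>

lemma wiener_test_on:
  fixes m :: "'a::euclidean_space \<Rightarrow> real"
  assumes m: "test_on R (\<lambda>\<xi>. of_real (m \<xi>))" "0 \<le> R" and even: "\<And>\<xi>. m (- \<xi>) = m \<xi>"
    and B: "wbound UNIV (decay_dim TYPE('a)) (decay_dim TYPE('a)) B (\<lambda>\<xi>. of_real (m \<xi>) :: complex)"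
  shows "wiener (wiener_const TYPE('a) * B) m"
proof -
  let ?m = "\<lambda>\<xi>. of_real (m \<xi>) :: complex"
  let ?M = "decay_dim TYPE('a)"
  let ?c = "fourier_const TYPE('a)"
  have mS: "?m \<in> schwartz" by (rule test_on_schwartz[OF m])
  have fS: "fourier ?m \<in> schwartz" by (rule fourier_schwartz[OF mS])
  have real: "of_real (Re (fourier ?m z)) = fourier ?m z" for z
  proof -
    have "cnj (fourier ?m z) = fourier ?m (- z)"
      unfolding fourier_alt complex_cnj_mult Bochner_Integration.integral_cnj[symmetric] by (simp add: cis_cnj del: Bochner_Integration.integral_cnj)
    also have "\<dots> = fourier (\<lambda>x. ?m (- x)) z" by (rule fourier_reflect[symmetric]) (rule schwartz_measurable[OF mS])
    also have "\<dots> = fourier ?m z" by (simp add: even)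
    finally show ?thesis by (metis Reals_cnj_iff of_real_Re)
  qed
  define k where "k z = ?c * Re (fourier ?m z)" for z
  have k_eq: "complex_of_real (k z) = of_real ?c * fourier ?m z" for z
    by (simp add: k_def real)
  have k_abs: "\<bar>k z\<bar> = ?c * norm (fourier ?m z)" for z
    using k_eq[of z] fourier_const_pos[where ?'a = 'a] by (metis abs_of_pos norm_mult norm_of_real)
  have le: "(1 + norm z) ^ ?M * norm (fourier ?m z) \<le> (1 + DIM('a)) ^ ?M * (?c * decay_mass TYPE('a) * B)" for z
    by (rule fourier_decay[OF mS]) (rule B)
  note int = decay_integrable[OF schwartz_measurable[OF fS] le]
  have "integrable lborel (\<lambda>z. of_real ?c * fourier ?m z)" using int(1) by simp
  then have "integrable lborel (\<lambda>z. complex_of_real (k z))" by (simp only: k_eq)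
  then have "integrable lborel k" by (simp add: complex_of_real_integrable_eq)
  moreover have "of_real (m \<xi>) = (\<integral>z. cis (z \<bullet> \<xi>) * of_real (k z) \<partial>lborel)" for \<xi>
  proof -
    have "of_real (m \<xi>) = fourier_inv (fourier ?m) \<xi>" by (rule fourier_inversion[OF mS, symmetric])
    also have "\<dots> = (\<integral>z. cis (z \<bullet> \<xi>) * of_real (k z) \<partial>lborel)"
      by (simp add: fourier_inv_def fourier_const_def[symmetric, of "TYPE('a)"] k_eq mult.left_commute[of "cis _"] inner_commute)
    finally show ?thesis .
  qed
  moreover have "(\<integral>z. \<bar>k z\<bar> \<partial>lborel) \<le> wiener_const TYPE('a) * B"
  proof -
    have "?c * (\<integral>z. norm (fourier ?m z) \<partial>lborel) \<le> ?c * (decay_mass TYPE('a) * ((1 + DIM('a)) ^ ?M * (?c * decay_mass TYPE('a) * B)))"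
      using int(2) fourier_const_pos[where ?'a = 'a] by (intro mult_left_mono) auto
    then show ?thesis by (simp add: k_abs wiener_const_def mult_ac)
  qed
  ultimately show ?thesis unfolding wiener_def kernel_of_def by blast
qed

lemma kernel_of_fourier:
  fixes v :: "'a::euclidean_space \<Rightarrow> complex"
  assumes k: "kernel_of k a" and v: "integrable lborel v"
  shows "fourier (\<lambda>\<xi>. of_real (a \<xi>) * v \<xi>) x = (\<integral>y. of_real (k (x - y)) * fourier v y \<partial>lborel)"
proof -
  have ki: "integrable lborel (\<lambda>z. complex_of_real (k z))" and [measurable]: "k \<in> borel_measurable borel" "v \<in> borel_measurable borel"
    and ak: "\<And>\<xi>. of_real (a \<xi>) = (\<integral>z. cis (z \<bullet> \<xi>) * of_real (k z) \<partial>lborel)"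
    using k v by (auto simp: kernel_of_def)
  let ?c = "of_real (fourier_const TYPE('a)) :: complex"
  have "fourier (\<lambda>\<xi>. of_real (a \<xi>) * v \<xi>) x = ?c * (\<integral>\<xi>. \<integral>z. of_real (k z) * (cis (- ((x - z) \<bullet> \<xi>)) * v \<xi>) \<partial>lborel \<partial>lborel)"
  proof -
    have "cis (- (\<xi> \<bullet> x)) * (of_real (a \<xi>) * v \<xi>) = (\<integral>z. of_real (k z) * (cis (- ((x - z) \<bullet> \<xi>)) * v \<xi>) \<partial>lborel)" for \<xi>
    proof -
      have "cis (- (\<xi> \<bullet> x)) * (of_real (a \<xi>) * v \<xi>) = (\<integral>z. (cis (- (\<xi> \<bullet> x)) * v \<xi>) * (cis (z \<bullet> \<xi>) * of_real (k z)) \<partial>lborel)"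
        unfolding integral_mult_right_zero ak[symmetric] by (simp add: mult_ac)
      also have "\<dots> = (\<integral>z. of_real (k z) * (cis (- ((x - z) \<bullet> \<xi>)) * v \<xi>) \<partial>lborel)"
      proof (rule Bochner_Integration.integral_cong[OF refl])
        fix z
        have "cis (- ((x - z) \<bullet> \<xi>)) = cis (- (\<xi> \<bullet> x)) * cis (z \<bullet> \<xi>)"
          by (simp add: cis_mult inner_diff_left inner_diff_right inner_commute)
        then show "(cis (- (\<xi> \<bullet> x)) * v \<xi>) * (cis (z \<bullet> \<xi>) * of_real (k z)) = of_real (k z) * (cis (- ((x - z) \<bullet> \<xi>)) * v \<xi>)"
          by simp
      qed
      finally show ?thesis .
    qed
    then show ?thesis by (simp add: fourier_alt)
  qed
  also have "(\<integral>\<xi>. \<integral>z. of_real (k z) * (cis (- ((x - z) \<bullet> \<xi>)) * v \<xi>) \<partial>lborel \<partial>lborel)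
      = (\<integral>z. \<integral>\<xi>. of_real (k z) * (cis (- ((x - z) \<bullet> \<xi>)) * v \<xi>) \<partial>lborel \<partial>lborel)"
    by (rule lborel_Fubini_product[OF _ v ki]) (simp_all add: norm_mult mult.commute)
  also have "?c * \<dots> = (\<integral>z. of_real (k z) * fourier v (x - z) \<partial>lborel)"
    by (simp add: fourier_alt inner_commute mult.left_commute[of "complex_of_real (fourier_const _)"] flip: integral_mult_right_zero)
  also have "\<dots> = (\<integral>y. of_real (k (x - y)) * fourier v y \<partial>lborel)"
  proof -
    have [measurable]: "fourier v \<in> borel_measurable borel"
      unfolding fourier_alt[abs_def] by measurable
    show ?thesis using lborel_integral_affine[of "\<lambda>z. of_real (k z) * fourier v (x - z)" "-1" x] by simp
  qed
  finally show ?thesis .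
qed

lemma fourier_measurable [measurable]:
  assumes [measurable]: "v \<in> borel_measurable borel"
  shows "fourier v \<in> borel_measurable borel"
  unfolding fourier_alt[abs_def] by measurable

lemma kernel_of_abs:
  assumes "kernel_of k a" "(\<integral>z. \<bar>k z\<bar> \<partial>lborel) \<le> B"
  shows "(\<lambda>z. ennreal \<bar>k z\<bar>) \<in> borel_measurable borel" "(\<integral>\<^sup>+z. ennreal \<bar>k z\<bar> \<partial>lborel) \<le> ennreal B" "0 \<le> B"
proof -
  have k: "integrable lborel k" using assms(1) by (simp add: kernel_of_def)
  then show "(\<lambda>z. ennreal \<bar>k z\<bar>) \<in> borel_measurable borel" by simp
  have "(\<integral>\<^sup>+z. ennreal \<bar>k z\<bar> \<partial>lborel) = ennreal (\<integral>z. \<bar>k z\<bar> \<partial>lborel)"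
    using k by (intro nn_integral_eq_integral) auto
  then show "(\<integral>\<^sup>+z. ennreal \<bar>k z\<bar> \<partial>lborel) \<le> ennreal B" using assms(2) by (simp add: ennreal_leI)
  show "0 \<le> B" using assms(2) by (rule order_trans[OF integral_nonneg_AE[OF AE_I2], rotated]) simp
qed

lemma pairing_kernel:
  fixes v :: "'a::euclidean_space \<Rightarrow> complex"
  assumes k: "kernel_of k a" "(\<integral>z. \<bar>k z\<bar> \<partial>lborel) \<le> B" and v: "integrable lborel v"
    and p: "pairing p q C (\<lambda>x. ennreal (norm (fourier v x)))"
  shows "pairing p q (C * B) (\<lambda>x. ennreal (norm (fourier (\<lambda>\<xi>. of_real (a \<xi>) * v \<xi>) x)))"
proof (rule pairing_mono[OF pairing_nconv[OF p kernel_of_abs[OF k]]])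
  have [measurable]: "k \<in> borel_measurable borel" "v \<in> borel_measurable borel" using k v by (auto simp: kernel_of_def)
  fix x
  have "ennreal (norm (fourier (\<lambda>\<xi>. of_real (a \<xi>) * v \<xi>) x)) \<le> (\<integral>\<^sup>+y. norm (of_real (k (x - y)) * fourier v y) \<partial>lborel)"
  proof (cases "integrable lborel (\<lambda>y. of_real (k (x - y)) * fourier v y)")
    case True
    then show ?thesis unfolding kernel_of_fourier[OF k(1) v] by (rule integral_norm_bound_ennreal)
  next
    \<comment> \<open>Without integrability the Bochner integral is 0 by convention, and the bound
      is trivial.\<close>
    case False
    then show ?thesis unfolding kernel_of_fourier[OF k(1) v] by (simp add: not_integrable_integral_eq)
  qed
  also have "\<dots> = nconv (\<lambda>z. ennreal \<bar>k z\<bar>) (\<lambda>y. ennreal (norm (fourier v y))) x"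
    by (subst nconv_alt) (auto simp: norm_mult ennreal_mult)
  finally show "ennreal (norm (fourier (\<lambda>\<xi>. of_real (a \<xi>) * v \<xi>) x)) \<le> nconv (\<lambda>z. ennreal \<bar>k z\<bar>) (\<lambda>y. ennreal (norm (fourier v y))) x" .
next
  have "fourier (\<lambda>\<xi>. of_real (a \<xi>) * v \<xi>) = (\<lambda>x. \<integral>y. of_real (k (x - y)) * fourier v y \<partial>lborel)"
    by (rule ext) (rule kernel_of_fourier[OF k(1) v])
  moreover have [measurable]: "k \<in> borel_measurable borel" "v \<in> borel_measurable borel" using k v by (auto simp: kernel_of_def)
  ultimately show "(\<lambda>x. ennreal (norm (fourier (\<lambda>\<xi>. of_real (a \<xi>) * v \<xi>) x))) \<in> borel_measurable borel"
    by simp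
qed

text \<open>The transpose of convolution with \<open>k\<close>: the integration variable stands
  first in the difference. It carries a multiplier acting on the test function over to
  \<open>g\<close>.\<close>

definition rconv :: "('a::euclidean_space \<Rightarrow> real) \<Rightarrow> ('a \<Rightarrow> real) \<Rightarrow> 'a \<Rightarrow> real" where
  "rconv k g y = (\<integral>x. k (x - y) * g x \<partial>lborel)"

lemma rconv_measurable [measurable]:
  assumes [measurable]: "k \<in> borel_measurable borel" "g \<in> borel_measurable borel"
  shows "rconv k g \<in> borel_measurable borel"
  unfolding rconv_def[abs_def] by measurable

lemma morrey_rconv:
  fixes k g :: "'a::euclidean_space \<Rightarrow> real"
  assumes k: "kernel_of k a" "(\<integral>z. \<bar>k z\<bar> \<partial>lborel) \<le> B" and g: "morrey p q K (\<lambda>x. ennreal \<bar>g x\<bar>)" "0 \<le> K"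
    and gm: "g \<in> borel_measurable borel"
  shows "morrey p q (B * K) (\<lambda>y. ennreal \<bar>rconv k g y\<bar>)"
proof -
  note [measurable] = gm
  have [measurable]: "k \<in> borel_measurable borel" using k by (auto simp: kernel_of_def)
  have "(\<integral>\<^sup>+x. ennreal \<bar>k (- x)\<bar> \<partial>lborel) = (\<integral>\<^sup>+x. ennreal \<bar>k x\<bar> \<partial>lborel)"
    using lborel_nn_integral_affine[of "\<lambda>x. ennreal \<bar>k x\<bar>" "-1" 0] by simp
  then have kB: "(\<integral>\<^sup>+x. ennreal \<bar>k (- x)\<bar> \<partial>lborel) \<le> ennreal B" using kernel_of_abs(2)[OF k] by simp
  show ?thesis
  proof (rule morrey_mono[OF morrey_nconv[OF g _ kB]])
    fix y
    have "ennreal \<bar>rconv k g y\<bar> \<le> (\<integral>\<^sup>+x. norm (k (x - y) * g x) \<partial>lborel)"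
    proof (cases "integrable lborel (\<lambda>x. k (x - y) * g x)")
      case True
      then show ?thesis unfolding rconv_def using integral_norm_bound_ennreal[OF True] by simp
    qed (simp add: rconv_def not_integrable_integral_eq)
    also have "\<dots> = nconv (\<lambda>z. ennreal \<bar>k (- z)\<bar>) (\<lambda>x. ennreal \<bar>g x\<bar>) y"
      by (subst nconv_alt) (auto simp: abs_mult ennreal_mult)
    finally show "ennreal \<bar>rconv k g y\<bar> \<le> nconv (\<lambda>z. ennreal \<bar>k (- z)\<bar>) (\<lambda>x. ennreal \<bar>g x\<bar>) y" .
  qed (use kernel_of_abs(3)[OF k] in auto)
qed

lemma pairing_integrable:
  fixes w :: "'a::euclidean_space \<Rightarrow> complex"
  assumes w: "pairing p q C (\<lambda>x. ennreal (norm (w x)))" "w \<in> borel_measurable borel"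
    and g: "morrey p q K (\<lambda>x. ennreal \<bar>g x\<bar>)" "0 \<le> K" "g \<in> borel_measurable borel"
  shows "integrable lborel (\<lambda>x. of_real (g x) * w x)" "norm (\<integral>x. of_real (g x) * w x \<partial>lborel) \<le> C * K"
proof -
  have C: "0 \<le> C" using w by (simp add: pairing_def)
  have "(\<integral>\<^sup>+x. ennreal (norm (of_real (g x) * w x)) \<partial>lborel) = (\<integral>\<^sup>+x. ennreal \<bar>g x\<bar> * ennreal (norm (w x)) \<partial>lborel)"
    by (simp add: norm_mult ennreal_mult)
  also have "\<dots> \<le> ennreal (C * K)" by (rule pairingD[OF w(1) g(1,2)])
  finally have le: "(\<integral>\<^sup>+x. ennreal (norm (of_real (g x) * w x)) \<partial>lborel) \<le> ennreal (C * K)" .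
  show int: "integrable lborel (\<lambda>x. of_real (g x) * w x)"
    using w(2) g(3) le_less_trans[OF le] by (intro integrableI_bounded) auto
  have "ennreal (norm (\<integral>x. of_real (g x) * w x \<partial>lborel)) \<le> ennreal (C * K)"
    using integral_norm_bound_ennreal[OF int] le by (rule order_trans)
  then show "norm (\<integral>x. of_real (g x) * w x \<partial>lborel) \<le> C * K"
    using C g(2) by (simp add: ennreal_le_iff)
qed

text \<open>Fubini. Absolute convergence comes from the duality bound applied to the convolution of
  the modulus of \<open>k\<close> with that of \<open>fourier v\<close>, not from decay of
  \<open>fourier v\<close>.\<close>

lemma pairing_rconv:
  fixes v :: "'a::euclidean_space \<Rightarrow> complex"
  assumes k: "kernel_of k a" and v: "integrable lborel v"
    and w: "pairing p q C (\<lambda>x. ennreal (norm (fourier v x)))"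
    and g: "morrey p q K (\<lambda>x. ennreal \<bar>g x\<bar>)" "0 \<le> K" "g \<in> borel_measurable borel"
  shows "(\<integral>x. of_real (g x) * fourier (\<lambda>\<xi>. of_real (a \<xi>) * v \<xi>) x \<partial>lborel) = (\<integral>y. of_real (rconv k g y) * fourier v y \<partial>lborel)"
proof -
  note [measurable] = g(3)
  have [measurable]: "k \<in> borel_measurable borel" "v \<in> borel_measurable borel" using k v by (auto simp: kernel_of_def)
  have "(\<integral>x. of_real (g x) * fourier (\<lambda>\<xi>. of_real (a \<xi>) * v \<xi>) x \<partial>lborel)
      = (\<integral>x. \<integral>y. of_real (g x) * (of_real (k (x - y)) * fourier v y) \<partial>lborel \<partial>lborel)"
    by (simp add: kernel_of_fourier[OF k v])
  also have "\<dots> = (\<integral>y. \<integral>x. of_real (g x) * (of_real (k (x - y)) * fourier v y) \<partial>lborel \<partial>lborel)"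
  proof (rule lborel_Fubini(3))
    have "(\<integral>\<^sup>+x. \<integral>\<^sup>+y. norm (of_real (g x) * (of_real (k (x - y)) * fourier v y)) \<partial>lborel \<partial>lborel)
        = (\<integral>\<^sup>+x. ennreal \<bar>g x\<bar> * nconv (\<lambda>z. ennreal \<bar>k z\<bar>) (\<lambda>y. ennreal (norm (fourier v y))) x \<partial>lborel)"
      by (intro nn_integral_cong) (simp add: nconv_alt norm_mult ennreal_mult nn_integral_cmult)
    also have "\<dots> \<le> ennreal (C * (\<integral>z. \<bar>k z\<bar> \<partial>lborel) * K)"
      by (rule pairingD[OF pairing_nconv[OF w kernel_of_abs[OF k order_refl]] g(1,2)])
    also have "\<dots> < \<infinity>" by simp
    finally show "(\<integral>\<^sup>+x. \<integral>\<^sup>+y. norm (of_real (g x) * (of_real (k (x - y)) * fourier v y)) \<partial>lborel \<partial>lborel) < \<infinity>" .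
  qed measurable
  also have "\<dots> = (\<integral>y. of_real (rconv k g y) * fourier v y \<partial>lborel)"
  proof (rule Bochner_Integration.integral_cong[OF refl])
    fix y
    have "(\<integral>x. of_real (g x) * (of_real (k (x - y)) * fourier v y) \<partial>lborel) = (\<integral>x. complex_of_real (k (x - y) * g x) * fourier v y \<partial>lborel)"
      by (simp add: mult_ac)
    also have "\<dots> = (\<integral>x. complex_of_real (k (x - y) * g x) \<partial>lborel) * fourier v y" by (rule integral_mult_left_zero)
    also have "(\<integral>x. complex_of_real (k (x - y) * g x) \<partial>lborel) = of_real (rconv k g y)"
      unfolding rconv_def by (rule integral_complex_of_real)
    finally show "(\<integral>x. of_real (g x) * (of_real (k (x - y)) * fourier v y) \<partial>lborel) = of_real (rconv k g y) * fourier v y" .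
  qed
  finally show ?thesis .
qed

section \<open>The symbols\<close>

lemma smooth_on_power_series:
  fixes c :: "nat \<Rightarrow> real"
  assumes "\<And>y. summable (\<lambda>n. c n * y ^ n)"
  shows "smooth_on UNIV (\<lambda>y. \<Sum>n. c n * y ^ n)"
proof -
  have s: "summable (\<lambda>n. (diffs ^^ k) c n * y ^ n)" for k y
    by (induction k arbitrary: y) (auto intro: assms termdiff_converges_all)
  have "smooth_on UNIV (\<lambda>y. \<Sum>n. (diffs ^^ 0) c n * y ^ n)"
    by (rule smooth_on_real_sequence[where h = "\<lambda>k y. \<Sum>n. (diffs ^^ k) c n * y ^ n"])
       (auto intro: termdiffs_strong_converges_everywhere[OF s] simp: has_real_derivative_iff_has_vector_derivative[symmetric])
  then show ?thesis by simp
qed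

text \<open>The phi-functions of exponential integrators at \<open>- y\<close>: exp (- y) for m = 0,
  (1 - exp (- y)) / y for m = 1, (exp (- y) - 1 + y) / y^2 for m = 2. The series extends the
  quotients smoothly through 0.\<close>

definition expser :: "nat \<Rightarrow> real \<Rightarrow> real" where
  "expser m y = (\<Sum>n. (-1) ^ n / fact (n + m) * y ^ n)"

lemma summable_expser: "summable (\<lambda>n. (-1) ^ n / fact (n + m) * y ^ n :: real)"
proof (rule summable_comparison_test'[of "\<lambda>n. \<bar>y\<bar> ^ n / fact n" 0])
  show "summable (\<lambda>n. \<bar>y\<bar> ^ n / fact n)" using summable_exp[of "\<bar>y\<bar>"] by (simp add: divide_inverse mult.commute)
  fix n :: nat
  have "(fact n :: real) \<le> fact (n + m)" by (rule fact_mono) simp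
  then show "norm ((-1) ^ n / fact (n + m) * y ^ n) \<le> \<bar>y\<bar> ^ n / fact n"
    by (simp add: abs_mult power_abs frac_le)
qed

lemma smooth_on_expser: "smooth_on UNIV (expser m)"
  using smooth_on_power_series[OF summable_expser] by (simp add: expser_def[abs_def])

lemma expser_rec: "expser m y = 1 / fact m - y * expser (Suc m) y"
proof -
  have "expser m y = (\<Sum>n. (-1) ^ Suc n / fact (Suc n + m) * y ^ Suc n) + 1 / fact m"
    using suminf_split_head[OF summable_expser[of m y]] by (simp add: expser_def)
  also have "(\<Sum>n. (-1) ^ Suc n / fact (Suc n + m) * y ^ Suc n) = (\<Sum>n. (- y) * ((-1) ^ n / fact (n + Suc m) * y ^ n))"
    by (rule suminf_cong) simp
  also have "\<dots> = - y * expser (Suc m) y"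
    unfolding expser_def by (rule suminf_mult[OF summable_expser])
  finally show ?thesis by simp
qed

lemma expser_0: "expser 0 y = exp (- y)"
  unfolding expser_def exp_def by (rule suminf_cong) (simp add: divide_inverse power_minus[of y])

lemma exp_minus_eq: "exp (- y) = 1 - y * expser 1 y"
  using expser_rec[of 0 y] by (simp add: expser_0)

lemma expser_1_eq: "expser 1 y = 1 - y * expser 2 y"
  using expser_rec[of 1 y] by (simp add: numeral_2_eq_2)

text \<open>\<open>y * expser 1 y\<close> equals \<open>1 - exp (- y)\<close>, which has the sign of
  \<open>y\<close>. Positivity on the whole line lets the reciprocal enter families that are smooth
  on the full parameter space, where the argument takes both signs.\<close>

lemma expser_1_pos: "0 < expser 1 y"
proof (cases "y = 0")
  case True
  then show ?thesis using expser_1_eq[of 0] by simp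
next
  case False
  have *: "y * expser 1 y = 1 - exp (- y)" using exp_minus_eq[of y] by simp
  show ?thesis
  proof (cases "0 < y")
    case True
    then have "0 < y * expser 1 y" unfolding * by simp
    then show ?thesis using True by (simp add: zero_less_mult_iff)
  next
    case False
    then have "y * expser 1 y < 0" unfolding * using \<open>y \<noteq> 0\<close> by simp
    then show ?thesis using False by (simp add: mult_less_0_iff)
  qed
qed

lemma smooth_on_Pair:
  fixes f :: "'a::euclidean_space \<Rightarrow> 'b::euclidean_space" and g :: "'a \<Rightarrow> 'c::euclidean_space"
  assumes "open S" "smooth_on S f" "smooth_on S g"
  shows "smooth_on S (\<lambda>x. (f x, g x))"
proof -
  have "smooth_on S (\<lambda>x. (f x, 0) + (0, g x))"
    by (intro smooth_on_add assms
        smooth_on_bounded_linear[OF assms(1) bounded_linear_Pair[OF bounded_linear_ident bounded_linear_zero] assms(2)]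
        smooth_on_bounded_linear[OF assms(1) bounded_linear_Pair[OF bounded_linear_zero bounded_linear_ident] assms(3)])
  then show ?thesis by simp
qed

section \<open>Littlewood-Paley cutoffs and the kernels of localised symbols\<close>

definition lp_annulus :: "(real \<Rightarrow> real) \<Rightarrow> 'a::euclidean_space \<Rightarrow> real" where
  "lp_annulus \<zeta> \<eta> = \<zeta> (norm \<eta>) - \<zeta> (2 * norm \<eta>)"

context
  fixes \<zeta> :: "real \<Rightarrow> real"
  assumes \<zeta>: "lp_cutoff \<zeta>"
begin

lemma cutoff_eq_0: "5/3 \<le> t \<Longrightarrow> \<zeta> t = 0"
proof (rule ccontr)
  assume t: "5/3 \<le> t" "\<zeta> t \<noteq> 0"
  then have "t \<in> closure {t. 0 \<le> t \<and> \<zeta> t \<noteq> 0}" using closure_subset by force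
  then have "t < 5/3" using \<zeta> unfolding lp_cutoff_def by auto
  with t show False by simp
qed

lemma cutoff_eq_1: "0 \<le> t \<Longrightarrow> t \<le> 3/2 \<Longrightarrow> \<zeta> t = 1"
  using \<zeta> unfolding lp_cutoff_def by blast

lemma cutoff_nonneg: "0 \<le> t \<Longrightarrow> 0 \<le> \<zeta> t"
  using \<zeta> unfolding lp_cutoff_def by blast

text \<open>Off the origin the norm is smooth and \<open>\<zeta>\<close> may be replaced by its
  smooth extension; near the origin the cutoff is constant. The two open sets cover the
  space.\<close>

lemma smooth_on_cutoff: "smooth_on UNIV (\<lambda>\<xi>::'a::euclidean_space. \<zeta> (norm \<xi>))"
proof -
  obtain g where g: "smooth_on UNIV g" "\<And>t. 0 \<le> t \<Longrightarrow> g t = \<zeta> t"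
    using \<zeta> unfolding lp_cutoff_def smooth_iff_smooth_on by blast
  have "smooth_on (- {0}) (\<lambda>\<xi>::'a. g (norm \<xi> powr 1))"
    by (rule smooth_on_compose[OF _ _ smooth_on_norm_powr g(1)]) auto
  then have "smooth_on (- {0}) (\<lambda>\<xi>::'a. \<zeta> (norm \<xi>))"
    using smooth_on_cong[of "- {0}" "\<lambda>\<xi>::'a. g (norm \<xi> powr 1)" "\<lambda>\<xi>. \<zeta> (norm \<xi>)"] g(2) by simp
  moreover have "smooth_on (ball 0 1) (\<lambda>\<xi>::'a. \<zeta> (norm \<xi>))"
    using smooth_on_cong[of "ball 0 1" "\<lambda>\<xi>::'a. 1" "\<lambda>\<xi>. \<zeta> (norm \<xi>)"] cutoff_eq_1 by simp
  moreover have "- {0} \<union> ball (0::'a) 1 = UNIV" by auto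
  ultimately show ?thesis using smooth_on_Un by metis
qed

lemma smooth_on_cutoff_dilate: "0 < c \<Longrightarrow> smooth_on UNIV (\<lambda>\<xi>::'a::euclidean_space. \<zeta> (c * norm \<xi>))"
  using smooth_on_dilate[OF smooth_on_cutoff, of c] by simp

lemma test_on_cutoff_dilate:
  assumes "0 < c"
  shows "test_on (5/3 / c) (\<lambda>\<xi>::'a::euclidean_space. of_real (\<zeta> (c * norm \<xi>)))"
  unfolding test_on_def
proof (intro conjI allI impI)
  show "smooth_on UNIV (\<lambda>\<xi>::'a. of_real (\<zeta> (c * norm \<xi>)) :: complex)"
    by (rule smooth_on_of_real[OF open_UNIV smooth_on_cutoff_dilate[OF assms]])
  fix \<xi> :: 'a assume "5/3 / c < norm \<xi>"
  then have "5/3 \<le> c * norm \<xi>" using assms by (simp add: field_simps)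
  then show "of_real (\<zeta> (c * norm \<xi>)) = (0::complex)" by (simp add: cutoff_eq_0)
qed

lemma lp_annulus_eq_0:
  "norm \<eta> \<le> 3/4 \<Longrightarrow> lp_annulus \<zeta> \<eta> = 0" "5/3 \<le> norm \<eta> \<Longrightarrow> lp_annulus \<zeta> \<eta> = 0"
  by (simp_all add: lp_annulus_def cutoff_eq_0 cutoff_eq_1)

lemma smooth_on_annulus: "smooth_on UNIV (lp_annulus \<zeta> :: 'a::euclidean_space \<Rightarrow> real)"
  unfolding lp_annulus_def[abs_def]
  by (intro smooth_on_diff smooth_on_cutoff smooth_on_cutoff_dilate) auto

text \<open>
  Off the origin the power of the norm is smooth, and the annulus cuts out the origin;
  hence the family is smooth in \<open>\<eta>\<close> and the parameters jointly.
\<close>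

lemma annulus_family:
  fixes \<Psi> :: "real \<times> real \<Rightarrow> real"
  assumes \<Psi>: "smooth_on UNIV \<Psi>"
  shows "smooth_on UNIV (\<lambda>(\<eta>::'a::euclidean_space, c, \<kappa>). complex_of_real
    (lp_annulus \<zeta> \<eta> * norm \<eta> powr \<theta> * \<Psi> (c, \<kappa> * norm \<eta> powr \<theta>)))"
proof -
  let ?S = "{z :: 'a \<times> real \<times> real. fst z \<noteq> 0}" and ?T = "{z :: 'a \<times> real \<times> real. norm (fst z) < 3/4}"
  let ?f = "\<lambda>z :: 'a \<times> real \<times> real. lp_annulus \<zeta> (fst z) * norm (fst z) powr \<theta> *
    \<Psi> (fst (snd z), snd (snd z) * norm (fst z) powr \<theta>)"
  have S: "open ?S" by (intro open_Collect_neq continuous_intros)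
  have T: "open ?T" by (intro open_Collect_less continuous_intros)
  have p: "smooth_on ?S (\<lambda>z. norm (fst z) powr \<theta>)"
    by (rule smooth_on_compose[OF S _ smooth_on_linear[OF S bounded_linear_fst] smooth_on_norm_powr[of "- {0}"]]) auto
  have a: "smooth_on ?S (\<lambda>z. lp_annulus \<zeta> (fst z))"
    by (rule smooth_on_compose[OF S _ smooth_on_linear[OF S bounded_linear_fst] smooth_on_annulus]) auto
  have c: "smooth_on ?S (\<lambda>z. fst (snd z))" "smooth_on ?S (\<lambda>z. snd (snd z))"
    by (intro smooth_on_linear[OF S] bounded_linear_compose[OF bounded_linear_fst bounded_linear_snd]
        bounded_linear_compose[OF bounded_linear_snd bounded_linear_snd])+
  have "smooth_on ?S (\<lambda>z. \<Psi> (fst (snd z), snd (snd z) * norm (fst z) powr \<theta>))"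
    by (rule smooth_on_compose[OF S _ smooth_on_Pair[OF S c(1) smooth_on_mult[OF S c(2) p]] \<Psi>]) simp
  then have "smooth_on ?S ?f" by (rule smooth_on_mult[OF S smooth_on_mult[OF S a p]])
  moreover have "smooth_on ?T ?f"
    using smooth_on_cong[OF T, of "\<lambda>_. 0" ?f] by (simp add: lp_annulus_eq_0)
  ultimately have "smooth_on (?S \<union> ?T) ?f" by (rule smooth_on_Un)
  moreover have "?S \<union> ?T = UNIV" by auto
  ultimately have "smooth_on UNIV ?f" by (simp only:)
  from smooth_on_of_real[OF open_UNIV this] show ?thesis
    by (simp add: case_prod_beta')
qed

text \<open>A compact parameter range gives uniform derivative bounds and hence one kernel bound.
  Later \<open>\<kappa>\<close> runs through the powers of \<open>2 powr (- \<theta>)\<close> in the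
  low-frequency sum and equals 1 for a single block, while \<open>c\<close> is a time increment, a
  rescaled time, or fixed to 0.\<close>

lemma wiener_annulus:
  fixes \<Psi> :: "real \<times> real \<Rightarrow> real"
  assumes \<Psi>: "smooth_on UNIV \<Psi>"
  shows "\<exists>B\<ge>0. \<forall>c\<in>{-C..C}. \<forall>\<kappa>\<in>{0..1}. wiener B (\<lambda>\<eta>::'a::euclidean_space. lp_annulus \<zeta> \<eta> * norm \<eta> powr \<theta> * \<Psi> (c, \<kappa> * norm \<eta> powr \<theta>))"
proof -
  let ?M = "decay_dim TYPE('a)"
  let ?f = "\<lambda>c \<kappa> (\<eta>::'a). lp_annulus \<zeta> \<eta> * norm \<eta> powr \<theta> * \<Psi> (c, \<kappa> * norm \<eta> powr \<theta>)"
  have "\<exists>B\<ge>0. \<forall>p\<in>{-C..C} \<times> {0..1}. test_on (5/3) (\<lambda>\<eta>. (\<lambda>(\<eta>, c, \<kappa>). complex_of_real (?f c \<kappa> \<eta>)) (\<eta>, p)) \<and>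
      wbound UNIV ?M ?M B (\<lambda>\<eta>. (\<lambda>(\<eta>, c, \<kappa>). complex_of_real (?f c \<kappa> \<eta>)) (\<eta>, p))"
    by (rule test_family_bound[OF annulus_family[OF \<Psi>]]) (auto intro: compact_Times simp: lp_annulus_eq_0)
  then obtain B where B: "B \<ge> 0" "\<And>c \<kappa>. c \<in> {-C..C} \<Longrightarrow> \<kappa> \<in> {0..1} \<Longrightarrow>
      test_on (5/3) (\<lambda>\<eta>. complex_of_real (?f c \<kappa> \<eta>)) \<and> wbound UNIV ?M ?M B (\<lambda>\<eta>. complex_of_real (?f c \<kappa> \<eta>))"
    by fastforce
  have "wiener (wiener_const TYPE('a) * B) (?f c \<kappa>)" if "c \<in> {-C..C}" "\<kappa> \<in> {0..1}" for c \<kappa>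
    using B(2)[OF that] by (intro wiener_test_on[of "5/3"]) (auto simp: lp_annulus_def)
  then show ?thesis using B(1) wiener_const_nonneg[where ?'a = 'a]
    by (intro exI[of _ "wiener_const TYPE('a) * B"]) auto
qed

text \<open>
  At low frequencies the symbol is not smooth, but it vanishes at the origin: the pieces
  of its dyadic decomposition have kernels whose norms decay geometrically.
\<close>

lemma wiener_low_frequency:
  fixes \<Psi> :: "real \<times> real \<Rightarrow> real"
  assumes \<Psi>: "smooth_on UNIV \<Psi>" and \<theta>: "0 < \<theta>"
  shows "\<exists>B\<ge>0. \<forall>c\<in>{-C..C}. wiener B (\<lambda>\<xi>::'a::euclidean_space. \<zeta> (norm \<xi>) * (norm \<xi> powr \<theta> * \<Psi> (c, norm \<xi> powr \<theta>)))"
proof -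
  obtain B where B: "B \<ge> 0" "\<And>c \<kappa>. c \<in> {-C..C} \<Longrightarrow> \<kappa> \<in> {0..1} \<Longrightarrow>
      wiener B (\<lambda>\<eta>::'a. lp_annulus \<zeta> \<eta> * norm \<eta> powr \<theta> * \<Psi> (c, \<kappa> * norm \<eta> powr \<theta>))"
    using wiener_annulus[OF \<Psi>, of C \<theta>] by blast
  \<comment> \<open>Writing the i-th piece as a dilation by \<open>2 ^ i\<close> of an annulus
    symbol brings in \<open>d ^ i\<close> twice: as the parameter \<open>\<kappa>\<close>, and as
    the prefactor that makes the norms summable.\<close>
  define d where "d = 2 powr (- \<theta>)"
  have d: "0 < d" "d < 1" using \<theta> powr_less_mono[of "- \<theta>" 0 2] by (auto simp: d_def)
  have "wiener (\<Sum>i. d ^ i * B) (\<lambda>\<xi>::'a. \<zeta> (norm \<xi>) * (norm \<xi> powr \<theta> * \<Psi> (c, norm \<xi> powr \<theta>)))"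
    if c: "c \<in> {-C..C}" for c
  proof (rule wiener_suminf)
    show "summable (\<lambda>i. d ^ i * B)" using d by (intro summable_mult2 summable_geometric) auto
    let ?a = "\<lambda>i (\<xi>::'a). d ^ i * (lp_annulus \<zeta> (2 ^ i *\<^sub>R \<xi>) * norm (2 ^ i *\<^sub>R \<xi>) powr \<theta> * \<Psi> (c, d ^ i * norm (2 ^ i *\<^sub>R \<xi>) powr \<theta>))"
    show "wiener (d ^ i * B) (?a i)" for i
    proof -
      have "d ^ i \<in> {0..1}" using d by (auto intro: power_le_one)
      from wiener_cmult[OF wiener_dilate[OF B(2)[OF c this]], of "2 ^ i" "d ^ i"] d
      show ?thesis by simp
    qed
    fix \<xi> :: 'a
    have scale: "d ^ i * norm (2 ^ i *\<^sub>R \<xi>) powr \<theta> = norm \<xi> powr \<theta>" for i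
    proof -
      have "(2 ^ i) powr \<theta> = (2 powr \<theta>) ^ i"
        by (simp add: powr_realpow[symmetric] powr_powr mult.commute)
      then have "d ^ i * (2 ^ i) powr \<theta> = 1"
        by (simp add: d_def power_mult_distrib[symmetric] powr_add[symmetric])
      then show ?thesis by (simp add: powr_mult mult.assoc[symmetric])
    qed
    have a_eq: "?a i \<xi> = lp_annulus \<zeta> (2 ^ i *\<^sub>R \<xi>) * (norm \<xi> powr \<theta> * \<Psi> (c, norm \<xi> powr \<theta>))" for i
      using scale[of i] by (simp add: mult_ac)
    show "(\<lambda>i. ?a i \<xi>) sums (\<zeta> (norm \<xi>) * (norm \<xi> powr \<theta> * \<Psi> (c, norm \<xi> powr \<theta>)))"
    \<comment> \<open>At the origin the annuli sum to 0 and not to \<open>\<zeta> 0\<close>, but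
      there the power of the norm vanishes. Elsewhere the sum telescopes.\<close>
    proof (cases "\<xi> = 0")
      case False
      have "(\<lambda>i. \<zeta> (2 ^ i * norm \<xi>)) \<longlonglongrightarrow> 0"
      proof (rule tendsto_eventually)
        obtain n where n: "5/3 / norm \<xi> < 2 ^ n" using real_arch_pow[of 2 "5/3 / norm \<xi>"] by auto
        have "\<zeta> (2 ^ i * norm \<xi>) = 0" if "n \<le> i" for i
        proof (rule cutoff_eq_0)
          have "5/3 / norm \<xi> \<le> 2 ^ i" using n power_increasing[OF that, of "2::real"] by linarith
          then show "5/3 \<le> 2 ^ i * norm \<xi>" using False by (simp add: field_simps)
        qed
        then show "\<forall>\<^sub>F i in sequentially. \<zeta> (2 ^ i * norm \<xi>) = 0" by (auto simp: eventually_sequentially)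
      qed
      from telescope_sums'[OF this] have "(\<lambda>i. \<zeta> (2 ^ i * norm \<xi>) - \<zeta> (2 ^ Suc i * norm \<xi>)) sums \<zeta> (norm \<xi>)" by simp
      then have "(\<lambda>i. lp_annulus \<zeta> (2 ^ i *\<^sub>R \<xi>)) sums \<zeta> (norm \<xi>)"
        by (simp add: lp_annulus_def mult.assoc)
      from sums_mult2[OF this] show ?thesis unfolding a_eq .
    qed (simp add: a_eq)
  qed
  moreover have "0 \<le> (\<Sum>i. d ^ i * B)"
    using d B(1) by (intro suminf_nonneg summable_mult2 summable_geometric) auto
  ultimately show ?thesis by blast
qed

lemma wiener_cutoff: "\<exists>B\<ge>0. wiener B (\<lambda>\<xi>::'a::euclidean_space. \<zeta> (norm \<xi>))"
proof -
  have t: "test_on (5/3) (\<lambda>\<xi>::'a. complex_of_real (\<zeta> (norm \<xi>)))"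
    using test_on_cutoff_dilate[of 1] by simp
  obtain B where B: "B \<ge> 0" "wbound UNIV (decay_dim TYPE('a)) (decay_dim TYPE('a)) B (\<lambda>\<xi>::'a. complex_of_real (\<zeta> (norm \<xi>)))"
    using test_on_wbound[OF t] by auto
  have "wiener (wiener_const TYPE('a) * B) (\<lambda>\<xi>::'a. \<zeta> (norm \<xi>))"
    by (rule wiener_test_on[OF t _ _ B(2)]) auto
  then show ?thesis using wiener_nonneg by blast
qed

text \<open>A regularised product is a limit demanded for all mollifiers, so its uniqueness requires
  that one exists. The normalised cutoff serves.\<close>

lemma exists_mollifier: "\<exists>\<rho>::'a::euclidean_space \<Rightarrow> real. mollifier \<rho>"
proof -
  let ?f = "\<lambda>\<xi>::'a. \<zeta> (norm \<xi>)"
  have t: "test_on (5/3) (\<lambda>\<xi>::'a. complex_of_real (?f \<xi>))"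
    using test_on_cutoff_dilate[of 1] by simp
  have int: "integrable lborel ?f"
    using test_on_integrable[OF t] by (simp add: complex_of_real_integrable_eq)
  have "measure lborel (ball (0::'a) 1) = (\<integral>x. indicator (ball (0::'a) 1) x \<partial>lborel)" by simp
  also have "\<dots> \<le> (\<integral>x. ?f x \<partial>lborel)"
  proof (rule integral_mono[OF _ int])
    show "integrable lborel (indicator (ball (0::'a) 1) :: 'a \<Rightarrow> real)"
      by (rule integrable_real_indicator) (use emeasure_ball_subset_less_top[of "ball (0::'a) 1" 0 1] in auto)
    show "indicator (ball 0 1) x \<le> ?f x" for x :: 'a
      by (auto simp: indicator_def cutoff_eq_1 cutoff_nonneg)
  qed
  finally have pos: "0 < (\<integral>x. ?f x \<partial>lborel)"
    using content_ball_pos[of 1 "0::'a"] by linarith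
  let ?\<rho> = "\<lambda>x. inverse (\<integral>x. ?f x \<partial>lborel) * ?f x"
  have "mollifier ?\<rho>"
    unfolding mollifier_def smooth_iff_smooth_on
  proof (intro conjI allI)
    show "smooth_on UNIV ?\<rho>" by (intro smooth_on_mult smooth_on_cutoff) auto
    have "{x. ?\<rho> x \<noteq> 0} \<subseteq> cball 0 (5/3)" using cutoff_eq_0 by (force simp: not_le)
    then show "bounded {x. ?\<rho> x \<noteq> 0}" by (rule bounded_subset[OF bounded_cball])
    show "0 \<le> ?\<rho> x" for x using pos by (simp add: cutoff_nonneg)
    show "(\<integral>x. ?\<rho> x \<partial>lborel) = 1" using pos int by simp
  qed
  then show ?thesis by blast
qed

end

section \<open>Functionals on test functions supported at the origin\<close>

text \<open>A distribution of order at most \<open>K\<close>, with constants depending on the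
  support radius.\<close>

definition test_functional :: "nat \<Rightarrow> (('a::euclidean_space \<Rightarrow> complex) \<Rightarrow> complex) \<Rightarrow> bool" where
  "test_functional K F \<longleftrightarrow>
     (\<forall>R u v. test_on R u \<longrightarrow> test_on R v \<longrightarrow> F (\<lambda>x. u x + v x) = F u + F v) \<and>
     (\<forall>R u c. test_on R u \<longrightarrow> F (\<lambda>x. c * u x) = c * F u) \<and>
     (\<forall>R\<ge>0. \<exists>C\<ge>0. \<forall>u B. test_on R u \<longrightarrow> wbound UNIV 0 K B u \<longrightarrow> norm (F u) \<le> C * B)"

lemma test_functional_add:
  "test_functional K F \<Longrightarrow> test_on R u \<Longrightarrow> test_on R v \<Longrightarrow> F (\<lambda>x. u x + v x) = F u + F v"
  unfolding test_functional_def by blast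

lemma test_functional_cmult: "test_functional K F \<Longrightarrow> test_on R u \<Longrightarrow> F (\<lambda>x. c * u x) = c * F u"
  unfolding test_functional_def by blast

lemma test_functional_bound:
  "test_functional K F \<Longrightarrow> 0 \<le> R \<Longrightarrow> \<exists>C\<ge>0. \<forall>u B. test_on R u \<longrightarrow> wbound UNIV 0 K B u \<longrightarrow> norm (F u) \<le> C * B"
  unfolding test_functional_def by blast

text \<open>Mollifications converge in the norm of order \<open>K\<close> at rate
  \<open>\<epsilon>\<close>, and for \<open>\<epsilon> < 1\<close> all supports stay in one ball, so
  a single constant of \<open>F\<close> applies.\<close>

lemma test_functional_mollify:
  fixes F :: "('a::euclidean_space \<Rightarrow> complex) \<Rightarrow> complex"
  assumes F: "test_functional K F" and \<rho>: "mollifier \<rho>" and \<psi>: "test_on R \<psi>" "0 \<le> R"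
  shows "((\<lambda>\<epsilon>. F (mollify \<rho> \<epsilon> \<psi>)) \<longlongrightarrow> F \<psi>) (at_right 0)"
proof -
  obtain r where r: "r > 0" "\<And>x. r < norm x \<Longrightarrow> \<rho> x = 0" using mollifier_support[OF \<rho>] by blast
  obtain B where B: "wbound UNIV 0 (Suc K) B \<psi>" using test_on_wbound[OF \<psi>] by blast
  obtain C where C: "C \<ge> 0" "\<And>u B. test_on (r + R) u \<Longrightarrow> wbound UNIV 0 K B u \<Longrightarrow> norm (F u) \<le> C * B"
    using test_functional_bound[OF F, of "r + R"] r \<psi>(2) by auto
  have le: "norm (F (mollify \<rho> \<epsilon> \<psi>) - F \<psi>) \<le> (C * (DIM('a) * r * B)) * \<epsilon>" if \<epsilon>: "0 < \<epsilon>" "\<epsilon> < 1" for \<epsilon>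
  proof -
    have \<psi>': "test_on (r + R) \<psi>" by (rule test_on_mono[OF \<psi>(1)]) (use r in simp)
    have "\<epsilon> * r + R \<le> r + R" using \<epsilon> r(1) by simp
    then have m: "test_on (r + R) (mollify \<rho> \<epsilon> \<psi>)"
      using test_on_mono[OF test_on_mollify[OF \<rho> r \<epsilon>(1) test_on_integrable[OF \<psi>], of R]] test_on_zero[OF \<psi>(1)] by blast
    have d: "test_on (r + R) (\<lambda>x. mollify \<rho> \<epsilon> \<psi> x - \<psi> x)" by (rule test_on_diff[OF m \<psi>'])
    have "F (mollify \<rho> \<epsilon> \<psi>) = F (\<lambda>x. (mollify \<rho> \<epsilon> \<psi> x - \<psi> x) + \<psi> x)" by simp
    also have "\<dots> = F (\<lambda>x. mollify \<rho> \<epsilon> \<psi> x - \<psi> x) + F \<psi>" by (rule test_functional_add[OF F d \<psi>'])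
    finally have "F (mollify \<rho> \<epsilon> \<psi>) - F \<psi> = F (\<lambda>x. mollify \<rho> \<epsilon> \<psi> x - \<psi> x)" by simp
    moreover have "norm (F (\<lambda>x. mollify \<rho> \<epsilon> \<psi> x - \<psi> x)) \<le> C * (DIM('a) * (\<epsilon> * r) * B)"
      by (rule C(2)[OF d mollify_converges[OF \<rho> r \<epsilon>(1) \<psi> B]])
    ultimately show ?thesis by (simp add: mult_ac)
  qed
  have ev: "eventually (\<lambda>\<epsilon>::real. 0 < \<epsilon> \<and> \<epsilon> < 1) (at_right 0)"
    by (auto simp: eventually_at_right_field intro!: exI[of _ 1])
  have "((\<lambda>\<epsilon>. F (mollify \<rho> \<epsilon> \<psi>) - F \<psi>) \<longlongrightarrow> 0) (at_right 0)"
  proof (rule Lim_null_comparison)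
    show "\<forall>\<^sub>F \<epsilon> in at_right 0. norm (F (mollify \<rho> \<epsilon> \<psi>) - F \<psi>) \<le> (C * (DIM('a) * r * B)) * \<epsilon>"
      using ev by eventually_elim (use le in blast)
    show "((\<lambda>\<epsilon>. (C * (DIM('a) * r * B)) * \<epsilon>) \<longlongrightarrow> 0) (at_right 0)"
      by (intro tendsto_mult_right_zero tendsto_ident_at)
  qed
  then show ?thesis by (rule LIM_zero_cancel)
qed

text \<open>
  An interpolation argument in place of Taylor expansion of the derivatives: vanishing of
  order \<open>2 m\<close> at the origin passes to first derivatives as vanishing of order \<open>m\<close>.
\<close>

lemma vanishing_partial_deriv:
  fixes f :: "'a::euclidean_space \<Rightarrow> complex"
  assumes f: "smooth_on UNIV f" "wbound UNIV 0 2 B f" and b: "b \<in> Basis" and m: "1 \<le> m"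
    and A: "\<And>\<xi>. norm (f \<xi>) \<le> A * norm \<xi> ^ (2 * m)" "0 \<le> A"
  shows "norm (partial_deriv b f \<xi>) \<le> (A * 4 ^ m + A + (real DIM('a))\<^sup>2 * B) * norm \<xi> ^ m"
proof -
  let ?C = "A * 4 ^ m + A + (real DIM('a))\<^sup>2 * B"
  have B0: "0 \<le> B" using wbound_nonneg[OF f(2)] by blast
  have nb: "norm b = 1" using b by simp
  have step: "t * norm (partial_deriv b f \<xi>) \<le> A * norm (\<xi> + t *\<^sub>R b) ^ (2 * m) + A * norm \<xi> ^ (2 * m) + (real DIM('a))\<^sup>2 * B * t\<^sup>2"
    if t: "0 < t" for t
  proof -
    have "(\<Sum>c\<in>Basis. ((t *\<^sub>R b) \<bullet> c) *\<^sub>R partial_deriv c f \<xi>) = t *\<^sub>R partial_deriv b f \<xi>"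
    proof -
      have "(\<Sum>c\<in>Basis. ((t *\<^sub>R b) \<bullet> c) *\<^sub>R partial_deriv c f \<xi>) = (\<Sum>c\<in>Basis. if b = c then t *\<^sub>R partial_deriv c f \<xi> else 0)"
        by (rule sum.cong) (use b in \<open>auto simp: inner_Basis\<close>)
      then show ?thesis using b by (simp add: sum.delta)
    qed
    then have "norm (f (\<xi> + t *\<^sub>R b) - f \<xi> - t *\<^sub>R partial_deriv b f \<xi>) \<le> (DIM('a) * norm (t *\<^sub>R b))\<^sup>2 * B"
      using taylor_second_order[OF f, of \<xi> "t *\<^sub>R b"] by simp
    then have 1: "norm (f (\<xi> + t *\<^sub>R b) - f \<xi> - t *\<^sub>R partial_deriv b f \<xi>) \<le> (real DIM('a))\<^sup>2 * B * t\<^sup>2"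
      using t nb by (simp add: power_mult_distrib mult_ac)
    define d where "d = f (\<xi> + t *\<^sub>R b) - f \<xi>"
    have "norm (t *\<^sub>R partial_deriv b f \<xi>) = norm (d - (d - t *\<^sub>R partial_deriv b f \<xi>))" by simp
    also have "\<dots> \<le> norm d + norm (d - t *\<^sub>R partial_deriv b f \<xi>)" by (rule norm_triangle_ineq4)
    also have "norm d \<le> norm (f (\<xi> + t *\<^sub>R b)) + norm (f \<xi>)" unfolding d_def by (rule norm_triangle_ineq4)
    finally have "norm (t *\<^sub>R partial_deriv b f \<xi>) \<le> norm (f (\<xi> + t *\<^sub>R b)) + norm (f \<xi>) + norm (f (\<xi> + t *\<^sub>R b) - f \<xi> - t *\<^sub>R partial_deriv b f \<xi>)"
      by (simp add: d_def)
    with 1 t show ?thesis using A(1)[of \<xi>] A(1)[of "\<xi> + t *\<^sub>R b"] by simp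
  qed
  show ?thesis
  proof (cases "\<xi> = 0")
    \<comment> \<open>At the origin the estimate in \<open>step\<close> is quadratic in
      \<open>t\<close> on the right and linear on the left; dividing by \<open>t\<close> and letting
      it tend to 0 shows that the derivative vanishes.\<close>
    case True
    have *: "norm (partial_deriv b f 0) \<le> ?C * t" if t: "0 < t" "t \<le> 1" for t
    proof -
      have "t ^ (2 * m) \<le> t\<^sup>2" using t m by (intro power_decreasing) auto
      then have "A * t ^ (2 * m) \<le> A * t\<^sup>2" using A(2) by (rule mult_left_mono)
      then have "t * norm (partial_deriv b f 0) \<le> A * t\<^sup>2 + (real DIM('a))\<^sup>2 * B * t\<^sup>2"
        using step[OF t(1)] True t nb m by (simp add: zero_power)
      also have "\<dots> \<le> ?C * t\<^sup>2" using A(2) by (simp add: distrib_right)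
      also have "\<dots> = t * (?C * t)" by (simp only: power2_eq_square mult_ac)
      finally show ?thesis using t by (simp only: mult_le_cancel_left_pos)
    qed
    have "((\<lambda>t. ?C * t) \<longlongrightarrow> 0) (at_right 0)" by (intro tendsto_mult_right_zero tendsto_ident_at)
    moreover have "eventually (\<lambda>t. norm (partial_deriv b f 0) \<le> ?C * t) (at_right 0)"
      using * by (auto simp: eventually_at_right_field intro!: exI[of _ 1])
    ultimately have "norm (partial_deriv b f 0) \<le> 0"
      by (intro tendsto_lowerbound) auto
    then show ?thesis using True m by (simp add: power_0_left)
  next
    case False
    show ?thesis
    proof (cases "norm \<xi> \<le> 1")
      case True
      \<comment> \<open>This step length balances the difference quotient, of size
        \<open>norm \<xi> ^ (2 * m) / t\<close>, against the second-order error, of size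
        \<open>t\<close>.\<close>
      let ?t = "norm \<xi> ^ m"
      have t: "0 < ?t" "?t \<le> norm \<xi>"
        using False True m power_decreasing[of 1 m "norm \<xi>"] by auto
      have "norm (\<xi> + ?t *\<^sub>R b) \<le> norm \<xi> + norm (?t *\<^sub>R b)" by (rule norm_triangle_ineq)
      also have "\<dots> \<le> 2 * norm \<xi>" using t nb by simp
      finally have "norm (\<xi> + ?t *\<^sub>R b) ^ (2 * m) \<le> (2 * norm \<xi>) ^ (2 * m)" by (intro power_mono) auto
      also have "\<dots> = (2\<^sup>2) ^ m * ?t\<^sup>2"
        by (simp only: power_mult_distrib power_mult[symmetric] mult.commute[of m 2])
      also have "(2\<^sup>2 :: real) = 4" by simp
      finally have "A * norm (\<xi> + ?t *\<^sub>R b) ^ (2 * m) \<le> A * (4 ^ m * ?t\<^sup>2)" using A(2) by (rule mult_left_mono)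
      moreover have "norm \<xi> ^ (2 * m) = ?t\<^sup>2" by (simp only: power_mult[symmetric] mult.commute)
      ultimately have "?t * norm (partial_deriv b f \<xi>) \<le> A * (4 ^ m * ?t\<^sup>2) + A * ?t\<^sup>2 + (real DIM('a))\<^sup>2 * B * ?t\<^sup>2"
        using step[OF t(1)] by simp
      also have "\<dots> = ?t * (?C * ?t)" by (simp add: algebra_simps power2_eq_square)
      finally show ?thesis using t(1) by (simp only: mult_le_cancel_left_pos)
    next
      case False
      have "norm (partial_deriv b f \<xi>) \<le> B" using f(2) b by (auto simp: numeral_2_eq_2)
      also have "\<dots> \<le> ?C"
      proof -
        have "1 * B \<le> (real DIM('a))\<^sup>2 * B" using B0 by (intro mult_right_mono one_le_power) (auto simp: Suc_leI)
        moreover have "0 \<le> A * 4 ^ m" using A(2) by simp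
        ultimately show ?thesis using A(2) by linarith
      qed
      also have "\<dots> \<le> ?C * norm \<xi> ^ m"
      proof -
        have "1 \<le> norm \<xi> ^ m" using False by (intro one_le_power) auto
        moreover have "0 \<le> ?C" using A(2) B0 by simp
        ultimately show ?thesis by (metis mult.right_neutral mult_left_mono)
      qed
      finally show ?thesis .
    qed
  qed
qed

text \<open>Each use of the interpolation estimate halves the order of vanishing; starting from
  \<open>2 ^ k * m\<close>, order \<open>m\<close> is left after \<open>k\<close>
  derivatives.\<close>

lemma vanishing_wbound:
  fixes f :: "'a::euclidean_space \<Rightarrow> complex"
  assumes "test_on R f" "0 \<le> R" "\<And>\<xi>. norm (f \<xi>) \<le> A * norm \<xi> ^ (2 ^ k * m)" "0 \<le> A" "1 \<le> m"
  shows "\<exists>C\<ge>0. \<forall>\<delta>\<in>{0<..1}. wbound (ball 0 \<delta>) 0 k (C * \<delta> ^ m) f"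
  using assms
proof (induction k arbitrary: f A)
  have base: "norm (f \<xi>) \<le> A * \<delta> ^ m"
    if "\<delta> \<in> {0<..1}" "\<xi> \<in> ball 0 \<delta>" "norm (f \<xi>) \<le> A * norm \<xi> ^ (2 ^ k * m)" "0 \<le> A"
    for f :: "'a \<Rightarrow> complex" and \<xi> A \<delta> k
  proof -
    have n: "norm \<xi> \<le> \<delta>" "norm \<xi> \<le> 1" using that by auto
    have "norm \<xi> ^ (2 ^ k * m) \<le> norm \<xi> ^ m" using n by (intro power_decreasing) auto
    also have "\<dots> \<le> \<delta> ^ m" using n by (intro power_mono) auto
    finally have "A * norm \<xi> ^ (2 ^ k * m) \<le> A * \<delta> ^ m" using that(4) by (rule mult_left_mono)
    with that(3) show ?thesis by linarith
  qed
  {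
    case 0
    have "wbound (ball 0 \<delta>) 0 0 (A * \<delta> ^ m) f" if \<delta>: "\<delta> \<in> {0<..1}" for \<delta>
    proof -
      have "norm (f \<xi>) \<le> A * \<delta> ^ m" if \<xi>: "\<xi> \<in> ball 0 \<delta>" for \<xi> by (rule base[where f = f and \<xi> = \<xi> and k = 0, OF \<delta> \<xi> 0(3)[of \<xi>] 0(4)])
      then show ?thesis by simp
    qed
    then show ?case using 0(4) by (intro exI[of _ A]) blast
  next
    case (Suc k)
    obtain B where B: "0 \<le> B" "wbound UNIV 0 2 B f" using test_on_wbound[OF Suc.prems(1,2)] by blast
    have "\<exists>C\<ge>0. \<forall>\<delta>\<in>{0<..1}. wbound (ball 0 \<delta>) 0 k (C * \<delta> ^ m) (partial_deriv b f)" if b: "b \<in> Basis" for b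
    proof (rule Suc.IH[OF test_on_partial_deriv[OF Suc.prems(1) b] Suc.prems(2)])
      have "1 \<le> 2 ^ k * m" using Suc.prems(5) by simp
      moreover have "norm (f \<xi>) \<le> A * norm \<xi> ^ (2 * (2 ^ k * m))" for \<xi>
        using Suc.prems(3)[of \<xi>] by (simp add: mult.assoc)
      ultimately show "norm (partial_deriv b f \<xi>) \<le> (A * 4 ^ (2 ^ k * m) + A + (real DIM('a))\<^sup>2 * B) * norm \<xi> ^ (2 ^ k * m)" for \<xi>
        by (intro vanishing_partial_deriv[OF test_on_smooth[OF Suc.prems(1)] B(2) b _ _ Suc.prems(4)])
      show "0 \<le> A * 4 ^ (2 ^ k * m) + A + (real DIM('a))\<^sup>2 * B" using Suc.prems(4) B(1) by simp
    qed (rule Suc.prems(5))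
    then obtain C where C: "\<And>b. b \<in> Basis \<Longrightarrow> 0 \<le> C b"
      "\<And>b \<delta>. b \<in> Basis \<Longrightarrow> \<delta> \<in> {0<..1} \<Longrightarrow> wbound (ball 0 \<delta>) 0 k (C b * \<delta> ^ m) (partial_deriv b f)"
      by metis
    define D where "D = A + (\<Sum>b\<in>Basis. C b)"
    have D0: "0 \<le> D" unfolding D_def using C(1) Suc.prems(4) by (intro add_nonneg_nonneg sum_nonneg) auto
    have CD: "C b \<le> D" if "b \<in> Basis" for b
      using member_le_sum[OF that, of C] C(1) Suc.prems(4) by (simp add: D_def)
    have AD: "A \<le> D" unfolding D_def using C(1) by (simp add: sum_nonneg)
    have "wbound (ball 0 \<delta>) 0 (Suc k) (D * \<delta> ^ m) f" if \<delta>: "\<delta> \<in> {0<..1}" for \<delta>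
      unfolding wbound.simps
    proof (intro conjI ballI)
      fix \<xi> :: 'a assume \<xi>: "\<xi> \<in> ball 0 \<delta>"
      have "norm (f \<xi>) \<le> A * \<delta> ^ m" by (rule base[where f = f and \<xi> = \<xi> and k = "Suc k", OF \<delta> \<xi> Suc.prems(3)[of \<xi>] Suc.prems(4)])
      also have "\<dots> \<le> D * \<delta> ^ m" using AD \<delta> by (intro mult_right_mono) auto
      finally show "(1 + norm \<xi>) ^ 0 * norm (f \<xi>) \<le> D * \<delta> ^ m" by simp
    next
      fix b :: 'a assume b: "b \<in> Basis"
      have "C b * \<delta> ^ m \<le> D * \<delta> ^ m" using CD[OF b] \<delta> by (intro mult_right_mono) auto
      then show "wbound (ball 0 \<delta>) 0 k (D * \<delta> ^ m) (partial_deriv b f)"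
        by (rule wbound_mono[OF C(2)[OF b \<delta>] order_refl order_refl _ order_refl])
    qed
    with D0 show ?case by blast
  }
qed

lemma test_on_sum_wbound:
  assumes "finite I" "\<And>i. i \<in> I \<Longrightarrow> test_on R (f i) \<and> wbound UNIV 0 n (B i) (f i)"
  shows "test_on R (\<lambda>x. \<Sum>i\<in>I. f i x) \<and> wbound UNIV 0 n (\<Sum>i\<in>I. B i) (\<lambda>x. \<Sum>i\<in>I. f i x)"
  using assms
proof (induction I rule: finite_induct)
  case empty
  show ?case by (simp add: test_on_def wbound_zero)
next
  case (insert i I)
  then show ?case
    using test_on_add[of R "f i" "\<lambda>x. \<Sum>i\<in>I. f i x"]
      wbound_add[OF open_UNIV test_on_smooth test_on_smooth, of R "f i" R "\<lambda>x. \<Sum>i\<in>I. f i x" 0 n]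
    by simp
qed

text \<open>A cut-off homogeneous Taylor term is a combination of fixed test functions with finitely
  many derivatives at the origin as coefficients. The constant is uniform in \<open>f\<close>, so
  small derivatives at the origin give a small test function.\<close>

lemma taylor_term_wbound:
  fixes \<sigma> :: "'a::euclidean_space \<Rightarrow> complex"
  assumes \<sigma>: "test_on R \<sigma>" "0 \<le> R"
  shows "\<exists>C\<ge>0. \<forall>f m. (\<forall>bs. set bs \<subseteq> Basis \<and> length bs = k \<longrightarrow> norm (iter_partial bs f 0) \<le> m) \<longrightarrow>
    test_on R (\<lambda>\<xi>. taylor_term k f 0 \<xi> * \<sigma> \<xi>) \<and> wbound UNIV 0 n (C * m) (\<lambda>\<xi>. taylor_term k f 0 \<xi> * \<sigma> \<xi>)"
proof (induction k)
  case 0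
  obtain B where B: "0 \<le> B" "wbound UNIV 0 n B \<sigma>" using test_on_wbound[OF \<sigma>] by blast
  have "test_on R (\<lambda>\<xi>. f 0 * \<sigma> \<xi>) \<and> wbound UNIV 0 n (B * m) (\<lambda>\<xi>. f 0 * \<sigma> \<xi>)"
    if "norm (f 0) \<le> m" for f :: "'a \<Rightarrow> complex" and m
  proof (intro conjI)
    show "test_on R (\<lambda>\<xi>. f 0 * \<sigma> \<xi>)" by (rule test_on_cmult[OF \<sigma>(1)])
    have "wbound UNIV 0 n (norm (f 0) * B) (\<lambda>\<xi>. f 0 * \<sigma> \<xi>)"
      by (rule wbound_cmult[OF open_UNIV test_on_smooth[OF \<sigma>(1)] B(2)])
    then show "wbound UNIV 0 n (B * m) (\<lambda>\<xi>. f 0 * \<sigma> \<xi>)"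
      by (rule wbound_mono) (use that B(1) in \<open>auto simp: mult.commute mult_left_mono\<close>)
  qed
  then show ?case using B(1) by (intro exI[of _ B]) auto
next
  case (Suc k)
  then obtain C where C: "C \<ge> 0" "\<And>f m. (\<And>bs. set bs \<subseteq> Basis \<Longrightarrow> length bs = k \<Longrightarrow> norm (iter_partial bs f 0) \<le> m) \<Longrightarrow>
    test_on R (\<lambda>\<xi>. taylor_term k f 0 \<xi> * \<sigma> \<xi>) \<and> wbound UNIV 0 n (C * m) (\<lambda>\<xi>. taylor_term k f 0 \<xi> * \<sigma> \<xi>)"
    by blast
  let ?D = "DIM('a) * ((real n + 1) * (1 + R) * C)"
  have "test_on R (\<lambda>\<xi>. taylor_term (Suc k) f 0 \<xi> * \<sigma> \<xi>) \<and> wbound UNIV 0 n (?D * m) (\<lambda>\<xi>. taylor_term (Suc k) f 0 \<xi> * \<sigma> \<xi>)"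
    if H: "\<And>bs. set bs \<subseteq> Basis \<Longrightarrow> length bs = Suc k \<Longrightarrow> norm (iter_partial bs f 0) \<le> m" for f :: "'a \<Rightarrow> complex" and m
  proof -
    have "test_on R (\<lambda>\<xi>. of_real (\<xi> \<bullet> b) * (taylor_term k (partial_deriv b f) 0 \<xi> * \<sigma> \<xi>)) \<and>
        wbound UNIV 0 n ((real n + 1) * (1 + R) * C * m) (\<lambda>\<xi>. of_real (\<xi> \<bullet> b) * (taylor_term k (partial_deriv b f) 0 \<xi> * \<sigma> \<xi>))"
      if b: "b \<in> Basis" for b
    proof -
      have "norm (iter_partial bs (partial_deriv b f) 0) \<le> m" if "set bs \<subseteq> Basis" "length bs = k" for bs
        using H[of "bs @ [b]"] that b by (simp add: iter_partial_snoc)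
      from C(2)[OF this] have T: "test_on R (\<lambda>\<xi>. taylor_term k (partial_deriv b f) 0 \<xi> * \<sigma> \<xi>)"
        and W: "wbound UNIV 0 n (C * m) (\<lambda>\<xi>. taylor_term k (partial_deriv b f) 0 \<xi> * \<sigma> \<xi>)" by auto
      have Cm: "0 \<le> C * m" using wbound_nonneg[OF W] by blast
      have W1: "wbound UNIV (Suc 0) n ((1 + R) ^ Suc 0 * (C * m)) (\<lambda>\<xi>. taylor_term k (partial_deriv b f) 0 \<xi> * \<sigma> \<xi>)"
        by (rule wbound_test_on[OF test_on_zero[OF T] wbound_mono[OF W] \<sigma>(2) Cm]) auto
      have "smooth_on UNIV (\<lambda>x::'a. of_real (x \<bullet> b) :: complex)"
        by (intro smooth_on_linear bounded_linear_compose[OF bounded_linear_of_real] bounded_linear_inner_left) simp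
      from test_on_mult[OF this T] wbound_coord_mult[OF test_on_smooth[OF T] W1 b]
      show ?thesis by (simp add: mult.assoc)
    qed
    from test_on_sum_wbound[OF finite_Basis this]
    show ?thesis by (simp add: sum_distrib_right scaleR_conv_of_real mult.assoc)
  qed
  moreover have "0 \<le> ?D" using C(1) \<sigma>(2) by simp
  ultimately show ?case by (intro exI[of _ ?D]) blast
qed

section \<open>Vanishing of a functional supported at the origin\<close>

context
  fixes \<zeta> :: "real \<Rightarrow> real" and K :: nat and E :: "('a::euclidean_space \<Rightarrow> complex) \<Rightarrow> complex"
    and \<rho> :: "'a \<Rightarrow> real" and \<theta> :: real
  assumes \<zeta>: "lp_cutoff \<zeta>" and E: "test_functional K E" and \<rho>: "mollifier \<rho>" and \<theta>: "0 < \<theta>"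
    and supp: "\<And>u \<delta>. test_on (3/2) u \<Longrightarrow> 0 < \<delta> \<Longrightarrow> (\<And>\<xi>. norm \<xi> < \<delta> \<Longrightarrow> u \<xi> = 0) \<Longrightarrow> E u = 0"
begin

text \<open>The two test functions differ by one that vanishes near the origin. The scale
  \<open>c\<close> is free, so \<open>E\<close> can be tested in arbitrarily small
  neighbourhoods.\<close>

lemma supported_localize:
  assumes u: "test_on (3/2) u" and c: "0 < c"
  shows "E u = E (\<lambda>\<xi>. of_real (\<zeta> (c * norm \<xi>)) * u \<xi>)"
proof -
  let ?s = "\<lambda>\<xi>::'a. complex_of_real (\<zeta> (c * norm \<xi>))"
  have sm: "smooth_on UNIV ?s" by (rule smooth_on_of_real[OF open_UNIV smooth_on_cutoff_dilate[OF \<zeta> c]])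
  have t1: "test_on (3/2) (\<lambda>\<xi>. ?s \<xi> * u \<xi>)" by (rule test_on_mult[OF sm u])
  have t2: "test_on (3/2) (\<lambda>\<xi>. u \<xi> - ?s \<xi> * u \<xi>)" by (rule test_on_diff[OF u t1])
  have "E (\<lambda>\<xi>. u \<xi> - ?s \<xi> * u \<xi>) = 0"
  proof (rule supp[OF t2, of "3/2 / c"])
    fix \<xi> :: 'a assume "norm \<xi> < 3/2 / c"
    then have "c * norm \<xi> \<le> 3/2" using c by (simp add: field_simps)
    then show "u \<xi> - ?s \<xi> * u \<xi> = 0" using cutoff_eq_1[OF \<zeta>, of "c * norm \<xi>"] c by simp
  qed (use c in simp)
  moreover have "E u = E (\<lambda>\<xi>. ?s \<xi> * u \<xi> + (u \<xi> - ?s \<xi> * u \<xi>))" by simp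
  ultimately show ?thesis using test_functional_add[OF E t1 t2] by simp
qed

text \<open>Cutting off at scale \<open>\<delta>\<close> costs \<open>K\<close> negative powers of
  \<open>\<delta>\<close> in the norm of order \<open>K\<close>, while the derivatives of
  \<open>u\<close> there are of size \<open>\<delta> ^ Suc K\<close> by
  \<open>vanishing_wbound\<close>. One power of \<open>\<delta>\<close> is left, and
  \<open>\<delta>\<close> tends to 0.\<close>

lemma supported_high_order:
  assumes u: "test_on (3/2) u" and A: "\<And>\<xi>. norm (u \<xi>) \<le> A * norm \<xi> ^ (2 ^ K * Suc K)" "0 \<le> A"
  shows "E u = 0"
proof -
  obtain C where C: "C \<ge> 0" "\<And>\<delta>. \<delta> \<in> {0<..1} \<Longrightarrow> wbound (ball 0 \<delta>) 0 K (C * \<delta> ^ Suc K) u"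
    using vanishing_wbound[OF u _ A] by auto
  let ?s = "\<lambda>c (\<xi>::'a). complex_of_real (\<zeta> (c * norm \<xi>))"
  have s1: "test_on (5/3) (?s 1)" using test_on_cutoff_dilate[OF \<zeta>, of 1] by simp
  obtain B where B: "B \<ge> 0" "wbound UNIV 0 K B (?s 1)" using test_on_wbound[OF s1] by auto
  obtain G where G: "G \<ge> 0" "\<And>v B. test_on (3/2) v \<Longrightarrow> wbound UNIV 0 K B v \<Longrightarrow> norm (E v) \<le> G * B"
    using test_functional_bound[OF E, of "3/2"] by auto
  let ?H = "G * (2 ^ K * ((5/3) ^ K * B * (C * 2 ^ Suc K)))"
  have *: "norm (E u) \<le> ?H * \<delta>" if \<delta>: "0 < \<delta>" "\<delta> \<le> 1/2" for \<delta>
  proof -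
    \<comment> \<open>With this scale the cutoff vanishes for
      \<open>norm \<xi> \<ge> \<delta>\<close>.\<close>
    define c where "c = 5/3 / \<delta>"
    have c: "1 \<le> c" using \<delta> by (simp add: c_def field_simps)
    have sm: "smooth_on UNIV (?s c)"
      by (rule smooth_on_of_real[OF open_UNIV smooth_on_cutoff_dilate[OF \<zeta>]]) (use c in simp)
    have sc: "wbound UNIV 0 K (c ^ K * B) (?s c)"
      using wbound_dilate[OF test_on_smooth[OF s1] B(2) c] c by simp
    have t: "test_on (3/2) (\<lambda>\<xi>. ?s c \<xi> * u \<xi>)" by (rule test_on_mult[OF sm u])
    let ?W = "2 ^ K * (c ^ K * B * (C * (2 * \<delta>) ^ Suc K))"
    \<comment> \<open>The product rule needs an open set. The ball of twice the radius overlaps the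
      open exterior where the product vanishes, and the two cover the space.\<close>
    have "wbound (ball 0 (2 * \<delta>)) (0 + 0) K ?W (\<lambda>\<xi>. ?s c \<xi> * u \<xi>)"
      using \<delta> smooth_on_subset[OF sm] smooth_on_subset[OF test_on_smooth[OF u]] wbound_mono[OF sc]
      by (intro wbound_mult C(2)) auto
    moreover have "wbound (- cball 0 \<delta>) 0 K ?W (\<lambda>\<xi>. ?s c \<xi> * u \<xi>)"
    proof (rule wbound_zero)
      fix \<xi> :: 'a assume "\<xi> \<in> - cball 0 \<delta>"
      then have "5/3 \<le> c * norm \<xi>" using \<delta> by (simp add: c_def field_simps)
      then show "?s c \<xi> * u \<xi> = 0" by (simp add: cutoff_eq_0[OF \<zeta>])
    qed (use c B C \<delta> in auto)
    moreover have "ball 0 (2 * \<delta>) \<union> - cball (0::'a) \<delta> = UNIV" using \<delta> by auto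
    ultimately have "wbound UNIV 0 K ?W (\<lambda>\<xi>. ?s c \<xi> * u \<xi>)"
      using wbound_Un[of "ball 0 (2 * \<delta>)" 0 K ?W "\<lambda>\<xi>. ?s c \<xi> * u \<xi>" "- cball 0 \<delta>"] by simp
    from G(2)[OF t this] have "norm (E u) \<le> G * ?W"
      using supported_localize[OF u, of c] c by simp
    also have "G * ?W = ?H * \<delta>"
    proof -
      have "c ^ K * (2 * \<delta>) ^ Suc K = (5/3) ^ K * 2 ^ Suc K * \<delta>"
        using \<delta> by (simp add: c_def power_mult_distrib power_divide)
      then show ?thesis by (simp add: mult_ac)
    qed
    finally show ?thesis .
  qed
  have "((\<lambda>t. ?H * t) \<longlongrightarrow> 0) (at_right 0)" by (intro tendsto_mult_right_zero tendsto_ident_at)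
  moreover have "eventually (\<lambda>t. norm (E u) \<le> ?H * t) (at_right 0)"
    using * by (auto simp: eventually_at_right_field intro!: exI[of _ "1/2"])
  ultimately have "norm (E u) \<le> 0" by (intro tendsto_lowerbound) auto
  then show ?thesis by simp
qed

lemma heat_symbol_diff: "\<bar>heat_symbol \<theta> s \<xi> - 1\<bar> \<le> s * norm \<xi> powr \<theta>" if "0 \<le> s"
proof -
  have "1 - s * norm \<xi> powr \<theta> \<le> heat_symbol \<theta> s \<xi>"
    unfolding heat_symbol_def using exp_ge_add_one_self[of "- (s * norm \<xi> powr \<theta>)"] by simp
  moreover have "heat_symbol \<theta> s \<xi> \<le> 1" using that by (simp add: heat_symbol_def)
  ultimately show ?thesis by simp
qed

text \<open>
  The gain over the vanishing order of \<open>\<psi>\<close> comes from \<open>m - 1\<close>, which is of order \<open>\<theta>\<close> at the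
  origin.
\<close>

lemma supported_mollify_tendsto_0:
  assumes IH: "\<And>u A. test_on (3/2) u \<Longrightarrow> 0 \<le> A \<Longrightarrow> (\<And>\<xi>. norm (u \<xi>) \<le> A * norm \<xi> ^ Suc n) \<Longrightarrow> E u = 0"
    and \<psi>: "test_on 1 \<psi>" and A: "0 \<le> A" "\<And>\<xi>. norm (\<psi> \<xi>) \<le> A * norm \<xi> ^ n" and s: "0 < s"
  shows "((\<lambda>\<epsilon>. E (mollify \<rho> \<epsilon> (\<lambda>\<xi>. of_real (heat_symbol \<theta> s \<xi> - 1) * \<psi> \<xi>))) \<longlongrightarrow> 0) (at_right 0)"
proof -
  let ?v = "\<lambda>\<xi>. of_real (heat_symbol \<theta> s \<xi> - 1) * \<psi> \<xi>"
  let ?P = "\<lambda>x. complex_of_real (\<rho> x)"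
  obtain r where r: "r > 0" "\<And>x. r < norm x \<Longrightarrow> \<rho> x = 0" using mollifier_support[OF \<rho>] by blast
  have [measurable]: "\<psi> \<in> borel_measurable borel" by (rule test_on_measurable[OF \<psi>])
  have vle: "norm (?v \<xi>) \<le> (A * s) * norm \<xi> powr (n + \<theta>)" for \<xi>
  proof -
    have "norm (?v \<xi>) \<le> (s * norm \<xi> powr \<theta>) * (A * norm \<xi> ^ n)"
      unfolding norm_mult norm_of_real by (intro mult_mono heat_symbol_diff A(2)) (use s in auto)
    also have "\<dots> = (A * s) * norm \<xi> powr (n + \<theta>)"
      by (cases "\<xi> = 0") (auto simp: powr_add powr_realpow)
    finally show ?thesis .
  qed
  have vint: "integrable lborel ?v"
  proof (rule Bochner_Integration.integrable_bound[OF test_on_integrable[OF \<psi>]])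
    have "\<bar>heat_symbol \<theta> s \<xi> - 1\<bar> \<le> 1" for \<xi> :: 'a using s by (simp add: heat_symbol_def)
    then show "AE \<xi> in lborel. norm (?v \<xi>) \<le> norm (\<psi> \<xi>)"
      unfolding norm_mult norm_of_real by (intro AE_I2 mult_left_le_one_le) auto
  qed (auto simp: heat_symbol_def)
  have vsupp: "?v \<xi> = 0" if "1 < norm \<xi>" for \<xi> using test_on_zero[OF \<psi> that] by simp
  \<comment> \<open>Equal to 1 up to radius 3/4 and 0 from 5/6 on: multiplying by it turns Taylor
    polynomials into test functions of radius 1.\<close>
  let ?\<sigma> = "\<lambda>\<xi>::'a. complex_of_real (\<zeta> (2 * norm \<xi>))"
  have \<sigma>: "test_on 1 ?\<sigma>" by (rule test_on_mono[OF test_on_cutoff_dilate[OF \<zeta>]]) auto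
  obtain B\<sigma> where B\<sigma>: "B\<sigma> \<ge> 0" "\<And>\<xi>. norm (?\<sigma> \<xi>) \<le> B\<sigma>" using test_on_wbound[OF \<sigma>, of 0 0] by auto
  have "\<forall>k. \<exists>C\<ge>0. \<forall>f m. (\<forall>bs. set bs \<subseteq> Basis \<and> length bs = k \<longrightarrow> norm (iter_partial bs f 0) \<le> m) \<longrightarrow>
    test_on 1 (\<lambda>\<xi>. taylor_term k f 0 \<xi> * ?\<sigma> \<xi>) \<and> wbound UNIV 0 K (C * m) (\<lambda>\<xi>. taylor_term k f 0 \<xi> * ?\<sigma> \<xi>)"
    using taylor_term_wbound[OF \<sigma>] by simp
  from choice[OF this] obtain C where C': "\<And>k. C k \<ge> 0 \<and> (\<forall>f m. (\<forall>bs. set bs \<subseteq> Basis \<and> length bs = k \<longrightarrow> norm (iter_partial bs f 0) \<le> m) \<longrightarrow>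
    test_on 1 (\<lambda>\<xi>. taylor_term k f 0 \<xi> * ?\<sigma> \<xi>) \<and> wbound UNIV 0 K (C k * m) (\<lambda>\<xi>. taylor_term k f 0 \<xi> * ?\<sigma> \<xi>))"
    by blast
  have C1: "C k \<ge> 0" for k using C'[of k] by blast
  have C2: "test_on 1 (\<lambda>\<xi>. taylor_term k f 0 \<xi> * ?\<sigma> \<xi>) \<and> wbound UNIV 0 K (C k * m) (\<lambda>\<xi>. taylor_term k f 0 \<xi> * ?\<sigma> \<xi>)"
    if "\<And>bs. set bs \<subseteq> Basis \<Longrightarrow> length bs = k \<Longrightarrow> norm (iter_partial bs f 0) \<le> m" for k f m
    using C'[of k] that by blast
  obtain G where G: "G \<ge> 0" "\<And>v B. test_on 1 v \<Longrightarrow> wbound UNIV 0 K B v \<Longrightarrow> norm (E v) \<le> G * B"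
    using test_functional_bound[OF E, of 1] by auto
  let ?L = "{bs. set bs \<subseteq> (Basis::'a set) \<and> length bs \<le> n}"
  have finL: "finite ?L" by (rule finite_lists_length_le) simp
  define I where "I bs = (\<integral>z. norm (iter_partial bs ?P z) \<partial>lborel)" for bs
  have I0: "0 \<le> I bs" for bs unfolding I_def by (intro integral_nonneg_AE) auto
  define J where "J = (\<Sum>bs\<in>?L. I bs)"
  have IJ: "I bs \<le> J" if "bs \<in> ?L" for bs
    unfolding J_def using member_le_sum[OF that, of I] I0 finL by blast
  have J0: "0 \<le> J" unfolding J_def using I0 by (intro sum_nonneg) auto
  let ?Q = "A * s * r powr (n + \<theta>) * J"
  have Q0: "0 \<le> ?Q" using A s J0 by simp
  let ?H = "G * (\<Sum>k<Suc n. C k * ?Q)"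
  \<comment> \<open>The restriction to \<open>\<epsilon> < 1 / (2 * r)\<close> keeps the mollified
    function supported in radius 3/2, where the localisation of \<open>E\<close> is
    available.\<close>
  have bound: "norm (E (mollify \<rho> \<epsilon> ?v)) \<le> ?H * \<epsilon> powr \<theta>" if \<epsilon>: "0 < \<epsilon>" "\<epsilon> < min 1 (1 / (2 * r))" for \<epsilon>
  proof -
    define u where "u = mollify \<rho> \<epsilon> ?v"
    have "\<epsilon> * r + 1 \<le> 3/2" using \<epsilon> r(1) by (simp add: field_simps)
    then have u: "test_on (3/2) u"
      unfolding u_def using test_on_mono[OF test_on_mollify[OF \<rho> r \<epsilon>(1) vint vsupp]] by blast
    have du: "norm (iter_partial bs u 0) \<le> ?Q * \<epsilon> powr \<theta>" if bs: "bs \<in> ?L" for bs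
    proof -
      have "norm (iter_partial bs u 0) \<le> A * s * (\<epsilon> * r) powr (n + \<theta>) * (1 / \<epsilon>) ^ length bs * I bs"
        unfolding u_def I_def
        by (rule mollify_derivs_at_0[OF \<rho> r \<epsilon>(1) vint vle]) (use A s \<theta> bs in auto)
      also have "\<dots> = A * s * r powr (n + \<theta>) * I bs * (\<epsilon> powr (n + \<theta>) * (1 / \<epsilon>) ^ length bs)"
        by (simp add: powr_mult)
      also have "\<epsilon> powr (n + \<theta>) * (1 / \<epsilon>) ^ length bs = \<epsilon> powr (n + \<theta> - length bs)"
        using \<epsilon>(1) by (simp add: powr_diff powr_realpow power_divide)
      also have "A * s * r powr (n + \<theta>) * I bs * \<epsilon> powr (n + \<theta> - length bs) \<le> ?Q * \<epsilon> powr \<theta>"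
      proof (intro mult_mono mult_left_mono IJ[OF bs])
        \<comment> \<open>Only derivatives of order at most \<open>n\<close> occur and
          \<open>\<epsilon>\<close> is below 1, so at least the power \<open>\<theta>\<close>
          survives the factors \<open>1 / \<epsilon>\<close>.\<close>
        show "\<epsilon> powr (n + \<theta> - length bs) \<le> \<epsilon> powr \<theta>"
          using \<epsilon> bs by (intro powr_mono') auto
      qed (use A s J0 I0 in auto)
      finally show ?thesis .
    qed
    \<comment> \<open>The Taylor polynomial of degree \<open>n\<close> is small by the bounds
      \<open>du\<close> on the derivatives at the origin; the remainder vanishes to order
      \<open>n + 1\<close> and is removed by \<open>IH\<close>.\<close>
    let ?T = "\<lambda>\<xi>. \<Sum>k<Suc n. of_real (1 / fact k) * (taylor_term k u 0 \<xi> * ?\<sigma> \<xi>)"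
    have tk: "test_on 1 (\<lambda>\<xi>. of_real (1 / fact k) * (taylor_term k u 0 \<xi> * ?\<sigma> \<xi>)) \<and>
        wbound UNIV 0 K (C k * ?Q * \<epsilon> powr \<theta>) (\<lambda>\<xi>. of_real (1 / fact k) * (taylor_term k u 0 \<xi> * ?\<sigma> \<xi>))" if k: "k \<in> {..<Suc n}" for k
    proof -
      have t: "test_on 1 (\<lambda>\<xi>. taylor_term k u 0 \<xi> * ?\<sigma> \<xi>) \<and> wbound UNIV 0 K (C k * (?Q * \<epsilon> powr \<theta>)) (\<lambda>\<xi>. taylor_term k u 0 \<xi> * ?\<sigma> \<xi>)"
        by (rule C2) (rule du, use k in auto)
      have "wbound UNIV 0 K (norm (complex_of_real (1 / fact k)) * (C k * (?Q * \<epsilon> powr \<theta>))) (\<lambda>\<xi>. of_real (1 / fact k) * (taylor_term k u 0 \<xi> * ?\<sigma> \<xi>))"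
        using t by (intro wbound_cmult) (auto simp: test_on_smooth)
      moreover have "norm (complex_of_real (1 / fact k)) * (C k * (?Q * \<epsilon> powr \<theta>)) \<le> C k * ?Q * \<epsilon> powr \<theta>"
      proof -
        have "norm (complex_of_real (1 / fact k)) \<le> 1"
          unfolding norm_of_real using fact_ge_1[of k, where 'a = real] by simp
        from mult_right_mono[OF this mult_nonneg_nonneg[OF C1[of k] mult_nonneg_nonneg[OF Q0 powr_ge_zero[of \<epsilon> \<theta>]]]]
        show ?thesis by (simp only: mult_1 mult.assoc)
      qed
      ultimately show ?thesis using t test_on_cmult wbound_mono[OF _ order_refl order_refl _ order_refl] by blast
    qed
    have T: "test_on 1 ?T" "wbound UNIV 0 K (\<Sum>k<Suc n. C k * ?Q * \<epsilon> powr \<theta>) ?T"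
      using test_on_sum_wbound[of "{..<Suc n}" 1 "\<lambda>k \<xi>. of_real (1 / fact k) * (taylor_term k u 0 \<xi> * ?\<sigma> \<xi>)" K
          "\<lambda>k. C k * ?Q * \<epsilon> powr \<theta>", OF finite_lessThan tk] by blast+
    have us: "test_on (3/2) (\<lambda>\<xi>. ?\<sigma> \<xi> * u \<xi>)" by (rule test_on_mult[OF test_on_smooth[OF \<sigma>] u])
    have T': "test_on (3/2) ?T" by (rule test_on_mono[OF T(1)]) simp
    obtain Bu where Bu: "Bu \<ge> 0" "wbound UNIV 0 (Suc n) Bu u" using test_on_wbound[OF u, of 0 "Suc n"] by (auto simp del: wbound.simps)
    have rem: "E (\<lambda>\<xi>. ?\<sigma> \<xi> * u \<xi> - ?T \<xi>) = 0"
    proof (rule IH[of _ "B\<sigma> * (real DIM('a) ^ Suc n * Bu)"])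
      show "test_on (3/2) (\<lambda>\<xi>. ?\<sigma> \<xi> * u \<xi> - ?T \<xi>)" by (rule test_on_diff[OF us T'])
      show "0 \<le> B\<sigma> * (real DIM('a) ^ Suc n * Bu)" using B\<sigma>(1) Bu(1) by simp
      fix \<xi>
      have "?\<sigma> \<xi> * u \<xi> - ?T \<xi> = ?\<sigma> \<xi> * (u (0 + \<xi>) - (\<Sum>k<Suc n. (1 / fact k) *\<^sub>R taylor_term k u 0 \<xi>))"
        by (simp add: right_diff_distrib sum_distrib_left scaleR_conv_of_real mult_ac del: sum.lessThan_Suc)
      also have "norm \<dots> \<le> B\<sigma> * ((DIM('a) * norm \<xi>) ^ Suc n * Bu)"
        unfolding norm_mult by (intro mult_mono B\<sigma> taylor_remainder[OF test_on_smooth[OF u] Bu(2)]) auto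
      finally show "norm (?\<sigma> \<xi> * u \<xi> - ?T \<xi>) \<le> B\<sigma> * (real DIM('a) ^ Suc n * Bu) * norm \<xi> ^ Suc n"
        by (simp add: power_mult_distrib mult_ac)
    qed
    have "E u = E (\<lambda>\<xi>. ?\<sigma> \<xi> * u \<xi>)" by (rule supported_localize[OF u]) simp
    also have "\<dots> = E (\<lambda>\<xi>. ?T \<xi> + (?\<sigma> \<xi> * u \<xi> - ?T \<xi>))" by simp
    also have "\<dots> = E ?T" using test_functional_add[OF E T' test_on_diff[OF us T']] rem by simp
    finally have "norm (E u) \<le> G * (\<Sum>k<Suc n. C k * ?Q * \<epsilon> powr \<theta>)" using G(2)[OF T] by simp
    also have "\<dots> = ?H * \<epsilon> powr \<theta>" by (simp only: sum_distrib_right mult.assoc)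
    finally show ?thesis unfolding u_def .
  qed
  show ?thesis
  proof (rule Lim_null_comparison)
    have "eventually (\<lambda>\<epsilon>::real. 0 < \<epsilon> \<and> \<epsilon> < min 1 (1 / (2 * r))) (at_right 0)"
      using r(1) by (auto simp: eventually_at_right_field intro!: exI[of _ "min 1 (1 / (2 * r))"])
    then show "\<forall>\<^sub>F \<epsilon> in at_right 0. norm (E (mollify \<rho> \<epsilon> ?v)) \<le> ?H * \<epsilon> powr \<theta>"
      by eventually_elim (use bound in blast)
    have "((\<lambda>\<epsilon>. \<epsilon> powr \<theta>) \<longlongrightarrow> 0) (at_right 0)"
      using \<theta> by (intro tendsto_eq_intros) (auto simp: eventually_at_right_field intro!: exI[of _ 1])
    then show "((\<lambda>\<epsilon>. ?H * \<epsilon> powr \<theta>) \<longlongrightarrow> 0) (at_right 0)" by (rule tendsto_mult_right_zero)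
  qed
qed

text \<open>Descending induction on the order of vanishing. At order \<open>2 ^ K * Suc K\<close>
  the finite order of \<open>E\<close> decides; each step down supplies the premise of
  \<open>H\<close> through \<open>supported_mollify_tendsto_0\<close>. Order 0 is mere
  boundedness.\<close>

lemma supported_eq_0:
  assumes H: "\<And>\<psi>. test_on 1 \<psi> \<Longrightarrow>
      (\<And>s. 0 < s \<Longrightarrow> ((\<lambda>\<epsilon>. E (mollify \<rho> \<epsilon> (\<lambda>\<xi>. of_real (heat_symbol \<theta> s \<xi> - 1) * \<psi> \<xi>))) \<longlongrightarrow> 0) (at_right 0)) \<Longrightarrow> E \<psi> = 0"
    and \<psi>: "test_on 1 \<psi>"
  shows "E \<psi> = 0"
proof -
  have "\<forall>u A. test_on (3/2) u \<longrightarrow> 0 \<le> A \<longrightarrow> (\<forall>\<xi>. norm (u \<xi>) \<le> A * norm \<xi> ^ n) \<longrightarrow> E u = 0" if "n \<le> 2 ^ K * Suc K" for n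
    using that
  proof (induction n rule: inc_induct)
    case base
    then show ?case using supported_high_order by blast
  next
    case (step n)
    show ?case
    proof (intro allI impI)
      fix u :: "'a \<Rightarrow> complex" and A :: real assume u: "test_on (3/2) u" "0 \<le> A" "\<forall>\<xi>. norm (u \<xi>) \<le> A * norm \<xi> ^ n"
      \<comment> \<open>\<open>H\<close> concerns radius 1 and the induction radius 3/2, the room
        that mollification needs; localising leads back from 3/2 to 1 without changing the value of
        \<open>E\<close>.\<close>
      let ?\<sigma> = "\<lambda>\<xi>::'a. complex_of_real (\<zeta> (2 * norm \<xi>))"
      have \<sigma>: "test_on 1 ?\<sigma>" by (rule test_on_mono[OF test_on_cutoff_dilate[OF \<zeta>]]) auto
      obtain B\<sigma> where B\<sigma>: "B\<sigma> \<ge> 0" "\<And>\<xi>. norm (?\<sigma> \<xi>) \<le> B\<sigma>" using test_on_wbound[OF \<sigma>, of 0 0] by auto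
      have t: "test_on 1 (\<lambda>\<xi>. ?\<sigma> \<xi> * u \<xi>)"
        using test_on_mult[OF test_on_smooth[OF u(1)] \<sigma>] by (simp add: mult.commute)
      have le: "norm (?\<sigma> \<xi> * u \<xi>) \<le> (B\<sigma> * A) * norm \<xi> ^ n" for \<xi>
        unfolding norm_mult mult.assoc using u(2,3) B\<sigma> by (intro mult_mono) auto
      have "E (\<lambda>\<xi>. ?\<sigma> \<xi> * u \<xi>) = 0"
        by (rule H[OF t], rule supported_mollify_tendsto_0[OF _ t _ le])
           (use step.IH B\<sigma>(1) u(2) in auto)
      then show "E u = 0" using supported_localize[OF u(1), of 2] by simp
    qed
  qed
  from this[of 0] obtain *: "\<And>u A. test_on (3/2) u \<Longrightarrow> 0 \<le> A \<Longrightarrow> (\<And>\<xi>. norm (u \<xi>) \<le> A) \<Longrightarrow> E u = 0"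
    by auto
  obtain B where "B \<ge> 0" "\<And>\<xi>. norm (\<psi> \<xi>) \<le> B" using test_on_wbound[OF \<psi>, of 0 0] by auto
  then show ?thesis using * test_on_mono[OF \<psi>, of "3/2"] by auto
qed

end

section \<open>Functionals given by distributions and by functions\<close>

lemma fourier_add:
  fixes u v :: "'a::euclidean_space \<Rightarrow> complex"
  assumes "integrable lborel u" "integrable lborel v"
  shows "fourier (\<lambda>x. u x + v x) = (\<lambda>\<xi>. fourier u \<xi> + fourier v \<xi>)"
  using integrable_cis_mult(1)[OF assms(1)] integrable_cis_mult(1)[OF assms(2)]
  by (auto simp: fourier_alt distrib_left)

lemma fourier_cmult: "fourier (\<lambda>x. c * u x) = (\<lambda>\<xi>. c * fourier u \<xi>)"
  for u :: "'a::euclidean_space \<Rightarrow> complex"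
  by (rule ext) (simp add: fourier_alt mult.left_commute[of _ c])

lemma test_on_wbound_weight:
  assumes "test_on R u" "0 \<le> R" "wbound UNIV 0 n B u"
  shows "wbound UNIV k n ((1 + R) ^ k * B) u"
  by (rule wbound_test_on[OF test_on_zero[OF assms(1)] wbound_mono[OF assms(3)] assms(2) wbound_nonneg[OF assms(3)]]) auto

text \<open>The transform exchanges derivatives and weights, and on compactly supported functions
  weights cost only a power of \<open>1 + R\<close>. The order of the functional is thus the number
  of weights in the tempered bound.\<close>

lemma dist_fourier_test_functional:
  fixes \<mu> :: "('a::euclidean_space) distrib"
  assumes \<mu>: "\<mu> \<in> tempered"
  shows "\<exists>K. test_functional K (dist_fourier \<mu>)"
proof -
  obtain C n where C: "C \<ge> 0" "\<And>\<phi> B. \<phi> \<in> schwartz \<Longrightarrow> wbound UNIV n n B \<phi> \<Longrightarrow> norm (\<mu> \<phi>) \<le> C * B"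
    using tempered_wbound[OF \<mu>] by blast
  \<comment> \<open>The radius may be negative, hence the maximum with 0.\<close>
  have sch: "u \<in> schwartz" if "test_on R u" for R and u :: "'a \<Rightarrow> complex"
    using test_on_schwartz[OF test_on_mono[OF that, of "max R 0"]] by simp
  have "test_functional n (dist_fourier \<mu>)"
    unfolding test_functional_def
  proof (intro conjI allI impI)
    fix R and u v :: "'a \<Rightarrow> complex" assume u: "test_on R u" and v: "test_on R v"
    show "dist_fourier \<mu> (\<lambda>x. u x + v x) = dist_fourier \<mu> u + dist_fourier \<mu> v"
      unfolding dist_fourier_def fourier_add[OF schwartz_integrable[OF sch[OF u]] schwartz_integrable[OF sch[OF v]]]
      by (intro tempered_add \<mu> fourier_schwartz sch[OF u] sch[OF v])
  next
    fix R c and u :: "'a \<Rightarrow> complex" assume u: "test_on R u"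
    show "dist_fourier \<mu> (\<lambda>x. c * u x) = c * dist_fourier \<mu> u"
      unfolding dist_fourier_def fourier_cmult by (intro tempered_cmult \<mu> fourier_schwartz sch[OF u])
  next
    fix R :: real assume R: "0 \<le> R"
    let ?M = "decay_dim TYPE('a) + n"
    let ?G = "real ((n + 1) ^ n) * ((1 + DIM('a)) ^ n * (fourier_const TYPE('a) * decay_mass TYPE('a)))"
    have "norm (dist_fourier \<mu> u) \<le> C * (?G * (1 + R) ^ ?M) * B" if u: "test_on R u" "wbound UNIV 0 n B u" for u B
    proof -
      have "wbound UNIV n n (real ((n + 1) ^ n) * ((1 + DIM('a)) ^ n * (fourier_const TYPE('a) * decay_mass TYPE('a) * ((1 + R) ^ ?M * B)))) (fourier u)"
        by (rule fourier_wbound[OF sch[OF u(1)] test_on_wbound_weight[OF u(1) R u(2)]])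
      from C(2)[OF fourier_schwartz[OF sch[OF u(1)]] this] show ?thesis
        by (simp add: dist_fourier_def mult_ac)
    qed
    moreover have "0 \<le> C * (?G * (1 + R) ^ ?M)"
      using C(1) R fourier_const_pos[where ?'a = 'a] decay_mass_nonneg[where ?'a = 'a]
      by (intro mult_nonneg_nonneg) auto
    ultimately show "\<exists>C\<ge>0. \<forall>u B. test_on R u \<longrightarrow> wbound UNIV 0 n B u \<longrightarrow> norm (dist_fourier \<mu> u) \<le> C * B"
      by (intro exI[of _ "C * (?G * (1 + R) ^ ?M)"]) blast
  qed
  then show ?thesis by blast
qed

lemma test_functional_mono:
  assumes "test_functional K F" "K \<le> K'"
  shows "test_functional K' F"
  using assms wbound_mono[OF _ order_refl assms(2) order_refl order_refl]
  unfolding test_functional_def by meson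

lemma test_functional_diff:
  fixes F G :: "('a::euclidean_space \<Rightarrow> complex) \<Rightarrow> complex"
  assumes F: "test_functional K F" and G: "test_functional K G"
  shows "test_functional K (\<lambda>u. F u - G u)"
  unfolding test_functional_def
proof (intro conjI allI impI)
  fix R :: real assume "0 \<le> R"
  then obtain C D where CD: "C \<ge> 0" "D \<ge> 0" "\<And>u B. test_on R u \<Longrightarrow> wbound UNIV 0 K B u \<Longrightarrow> norm (F u) \<le> C * B"
    "\<And>u B. test_on R u \<Longrightarrow> wbound UNIV 0 K B u \<Longrightarrow> norm (G u) \<le> D * B"
    using test_functional_bound[OF F] test_functional_bound[OF G] by metis
  have "norm (F u - G u) \<le> (C + D) * B" if "test_on R u" "wbound UNIV 0 K B u" for u B
    using norm_triangle_ineq4[of "F u" "G u"] CD(3)[OF that] CD(4)[OF that] by (simp add: distrib_right)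
  then show "\<exists>C\<ge>0. \<forall>u B. test_on R u \<longrightarrow> wbound UNIV 0 K B u \<longrightarrow> norm (F u - G u) \<le> C * B"
    using CD(1,2) by (intro exI[of _ "C + D"]) auto
qed (simp_all add: test_functional_add[OF F] test_functional_add[OF G] test_functional_cmult[OF F] test_functional_cmult[OF G] right_diff_distrib)

lemma pairing_fourier_schwartz:
  fixes u :: "'a::euclidean_space \<Rightarrow> complex"
  assumes "u \<in> schwartz" "wbound UNIV (decay_dim TYPE('a)) (decay_dim TYPE('a)) B u"
  shows "pairing p q (pairing_const q TYPE('a) * ((1 + DIM('a)) ^ decay_dim TYPE('a) * (fourier_const TYPE('a) * decay_mass TYPE('a) * B))) (\<lambda>x. ennreal (norm (fourier u x)))"
proof (rule pairing_decay)
  let ?K = "(1 + DIM('a)) ^ decay_dim TYPE('a) * (fourier_const TYPE('a) * decay_mass TYPE('a) * B)"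
  show "0 \<le> ?K"
    using fourier_const_pos[where ?'a = 'a] decay_mass_nonneg[where ?'a = 'a] wbound_nonneg[OF assms(2)]
    by (intro mult_nonneg_nonneg) auto
  show "ennreal (norm (fourier u x)) \<le> ennreal (?K * inverse ((1 + norm x) ^ decay_dim TYPE('a)))" for x
    by (intro ennreal_leI le_decay fourier_decay assms)
  show "(\<lambda>x. ennreal (norm (fourier u x))) \<in> borel_measurable borel"
    using schwartz_measurable[OF assms(1)] by measurable
qed

lemma pairing_fourier_test_on:
  fixes u :: "'a::euclidean_space \<Rightarrow> complex"
  assumes "u \<in> schwartz"
  shows "\<exists>C. pairing p q C (\<lambda>x. ennreal (norm (fourier u x)))"
  using pairing_fourier_schwartz[OF assms] schwartz_wbound[OF assms] by blast

text \<open>Bounds on \<open>decay_dim\<close> derivatives of \<open>u\<close> make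
  \<open>fourier u\<close> decay fast enough to be paired with a Morrey function; compact support
  absorbs the weights.\<close>

lemma function_test_functional:
  fixes h :: "'a::euclidean_space \<Rightarrow> real"
  assumes h: "morrey p q K (\<lambda>x. ennreal \<bar>h x\<bar>)" "0 \<le> K" "h \<in> borel_measurable borel"
  shows "test_functional (decay_dim TYPE('a)) (\<lambda>u. \<integral>x. of_real (h x) * fourier u x \<partial>lborel)"
proof -
  have sch: "u \<in> schwartz" if "test_on R u" for R and u :: "'a \<Rightarrow> complex"
    using test_on_schwartz[OF test_on_mono[OF that, of "max R 0"]] by simp
  have int: "integrable lborel (\<lambda>x. of_real (h x) * fourier u x)" if "u \<in> schwartz" for u
    using pairing_fourier_test_on[OF that, of p q] pairing_integrable(1)[OF _ _ h] schwartz_measurable[OF fourier_schwartz[OF that]] by blast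
  let ?L = "\<lambda>u. \<integral>x. of_real (h x) * fourier u x \<partial>lborel"
  show ?thesis
    unfolding test_functional_def
  proof (intro conjI allI impI)
    fix R and u v :: "'a \<Rightarrow> complex" assume "test_on R u" "test_on R v"
    then have u: "u \<in> schwartz" and v: "v \<in> schwartz" using sch by auto
    show "?L (\<lambda>x. u x + v x) = ?L u + ?L v"
      unfolding fourier_add[OF schwartz_integrable[OF u] schwartz_integrable[OF v]]
      using int[OF u] int[OF v] by (simp add: distrib_left)
  next
    fix R c and u :: "'a \<Rightarrow> complex" assume "test_on R u"
    show "?L (\<lambda>x. c * u x) = c * ?L u"
      unfolding fourier_cmult by (simp add: mult.left_commute[of _ c])
  next
    fix R :: real assume R: "0 \<le> R"
    let ?M = "decay_dim TYPE('a)"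
    let ?G = "pairing_const q TYPE('a) * ((1 + DIM('a)) ^ ?M * (fourier_const TYPE('a) * decay_mass TYPE('a)))"
    have "norm (?L u) \<le> ?G * (1 + R) ^ ?M * K * B" if u: "test_on R u" "wbound UNIV 0 ?M B u" for u B
      using pairing_integrable(2)[OF pairing_fourier_schwartz[OF sch[OF u(1)] test_on_wbound_weight[OF u(1) R u(2)]]
          schwartz_measurable[OF fourier_schwartz[OF sch[OF u(1)]]] h]
      by (simp add: mult_ac)
    moreover have "0 \<le> ?G * (1 + R) ^ ?M * K"
      using R h(2) fourier_const_pos[where ?'a = 'a] decay_mass_nonneg[where ?'a = 'a]
      by (intro mult_nonneg_nonneg) (auto simp: pairing_const_def)
    ultimately show "\<exists>C\<ge>0. \<forall>u B. test_on R u \<longrightarrow> wbound UNIV 0 ?M B u \<longrightarrow> norm (?L u) \<le> C * B"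
      by (intro exI[of _ "?G * (1 + R) ^ ?M * K"]) blast
  qed
qed

section \<open>The time-integrated symbol\<close>

text \<open>The integral of \<open>heat_symbol \<theta> \<tau> \<xi>\<close> over
  \<open>\<tau>\<close> from 0 to \<open>s\<close>. The form through \<open>expser 1\<close> avoids
  dividing by the power of the norm and gives the value \<open>s\<close> at the origin.\<close>

definition duhamel_symbol :: "real \<Rightarrow> real \<Rightarrow> 'a::euclidean_space \<Rightarrow> real" where
  "duhamel_symbol \<theta> s \<xi> = s * expser 1 (s * norm \<xi> powr \<theta>)"

lemma duhamel_symbol_pos: "0 < s \<Longrightarrow> 0 < duhamel_symbol \<theta> s \<xi>"
  using expser_1_pos[of "s * norm \<xi> powr \<theta>"] by (simp add: duhamel_symbol_def)

lemma duhamel_symbol_mult: "X = norm \<xi> powr \<theta> \<Longrightarrow> X * duhamel_symbol \<theta> s \<xi> = 1 - heat_symbol \<theta> s \<xi>"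
  using exp_minus_eq[of "s * norm \<xi> powr \<theta>"] by (simp add: duhamel_symbol_def heat_symbol_def)

text \<open>First-order expansion in time with its remainder written out. The remainder carries a
  factor \<open>norm \<xi> powr \<theta>\<close>, as the low-frequency kernel bound requires, and
  apart from its square prefactor \<open>h\<close> enters only through an entire function, which
  gives uniformity for bounded \<open>h\<close>.\<close>

lemma duhamel_symbol_diff:
  "duhamel_symbol \<theta> (s + h) \<xi> = duhamel_symbol \<theta> s \<xi> + h * heat_symbol \<theta> s \<xi>
     + (- (h\<^sup>2)) * (norm \<xi> powr \<theta> * (exp (- (s * norm \<xi> powr \<theta>)) * expser 2 (h * norm \<xi> powr \<theta>)))"
proof -
  let ?X = "norm \<xi> powr \<theta>"
  let ?r = "h * heat_symbol \<theta> s \<xi> + (- (h\<^sup>2)) * (?X * (exp (- (s * ?X)) * expser 2 (h * ?X)))"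
  have r: "?r = heat_symbol \<theta> s \<xi> * (h * expser 1 (h * ?X))"
    unfolding expser_1_eq[of "h * ?X"] by (simp add: heat_symbol_def algebra_simps power2_eq_square)
  have "duhamel_symbol \<theta> (s + h) \<xi> - duhamel_symbol \<theta> s \<xi> = ?r"
  \<comment> \<open>The two sides are compared after multiplication by \<open>?X\<close>; where
    \<open>?X\<close> vanishes the values are computed directly.\<close>
  proof (cases "?X = 0")
    case True
    then show ?thesis unfolding r using expser_1_eq[of 0] by (simp add: duhamel_symbol_def heat_symbol_def)
  next
    case False
    have "?X * (duhamel_symbol \<theta> (s + h) \<xi> - duhamel_symbol \<theta> s \<xi>) = heat_symbol \<theta> s \<xi> - heat_symbol \<theta> (s + h) \<xi>"
      using duhamel_symbol_mult[of ?X \<xi> \<theta> "s + h"] duhamel_symbol_mult[of ?X \<xi> \<theta> s] by (simp add: right_diff_distrib)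
    also have "heat_symbol \<theta> (s + h) \<xi> = heat_symbol \<theta> s \<xi> * exp (- (h * ?X))"
      by (simp add: heat_symbol_def exp_add[symmetric] algebra_simps)
    also have "heat_symbol \<theta> s \<xi> - heat_symbol \<theta> s \<xi> * exp (- (h * ?X)) = ?X * ?r"
      unfolding r exp_minus_eq[of "h * ?X"] by (simp add: algebra_simps)
    finally show ?thesis using False by simp
  qed
  then show ?thesis by simp
qed

text \<open>Separates the value \<open>1 / s\<close> at the origin from a part divisible by
  \<open>norm \<xi> powr \<theta>\<close>. After localisation the former is handled by the kernel of
  the cutoff, the latter by the dyadic kernel bounds.\<close>

lemma inverse_duhamel_symbol:
  assumes "0 < s"
  shows "inverse (duhamel_symbol \<theta> s \<xi>) = 1 / s + norm \<xi> powr \<theta> * (expser 2 (s * norm \<xi> powr \<theta>) * inverse (expser 1 (s * norm \<xi> powr \<theta>)))"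
proof -
  let ?y = "s * norm \<xi> powr \<theta>"
  have p: "expser 1 ?y \<noteq> 0" using expser_1_pos[of ?y] by simp
  have "1 = expser 1 ?y + ?y * expser 2 ?y" using expser_1_eq[of ?y] by simp
  then have "inverse (expser 1 ?y) = 1 + ?y * (expser 2 ?y * inverse (expser 1 ?y))"
    using p by (simp add: field_simps)
  moreover have "inverse s * (1 + ?y * u) = 1 / s + norm \<xi> powr \<theta> * u" for u
    using assms by (simp add: field_simps)
  moreover have "inverse (duhamel_symbol \<theta> s \<xi>) = inverse s * inverse (expser 1 ?y)"
    unfolding duhamel_symbol_def by (rule inverse_mult_distrib)
  ultimately show ?thesis by metis
qed

lemma smooth_on_expser_product: "smooth_on UNIV (\<lambda>z::real \<times> real. expser m (fst z * snd z))"
proof (rule smooth_on_compose[OF open_UNIV _ _ smooth_on_expser])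
  show "smooth_on UNIV (\<lambda>z::real \<times> real. fst z * snd z)"
    by (intro smooth_on_mult smooth_on_linear bounded_linear_fst bounded_linear_snd) auto
qed simp

lemma smooth_on_snd_compose: "smooth_on UNIV f \<Longrightarrow> smooth_on UNIV (\<lambda>z::real \<times> real. f (snd z))"
  by (rule smooth_on_compose[OF open_UNIV _ smooth_on_linear[OF open_UNIV bounded_linear_snd]]) auto

lemma smooth_on_scaled: "smooth_on UNIV f \<Longrightarrow> smooth_on UNIV (\<lambda>x::real. f (c * x))"
  using smooth_on_dilate[of f c] by simp

lemma smooth_on_quotient_expser: "smooth_on UNIV (\<lambda>z::real \<times> real. expser 2 (fst z * snd z) * inverse (expser 1 (fst z * snd z)))"
proof (rule smooth_on_mult[OF open_UNIV smooth_on_expser_product])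
  show "smooth_on UNIV (\<lambda>z::real \<times> real. inverse (expser 1 (fst z * snd z)))"
    by (rule smooth_on_compose[OF open_UNIV _ smooth_on_expser_product smooth_on_inverse]) (use expser_1_pos in \<open>auto simp del: One_nat_def\<close>)
qed

lemma smooth_on_exp_expser: "smooth_on UNIV (\<lambda>z::real \<times> real. exp (- (s * snd z)) * expser 2 (fst z * snd z))"
proof (rule smooth_on_mult[OF open_UNIV _ smooth_on_expser_product])
  have "smooth_on UNIV (\<lambda>x. exp ((- s) * x))" by (rule smooth_on_scaled[OF smooth_on_exp])
  from smooth_on_snd_compose[OF this] show "smooth_on UNIV (\<lambda>z::real \<times> real. exp (- (s * snd z)))" by simp
qed

text \<open>The power of the norm is singular only at the origin, near which \<open>\<phi>\<close>
  vanishes; the product is therefore smooth jointly in \<open>\<xi>\<close> and the parameter, and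
  compactness gives uniform bounds.\<close>

lemma off_origin_family:
  fixes \<Psi> :: "real \<times> real \<Rightarrow> real" and \<phi> :: "'a::euclidean_space \<Rightarrow> complex"
  assumes \<Psi>: "smooth_on UNIV \<Psi>" and \<phi>: "test_on R \<phi>" "0 \<le> R" and \<delta>: "0 < \<delta>" "\<And>\<xi>. norm \<xi> < \<delta> \<Longrightarrow> \<phi> \<xi> = 0"
  shows "\<exists>B\<ge>0. \<forall>c\<in>{-C..C}. test_on R (\<lambda>\<xi>. of_real (\<Psi> (c, norm \<xi> powr \<theta>)) * \<phi> \<xi>) \<and>
    wbound UNIV k n B (\<lambda>\<xi>. of_real (\<Psi> (c, norm \<xi> powr \<theta>)) * \<phi> \<xi>)"
proof -
  let ?S = "{z :: 'a \<times> real. fst z \<noteq> 0}" and ?T = "{z :: 'a \<times> real. norm (fst z) < \<delta>}"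
  let ?f = "\<lambda>z :: 'a \<times> real. complex_of_real (\<Psi> (snd z, norm (fst z) powr \<theta>)) * \<phi> (fst z)"
  have S: "open ?S" by (intro open_Collect_neq continuous_intros)
  have T: "open ?T" by (intro open_Collect_less continuous_intros)
  have p: "smooth_on ?S (\<lambda>z. norm (fst z) powr \<theta>)"
    by (rule smooth_on_compose[OF S _ smooth_on_linear[OF S bounded_linear_fst] smooth_on_norm_powr[of "- {0}"]]) auto
  have "smooth_on ?S (\<lambda>z. \<Psi> (snd z, norm (fst z) powr \<theta>))"
    by (rule smooth_on_compose[OF S _ smooth_on_Pair[OF S smooth_on_linear[OF S bounded_linear_snd] p] \<Psi>]) simp
  from smooth_on_of_real[OF S this]
  have "smooth_on ?S ?f"
    by (rule smooth_on_mult[OF S])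
       (rule smooth_on_compose[OF S _ smooth_on_linear[OF S bounded_linear_fst] test_on_smooth[OF \<phi>(1)]], simp)
  moreover have "smooth_on ?T ?f"
    using smooth_on_cong[OF T, of "\<lambda>_. 0" ?f] \<delta>(2) by simp
  ultimately have "smooth_on (?S \<union> ?T) ?f" by (rule smooth_on_Un)
  moreover have "?S \<union> ?T = UNIV" using \<delta>(1) by auto
  ultimately have sm: "smooth_on UNIV ?f" by (simp only:)
  have "\<exists>B\<ge>0. \<forall>c\<in>{-C..C}. test_on R (\<lambda>\<xi>. ?f (\<xi>, c)) \<and> wbound UNIV k n B (\<lambda>\<xi>. ?f (\<xi>, c))"
    by (rule test_family_bound[OF sm]) (use \<phi> in \<open>auto simp: test_on_zero\<close>)
  then show ?thesis by simp
qed

corollary off_origin_test_on: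
  assumes "smooth_on UNIV f" "test_on R \<phi>" "0 \<le> R" "0 < \<delta>" "\<And>\<xi>. norm \<xi> < \<delta> \<Longrightarrow> \<phi> \<xi> = 0"
  shows "test_on R (\<lambda>\<xi>. of_real (f (norm \<xi> powr \<theta>)) * \<phi> \<xi>)"
  using off_origin_family[OF smooth_on_snd_compose[OF assms(1)] assms(2-), of 0 \<theta> 0 0] by simp blast

section \<open>Time integration and regularised products\<close>

lemma has_vector_derivative_quadratic:
  fixes \<Phi> :: "real \<Rightarrow> complex"
  assumes "\<And>h. \<bar>h\<bar> \<le> 1 \<Longrightarrow> norm (\<Phi> (s + h) - \<Phi> s - of_real h * d) \<le> C * h\<^sup>2"
  shows "(\<Phi> has_vector_derivative d) (at s)"
  unfolding has_vector_derivative_def has_derivative_at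
proof (intro conjI bounded_linear_scaleR_left)
  have lim: "((\<lambda>h. C * \<bar>h\<bar>) \<longlongrightarrow> 0) (at 0)"
    by (intro tendsto_mult_right_zero tendsto_rabs_zero tendsto_ident_at)
  have "eventually (\<lambda>h::real. \<bar>h\<bar> \<le> 1) (at 0)"
    unfolding eventually_at by (intro exI[of _ 1]) auto
  then have ev: "eventually (\<lambda>h. norm (norm (\<Phi> (s + h) - \<Phi> s - h *\<^sub>R d) / norm h) \<le> C * \<bar>h\<bar>) (at 0)"
  proof eventually_elim
    case (elim h)
    have "norm (\<Phi> (s + h) - \<Phi> s - h *\<^sub>R d) \<le> C * (\<bar>h\<bar> * \<bar>h\<bar>)"
      using assms[OF elim] by (simp add: scaleR_conv_of_real power2_eq_square)
    then show ?case
      by (cases "h = 0") (simp_all add: pos_divide_le_eq mult.assoc)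
  qed
  show "(\<lambda>h. norm (\<Phi> (s + h) - \<Phi> s - h *\<^sub>R d) / norm h) \<midarrow>0\<rightarrow> 0"
    by (rule Lim_null_comparison[OF ev lim])
qed

text \<open>The fundamental theorem of calculus in the variable \<open>t - \<tau>\<close>; passing
  to the open interval matches the domain of the Duhamel integral.\<close>

lemma has_integral_reflected_derivative:
  fixes \<Phi> :: "real \<Rightarrow> complex"
  assumes t: "0 < t" and d: "\<And>s. (\<Phi> has_vector_derivative \<Phi>' s) (at s)" and 0: "\<Phi> 0 = 0"
  shows "((\<lambda>\<tau>. \<Phi>' (t - \<tau>)) has_integral \<Phi> t) {0<..<t}"
proof -
  have "((\<lambda>\<tau>. - \<Phi> (t - \<tau>)) has_vector_derivative \<Phi>' (t - \<tau>)) (at \<tau> within {0..t})" for \<tau>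
  proof -
    have "((\<lambda>\<tau>. t - \<tau>) has_vector_derivative (- 1)) (at \<tau>)"
      by (auto intro!: derivative_eq_intros simp: has_real_derivative_iff_has_vector_derivative[symmetric])
    from vector_diff_chain_at[OF this d]
    have "((\<lambda>\<tau>. \<Phi> (t - \<tau>)) has_vector_derivative - \<Phi>' (t - \<tau>)) (at \<tau>)" by (simp add: o_def)
    from has_vector_derivative_minus[OF this] show ?thesis
      by (auto intro: has_vector_derivative_at_within)
  qed
  then have "((\<lambda>\<tau>. \<Phi>' (t - \<tau>)) has_integral (- \<Phi> (t - t) - - \<Phi> (t - 0))) {0..t}"
    using t by (intro fundamental_theorem_of_calculus) auto
  then show ?thesis
    using has_integral_open_interval[of "\<lambda>\<tau>. \<Phi>' (t - \<tau>)" "\<Phi> t" 0 t] 0 by (simp add: cbox_interval)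
qed

text \<open>Makes the definite description in \<open>dist_mult\<close> meaningful. The cutoff
  supplies a mollifier; without one, every value would qualify.\<close>

lemma has_reg_value_unique:
  fixes F :: "('a::euclidean_space) distrib"
  assumes "lp_cutoff \<zeta>" "has_reg_value F \<psi> v" "has_reg_value F \<psi> w"
  shows "v = w"
proof -
  obtain \<rho> :: "'a \<Rightarrow> real" where "mollifier \<rho>" using exists_mollifier[OF assms(1)] by blast
  then show ?thesis
    using assms(2,3) unfolding has_reg_value_def by (metis tendsto_unique trivial_limit_at_right_real)
qed

lemma fourier_tconv:
  fixes \<kappa> w :: "'a::euclidean_space \<Rightarrow> complex"
  assumes \<kappa>: "integrable lborel \<kappa>" and w: "integrable lborel w"
  shows "fourier (tconv \<kappa> w) x = (\<integral>\<xi>. cis (- (\<xi> \<bullet> x)) * \<kappa> \<xi> \<partial>lborel) * fourier w x"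
proof -
  have [measurable]: "\<kappa> \<in> borel_measurable borel" "w \<in> borel_measurable borel" using \<kappa> w by auto
  let ?c = "of_real (fourier_const TYPE('a)) :: complex"
  let ?K = "\<integral>\<xi>. cis (- (\<xi> \<bullet> x)) * \<kappa> \<xi> \<partial>lborel"
  have "fourier (tconv \<kappa> w) x = ?c * (\<integral>\<xi>. \<integral>y. cis (- (\<xi> \<bullet> x)) * (\<kappa> (\<xi> - y) * w y) \<partial>lborel \<partial>lborel)"
    by (simp add: fourier_alt tconv_def)
  also have "(\<integral>\<xi>. \<integral>y. cis (- (\<xi> \<bullet> x)) * (\<kappa> (\<xi> - y) * w y) \<partial>lborel \<partial>lborel)
      = (\<integral>y. \<integral>\<xi>. cis (- (\<xi> \<bullet> x)) * (\<kappa> (\<xi> - y) * w y) \<partial>lborel \<partial>lborel)"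
  proof (rule lborel_Fubini(3))
    have "(\<integral>\<^sup>+\<xi>. \<integral>\<^sup>+y. norm (cis (- (\<xi> \<bullet> x)) * (\<kappa> (\<xi> - y) * w y)) \<partial>lborel \<partial>lborel)
        = (\<integral>\<^sup>+\<xi>. \<integral>\<^sup>+y. ennreal (norm (\<kappa> (\<xi> - y))) * ennreal (norm (w y)) \<partial>lborel \<partial>lborel)"
      by (simp add: norm_mult ennreal_mult)
    also have "\<dots> = (\<integral>\<^sup>+y. \<integral>\<^sup>+\<xi>. ennreal (norm (\<kappa> (\<xi> - y))) * ennreal (norm (w y)) \<partial>lborel \<partial>lborel)"
      by (rule lborel_pair.Fubini') measurable
    also have "\<dots> = (\<integral>\<^sup>+y. (\<integral>\<^sup>+\<xi>. ennreal (norm (\<kappa> \<xi>)) \<partial>lborel) * ennreal (norm (w y)) \<partial>lborel)"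
    proof (intro nn_integral_cong)
      fix y
      have "(\<integral>\<^sup>+\<xi>. ennreal (norm (\<kappa> (\<xi> - y))) \<partial>lborel) = (\<integral>\<^sup>+\<xi>. ennreal (norm (\<kappa> \<xi>)) \<partial>lborel)"
        using lborel_nn_integral_affine[of "\<lambda>\<xi>. ennreal (norm (\<kappa> (\<xi> - y)))" 1 y] by simp
      then show "(\<integral>\<^sup>+\<xi>. ennreal (norm (\<kappa> (\<xi> - y))) * ennreal (norm (w y)) \<partial>lborel) = (\<integral>\<^sup>+\<xi>. ennreal (norm (\<kappa> \<xi>)) \<partial>lborel) * ennreal (norm (w y))"
        by (simp add: nn_integral_multc)
    qed
    also have "\<dots> = (\<integral>\<^sup>+\<xi>. ennreal (norm (\<kappa> \<xi>)) \<partial>lborel) * (\<integral>\<^sup>+y. ennreal (norm (w y)) \<partial>lborel)"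
      by (simp add: nn_integral_cmult)
    also have "\<dots> < \<infinity>" using \<kappa> w by (simp add: integrable_iff_bounded ennreal_mult_less_top)
    finally show "(\<integral>\<^sup>+\<xi>. \<integral>\<^sup>+y. norm (cis (- (\<xi> \<bullet> x)) * (\<kappa> (\<xi> - y) * w y)) \<partial>lborel \<partial>lborel) < \<infinity>" .
  qed measurable
  also have "\<dots> = (\<integral>y. ?K * (cis (- (y \<bullet> x)) * w y) \<partial>lborel)"
  proof (rule Bochner_Integration.integral_cong[OF refl])
    fix y
    have "(\<integral>\<xi>. cis (- (\<xi> \<bullet> x)) * (\<kappa> (\<xi> - y) * w y) \<partial>lborel) = (\<integral>\<xi>. cis (- ((y + \<xi>) \<bullet> x)) * (\<kappa> \<xi> * w y) \<partial>lborel)"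
      using lborel_integral_affine[of "\<lambda>\<xi>. cis (- (\<xi> \<bullet> x)) * (\<kappa> (\<xi> - y) * w y)" 1 y] by simp
    also have "\<dots> = (\<integral>\<xi>. (cis (- (\<xi> \<bullet> x)) * \<kappa> \<xi>) * (cis (- (y \<bullet> x)) * w y) \<partial>lborel)"
    proof (rule Bochner_Integration.integral_cong[OF refl])
      fix \<xi>
      have "cis (- ((y + \<xi>) \<bullet> x)) = cis (- (\<xi> \<bullet> x)) * cis (- (y \<bullet> x))" by (simp add: cis_mult inner_add_left add.commute)
      then show "cis (- ((y + \<xi>) \<bullet> x)) * (\<kappa> \<xi> * w y) = (cis (- (\<xi> \<bullet> x)) * \<kappa> \<xi>) * (cis (- (y \<bullet> x)) * w y)" by simp
    qed
    also have "\<dots> = ?K * (cis (- (y \<bullet> x)) * w y)" by (rule integral_mult_left_zero)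
    finally show "(\<integral>\<xi>. cis (- (\<xi> \<bullet> x)) * (\<kappa> (\<xi> - y) * w y) \<partial>lborel) = ?K * (cis (- (y \<bullet> x)) * w y)" .
  qed
  also have "\<dots> = ?K * (\<integral>y. cis (- (y \<bullet> x)) * w y \<partial>lborel)" by (rule integral_mult_right_zero)
  finally show ?thesis by (simp add: fourier_alt mult_ac)
qed

text \<open>Here \<open>w\<close> is merely integrable. Mollifying multiplies
  \<open>fourier w\<close> by the transform of the rescaled kernel, which has modulus at most 1 and
  tends to 1 pointwise, so dominated convergence applies. This covers symbols not smooth at the
  origin, which \<open>test_functional_mollify\<close> does not reach.\<close>

lemma function_functional_mollify:
  fixes h :: "'a::euclidean_space \<Rightarrow> real" and w :: "'a \<Rightarrow> complex"
  assumes \<rho>: "mollifier \<rho>" and w: "integrable lborel w" and h: "h \<in> borel_measurable borel"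
    and int: "integrable lborel (\<lambda>x. of_real (h x) * fourier w x)"
  shows "((\<lambda>\<epsilon>. \<integral>x. of_real (h x) * fourier (mollify \<rho> \<epsilon> w) x \<partial>lborel) \<longlongrightarrow> (\<integral>x. of_real (h x) * fourier w x \<partial>lborel)) (at_right 0)"
proof (rule tendsto_at_right_sequentially[of 0 1])
  obtain r where r: "r > 0" "\<And>x. r < norm x \<Longrightarrow> \<rho> x = 0" using mollifier_support[OF \<rho>] by blast
  have \<rho>': "smooth \<rho>" "\<And>x. 0 \<le> \<rho> x" "(\<integral>x. \<rho> x \<partial>lborel) = 1" using \<rho> by (auto simp: mollifier_def)
  have m\<rho>[measurable]: "\<rho> \<in> borel_measurable borel"
    using \<rho>'(1) by (intro borel_measurable_continuous_onI smooth_on_continuous_on) (simp add: smooth_iff_smooth_on)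
  note [measurable] = h
  have mw[measurable]: "w \<in> borel_measurable borel" using w by simp
  fix S :: "nat \<Rightarrow> real" assume S: "\<And>n. 0 < S n" "S \<longlonglongrightarrow> 0"
  have dint: "integrable lborel (dilated \<rho> (S n))" for n
    by (rule test_on_integrable[OF test_on_dilated[OF \<rho>'(1) r(2) S(1)]]) (use S(1)[of n] r(1) in \<open>auto intro!: mult_nonneg_nonneg\<close>)
  define K where "K n x = (\<integral>\<xi>. cis (- (\<xi> \<bullet> x)) * dilated \<rho> (S n) \<xi> \<partial>lborel)" for n x
  have eq: "fourier (mollify \<rho> (S n) w) x = K n x * fourier w x" for n x
    unfolding mollify_eq_tconv K_def by (rule fourier_tconv[OF dint w])
  have K1: "norm (K n x) \<le> 1" for n x
  proof -
    have "norm (K n x) \<le> (\<integral>\<xi>. norm (cis (- (\<xi> \<bullet> x)) * dilated \<rho> (S n) \<xi>) \<partial>lborel)"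
      unfolding K_def by (rule integral_norm_bound)
    then show ?thesis using dilated_integral(2)[OF \<rho> S(1)[of n]] by (simp add: norm_mult)
  qed
  have Klim: "(\<lambda>n. K n x) \<longlonglongrightarrow> 1" for x
  proof -
    have \<rho>int: "integrable lborel \<rho>" using \<rho>'(3) not_integrable_integral_eq by fastforce
    have K_alt: "K n x = (\<integral>z. cis (- (S n * (z \<bullet> x))) * of_real (\<rho> z) \<partial>lborel)" for n
    proof -
      have "K n x = S n ^ DIM('a) *\<^sub>R (\<integral>z. cis (- ((S n *\<^sub>R z) \<bullet> x)) * dilated \<rho> (S n) (S n *\<^sub>R z) \<partial>lborel)"
        unfolding K_def using S(1)[of n] m\<rho>
        by (subst lborel_integral_affine[of _ "S n" 0]) (auto simp: dilated_def[abs_def])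
      also have "\<dots> = (\<integral>z. S n ^ DIM('a) *\<^sub>R (cis (- ((S n *\<^sub>R z) \<bullet> x)) * dilated \<rho> (S n) (S n *\<^sub>R z)) \<partial>lborel)"
        by simp
      also have "\<dots> = (\<integral>z. cis (- (S n * (z \<bullet> x))) * of_real (\<rho> z) \<partial>lborel)"
        using S(1)[of n] by (intro Bochner_Integration.integral_cong refl) (simp add: dilated_def)
      finally show ?thesis .
    qed
    have "(\<lambda>n. \<integral>z. cis (- (S n * (z \<bullet> x))) * of_real (\<rho> z) \<partial>lborel) \<longlonglongrightarrow> (\<integral>z. of_real (\<rho> z) \<partial>lborel)"
    proof (rule integral_dominated_convergence[where w = \<rho>])
      have "(\<lambda>n. cis (- (S n * (z \<bullet> x))) * of_real (\<rho> z)) \<longlonglongrightarrow> cis (- (0 * (z \<bullet> x))) * of_real (\<rho> z)" for z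
        by (intro tendsto_mult tendsto_const isCont_tendsto_compose[of _ cis] tendsto_minus S(2))
             (rule has_derivative_continuous[OF has_derivative_cis[OF has_derivative_ident]])
      then show "AE z in lborel. (\<lambda>n. cis (- (S n * (z \<bullet> x))) * of_real (\<rho> z)) \<longlonglongrightarrow> of_real (\<rho> z)" by simp
      show "AE z in lborel. norm (cis (- (S n * (z \<bullet> x))) * of_real (\<rho> z)) \<le> \<rho> z" for n
        using \<rho>'(2) by (simp add: norm_mult)
    qed (use \<rho>int in auto)
    then show ?thesis using \<rho>'(3) by (simp add: K_alt)
  qed
  have [measurable]: "K n \<in> borel_measurable borel" for n
    unfolding K_def[abs_def] dilated_def[abs_def] by measurable
  show "(\<lambda>n. \<integral>x. of_real (h x) * fourier (mollify \<rho> (S n) w) x \<partial>lborel) \<longlonglongrightarrow> (\<integral>x. of_real (h x) * fourier w x \<partial>lborel)"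
    unfolding eq
  proof (rule integral_dominated_convergence[where w = "\<lambda>x. norm (of_real (h x) * fourier w x)"])
    have "(\<lambda>n. of_real (h x) * (K n x * fourier w x)) \<longlonglongrightarrow> of_real (h x) * (1 * fourier w x)" for x
      by (intro tendsto_mult tendsto_const Klim)
    then show "AE x in lborel. (\<lambda>n. of_real (h x) * (K n x * fourier w x)) \<longlonglongrightarrow> of_real (h x) * fourier w x" by simp
    show "AE x in lborel. norm (of_real (h x) * (K n x * fourier w x)) \<le> norm (of_real (h x) * fourier w x)" for n
      using K1 by (intro AE_I2) (simp add: norm_mult mult_left_mono mult_left_le_one_le)
  qed (use int in auto)
qed simp

section \<open>Recovering the initial datum from the Duhamel integral\<close>

lemma wiener_bounded:
  fixes a :: "'a::euclidean_space \<Rightarrow> real"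
  assumes "wiener B a"
  shows "a \<in> borel_measurable borel" "\<bar>a \<xi>\<bar> \<le> B"
proof -
  obtain k where k: "integrable lborel k" "\<And>\<xi>. of_real (a \<xi>) = (\<integral>z. cis (z \<bullet> \<xi>) * of_real (k z) \<partial>lborel)"
    "(\<integral>z. \<bar>k z\<bar> \<partial>lborel) \<le> B" using assms(1) by (auto simp: wiener_def kernel_of_def)
  have [measurable]: "k \<in> borel_measurable borel" using k(1) by simp
  have "a = (\<lambda>\<xi>. Re (\<integral>z. cis (z \<bullet> \<xi>) * of_real (k z) \<partial>lborel))" by (rule ext) (simp flip: k(2))
  also have "\<dots> \<in> borel_measurable borel" by measurable
  finally show "a \<in> borel_measurable borel" .
  have "\<bar>a \<xi>\<bar> = norm (\<integral>z. cis (z \<bullet> \<xi>) * of_real (k z) \<partial>lborel)" by (simp flip: k(2))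
  also have "\<dots> \<le> (\<integral>z. norm (cis (z \<bullet> \<xi>) * of_real (k z)) \<partial>lborel)" by (rule integral_norm_bound)
  also have "\<dots> \<le> B" using k(3) by (simp add: norm_mult)
  finally show "\<bar>a \<xi>\<bar> \<le> B" .
qed

lemma wiener_multiplier:
  fixes \<psi> :: "'a::euclidean_space \<Rightarrow> complex"
  assumes a: "wiener B a" and \<psi>: "integrable lborel \<psi>"
    and C: "pairing p q C (\<lambda>x. ennreal (norm (fourier \<psi> x)))"
  shows "integrable lborel (\<lambda>\<xi>. of_real (a \<xi>) * \<psi> \<xi>)"
    "pairing p q (C * B) (\<lambda>x. ennreal (norm (fourier (\<lambda>\<xi>. of_real (a \<xi>) * \<psi> \<xi>) x)))"
proof -
  note [measurable] = wiener_bounded(1)[OF a]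
  show "integrable lborel (\<lambda>\<xi>. of_real (a \<xi>) * \<psi> \<xi>)"
    by (rule Bochner_Integration.integrable_bound[of _ "\<lambda>\<xi>. B * norm (\<psi> \<xi>)"])
       (use \<psi> wiener_bounded(2)[OF a] in \<open>auto simp: norm_mult intro!: AE_I2 mult_right_mono order_trans[OF _ abs_ge_self]\<close>)
  obtain k where k: "kernel_of k a" "(\<integral>z. \<bar>k z\<bar> \<partial>lborel) \<le> B" using a unfolding wiener_def by blast
  show "pairing p q (C * B) (\<lambda>x. ennreal (norm (fourier (\<lambda>\<xi>. of_real (a \<xi>) * \<psi> \<xi>) x)))"
    by (rule pairing_kernel[OF k \<psi> C])
qed

lemma mollify_add:
  fixes u v :: "'a::euclidean_space \<Rightarrow> complex"
  assumes "mollifier \<rho>" "0 < \<epsilon>" "integrable lborel u" "integrable lborel v"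
  shows "mollify \<rho> \<epsilon> (\<lambda>x. u x + v x) = (\<lambda>x. mollify \<rho> \<epsilon> u x + mollify \<rho> \<epsilon> v x)"
proof -
  obtain r where r: "r > 0" "\<And>x. r < norm x \<Longrightarrow> \<rho> x = 0" using mollifier_support[OF assms(1)] by blast
  have \<kappa>: "test_on (\<epsilon> * r) (dilated \<rho> \<epsilon>)"
    by (rule test_on_dilated[OF _ r(2) assms(2)]) (use assms(1) in \<open>auto simp: mollifier_def\<close>)
  obtain B where B: "\<And>x. norm (dilated \<rho> \<epsilon> x) \<le> B"
    using test_on_wbound[OF \<kappa>, of 0 0] assms(2) r(1) by auto
  show ?thesis
    unfolding mollify_eq_tconv tconv_def
    using tconv_integrable(1)[OF \<kappa> B assms(3)] tconv_integrable(1)[OF \<kappa> B assms(4)]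
    by (simp add: distrib_left)
qed

section \<open>The transform of the datum recovered from the Duhamel integral at one time\<close>

context
  fixes \<zeta> :: "real \<Rightarrow> real" and \<theta> t p q K :: real and \<mu> :: "('a::euclidean_space) distrib" and g :: "'a \<Rightarrow> real"
  assumes \<zeta>: "lp_cutoff \<zeta>" and \<theta>: "0 < \<theta>" and t: "0 < t" and \<mu>: "\<mu> \<in> tempered"
    and duh: "duhamel_defined \<theta> t \<mu>"
    and g: "morrey p q K (\<lambda>x. ennreal \<bar>g x\<bar>)" "0 \<le> K" "g \<in> borel_measurable borel"
    and rep: "\<And>\<phi>. \<phi> \<in> schwartz \<Longrightarrow> duhamel \<theta> t \<mu> \<phi> = (\<integral>x. of_real (g x) * \<phi> x \<partial>lborel)"
begin

text \<open>The product at time \<open>s\<close> occurs in the Duhamel integrand at time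
  \<open>t - s\<close>, so its limit exists there, and by uniqueness the definite description
  denotes it.\<close>

lemma heat_reg_value:
  assumes "0 < s" "s < t" "\<phi> \<in> schwartz"
  shows "has_reg_value (dist_fourier \<mu>) (\<lambda>\<xi>. of_real (heat_symbol \<theta> s \<xi>) * \<phi> \<xi>)
    (dist_mult (heat_symbol \<theta> s) (dist_fourier \<mu>) \<phi>)"
proof -
  have "heat_defined \<theta> (t - (t - s)) \<mu>"
    using duh assms unfolding duhamel_defined_def by (metis greaterThanLessThan_iff diff_gt_0_iff_gt diff_less_eq less_add_same_cancel1)
  then have "\<exists>v. has_reg_value (dist_fourier \<mu>) (\<lambda>\<xi>. of_real (heat_symbol \<theta> s \<xi>) * \<phi> \<xi>) v"
    using assms(3) by (auto simp: heat_defined_def multipliable_def)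
  then have "\<exists>!v. has_reg_value (dist_fourier \<mu>) (\<lambda>\<xi>. of_real (heat_symbol \<theta> s \<xi>) * \<phi> \<xi>) v"
    using has_reg_value_unique[OF \<zeta>] by blast
  from theI'[OF this] show ?thesis by (simp add: dist_mult_def)
qed

lemma heat_reg_value_eq:
  assumes "0 < s" "s < t" "\<phi> \<in> schwartz" "mollifier \<rho>"
    and "((\<lambda>\<epsilon>. dist_fourier \<mu> (mollify \<rho> \<epsilon> (\<lambda>\<xi>. of_real (heat_symbol \<theta> s \<xi>) * \<phi> \<xi>))) \<longlongrightarrow> v) (at_right 0)"
  shows "dist_mult (heat_symbol \<theta> s) (dist_fourier \<mu>) \<phi> = v"
  using heat_reg_value[OF assms(1-3)] assms(4,5) unfolding has_reg_value_def
  by (metis tendsto_unique trivial_limit_at_right_real)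

text \<open>Testing against \<open>fourier \<phi>\<close> undoes the inverse transform, so the
  integrand becomes the regularised product evaluated at \<open>\<phi>\<close>; a primitive in time
  that vanishes at 0 then evaluates the integral.\<close>

lemma duhamel_primitive:
  assumes \<phi>: "\<phi> \<in> schwartz" and eq: "\<And>s. 0 < s \<Longrightarrow> s < t \<Longrightarrow> dist_mult (heat_symbol \<theta> s) (dist_fourier \<mu>) \<phi> = \<Phi>' s"
    and d: "\<And>s. (\<Phi> has_vector_derivative \<Phi>' s) (at s)" and 0: "\<Phi> 0 = 0"
  shows "(\<integral>x. of_real (g x) * fourier \<phi> x \<partial>lborel) = \<Phi> t"
proof -
  have f\<phi>: "fourier \<phi> \<in> schwartz" by (rule fourier_schwartz[OF \<phi>])
  have inv: "fourier_inv (fourier \<phi>) = \<phi>" by (rule ext) (rule fourier_inversion[OF \<phi>])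
  have heat_eq: "heat \<theta> (t - \<tau>) \<mu> (fourier \<phi>) = \<Phi>' (t - \<tau>)" if "\<tau> \<in> {0<..<t}" for \<tau>
    using that eq[of "t - \<tau>"] by (simp add: heat_def dist_fourier_inv_def inv)
  have si: "set_integrable lebesgue {0<..<t} (\<lambda>\<tau>. heat \<theta> (t - \<tau>) \<mu> (fourier \<phi>))"
    using duh f\<phi> unfolding duhamel_defined_def by blast
  have "((\<lambda>\<tau>. heat \<theta> (t - \<tau>) \<mu> (fourier \<phi>)) has_integral duhamel \<theta> t \<mu> (fourier \<phi>)) {0<..<t}"
    unfolding duhamel_def by (rule has_integral_set_lebesgue[OF si])
  then have "((\<lambda>\<tau>. \<Phi>' (t - \<tau>)) has_integral duhamel \<theta> t \<mu> (fourier \<phi>)) {0<..<t}"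
    by (rule has_integral_eq[rotated]) (rule heat_eq)
  then have "duhamel \<theta> t \<mu> (fourier \<phi>) = \<Phi> t"
    using has_integral_reflected_derivative[OF t d 0] by (rule has_integral_unique)
  then show ?thesis using rep[OF f\<phi>] by simp
qed

text \<open>Off the origin all products are classical. Multiplying \<open>\<phi>\<close> by the
  Duhamel symbol gives a curve of test functions in time, whose derivative is the product with the
  heat symbol up to a quadratic error, so \<open>duhamel_primitive\<close> applies.\<close>

lemma duhamel_off_origin:
  assumes \<phi>: "test_on R \<phi>" "0 \<le> R" and \<delta>: "0 < \<delta>" "\<And>\<xi>. norm \<xi> < \<delta> \<Longrightarrow> \<phi> \<xi> = 0"
  shows "(\<integral>x. of_real (g x) * fourier \<phi> x \<partial>lborel) = dist_fourier \<mu> (\<lambda>\<xi>. of_real (duhamel_symbol \<theta> t \<xi>) * \<phi> \<xi>)"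
proof -
  obtain M where F: "test_functional M (dist_fourier \<mu>)" using dist_fourier_test_functional[OF \<mu>] by blast
  obtain \<rho> :: "'a \<Rightarrow> real" where \<rho>: "mollifier \<rho>" using exists_mollifier[OF \<zeta>] by blast
  let ?m = "\<lambda>s \<xi>. of_real (heat_symbol \<theta> s \<xi>) * \<phi> \<xi>"
  let ?a = "\<lambda>s \<xi>. of_real (duhamel_symbol \<theta> s \<xi>) * \<phi> \<xi>"
  let ?w = "\<lambda>s h \<xi>. of_real (norm \<xi> powr \<theta> * (exp (- (s * norm \<xi> powr \<theta>)) * expser 2 (h * norm \<xi> powr \<theta>))) * \<phi> \<xi>"
  have m: "test_on R (?m s)" for s
    using off_origin_test_on[OF smooth_on_scaled[OF smooth_on_exp, of "- s"] \<phi> \<delta>, of \<theta>]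
    by (simp add: heat_symbol_def)
  have a: "test_on R (?a s)" for s
    using off_origin_test_on[OF smooth_on_mult[OF open_UNIV smooth_on_const smooth_on_scaled[OF smooth_on_expser]] \<phi> \<delta>, of s 1 s \<theta>]
    by (simp add: duhamel_symbol_def)
  obtain C where C: "C \<ge> 0" "\<And>u B. test_on R u \<Longrightarrow> wbound UNIV 0 M B u \<Longrightarrow> norm (dist_fourier \<mu> u) \<le> C * B"
    using test_functional_bound[OF F \<phi>(2)] by auto
  show ?thesis
  proof (rule duhamel_primitive[where \<Phi> = "\<lambda>s. dist_fourier \<mu> (?a s)" and \<Phi>' = "\<lambda>s. dist_fourier \<mu> (?m s)"])
    show "\<phi> \<in> schwartz" by (rule test_on_schwartz[OF \<phi>])
    then show "dist_mult (heat_symbol \<theta> s) (dist_fourier \<mu>) \<phi> = dist_fourier \<mu> (?m s)" if "0 < s" "s < t" for s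
      using heat_reg_value_eq[OF that _ \<rho> test_functional_mollify[OF F \<rho> m \<phi>(2)]] by blast
    have "?a 0 = (\<lambda>\<xi>. 0 * \<phi> \<xi>)" by (simp add: duhamel_symbol_def)
    then show "dist_fourier \<mu> (?a 0) = 0" using test_functional_cmult[OF F \<phi>(1), of 0] by simp
    fix s
    have "smooth_on UNIV (\<lambda>z::real \<times> real. snd z * (exp (- (s * snd z)) * expser 2 (fst z * snd z)))"
      by (rule smooth_on_mult[OF open_UNIV smooth_on_linear[OF open_UNIV bounded_linear_snd] smooth_on_exp_expser])
    from off_origin_family[OF this \<phi> \<delta>, of 1 \<theta> 0 M]
    obtain B where B: "B \<ge> 0" "\<And>h. h \<in> {-1..1} \<Longrightarrow> test_on R (?w s h) \<and> wbound UNIV 0 M B (?w s h)" by auto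
    show "((\<lambda>s. dist_fourier \<mu> (?a s)) has_vector_derivative dist_fourier \<mu> (?m s)) (at s)"
    proof (rule has_vector_derivative_quadratic[where C = "C * B"])
      fix h :: real assume h: "\<bar>h\<bar> \<le> 1"
      then have "h \<in> {-1..1}" by (simp add: abs_le_iff)
      from B(2)[OF this] have w: "test_on R (?w s h)" "wbound UNIV 0 M B (?w s h)" by blast+
      have "?a (s + h) = (\<lambda>\<xi>. (?a s \<xi> + of_real h * ?m s \<xi>) + of_real (- (h\<^sup>2)) * ?w s h \<xi>)"
        unfolding duhamel_symbol_diff[of \<theta> s h] by (simp add: algebra_simps)
      then have "dist_fourier \<mu> (?a (s + h)) = dist_fourier \<mu> (?a s) + of_real h * dist_fourier \<mu> (?m s) + of_real (- (h\<^sup>2)) * dist_fourier \<mu> (?w s h)"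
        using test_functional_add[OF F test_on_add[OF a test_on_cmult[OF m]] test_on_cmult[OF w(1)], of s "of_real h" s "of_real (- (h\<^sup>2))"]
          test_functional_add[OF F a test_on_cmult[OF m], of s "of_real h" s]
          test_functional_cmult[OF F m, of "of_real h" s] test_functional_cmult[OF F w(1), of "of_real (- (h\<^sup>2))"]
        by (simp only:)
      then have "norm (dist_fourier \<mu> (?a (s + h)) - dist_fourier \<mu> (?a s) - of_real h * dist_fourier \<mu> (?m s)) = h\<^sup>2 * norm (dist_fourier \<mu> (?w s h))"
        by (simp add: norm_mult norm_power)
      also have "\<dots> \<le> h\<^sup>2 * (C * B)" by (intro mult_left_mono C(2) w) auto
      finally show "norm (dist_fourier \<mu> (?a (s + h)) - dist_fourier \<mu> (?a s) - of_real h * dist_fourier \<mu> (?m s)) \<le> C * B * h\<^sup>2"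
        by (simp add: mult_ac)
    qed
  qed
qed

text \<open>The reciprocal of the Duhamel symbol is smooth off the origin, so the preceding identity
  may be applied to the quotient of \<open>u\<close> by that symbol.\<close>

lemma datum_off_origin:
  assumes u: "test_on R u" "0 \<le> R" and \<delta>: "0 < \<delta>" "\<And>\<xi>. norm \<xi> < \<delta> \<Longrightarrow> u \<xi> = 0"
  shows "dist_fourier \<mu> u = (\<integral>x. of_real (g x) * fourier (\<lambda>\<xi>. of_real (inverse (duhamel_symbol \<theta> t \<xi>)) * u \<xi>) x \<partial>lborel)"
proof -
  let ?v = "\<lambda>\<xi>. of_real (inverse (duhamel_symbol \<theta> t \<xi>)) * u \<xi>"
  have "smooth_on UNIV (\<lambda>x. inverse (t * expser 1 (t * x)))"
    by (rule smooth_on_compose[OF open_UNIV _ smooth_on_mult[OF open_UNIV smooth_on_const smooth_on_scaled[OF smooth_on_expser]] smooth_on_inverse])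
       (use t expser_1_pos in \<open>auto simp del: One_nat_def\<close>)
  from off_origin_test_on[OF this u \<delta>, of \<theta>]
  have v: "test_on R ?v" by (simp add: duhamel_symbol_def)
  have "(\<integral>x. of_real (g x) * fourier ?v x \<partial>lborel) = dist_fourier \<mu> (\<lambda>\<xi>. of_real (duhamel_symbol \<theta> t \<xi>) * ?v \<xi>)"
    by (rule duhamel_off_origin[OF v u(2) \<delta>(1)]) (simp add: \<delta>(2))
  moreover have "(\<lambda>\<xi>. of_real (duhamel_symbol \<theta> t \<xi>) * ?v \<xi>) = u"
  proof
    fix \<xi>
    show "of_real (duhamel_symbol \<theta> t \<xi>) * ?v \<xi> = u \<xi>"
      using duhamel_symbol_pos[OF t, of \<theta> \<xi>] by (simp add: mult.assoc[symmetric] flip: of_real_mult)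
  qed
  ultimately show ?thesis by (simp only:)
qed

text \<open>The quotient is realised by the function \<open>rconv k g\<close>, which
  \<open>L\<close> pairs with transforms; the identity off the origin confines the support of
  \<open>E\<close>. For \<open>supported_eq_0\<close>, the regularised product is evaluated as
  \<open>E \<psi>\<close> plus \<open>L\<close> of the pointwise product, and this sum has an
  explicit primitive in time.\<close>

lemma datum_low_frequency:
  assumes k: "kernel_of k (\<lambda>\<xi>::'a. \<zeta> (norm \<xi>) * inverse (duhamel_symbol \<theta> t \<xi>))" and \<psi>: "test_on 1 \<psi>"
  shows "dist_fourier \<mu> \<psi> = (\<integral>x. of_real (g x) * fourier (\<lambda>\<xi>. of_real (inverse (duhamel_symbol \<theta> t \<xi>)) * \<psi> \<xi>) x \<partial>lborel)"
proof -
  let ?I = "\<lambda>\<xi>::'a. \<zeta> (norm \<xi>) * inverse (duhamel_symbol \<theta> t \<xi>)"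
  let ?h = "rconv k g"
  let ?Kh = "(\<integral>z. \<bar>k z\<bar> \<partial>lborel) * K"
  have h: "morrey p q ?Kh (\<lambda>x. ennreal \<bar>?h x\<bar>)" by (rule morrey_rconv[OF k order_refl g])
  have Kh: "0 \<le> ?Kh" using g(2) by (intro mult_nonneg_nonneg integral_nonneg_AE) auto
  have hm[measurable]: "?h \<in> borel_measurable borel"
    using k g(3) by (intro rconv_measurable) (auto simp: kernel_of_def)
  define L where "L u = (\<integral>x. of_real (?h x) * fourier u x \<partial>lborel)" for u
  obtain M where F: "test_functional M (dist_fourier \<mu>)" using dist_fourier_test_functional[OF \<mu>] by blast
  let ?N = "max M (decay_dim TYPE('a))"
  have F': "test_functional ?N (dist_fourier \<mu>)" by (rule test_functional_mono[OF F]) simp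
  have L': "test_functional ?N L"
    unfolding L_def[abs_def] by (rule test_functional_mono[OF function_test_functional[OF h Kh hm]]) simp
  define E where "E u = dist_fourier \<mu> u - L u" for u
  have E: "test_functional ?N E" unfolding E_def[abs_def] by (rule test_functional_diff[OF F' L'])
  \<comment> \<open>Up to radius 3/2 the cutoff in the symbol of \<open>k\<close> equals 1, so there
    \<open>k\<close> represents the true quotient.\<close>
  have cut: "of_real (?I \<xi>) * u \<xi> = of_real (inverse (duhamel_symbol \<theta> t \<xi>)) * u \<xi>" if "test_on (3/2) u" for u \<xi>
    using cutoff_eq_1[OF \<zeta>, of "norm \<xi>"] test_on_zero[OF that, of \<xi>] by (cases "norm \<xi> \<le> 3/2") auto
  have L_eq: "L u = (\<integral>x. of_real (g x) * fourier (\<lambda>\<xi>. of_real (inverse (duhamel_symbol \<theta> t \<xi>)) * u \<xi>) x \<partial>lborel)"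
    if u: "test_on (3/2) u" for u
  proof -
    have uS: "u \<in> schwartz" by (rule test_on_schwartz[OF u]) simp
    obtain C where C: "pairing p q C (\<lambda>x. ennreal (norm (fourier u x)))" using pairing_fourier_test_on[OF uS] by blast
    show ?thesis
      unfolding L_def pairing_rconv[OF k schwartz_integrable[OF uS] C g, symmetric] cut[OF u] ..
  qed
  have supp: "E u = 0" if "test_on (3/2) u" "0 < \<delta>" "\<And>\<xi>. norm \<xi> < \<delta> \<Longrightarrow> u \<xi> = 0" for u \<delta>
    using datum_off_origin[OF that(1) _ that(2,3)] L_eq[OF that(1)] by (simp add: E_def)
  obtain \<rho> :: "'a \<Rightarrow> real" where \<rho>: "mollifier \<rho>" using exists_mollifier[OF \<zeta>] by blast
  obtain r where r: "r > 0" "\<And>x. r < norm x \<Longrightarrow> \<rho> x = 0" using mollifier_support[OF \<rho>] by blast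
  have "E \<psi> = 0"
  proof (rule supported_eq_0[OF \<zeta> E \<rho> \<theta> supp _ \<psi>])
    fix \<psi> assume \<psi>: "test_on 1 \<psi>"
      and lim: "\<And>s. 0 < s \<Longrightarrow> ((\<lambda>\<epsilon>. E (mollify \<rho> \<epsilon> (\<lambda>\<xi>. of_real (heat_symbol \<theta> s \<xi> - 1) * \<psi> \<xi>))) \<longlongrightarrow> 0) (at_right 0)"
    have \<psi>S: "\<psi> \<in> schwartz" by (rule test_on_schwartz[OF \<psi>]) simp
    have \<psi>i: "integrable lborel \<psi>" by (rule schwartz_integrable[OF \<psi>S])
    obtain C where C: "pairing p q C (\<lambda>x. ennreal (norm (fourier \<psi> x)))" using pairing_fourier_test_on[OF \<psi>S] by blast
    let ?A = "\<lambda>a \<xi>. complex_of_real (a \<xi>) * \<psi> \<xi>"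
    \<comment> \<open>Inserting the cutoff changes nothing on the support of \<open>\<psi>\<close>
      and gives access to kernels of localised symbols, whatever the symbol does at
      infinity.\<close>
    have cut\<psi>: "?A a = ?A (\<lambda>\<xi>. \<zeta> (norm \<xi>) * a \<xi>)" for a
    proof
      fix \<xi>
      show "?A a \<xi> = ?A (\<lambda>\<xi>. \<zeta> (norm \<xi>) * a \<xi>) \<xi>"
        using cutoff_eq_1[OF \<zeta>, of "norm \<xi>"] test_on_zero[OF \<psi>, of \<xi>] by (cases "norm \<xi> \<le> 1") auto
    qed
    have A_int: "integrable lborel (?A a)" and A_pair: "pairing p q (C * B) (\<lambda>x. ennreal (norm (fourier (?A a) x)))"
      and A_hint: "integrable lborel (\<lambda>x. of_real (?h x) * fourier (?A a) x)" and A_le: "norm (L (?A a)) \<le> C * B * ?Kh"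
      if w: "wiener B (\<lambda>\<xi>. \<zeta> (norm \<xi>) * a \<xi>)" for a B
    proof -
      show i: "integrable lborel (?A a)" and p: "pairing p q (C * B) (\<lambda>x. ennreal (norm (fourier (?A a) x)))"
        unfolding cut\<psi>[of a] by (rule wiener_multiplier[OF w \<psi>i C])+
      have m: "fourier (?A a) \<in> borel_measurable borel" using i by (intro fourier_measurable) simp
      show "integrable lborel (\<lambda>x. of_real (?h x) * fourier (?A a) x)" "norm (L (?A a)) \<le> C * B * ?Kh"
        unfolding L_def by (rule pairing_integrable[OF p m h Kh hm])+
    qed
    obtain B0 where B0: "wiener B0 (\<lambda>\<xi>::'a. \<zeta> (norm \<xi>))" using wiener_cutoff[OF \<zeta>] by blast
    \<comment> \<open>The constant is handled by the kernel of the cutoff, the rest by the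
      low-frequency bound with the parameter range reduced to the point 0.\<close>
    have wsum: "\<exists>B. wiener B (\<lambda>\<xi>::'a. \<zeta> (norm \<xi>) * (c + norm \<xi> powr \<theta> * f (norm \<xi> powr \<theta>)))" if f: "smooth_on UNIV f" for c f
    proof -
      obtain B1 where "wiener B1 (\<lambda>\<xi>::'a. \<zeta> (norm \<xi>) * (norm \<xi> powr \<theta> * f (norm \<xi> powr \<theta>)))"
        using wiener_low_frequency[OF \<zeta> smooth_on_snd_compose[OF f] \<theta>, of 0] by auto
      from wiener_add[OF wiener_cmult[OF B0, of c] this] show ?thesis
        by (auto simp: distrib_left mult.commute)
    qed
    have wm: "\<exists>B. wiener B (\<lambda>\<xi>::'a. \<zeta> (norm \<xi>) * heat_symbol \<theta> s \<xi>)" for s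
    proof -
      have "heat_symbol \<theta> s \<xi> = 1 + norm \<xi> powr \<theta> * ((- s) * expser 1 (s * norm \<xi> powr \<theta>))" for \<xi> :: 'a
        using exp_minus_eq[of "s * norm \<xi> powr \<theta>"] by (simp add: heat_symbol_def)
      then show ?thesis
        using wsum[OF smooth_on_mult[OF open_UNIV smooth_on_const smooth_on_scaled[OF smooth_on_expser]], of 1 "- s" 1 s] by simp
    qed
    have wa: "\<exists>B. wiener B (\<lambda>\<xi>::'a. \<zeta> (norm \<xi>) * duhamel_symbol \<theta> s \<xi>)" for s
    proof -
      have "duhamel_symbol \<theta> s \<xi> = s + norm \<xi> powr \<theta> * ((- (s\<^sup>2)) * expser 2 (s * norm \<xi> powr \<theta>))" for \<xi> :: 'a
        unfolding duhamel_symbol_def expser_1_eq[of "s * norm \<xi> powr \<theta>"] by (simp add: algebra_simps power2_eq_square)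
      then show ?thesis
        using wsum[OF smooth_on_mult[OF open_UNIV smooth_on_const smooth_on_scaled[OF smooth_on_expser]], of s "- (s\<^sup>2)" 2 s] by simp
    qed
    let ?m = "\<lambda>s. ?A (heat_symbol \<theta> s)" and ?a = "\<lambda>s. ?A (duhamel_symbol \<theta> s)"
    have "(\<integral>x. of_real (g x) * fourier \<psi> x \<partial>lborel) = of_real t * E \<psi> + L (?a t)"
    proof (rule duhamel_primitive[where \<Phi> = "\<lambda>s. of_real s * E \<psi> + L (?a s)" and \<Phi>' = "\<lambda>s. E \<psi> + L (?m s)", OF \<psi>S])
      have "?a 0 = (\<lambda>\<xi>. 0 * \<psi> \<xi>)" by (simp add: duhamel_symbol_def)
      then show "of_real 0 * E \<psi> + L (?a 0) = 0" using test_functional_cmult[OF L' \<psi>, of 0] by simp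
    next
      fix s assume s: "0 < s" "s < t"
      obtain B where B: "wiener B (\<lambda>\<xi>::'a. \<zeta> (norm \<xi>) * heat_symbol \<theta> s \<xi>)" using wm by blast
      have ev: "eventually (\<lambda>\<epsilon>::real. 0 < \<epsilon>) (at_right 0)" by (simp add: eventually_at_right_less)
      have m1: "integrable lborel (\<lambda>\<xi>. of_real (heat_symbol \<theta> s \<xi> - 1) * \<psi> \<xi>)"
      proof -
        have "integrable lborel (\<lambda>\<xi>. ?m s \<xi> - \<psi> \<xi>)" using A_int[OF B] \<psi>i by simp
        then show ?thesis by (simp add: left_diff_distrib)
      qed
      \<comment> \<open>For \<open>E\<close> the product is separated into \<open>\<psi>\<close>, a
        test function, and the part with \<open>heat_symbol \<theta> s \<xi> - 1\<close>, whose
        limit is 0 by \<open>lim\<close>. For \<open>L\<close> the nonsmooth product is kept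
        whole.\<close>
      have "((\<lambda>\<epsilon>. E (mollify \<rho> \<epsilon> (\<lambda>\<xi>. of_real (heat_symbol \<theta> s \<xi> - 1) * \<psi> \<xi>)) + E (mollify \<rho> \<epsilon> \<psi>) + L (mollify \<rho> \<epsilon> (?m s))) \<longlongrightarrow> 0 + E \<psi> + L (?m s)) (at_right 0)"
      proof (intro tendsto_add lim s(1))
        show "((\<lambda>\<epsilon>. E (mollify \<rho> \<epsilon> \<psi>)) \<longlongrightarrow> E \<psi>) (at_right 0)" by (rule test_functional_mollify[OF E \<rho> \<psi>]) simp
        show "((\<lambda>\<epsilon>. L (mollify \<rho> \<epsilon> (?m s))) \<longlongrightarrow> L (?m s)) (at_right 0)"
          unfolding L_def by (rule function_functional_mollify[OF \<rho> A_int[OF B] hm A_hint[OF B]])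
      qed
      moreover have "\<forall>\<^sub>F \<epsilon> in at_right 0. E (mollify \<rho> \<epsilon> (\<lambda>\<xi>. of_real (heat_symbol \<theta> s \<xi> - 1) * \<psi> \<xi>)) + E (mollify \<rho> \<epsilon> \<psi>) + L (mollify \<rho> \<epsilon> (?m s))
          = dist_fourier \<mu> (mollify \<rho> \<epsilon> (?m s))"
        using ev
      proof eventually_elim
        case (elim \<epsilon>)
        have eq: "?m s = (\<lambda>\<xi>. of_real (heat_symbol \<theta> s \<xi> - 1) * \<psi> \<xi> + \<psi> \<xi>)" by (simp add: left_diff_distrib)
        have t1: "test_on (\<epsilon> * r + 1) (mollify \<rho> \<epsilon> (\<lambda>\<xi>. of_real (heat_symbol \<theta> s \<xi> - 1) * \<psi> \<xi>))"
          by (rule test_on_mollify[OF \<rho> r elim m1]) (use test_on_zero[OF \<psi>] in auto)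
        have t2: "test_on (\<epsilon> * r + 1) (mollify \<rho> \<epsilon> \<psi>)"
          by (rule test_on_mollify[OF \<rho> r elim \<psi>i]) (use test_on_zero[OF \<psi>] in auto)
        have eqE: "E (mollify \<rho> \<epsilon> (?m s)) = E (mollify \<rho> \<epsilon> (\<lambda>\<xi>. of_real (heat_symbol \<theta> s \<xi> - 1) * \<psi> \<xi>)) + E (mollify \<rho> \<epsilon> \<psi>)"
          unfolding eq mollify_add[OF \<rho> elim m1 \<psi>i] by (rule test_functional_add[OF E t1 t2])
        show ?case unfolding eqE[symmetric] by (simp add: E_def)
      qed
      ultimately have "((\<lambda>\<epsilon>. dist_fourier \<mu> (mollify \<rho> \<epsilon> (?m s))) \<longlongrightarrow> 0 + E \<psi> + L (?m s)) (at_right 0)"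
        by (rule Lim_transform_eventually)
      then show "dist_mult (heat_symbol \<theta> s) (dist_fourier \<mu>) \<psi> = E \<psi> + L (?m s)"
        using heat_reg_value_eq[OF s \<psi>S \<rho>] by simp
    next
      fix s
      let ?w = "\<lambda>h \<xi>::'a. norm \<xi> powr \<theta> * (exp (- (s * norm \<xi> powr \<theta>)) * expser 2 (h * norm \<xi> powr \<theta>))"
      obtain Bm where Bm: "wiener Bm (\<lambda>\<xi>::'a. \<zeta> (norm \<xi>) * heat_symbol \<theta> s \<xi>)" using wm by blast
      obtain Ba where Ba: "wiener Ba (\<lambda>\<xi>::'a. \<zeta> (norm \<xi>) * duhamel_symbol \<theta> s \<xi>)" using wa by blast
      obtain B where B: "\<And>h. h \<in> {-1..1} \<Longrightarrow> wiener B (\<lambda>\<xi>::'a. \<zeta> (norm \<xi>) * ?w h \<xi>)"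
        using wiener_low_frequency[OF \<zeta> smooth_on_exp_expser \<theta>, of 1 s] unfolding fst_conv snd_conv by blast
      show "((\<lambda>s. of_real s * E \<psi> + L (?a s)) has_vector_derivative E \<psi> + L (?m s)) (at s)"
      proof (rule has_vector_derivative_quadratic[where C = "C * B * ?Kh"])
        fix h :: real assume h: "\<bar>h\<bar> \<le> 1"
        then have w: "wiener B (\<lambda>\<xi>::'a. \<zeta> (norm \<xi>) * ?w h \<xi>)" by (intro B) (simp add: abs_le_iff)
        let ?c = "complex_of_real (- (h\<^sup>2))"
        have eq: "?a (s + h) = (\<lambda>\<xi>. (?a s \<xi> + of_real h * ?m s \<xi>) + ?c * ?A (?w h) \<xi>)"
          unfolding duhamel_symbol_diff[of \<theta> s h] by (simp add: algebra_simps)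
        have i: "integrable lborel (?a s)" "integrable lborel (\<lambda>\<xi>. of_real h * ?m s \<xi>)" "integrable lborel (\<lambda>\<xi>. ?c * ?A (?w h) \<xi>)"
          by (intro integrable_mult_right A_int[OF Ba] A_int[OF Bm] A_int[OF w])+
        have "fourier (?a (s + h)) = (\<lambda>x. (fourier (?a s) x + of_real h * fourier (?m s) x) + ?c * fourier (?A (?w h)) x)"
          unfolding eq fourier_add[OF Bochner_Integration.integrable_add[OF i(1,2)] i(3)] fourier_add[OF i(1,2)] fourier_cmult ..
        then have "L (?a (s + h)) = (\<integral>x. (of_real (?h x) * fourier (?a s) x + of_real h * (of_real (?h x) * fourier (?m s) x)) + ?c * (of_real (?h x) * fourier (?A (?w h)) x) \<partial>lborel)"
          unfolding L_def by (simp add: algebra_simps)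
        also have "\<dots> = (L (?a s) + of_real h * L (?m s)) + ?c * L (?A (?w h))"
          unfolding L_def
          by (subst Bochner_Integration.integral_add, intro Bochner_Integration.integrable_add integrable_mult_right A_hint[OF Ba] A_hint[OF Bm],
              intro integrable_mult_right A_hint[OF w],
              subst Bochner_Integration.integral_add, intro A_hint[OF Ba], intro integrable_mult_right A_hint[OF Bm],
              simp only: integral_mult_right_zero)
        finally have Lsh: "L (?a (s + h)) = (L (?a s) + of_real h * L (?m s)) + ?c * L (?A (?w h))" .
        have "(of_real (s + h) * E \<psi> + L (?a (s + h))) - (of_real s * E \<psi> + L (?a s)) - of_real h * (E \<psi> + L (?m s))
            = ?c * L (?A (?w h))"
          unfolding Lsh by (simp only: of_real_add) algebra
        then have "norm ((of_real (s + h) * E \<psi> + L (?a (s + h))) - (of_real s * E \<psi> + L (?a s)) - of_real h * (E \<psi> + L (?m s)))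
            = h\<^sup>2 * norm (L (?A (?w h)))"
          by (simp only: norm_mult norm_of_real) simp
        also have "\<dots> \<le> h\<^sup>2 * (C * B * ?Kh)" by (intro mult_left_mono A_le[OF w]) auto
        finally show "norm ((of_real (s + h) * E \<psi> + L (?a (s + h))) - (of_real s * E \<psi> + L (?a s)) - of_real h * (E \<psi> + L (?m s)))
            \<le> C * B * ?Kh * h\<^sup>2" by (simp add: mult_ac)
      qed
    qed
    \<comment> \<open>On the support of \<open>\<psi>\<close> the Duhamel symbol cancels against its
      reciprocal. The same pairing then stands on both sides of the time-integrated identity, which
      leaves \<open>of_real t * E \<psi> = 0\<close>.\<close>
    moreover have "L (?a t) = (\<integral>x. of_real (g x) * fourier \<psi> x \<partial>lborel)"
    proof -
      obtain B where B: "wiener B (\<lambda>\<xi>::'a. \<zeta> (norm \<xi>) * duhamel_symbol \<theta> t \<xi>)" using wa by blast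
      have eq: "of_real (?I \<xi>) * ?a t \<xi> = \<psi> \<xi>" for \<xi>
        using duhamel_symbol_pos[OF t, of \<theta> \<xi>] cutoff_eq_1[OF \<zeta>, of "norm \<xi>"] test_on_zero[OF \<psi>, of \<xi>]
        by (cases "norm \<xi> \<le> 1") (auto simp: mult.assoc[symmetric] simp flip: of_real_mult)
      show ?thesis
        unfolding L_def pairing_rconv[OF k A_int[OF B] A_pair[OF B] g, symmetric] eq ..
    qed
    ultimately show "E \<psi> = 0" using t by simp
  qed
  then show ?thesis using L_eq[OF test_on_mono[OF \<psi>, of "3/2"]] by (simp add: E_def)
qed

end

section \<open>Choice of the time and estimates of the blocks\<close>

lemma AE_lebesgue_on_interval:
  fixes a b T :: real
  assumes "AE t in lebesgue_on {0<..<T}. P t" "0 \<le> a" "a < b" "b \<le> T"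
  shows "\<exists>t. a < t \<and> t < b \<and> P t"
proof (rule ccontr)
  assume "\<not> ?thesis"
  moreover have "AE t in lebesgue. t \<in> {0<..<T} \<longrightarrow> P t"
    using assms(1) by (simp add: AE_restrict_space_iff)
  ultimately have "AE t in lebesgue. t \<notin> {a<..<b}"
    using assms(2-4) by (auto elim!: eventually_mono)
  then have "{a<..<b} \<in> null_sets lebesgue"
    by (subst (asm) AE_iff_null_sets[symmetric]) auto
  then have "emeasure lborel {a<..<b} = 0" by (auto simp: null_sets_def)
  then show False using assms(3) by simp
qed

lemma lm_norm_cong_AE:
  fixes f g :: "'a::euclidean_space \<Rightarrow> real"
  assumes f: "f \<in> borel_measurable lebesgue" and g: "g \<in> borel_measurable lebesgue" and eq: "AE x in lebesgue. f x = g x"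
  shows "lm_norm p q f = lm_norm p q g"
proof -
  have "distribution_function (\<lambda>x. f x * indicator (ball z R) x) \<sigma> = distribution_function (\<lambda>x. g x * indicator (ball z R) x) \<sigma>" for z R \<sigma>
    unfolding distribution_function_def
  proof (rule emeasure_eq_AE)
    show "AE x in lebesgue. (x \<in> {x. \<sigma> < \<bar>f x * indicator (ball z R) x\<bar>}) = (x \<in> {x. \<sigma> < \<bar>g x * indicator (ball z R) x\<bar>})"
      using eq by eventually_elim simp
    have *: "{x. \<sigma> < \<bar>h x * indicator (ball z R) x\<bar>} \<in> sets lebesgue" if [measurable]: "h \<in> borel_measurable lebesgue" for h :: "'a \<Rightarrow> real"
    proof -
      have [measurable]: "ball z R \<in> sets lebesgue" by (simp add: fmeasurableD)
      have "{x \<in> space lebesgue. \<sigma> < \<bar>h x * indicator (ball z R) x\<bar>} \<in> sets lebesgue" by measurable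
      then show ?thesis by simp
    qed
    show "{x. \<sigma> < \<bar>f x * indicator (ball z R) x\<bar>} \<in> sets lebesgue" "{x. \<sigma> < \<bar>g x * indicator (ball z R) x\<bar>} \<in> sets lebesgue"
      using *[OF f] *[OF g] by auto
  qed
  then show ?thesis by (simp add: lm_norm_def weak_lebesgue_norm_def rearrangement_def)
qed

text \<open>Elements of \<open>lm_space\<close> are Lebesgue measurable, whereas the Morrey bounds
  and the Tonelli arguments are stated for Borel functions; changing \<open>g\<close> on a null set
  alters neither its norm nor its distribution.\<close>

lemma exists_borel_representative:
  fixes g :: "'a::euclidean_space \<Rightarrow> real"
  assumes g: "g \<in> lm_space p q" and rep: "represents g f"
  shows "\<exists>g'\<in>borel_measurable borel. lm_norm p q g' = lm_norm p q g \<and>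
    (\<forall>\<phi>\<in>schwartz. f \<phi> = (\<integral>x. of_real (g' x) * \<phi> x \<partial>lborel))"
proof -
  have gm[measurable]: "g \<in> borel_measurable lebesgue" using g by (simp add: lm_space_def)
  obtain g' where g': "g' \<in> borel_measurable lborel" "AE x in lborel. g x = g' x"
    using completion_ex_borel_measurable_real[OF gm] by blast
  have g'b[measurable]: "g' \<in> borel_measurable borel" using g'(1) by simp
  have g'm[measurable]: "g' \<in> borel_measurable lebesgue" using g'(1) by (rule measurable_completion)
  have eq: "AE x in lebesgue. g x = g' x" using g'(2) by (rule AE_completion)
  have "f \<phi> = (\<integral>x. of_real (g' x) * \<phi> x \<partial>lborel)" if \<phi>: "\<phi> \<in> schwartz" for \<phi>
  proof -
    have [measurable]: "\<phi> \<in> borel_measurable borel" by (rule schwartz_measurable[OF \<phi>])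
    have [measurable]: "\<phi> \<in> borel_measurable lebesgue" by (rule measurable_completion) simp
    have "f \<phi> = (\<integral>x. of_real (g x) * \<phi> x \<partial>lebesgue)" using rep \<phi> by (simp add: represents_def)
    also have "\<dots> = (\<integral>x. of_real (g' x) * \<phi> x \<partial>lebesgue)"
      by (rule integral_cong_AE) (use eq in \<open>auto elim!: eventually_mono\<close>)
    also have "\<dots> = (\<integral>x. of_real (g' x) * \<phi> x \<partial>lborel)" by (rule integral_completion) simp
    finally show ?thesis .
  qed
  then show ?thesis using lm_norm_cong_AE[OF gm g'm eq, of p q] g'b by auto
qed

lemma lp_symbol_annulus: "0 < j \<Longrightarrow> lp_symbol \<zeta> j \<xi> = lp_annulus \<zeta> ((1 / 2 ^ j) *\<^sub>R \<xi>)"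
  by (simp add: lp_symbol_def lp_annulus_def Let_def divide_inverse)

text \<open>In the dilated variable the power \<open>norm \<xi> powr \<theta>\<close> acquires the
  factor \<open>(2 ^ j) powr \<theta>\<close>, so \<open>expser\<close> is evaluated with the
  parameter \<open>t * (2 ^ j) powr \<theta>\<close>, which lies in a compact range. The same factor
  in front accounts for the growth of the norm.\<close>

lemma wiener_lp_symbol:
  fixes \<zeta> :: "real \<Rightarrow> real" and \<theta> T :: real
  assumes \<zeta>: "lp_cutoff \<zeta>" and \<theta>: "0 < \<theta>" and T: "0 < T"
  shows "\<exists>D\<ge>0. \<forall>j t. T / 2 < t * (2 ^ j) powr \<theta> \<longrightarrow> t * (2 ^ j) powr \<theta> < T \<longrightarrow>
    wiener ((2 ^ j) powr \<theta> * D) (\<lambda>\<xi>::'a::euclidean_space. lp_symbol \<zeta> j \<xi> * inverse (duhamel_symbol \<theta> t \<xi>))"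
proof -
  let ?\<Psi> = "\<lambda>z::real \<times> real. expser 2 (fst z * snd z) * inverse (expser 1 (fst z * snd z))"
  obtain B0 where B0: "0 \<le> B0" "wiener B0 (\<lambda>\<xi>::'a. \<zeta> (norm \<xi>))" using wiener_cutoff[OF \<zeta>] by blast
  obtain B1 where B1: "0 \<le> B1" "\<And>c. c \<in> {-T..T} \<Longrightarrow> wiener B1 (\<lambda>\<xi>::'a. \<zeta> (norm \<xi>) * (norm \<xi> powr \<theta> * ?\<Psi> (c, norm \<xi> powr \<theta>)))"
    using wiener_low_frequency[OF \<zeta> smooth_on_quotient_expser \<theta>] by blast
  obtain B2 where B2: "0 \<le> B2" "\<And>c \<kappa>. c \<in> {-T..T} \<Longrightarrow> \<kappa> \<in> {0..1} \<Longrightarrow> wiener B2 (\<lambda>\<eta>::'a. lp_annulus \<zeta> \<eta> * norm \<eta> powr \<theta> * ?\<Psi> (c, \<kappa> * norm \<eta> powr \<theta>))"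
    using wiener_annulus[OF \<zeta> smooth_on_quotient_expser] by blast
  have an: "wiener (2 * B0) (lp_annulus \<zeta> :: 'a \<Rightarrow> real)"
  proof -
    have "wiener (B0 + \<bar>-1\<bar> * B0) (\<lambda>\<xi>::'a. \<zeta> (norm \<xi>) + (-1) * \<zeta> (norm (2 *\<^sub>R \<xi>)))"
      by (intro wiener_add wiener_cmult wiener_dilate[where a = "\<lambda>\<xi>. \<zeta> (norm \<xi>)"] B0(2)) simp
    then show ?thesis by (simp add: lp_annulus_def[abs_def])
  qed
  \<comment> \<open>The term with \<open>1 / t\<close> is at most
    \<open>(2 ^ j) powr \<theta> * (2 / T)\<close> times the annulus norm \<open>2 * B0\<close>,
    hence \<open>4 * B0 / T\<close>. The constants \<open>B1\<close> and \<open>B2\<close> bound the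
    part with the power of the norm for \<open>j = 0\<close> and \<open>j > 0\<close>.\<close>
  define D where "D = 4 * B0 / T + B1 + B2"
  have D0: "0 \<le> D" using B0(1) B1(1) B2(1) T by (simp add: D_def)
  have "wiener ((2 ^ j) powr \<theta> * D) (\<lambda>\<xi>::'a. lp_symbol \<zeta> j \<xi> * inverse (duhamel_symbol \<theta> t \<xi>))"
    if t: "T / 2 < t * (2 ^ j) powr \<theta>" "t * (2 ^ j) powr \<theta> < T" for j t
  proof -
    let ?G = "(2 ^ j) powr \<theta> :: real"
    have G: "0 < ?G" by simp
    have t0: "0 < t" using t(1) T G by (smt (verit) half_gt_zero zero_less_mult_pos2)
    have ct: "t * ?G \<in> {-T..T}" using t T by auto
    have inv_t: "1 / t \<le> ?G * (2 / T)"
    proof -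
      have "T \<le> 2 * (t * ?G)" using t(1) by simp
      then show ?thesis using t0 T by (simp add: field_simps)
    qed
    show ?thesis
    proof (cases "j = 0")
      case True
      then have ct': "t \<in> {-T..T}" using ct by simp
      have "lp_symbol \<zeta> j \<xi> * inverse (duhamel_symbol \<theta> t \<xi>) = (1 / t) * \<zeta> (norm \<xi>) + \<zeta> (norm \<xi>) * (norm \<xi> powr \<theta> * ?\<Psi> (t, norm \<xi> powr \<theta>))" for \<xi> :: 'a
        unfolding inverse_duhamel_symbol[OF t0] using True by (simp add: lp_symbol_def distrib_left)
      moreover have "wiener (\<bar>1 / t\<bar> * B0 + B1) (\<lambda>\<xi>::'a. (1 / t) * \<zeta> (norm \<xi>) + \<zeta> (norm \<xi>) * (norm \<xi> powr \<theta> * ?\<Psi> (t, norm \<xi> powr \<theta>)))"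
        by (intro wiener_add wiener_cmult B0(2) B1(2) ct')
      moreover have "\<bar>1 / t\<bar> * B0 + B1 \<le> ?G * D"
      proof -
        have "(1 / t) * B0 \<le> (2 / T) * B0" using inv_t True B0(1) by (intro mult_right_mono) auto
        moreover have "(2 / T) * B0 \<le> 4 * B0 / T" using B0(1) T by (simp add: field_simps)
        ultimately have "(1 / t) * B0 + B1 \<le> D" using B2(1) by (simp add: D_def)
        then show ?thesis using t0 True by simp
      qed
      ultimately show ?thesis using wiener_mono by simp
    next
      case False
      let ?s = "1 / 2 ^ j :: real"
      have nx: "norm \<xi> powr \<theta> = ?G * norm (?s *\<^sub>R \<xi>) powr \<theta>" for \<xi> :: 'a
      proof -
        have "norm \<xi> = 2 ^ j * norm (?s *\<^sub>R \<xi>)" by simp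
        then have "norm \<xi> powr \<theta> = (2 ^ j * norm (?s *\<^sub>R \<xi>)) powr \<theta>" by (rule arg_cong)
        then show ?thesis by (simp only: powr_mult)
      qed
      let ?an = "\<lambda>\<eta>::'a. lp_annulus \<zeta> \<eta> * norm \<eta> powr \<theta> * ?\<Psi> (t * ?G, 1 * norm \<eta> powr \<theta>)"
      have "lp_symbol \<zeta> j \<xi> * inverse (duhamel_symbol \<theta> t \<xi>) = (1 / t) * lp_annulus \<zeta> (?s *\<^sub>R \<xi>) + ?G * ?an (?s *\<^sub>R \<xi>)" for \<xi> :: 'a
      proof -
        have "lp_symbol \<zeta> j \<xi> = lp_annulus \<zeta> (?s *\<^sub>R \<xi>)" using False by (simp add: lp_symbol_annulus)
        then show ?thesis unfolding inverse_duhamel_symbol[OF t0] nx[of \<xi>] by (simp add: algebra_simps del: norm_scaleR)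
      qed
      moreover have "wiener (\<bar>1 / t\<bar> * (2 * B0) + \<bar>?G\<bar> * B2) (\<lambda>\<xi>::'a. (1 / t) * lp_annulus \<zeta> (?s *\<^sub>R \<xi>) + ?G * ?an (?s *\<^sub>R \<xi>))"
        by (rule wiener_add[OF wiener_cmult[OF wiener_dilate[OF an]] wiener_cmult[OF wiener_dilate[OF B2(2)[OF ct]]]]) auto
      moreover have "\<bar>1 / t\<bar> * (2 * B0) + \<bar>?G\<bar> * B2 \<le> ?G * D"
      proof -
        have "(1 / t) * (2 * B0) \<le> (?G * (2 / T)) * (2 * B0)" using inv_t B0(1) by (intro mult_right_mono) auto
        also have "\<dots> = ?G * (4 * B0 / T)" by simp
        finally have "(1 / t) * (2 * B0) + ?G * B2 \<le> ?G * (4 * B0 / T) + ?G * B2" by simp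
        also have "\<dots> = ?G * (4 * B0 / T + B2)" by (simp add: distrib_left)
        also have "\<dots> \<le> ?G * D" using B1(1) G by (intro mult_left_mono) (auto simp: D_def)
        finally show ?thesis using t0 G by simp
      qed
      ultimately show ?thesis using wiener_mono by simp
    qed
  qed
  with D0 show ?thesis by blast
qed

text \<open>Positive levels avoid the origin. The symbol of level 0 reaches beyond the unit ball
  treated by \<open>datum_low_frequency\<close>, so it is split into a narrower cutoff and an
  annulus away from the origin.\<close>

lemma lp_block_representation:
  fixes \<zeta> :: "real \<Rightarrow> real" and \<mu> :: "('a::euclidean_space) distrib" and g :: "'a \<Rightarrow> real"
  assumes \<zeta>: "lp_cutoff \<zeta>" and \<theta>: "0 < \<theta>" and t: "0 < t" and \<mu>: "\<mu> \<in> tempered"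
    and duh: "duhamel_defined \<theta> t \<mu>"
    and g: "morrey p q K (\<lambda>x. ennreal \<bar>g x\<bar>)" "0 \<le> K" "g \<in> borel_measurable borel"
    and rep: "\<And>\<phi>. \<phi> \<in> schwartz \<Longrightarrow> duhamel \<theta> t \<mu> \<phi> = (\<integral>x. of_real (g x) * \<phi> x \<partial>lborel)"
    and k: "kernel_of k (\<lambda>\<xi>::'a. lp_symbol \<zeta> j \<xi> * inverse (duhamel_symbol \<theta> t \<xi>))"
    and \<phi>: "\<phi> \<in> schwartz"
  shows "lp_block \<zeta> j \<mu> \<phi> = (\<integral>y. of_real (rconv k g y) * \<phi> y \<partial>lborel)"
proof -
  note datum_off = datum_off_origin[OF \<zeta> \<theta> t \<mu> duh g rep]
  let ?\<psi> = "fourier_inv \<phi>"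
  let ?I = "\<lambda>\<xi>::'a. inverse (duhamel_symbol \<theta> t \<xi>)"
  let ?b = "\<lambda>\<xi>::'a. lp_symbol \<zeta> j \<xi> * ?I \<xi>"
  let ?Lg = "\<lambda>v. \<integral>x. of_real (g x) * fourier v x \<partial>lborel"
  have \<psi>S: "?\<psi> \<in> schwartz" by (rule fourier_inv_schwartz[OF \<phi>])
  have f\<psi>: "fourier ?\<psi> = \<phi>" by (rule ext) (rule fourier_inversion'[OF \<phi>])
  obtain C where C: "pairing p q C (\<lambda>x. ennreal (norm (fourier ?\<psi> x)))" using pairing_fourier_test_on[OF \<psi>S] by blast
  have w: "wiener (\<integral>z. \<bar>k z\<bar> \<partial>lborel) ?b" unfolding wiener_def using k by blast
  have "dist_fourier \<mu> (\<lambda>\<xi>. of_real (lp_symbol \<zeta> j \<xi>) * ?\<psi> \<xi>) = ?Lg (\<lambda>\<xi>. of_real (?b \<xi>) * ?\<psi> \<xi>)"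
  proof (cases "j = 0")
    case False
    let ?u = "\<lambda>\<xi>. of_real (lp_symbol \<zeta> j \<xi>) * ?\<psi> \<xi>"
    have s: "lp_symbol \<zeta> j = (\<lambda>\<xi>::'a. lp_annulus \<zeta> ((1 / 2 ^ j) *\<^sub>R \<xi>))" using False by (auto simp: lp_symbol_annulus)
    have tl: "test_on (5/3 * 2 ^ j) (\<lambda>\<xi>::'a. complex_of_real (lp_symbol \<zeta> j \<xi>))"
      unfolding s test_on_def
    proof (intro conjI allI impI)
      show "smooth_on UNIV (\<lambda>\<xi>::'a. complex_of_real (lp_annulus \<zeta> ((1 / 2 ^ j) *\<^sub>R \<xi>)))"
        by (rule smooth_on_of_real[OF open_UNIV smooth_on_dilate[OF smooth_on_annulus[OF \<zeta>]]])
      fix \<xi> :: 'a assume "5/3 * 2 ^ j < norm \<xi>"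
      then have "5/3 \<le> norm ((1 / 2 ^ j) *\<^sub>R \<xi>)" by (simp add: field_simps)
      then show "complex_of_real (lp_annulus \<zeta> ((1 / 2 ^ j) *\<^sub>R \<xi>)) = 0" by (simp add: lp_annulus_eq_0(2)[OF \<zeta>] del: norm_scaleR)
    qed
    have "?u \<xi> = 0" if "norm \<xi> < 3/4 * 2 ^ j" for \<xi>
    proof -
      have "norm ((1 / 2 ^ j) *\<^sub>R \<xi>) \<le> 3/4" using that by (simp add: field_simps)
      then show ?thesis unfolding s by (simp add: lp_annulus_eq_0(1)[OF \<zeta>] del: norm_scaleR)
    qed
    from datum_off[where \<delta> = "3/4 * 2 ^ j", OF _ schwartz_mult_test[OF \<psi>S tl] _ _ this]
    have "dist_fourier \<mu> ?u = ?Lg (\<lambda>\<xi>. of_real (?I \<xi>) * ?u \<xi>)" by simp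
    then show ?thesis by (simp add: mult_ac)
  next
    case True
    then have lp: "lp_symbol \<zeta> j = (\<lambda>\<xi>::'a. \<zeta> (norm \<xi>))" by (auto simp: lp_symbol_def)
    have k0: "kernel_of k (\<lambda>\<xi>::'a. \<zeta> (norm \<xi>) * ?I \<xi>)" using k by (simp add: lp)
    let ?u2 = "\<lambda>\<xi>. of_real (\<zeta> (2 * norm \<xi>)) * ?\<psi> \<xi>" and ?u3 = "\<lambda>\<xi>. of_real (lp_annulus \<zeta> \<xi>) * ?\<psi> \<xi>"
    have u2: "test_on 1 ?u2"
      by (rule test_on_mono[OF schwartz_mult_test[OF \<psi>S test_on_cutoff_dilate[OF \<zeta>]]]) auto
    have u3: "test_on (5/3) ?u3"
    proof (rule schwartz_mult_test[OF \<psi>S])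
      show "test_on (5/3) (\<lambda>\<xi>::'a. complex_of_real (lp_annulus \<zeta> \<xi>))"
        unfolding test_on_def
      proof (intro conjI allI impI smooth_on_of_real[OF open_UNIV smooth_on_annulus[OF \<zeta>]])
        fix \<xi> :: 'a assume "5/3 < norm \<xi>"
        then show "complex_of_real (lp_annulus \<zeta> \<xi>) = 0" by (subst lp_annulus_eq_0(2)[OF \<zeta>]) auto
      qed
    qed
    have u2S: "?u2 \<in> schwartz" by (rule test_on_schwartz[OF u2]) simp
    obtain C2 where C2: "pairing p q C2 (\<lambda>x. ennreal (norm (fourier ?u2 x)))" using pairing_fourier_test_on[OF u2S] by blast
    let ?v1 = "\<lambda>\<xi>. of_real (?b \<xi>) * ?\<psi> \<xi>" and ?v2 = "\<lambda>\<xi>. of_real (?b \<xi>) * ?u2 \<xi>" and ?v3 = "\<lambda>\<xi>. of_real (?I \<xi>) * ?u3 \<xi>"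
    note w1 = wiener_multiplier[OF w schwartz_integrable[OF \<psi>S] C]
    note w2 = wiener_multiplier[OF w schwartz_integrable[OF u2S] C2]
    \<comment> \<open>The inner cutoff lives where the outer one equals 1, so the outer one may be
      dropped.\<close>
    have v2: "?v2 = (\<lambda>\<xi>. of_real (?I \<xi>) * ?u2 \<xi>)"
    proof
      fix \<xi> :: 'a
      have "\<zeta> (2 * norm \<xi>) = 0 \<or> \<zeta> (norm \<xi>) = 1"
        using cutoff_eq_1[OF \<zeta>, of "norm \<xi>"] cutoff_eq_0[OF \<zeta>, of "2 * norm \<xi>"] norm_ge_zero[of \<xi>]
        by (cases "norm \<xi> \<le> 3/2") linarith+
      then show "?v2 \<xi> = of_real (?I \<xi>) * ?u2 \<xi>" by (auto simp: lp)
    qed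
    have v123: "?v1 = (\<lambda>\<xi>. ?v2 \<xi> + ?v3 \<xi>)"
    proof
      fix \<xi> :: 'a
      have "?v1 \<xi> = of_real (?I \<xi>) * ?u2 \<xi> + ?v3 \<xi>" by (simp add: lp lp_annulus_def algebra_simps)
      then show "?v1 \<xi> = ?v2 \<xi> + ?v3 \<xi>" using fun_cong[OF v2, of \<xi>] by (simp only:)
    qed
    \<comment> \<open>Integrability of \<open>?v3\<close>, and later of its pairing with
      \<open>g\<close>, is inherited from the other two terms by subtraction.\<close>
    have "integrable lborel (\<lambda>\<xi>. ?v1 \<xi> - ?v2 \<xi>)" using w1(1) w2(1) by (rule Bochner_Integration.integrable_diff)
    moreover have "(\<lambda>\<xi>. ?v1 \<xi> - ?v2 \<xi>) = ?v3"
    proof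
      show "?v1 \<xi> - ?v2 \<xi> = ?v3 \<xi>" for \<xi> :: 'a using fun_cong[OF v123, of \<xi>] by (simp only: add_diff_cancel_left')
    qed
    ultimately have v3i: "integrable lborel ?v3" by (simp only:)
    have f1: "fourier ?v1 = (\<lambda>x. fourier ?v2 x + fourier ?v3 x)"
      unfolding v123 by (rule fourier_add[OF w2(1) v3i])
    have i1: "integrable lborel (\<lambda>x. of_real (g x) * fourier ?v1 x)"
      by (rule pairing_integrable(1)[OF w1(2) _ g]) (use w1(1) in \<open>intro fourier_measurable; simp\<close>)
    have i2: "integrable lborel (\<lambda>x. of_real (g x) * fourier ?v2 x)"
      by (rule pairing_integrable(1)[OF w2(2) _ g]) (use w2(1) in \<open>intro fourier_measurable; simp\<close>)
    have "integrable lborel (\<lambda>x. of_real (g x) * fourier ?v1 x - of_real (g x) * fourier ?v2 x)" using i1 i2 by (rule Bochner_Integration.integrable_diff)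
    then have i3: "integrable lborel (\<lambda>x. of_real (g x) * fourier ?v3 x)" unfolding f1 by (simp add: distrib_left)
    obtain M where F: "test_functional M (dist_fourier \<mu>)" using dist_fourier_test_functional[OF \<mu>] by blast
    have "(\<lambda>\<xi>. of_real (lp_symbol \<zeta> j \<xi>) * ?\<psi> \<xi>) = (\<lambda>\<xi>. ?u2 \<xi> + ?u3 \<xi>)"
      by (rule ext) (simp add: lp lp_annulus_def algebra_simps)
    then have "dist_fourier \<mu> (\<lambda>\<xi>. of_real (lp_symbol \<zeta> j \<xi>) * ?\<psi> \<xi>) = dist_fourier \<mu> ?u2 + dist_fourier \<mu> ?u3"
      using test_functional_add[OF F test_on_mono[OF u2, of "5/3"] u3] by simp
    also have "dist_fourier \<mu> ?u2 = ?Lg ?v2"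
      unfolding v2 by (rule datum_low_frequency[OF \<zeta> \<theta> t \<mu> duh g rep k0 u2])
    also have "dist_fourier \<mu> ?u3 = ?Lg ?v3"
      by (rule datum_off[OF _ u3, of "3/4"]) (auto simp: lp_annulus_eq_0(1)[OF \<zeta>])
    also have "?Lg ?v2 + ?Lg ?v3 = ?Lg ?v1" unfolding f1 using i2 i3 by (simp add: distrib_left)
    finally show ?thesis .
  qed
  also have "\<dots> = (\<integral>y. of_real (rconv k g y) * fourier ?\<psi> y \<partial>lborel)"
    by (rule pairing_rconv[OF k schwartz_integrable[OF \<psi>S] C g])
  finally show ?thesis
    by (simp add: f\<psi> lp_block_def dist_fourier_inv_def smooth_mult_def)
qed

text \<open>The bound \<open>M\<close> lies strictly above the norm because the norm of a
  distribution is an infimum over representatives; strictness yields an actual function at the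
  chosen time.\<close>

lemma lp_block_bound:
  fixes \<zeta> :: "real \<Rightarrow> real" and \<theta> T p q :: real
  assumes \<zeta>: "lp_cutoff \<zeta>" and \<theta>: "0 < \<theta>" and T: "0 < T" and q: "1 < q"
  shows "\<exists>C>0. \<forall>\<mu>\<in>(duhamel_domain \<theta> T p q :: ('a::euclidean_space) distrib set). \<forall>j M.
    linf_lm_norm T p q (\<lambda>t. duhamel \<theta> t \<mu>) < ennreal M \<longrightarrow>
    (\<exists>h\<in>lm_space p q. represents h (lp_block \<zeta> j \<mu>) \<and> lm_norm p q h \<le> ennreal ((2 ^ j) powr \<theta> * (C * M)))"
proof -
  obtain D where D: "0 \<le> D" "\<And>j t. T / 2 < t * (2 ^ j) powr \<theta> \<Longrightarrow> t * (2 ^ j) powr \<theta> < T \<Longrightarrow>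
    wiener ((2 ^ j) powr \<theta> * D) (\<lambda>\<xi>::'a. lp_symbol \<zeta> j \<xi> * inverse (duhamel_symbol \<theta> t \<xi>))"
    using wiener_lp_symbol[OF \<zeta> \<theta> T] by blast
  \<comment> \<open>Adding 1 keeps the constant positive when \<open>D\<close> is 0.\<close>
  define C where "C = (D + 1) * weak_const q"
  have C: "0 < C" using D(1) weak_const_pos[OF q] by (simp add: C_def)
  have "\<exists>h\<in>lm_space p q. represents h (lp_block \<zeta> j \<mu>) \<and> lm_norm p q h \<le> ennreal ((2 ^ j) powr \<theta> * (C * M))"
    if \<mu>: "\<mu> \<in> duhamel_domain \<theta> T p q" and M: "linf_lm_norm T p q (\<lambda>t. duhamel \<theta> t \<mu>) < ennreal M"
    for \<mu> :: "'a distrib" and j M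
  proof -
    let ?G = "(2 ^ j) powr \<theta> :: real"
    have G: "1 \<le> ?G" using \<theta> by (intro ge_one_powr_ge_zero) auto
    have M0: "0 < M"
    proof (rule ccontr)
      assume "\<not> 0 < M"
      then show False using M by (simp add: ennreal_neg)
    qed
    have \<mu>t: "\<mu> \<in> tempered" and dd: "AE t in lebesgue_on {0<..<T}. duhamel_defined \<theta> t \<mu>"
      using \<mu> by (auto simp: duhamel_domain_def)
    have "AE t in lebesgue_on {0<..<T}. dist_lm_norm p q (duhamel \<theta> t \<mu>) \<le> linf_lm_norm T p q (\<lambda>t. duhamel \<theta> t \<mu>)"
      unfolding linf_lm_norm_def by (rule esssup_AE)
    with dd have "AE t in lebesgue_on {0<..<T}. duhamel_defined \<theta> t \<mu> \<and> dist_lm_norm p q (duhamel \<theta> t \<mu>) < ennreal M"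
      by eventually_elim (use M in auto)
    \<comment> \<open>Since \<open>?G\<close> is at least 1, the window for \<open>t\<close> lies
      inside the time interval, and almost every time in it is good.\<close>
    moreover have "T / (2 * ?G) < T / ?G" "T / ?G \<le> T" using T G by (auto simp: field_simps)
    ultimately obtain t where t: "T / (2 * ?G) < t" "t < T / ?G" and dt: "duhamel_defined \<theta> t \<mu>"
      and nt: "dist_lm_norm p q (duhamel \<theta> t \<mu>) < ennreal M"
      using AE_lebesgue_on_interval[where a = "T / (2 * ?G)" and b = "T / ?G" and T = T] T G by fastforce
    have t0: "0 < t" using t(1) T G by (smt (verit) divide_pos_pos)
    have w: "wiener (?G * D) (\<lambda>\<xi>::'a. lp_symbol \<zeta> j \<xi> * inverse (duhamel_symbol \<theta> t \<xi>))"
      by (rule D(2)) (use t G in \<open>auto simp: field_simps\<close>)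
    then obtain k where k: "kernel_of k (\<lambda>\<xi>::'a. lp_symbol \<zeta> j \<xi> * inverse (duhamel_symbol \<theta> t \<xi>))"
      "(\<integral>z. \<bar>k z\<bar> \<partial>lborel) \<le> ?G * D" unfolding wiener_def by blast
    obtain g0 where g0: "g0 \<in> lm_space p q" "represents g0 (duhamel \<theta> t \<mu>)" "lm_norm p q g0 < ennreal M"
      using nt unfolding dist_lm_norm_def INF_less_iff by blast
    obtain g where g: "g \<in> borel_measurable borel" "lm_norm p q g \<le> ennreal M"
      "\<And>\<phi>. \<phi> \<in> schwartz \<Longrightarrow> duhamel \<theta> t \<mu> \<phi> = (\<integral>x. of_real (g x) * \<phi> x \<partial>lborel)"
      using exists_borel_representative[OF g0(1,2)] g0(3) by (metis less_imp_le)
    let ?K = "weak_const q * M"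
    have K0: "0 \<le> ?K" using weak_const_pos[OF q] M0 by simp
    have gm: "morrey p q ?K (\<lambda>x. ennreal \<bar>g x\<bar>)" by (rule morrey_if_lm_norm_le[OF q g(1) M0 g(2)])
    let ?h = "rconv k g"
    have hb: "?h \<in> borel_measurable borel"
      using k(1) g(1) by (intro rconv_measurable) (auto simp: kernel_of_def)
    have hm: "morrey p q (?G * D * ?K) (\<lambda>y. ennreal \<bar>?h y\<bar>)" by (rule morrey_rconv[OF k gm K0 g(1)])
    have GDK: "0 \<le> ?G * D * ?K" using D(1) K0 by simp
    have hn: "lm_norm p q ?h \<le> ennreal (?G * D * ?K)" by (rule lm_norm_le_if_morrey[OF q hb GDK hm])
    have hL: "?h \<in> borel_measurable lebesgue" using hb by (intro measurable_completion) simp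
    have "lm_norm p q ?h < top" using hn by (rule le_less_trans) simp
    then have "?h \<in> lm_space p q" using hL by (simp add: lm_space_def)
    moreover have "represents ?h (lp_block \<zeta> j \<mu>)"
      unfolding represents_def
    proof (intro ballI conjI)
      fix \<phi> :: "'a \<Rightarrow> complex" assume \<phi>: "\<phi> \<in> schwartz"
      have \<phi>m: "\<phi> \<in> borel_measurable borel" by (rule schwartz_measurable[OF \<phi>])
      have pm: "(\<lambda>x. complex_of_real (?h x) * \<phi> x) \<in> borel_measurable lborel" using hb \<phi>m by simp
      obtain B where B: "wbound UNIV (decay_dim TYPE('a)) 0 B \<phi>" using schwartz_wbound[OF \<phi>] by blast
      have "integrable lborel (\<lambda>x. complex_of_real (?h x) * \<phi> x)"
        by (rule pairing_integrable(1)[OF pairing_schwartz[OF \<phi>m B] \<phi>m hm GDK hb])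
      then show "integrable lebesgue (\<lambda>x. complex_of_real (?h x) * \<phi> x)"
        using integrable_completion[OF pm] by simp
      show "lp_block \<zeta> j \<mu> \<phi> = (\<integral>x. complex_of_real (?h x) * \<phi> x \<partial>lebesgue)"
        unfolding integral_completion[OF pm]
        by (rule lp_block_representation[OF \<zeta> \<theta> t0 \<mu>t dt gm K0 g(1) g(3) k(1) \<phi>])
    qed
    moreover have "lm_norm p q ?h \<le> ennreal (?G * (C * M))"
    proof -
      have "D * ?K \<le> C * M" using weak_const_pos[OF q] M0 by (simp add: C_def algebra_simps)
      then have "?G * D * ?K \<le> ?G * (C * M)" using G by (simp add: mult.assoc)
      then show ?thesis using hn by (meson ennreal_leI order_trans)
    qed
    ultimately show ?thesis by blast
  qed
  with C show ?thesis by blast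
qed

theorem proposition2p18:
  fixes \<theta> T p q :: real and \<zeta> :: "real \<Rightarrow> real"
  assumes "\<theta> > 0" and "T > 0" and "1 < q" and "q \<le> p"
    and "lp_cutoff \<zeta>"
  shows "\<exists>C::real. C > 0 \<and>
    (\<forall>\<mu> \<in> (duhamel_domain \<theta> T p q :: ('a::euclidean_space) distrib set).
       \<mu> \<in> blm_space \<zeta> (- \<theta>) p q \<and>
       blm_norm \<zeta> (- \<theta>) p q \<mu>
         \<le> ennreal C * linf_lm_norm T p q (\<lambda>t. duhamel \<theta> t \<mu>))"
proof -
  obtain C where C: "0 < C" and H: "\<And>\<mu> j M. \<mu> \<in> (duhamel_domain \<theta> T p q :: 'a distrib set) \<Longrightarrow>
    linf_lm_norm T p q (\<lambda>t. duhamel \<theta> t \<mu>) < ennreal M \<Longrightarrow>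
    \<exists>h\<in>lm_space p q. represents h (lp_block \<zeta> j \<mu>) \<and> lm_norm p q h \<le> ennreal ((2 ^ j) powr \<theta> * (C * M))"
    using lp_block_bound[OF assms(5,1,2,3), of p, where ?'a = 'a] by blast
  have "\<mu> \<in> blm_space \<zeta> (- \<theta>) p q \<and> blm_norm \<zeta> (- \<theta>) p q \<mu> \<le> ennreal C * linf_lm_norm T p q (\<lambda>t. duhamel \<theta> t \<mu>)"
    if \<mu>: "\<mu> \<in> duhamel_domain \<theta> T p q" for \<mu> :: "'a distrib"
  proof -
    let ?N = "linf_lm_norm T p q (\<lambda>t. duhamel \<theta> t \<mu>)"
    have N: "?N < top" and \<mu>t: "\<mu> \<in> tempered" using \<mu> by (auto simp: duhamel_domain_def)
    obtain m where m: "?N = ennreal m" "0 \<le> m" using N by (cases ?N) auto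
    have le: "blm_norm \<zeta> (- \<theta>) p q \<mu> \<le> ennreal (C * M)" if M: "m < M" for M
      unfolding blm_norm_def
    proof (rule SUP_least)
      fix j :: nat
      have "?N < ennreal M" using m M by (simp add: ennreal_less_iff)
      from H[OF \<mu> this, of j] obtain h where h: "h \<in> lm_space p q" "represents h (lp_block \<zeta> j \<mu>)"
        "lm_norm p q h \<le> ennreal ((2 ^ j) powr \<theta> * (C * M))" by blast
      have "dist_lm_norm p q (lp_block \<zeta> j \<mu>) \<le> lm_norm p q h"
        unfolding dist_lm_norm_def by (rule INF_lower) (use h in simp)
      then have "dist_lm_norm p q (lp_block \<zeta> j \<mu>) \<le> ennreal ((2 ^ j) powr \<theta> * (C * M))" using h(3) by (rule order_trans)
      then have "ennreal (2 powr (- \<theta> * real j)) * dist_lm_norm p q (lp_block \<zeta> j \<mu>) \<le> ennreal (2 powr (- \<theta> * real j)) * ennreal ((2 ^ j) powr \<theta> * (C * M))"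
        by (rule mult_left_mono) simp
      also have "\<dots> = ennreal (2 powr (- \<theta> * real j) * ((2 ^ j) powr \<theta> * (C * M)))"
        using C M m(2) by (simp add: ennreal_mult)
      also have "2 powr (- \<theta> * real j) * ((2 ^ j) powr \<theta> * (C * M)) = C * M"
      proof -
        have "(2 ^ j) powr \<theta> = 2 powr (\<theta> * real j)" by (simp add: powr_realpow[symmetric] powr_powr mult.commute)
        then have "2 powr (- \<theta> * real j) * (2 ^ j) powr \<theta> = 1" by (simp add: powr_add[symmetric])
        then show ?thesis by (simp add: mult.assoc[symmetric])
      qed
      finally show "ennreal (2 powr (- \<theta> * real j)) * dist_lm_norm p q (lp_block \<zeta> j \<mu>) \<le> ennreal (C * M)" .
    qed
    have "blm_norm \<zeta> (- \<theta>) p q \<mu> \<le> ennreal (C * m)"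
    proof (rule ennreal_le_epsilon)
      fix e :: real assume e: "0 < e"
      \<comment> \<open>The block bounds are available only strictly above the norm
        \<open>m\<close>; this choice makes the excess exactly \<open>e\<close>.\<close>
      have "blm_norm \<zeta> (- \<theta>) p q \<mu> \<le> ennreal (C * (m + e / C))" by (rule le) (use e C in simp)
      also have "C * (m + e / C) = C * m + e" using C by (simp add: distrib_left)
      finally show "blm_norm \<zeta> (- \<theta>) p q \<mu> \<le> ennreal (C * m) + ennreal e"
        using C m(2) e by simp
    qed
    then have bound: "blm_norm \<zeta> (- \<theta>) p q \<mu> \<le> ennreal C * ?N" using C m by (simp add: ennreal_mult)
    have "blm_norm \<zeta> (- \<theta>) p q \<mu> < top" using le[of "m + 1"] by (rule le_less_trans) auto
    moreover have "\<exists>h\<in>lm_space p q. represents h (lp_block \<zeta> j \<mu>)" for j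
      using H[OF \<mu>, of "m + 1" j] m by (auto simp: ennreal_less_iff simp del: ennreal_plus)
    ultimately show ?thesis using \<mu>t bound by (simp add: blm_space_def)
  qed
  with C show ?thesis by blast
qed

end
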